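(* Let $\mathfrak g$ be a complex Lie superalgebra containing a subalgebra $\mathfrak{sl}_2=\mathrm{span}\{e,h,f\}$ which acts locally finitely on $\mathfrak g$, and let $a\in\mathbb C$. (i) Consider the restriction of the Enright functor $\mathcal C_a:\mathcal M(a)^e\to\mathcal M(-a)^e$ (and likewise $\mathcal C_{-a}:\mathcal M(-a)^e\to\mathcal M(a)^e$). There exists a morphism of functors $\mathrm{Id}_{\mathcal M(a)^e}\to\mathcal C_{-a}\mathcal C_a$. (ii) For $a\notin\mathbb Z$ the functor $\mathcal C_a:\mathcal M(a)^e\to\mathcal M(-a)^e$ is an equivalence of categories. (iii) Let $N_1,N_2\in\mathcal M(0)^e$ be such that $N_1^f=0$. Then the natural map $\mathrm{Hom}_{\mathfrak g}(N_1,N_2)\to\mathrm{Hom}_{\mathfrak g}(\mathcal C_0(N_1),\mathcal C_0(N_2))$ is injective, and hence $\dim\mathrm{Hom}_{\mathfrak g}(N_1,N_2)\le\dim\mathrm{Hom}_{\mathfrak g}(\mathcal C_0(N_1),\mathcal C_0(N_2))$.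
   Context: $\{e,h,f\}$ is the standard basis of $\mathfrak{sl}_2$ (even elements). $U(\mathfrak g)[f^{-1}]$ is the localization of $U(\mathfrak g)$ at the Ore set $\{f^s\}_{s\ge0}$. For $a\in\mathbb C$, $\phi_a(u)=\sum_{i\ge0}\binom ai(\mathrm{ad}f)^i(u)f^{-i}$ is an automorphism of $U(\mathfrak g)[f^{-1}]$ (for $a=s\in\mathbb Z$ it is $u\mapsto f^suf^{-s}$). Let $U'f^a$ be the $U(\mathfrak g)[f^{-1}]$-bimodule that is free of rank one as a left module on a generator $f^a$, with right action $(uf^a)u'=u\phi_a(u')f^a$. For a $\mathfrak g$-module $N$, put $N[f^{-1}]=U(\mathfrak g)[f^{-1}]\otimes_{U(\mathfrak g)}N$; the twisted localization functor is $\mathcal D_a(N)=U'f^a\otimes_{U(\mathfrak g)[f^{-1}]}N[f^{-1}]$, restricted to $\mathfrak g$. The Enright functor is $\mathcal C_a(N)=\{v\in\mathcal D_a(N)\mid\dim\mathbb C[e]v<\infty\}$. $N^f=\{v\in N\mid f^sv=0\text{ for }s\gg0\}$. $\mathcal M(b)$ is the category of $\mathfrak g$-modules on which $h$ acts diagonally with eigenvalues in $b+\mathbb Z$; $\mathcal M(b)^e$ is the full subcategory of modules on which $e$ acts locally nilpotently. $\mathcal C_a$ maps $\mathcal M(a)$ to $\mathcal M(-a)^e$.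
   Formalization: In (iii) the hypothesis N_1^f=0 is replaced by N_2^f=0, with no condition on N_1; as printed (iii) fails for g=sl_2, N_1 the Verma module of highest weight 0 and N_2 the trivial module, where Hom(N_1,N_2) is one-dimensional but C_0(N_2)=0. *)

theory Defs
  imports Complex_Main "HOL-Algebra.QuotRing" "HOL-Algebra.Module"
    "HOL-Library.Poly_Mapping" "HOL-Library.Z2"
begin

unbundle cardinal_syntax

section \<open>Lie superalgebras\<close>

text \<open>Parities are elements of \<^typ>\<open>bit\<close>, the field with two elements; \<open>prt L i\<close> is the
  homogeneous component of parity \<open>i\<close>. The underlying space is the whole type.\<close>

record 'g superalg =
  scl :: "complex \<Rightarrow> 'g \<Rightarrow> 'g"
  brk :: "'g \<Rightarrow> 'g \<Rightarrow> 'g"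
  prt :: "bit \<Rightarrow> 'g set"

definition koszul :: "bit \<Rightarrow> bit \<Rightarrow> complex" where
  "koszul i j = (if i = 1 \<and> j = 1 then - 1 else 1)"

locale lie_superalgebra =
  fixes L :: "'g::ab_group_add superalg"
  assumes vector_space: "vector_space (scl L)"
    and subspace_prt: "module.subspace (scl L) (prt L i)"
    and prt_Int: "prt L 0 \<inter> prt L 1 = {0}"
    and prt_sum: "\<exists>y\<in>prt L 0. \<exists>z\<in>prt L 1. x = y + z"
    and brk_add_left: "brk L (x + y) z = brk L x z + brk L y z"
    and brk_add_right: "brk L x (y + z) = brk L x y + brk L x z"
    and brk_scl_left: "brk L (scl L c x) y = scl L c (brk L x y)"
    and brk_scl_right: "brk L x (scl L c y) = scl L c (brk L x y)"
    and brk_prt: "x \<in> prt L i \<Longrightarrow> y \<in> prt L j \<Longrightarrow> brk L x y \<in> prt L (i + j)"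
    and super_skew: "x \<in> prt L i \<Longrightarrow> y \<in> prt L j \<Longrightarrow>
      brk L x y = - scl L (koszul i j) (brk L y x)"
    and super_jacobi: "x \<in> prt L i \<Longrightarrow> y \<in> prt L j \<Longrightarrow>
      brk L x (brk L y z) = brk L (brk L x y) z + scl L (koszul i j) (brk L y (brk L x z))"

definition sl2_triple :: "'g::ab_group_add superalg \<Rightarrow> 'g \<Rightarrow> 'g \<Rightarrow> 'g \<Rightarrow> bool" where
  "sl2_triple L e h f \<longleftrightarrow>
     {e, h, f} \<subseteq> prt L 0 \<and> distinct [e, h, f] \<and> \<not> module.dependent (scl L) {e, h, f} \<and>
     brk L h e = scl L 2 e \<and> brk L h f = scl L (- 2) f \<and> brk L e f = h"

definition acts_locally_finitely :: "'g::ab_group_add superalg \<Rightarrow> 'g set \<Rightarrow> bool" where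
  "acts_locally_finitely L S \<longleftrightarrow>
     (\<forall>x. \<exists>W B. finite B \<and> W = module.span (scl L) B \<and> x \<in> W \<and> (\<forall>s\<in>S. \<forall>w\<in>W. brk L s w \<in> W))"


section \<open>Free algebras, the enveloping algebra and its localization\<close>

datatype 'x mon = Mon (letters: "'x list")

instantiation mon :: (type) monoid_add
begin
definition zero_mon :: "'a mon" where "zero_mon = Mon []"
definition plus_mon :: "'a mon \<Rightarrow> 'a mon \<Rightarrow> 'a mon" where
  "plus_mon v w = Mon (letters v @ letters w)"
instance by standard (simp_all add: zero_mon_def plus_mon_def)
end

text \<open>Since the monoid of words is written additively, the convolution product of
  \<^typ>\<open>'x mon \<Rightarrow>\<^sub>0 'k\<close> is that of the free associative \<open>'k\<close>-algebra on the set \<open>'x\<close>.\<close>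

type_synonym ('x, 'k) falg = "'x mon \<Rightarrow>\<^sub>0 'k"

definition const :: "'k::comm_ring_1 \<Rightarrow> ('x, 'k) falg" where
  "const c = Poly_Mapping.single 0 c"

definition gen :: "'x \<Rightarrow> ('x, 'k::comm_ring_1) falg" where
  "gen x = Poly_Mapping.single (Mon [x]) 1"

definition free_alg :: "('x, 'k::comm_ring_1) falg ring" where
  "free_alg = \<lparr>carrier = UNIV, mult = (*), one = 1, zero = 0, add = (+)\<rparr>"

inductive homog :: "(bit \<Rightarrow> 'x set) \<Rightarrow> bit \<Rightarrow> ('x, 'k::comm_ring_1) falg \<Rightarrow> bool"
  for P where
  "homog P 0 (const c)"
| "x \<in> P i \<Longrightarrow> homog P i (gen x)"
| "homog P i p \<Longrightarrow> homog P j q \<Longrightarrow> homog P (i + j) (p * q)"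
| "homog P i p \<Longrightarrow> homog P i q \<Longrightarrow> homog P i (p + q)"

text \<open>The first two families of relations turn the free algebra on the set of elements of the
  Lie superalgebra into the tensor algebra.\<close>

definition env_ideal :: "'g::ab_group_add superalg \<Rightarrow> ('g, complex) falg set" where
  "env_ideal L = Idl\<^bsub>free_alg\<^esub>
     ({gen (x + y) - gen x - gen y |x y. True} \<union>
      {gen (scl L c x) - const c * gen x |c x. True} \<union>
      {gen x * gen y - const (koszul i j) * gen y * gen x - gen (brk L x y) |x y i j.
         x \<in> prt L i \<and> y \<in> prt L j})"

type_synonym 'g uel = "('g, complex) falg set"

definition env :: "'g::ab_group_add superalg \<Rightarrow> 'g uel ring" where
  "env L = free_alg Quot env_ideal L"

definition in_env :: "'g::ab_group_add superalg \<Rightarrow> 'g \<Rightarrow> 'g uel" where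
  "in_env L x = env_ideal L +>\<^bsub>free_alg\<^esub> gen x"

definition sc_env :: "'g::ab_group_add superalg \<Rightarrow> complex \<Rightarrow> 'g uel" where
  "sc_env L c = env_ideal L +>\<^bsub>free_alg\<^esub> const c"

definition env_part :: "'g::ab_group_add superalg \<Rightarrow> bit \<Rightarrow> 'g uel set" where
  "env_part L i = {env_ideal L +>\<^bsub>free_alg\<^esub> p |p. homog (prt L) i p}"

text \<open>The localization \<open>R[s\<^sup>-\<^sup>1]\<close> of a noncommutative ring at the powers of \<open>s\<close>: the universal ring
  under \<open>R\<close> in which \<open>s\<close> becomes invertible. The generator \<open>Some r\<close> stands for the image of \<open>r\<close>
  and \<open>None\<close> for the inverse of \<open>s\<close>; generators \<open>Some x\<close> with \<open>x\<close> outside the carrier are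
  set to zero. When the powers of \<open>s\<close> form an Ore set, this is the Ore
  localization (whose elements are fractions \<open>r s\<^sup>-\<^sup>n\<close>).\<close>

definition loc_ideal :: "('r, 'm) ring_scheme \<Rightarrow> 'r \<Rightarrow> ('r option, int) falg set" where
  "loc_ideal R s = Idl\<^bsub>free_alg\<^esub>
     ({gen (Some (x \<oplus>\<^bsub>R\<^esub> y)) - gen (Some x) - gen (Some y) |x y. x \<in> carrier R \<and> y \<in> carrier R} \<union>
      {gen (Some (x \<otimes>\<^bsub>R\<^esub> y)) - gen (Some x) * gen (Some y) |x y. x \<in> carrier R \<and> y \<in> carrier R} \<union>
      {gen (Some \<one>\<^bsub>R\<^esub>) - 1} \<union>
      {gen (Some x) |x. x \<notin> carrier R} \<union>
      {gen (Some s) * gen None - 1, gen None * gen (Some s) - 1})"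

definition localization :: "('r, 'm) ring_scheme \<Rightarrow> 'r \<Rightarrow> ('r option, int) falg set ring" where
  "localization R s = free_alg Quot loc_ideal R s"

type_synonym 'g lel = "('g uel option, int) falg set"

definition lenv :: "'g::ab_group_add superalg \<Rightarrow> 'g \<Rightarrow> 'g lel ring" where
  "lenv L f = localization (env L) (in_env L f)"

definition to_lenv :: "'g::ab_group_add superalg \<Rightarrow> 'g \<Rightarrow> 'g uel \<Rightarrow> 'g lel" where
  "to_lenv L f u = loc_ideal (env L) (in_env L f) +>\<^bsub>free_alg\<^esub> gen (Some u)"

definition f_inv :: "'g::ab_group_add superalg \<Rightarrow> 'g \<Rightarrow> 'g lel" where
  "f_inv L f = loc_ideal (env L) (in_env L f) +>\<^bsub>free_alg\<^esub> gen None"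

definition lenv_part :: "'g::ab_group_add superalg \<Rightarrow> 'g \<Rightarrow> bit \<Rightarrow> 'g lel set" where
  "lenv_part L f i = {loc_ideal (env L) (in_env L f) +>\<^bsub>free_alg\<^esub> p |p.
     homog (\<lambda>j. Some ` env_part L j \<union> (if j = 0 then {None} else {})) i p}"

definition ad_f :: "'g::ab_group_add superalg \<Rightarrow> 'g \<Rightarrow> 'g lel \<Rightarrow> 'g lel" where
  "ad_f L f u = (let F = to_lenv L f (in_env L f)
     in F \<otimes>\<^bsub>lenv L f\<^esub> u \<ominus>\<^bsub>lenv L f\<^esub> u \<otimes>\<^bsub>lenv L f\<^esub> F)"

text \<open>The sum defining \<open>\<phi>\<^sub>a(u)\<close> runs over the \<open>i\<close> with \<open>(ad f)\<^sup>i(u) \<noteq> 0\<close>, which are finitely many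
  when \<open>ad f\<close> is locally nilpotent.\<close>

definition twist :: "'g::ab_group_add superalg \<Rightarrow> 'g \<Rightarrow> complex \<Rightarrow> 'g lel \<Rightarrow> 'g lel" where
  "twist L f a u = finsum (lenv L f)
     (\<lambda>i. to_lenv L f (sc_env L (a gchoose i)) \<otimes>\<^bsub>lenv L f\<^esub> (ad_f L f ^^ i) u
           \<otimes>\<^bsub>lenv L f\<^esub> (f_inv L f [^]\<^bsub>lenv L f\<^esub> i))
     {i. (ad_f L f ^^ i) u \<noteq> \<zero>\<^bsub>lenv L f\<^esub>}"


section \<open>Modules\<close>

text \<open>The fields \<open>mult\<close> and \<open>one\<close> that \<^typ>\<open>('r, 'v) module\<close> inherits from rings carry no meaning
  for modules. \<open>mpart\<close> holds the homogeneous components of a \<open>\<int>/2\<close>-graded module.\<close>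

record ('r, 'v) smod = "('r, 'v) module" +
  mpart :: "bit \<Rightarrow> 'v set"

locale left_module = R?: ring R + M?: abelian_group M
  for R (structure) and M (structure) +
  assumes smult_closed: "r \<in> carrier R \<Longrightarrow> v \<in> carrier M \<Longrightarrow> r \<odot>\<^bsub>M\<^esub> v \<in> carrier M"
    and smult_l_distr: "r \<in> carrier R \<Longrightarrow> s \<in> carrier R \<Longrightarrow> v \<in> carrier M \<Longrightarrow>
      (r \<oplus>\<^bsub>R\<^esub> s) \<odot>\<^bsub>M\<^esub> v = r \<odot>\<^bsub>M\<^esub> v \<oplus>\<^bsub>M\<^esub> s \<odot>\<^bsub>M\<^esub> v"
    and smult_r_distr: "r \<in> carrier R \<Longrightarrow> v \<in> carrier M \<Longrightarrow> w \<in> carrier M \<Longrightarrow>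
      r \<odot>\<^bsub>M\<^esub> (v \<oplus>\<^bsub>M\<^esub> w) = r \<odot>\<^bsub>M\<^esub> v \<oplus>\<^bsub>M\<^esub> r \<odot>\<^bsub>M\<^esub> w"
    and smult_assoc: "r \<in> carrier R \<Longrightarrow> s \<in> carrier R \<Longrightarrow> v \<in> carrier M \<Longrightarrow>
      (r \<otimes>\<^bsub>R\<^esub> s) \<odot>\<^bsub>M\<^esub> v = r \<odot>\<^bsub>M\<^esub> (s \<odot>\<^bsub>M\<^esub> v)"
    and smult_one: "v \<in> carrier M \<Longrightarrow> \<one>\<^bsub>R\<^esub> \<odot>\<^bsub>M\<^esub> v = v"

definition act :: "'g::ab_group_add superalg \<Rightarrow> ('g uel, 'v) smod \<Rightarrow> 'g \<Rightarrow> 'v \<Rightarrow> 'v" where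
  "act L M x v = in_env L x \<odot>\<^bsub>M\<^esub> v"

definition csc :: "'g::ab_group_add superalg \<Rightarrow> ('g uel, 'v) smod \<Rightarrow> complex \<Rightarrow> 'v \<Rightarrow> 'v" where
  "csc L M c v = sc_env L c \<odot>\<^bsub>M\<^esub> v"

definition super_graded :: "'g::ab_group_add superalg \<Rightarrow> ('g uel, 'v) smod \<Rightarrow> bool" where
  "super_graded L M \<longleftrightarrow>
     (\<forall>i. additive_subgroup (mpart M i) M \<and> (\<forall>c. \<forall>v\<in>mpart M i. csc L M c v \<in> mpart M i)) \<and>
     mpart M 0 \<inter> mpart M 1 = {\<zero>\<^bsub>M\<^esub>} \<and>
     (\<forall>v\<in>carrier M. \<exists>x\<in>mpart M 0. \<exists>y\<in>mpart M 1. v = x \<oplus>\<^bsub>M\<^esub> y) \<and>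
     (\<forall>i j. \<forall>x\<in>prt L i. \<forall>v\<in>mpart M j. act L M x v \<in> mpart M (i + j))"

text \<open>A module over a Lie superalgebra is either required to be \<open>\<int>/2\<close>-graded, with parity
  preserving homomorphisms (\<open>super = True\<close>), or is an arbitrary module over the enveloping algebra
  (\<open>super = False\<close>).\<close>

definition lie_module :: "bool \<Rightarrow> 'g::ab_group_add superalg \<Rightarrow> ('g uel, 'v) smod \<Rightarrow> bool" where
  "lie_module super L M \<longleftrightarrow> left_module (env L) M \<and> (super \<longrightarrow> super_graded L M)"

definition lie_hom :: "bool \<Rightarrow> 'g::ab_group_add superalg \<Rightarrow>
    ('g uel, 'v) smod \<Rightarrow> ('g uel, 'w) smod \<Rightarrow> ('v \<Rightarrow> 'w) set" where
  "lie_hom super L M N = {\<phi> \<in> extensional (carrier M) \<inter> (carrier M \<rightarrow> carrier N).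
     (\<forall>v\<in>carrier M. \<forall>w\<in>carrier M. \<phi> (v \<oplus>\<^bsub>M\<^esub> w) = \<phi> v \<oplus>\<^bsub>N\<^esub> \<phi> w) \<and>
     (\<forall>u\<in>carrier (env L). \<forall>v\<in>carrier M. \<phi> (u \<odot>\<^bsub>M\<^esub> v) = u \<odot>\<^bsub>N\<^esub> \<phi> v) \<and>
     (super \<longrightarrow> (\<forall>i. \<phi> ` mpart M i \<subseteq> mpart N i))}"

subsection \<open>Complex vector spaces given by carriers\<close>

definition lspan :: "(complex, 'v, 'm) module_scheme \<Rightarrow> 'v set \<Rightarrow> 'v set" where
  "lspan V S = {finsum V (\<lambda>b. c b \<odot>\<^bsub>V\<^esub> b) B |c B. finite B \<and> B \<subseteq> S}"

definition lindep :: "(complex, 'v, 'm) module_scheme \<Rightarrow> 'v set \<Rightarrow> bool" where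
  "lindep V S \<longleftrightarrow> (\<exists>c B. finite B \<and> B \<subseteq> S \<and> finsum V (\<lambda>b. c b \<odot>\<^bsub>V\<^esub> b) B = \<zero>\<^bsub>V\<^esub> \<and> (\<exists>b\<in>B. c b \<noteq> 0))"

definition is_basis :: "(complex, 'v, 'm) module_scheme \<Rightarrow> 'v set \<Rightarrow> bool" where
  "is_basis V B \<longleftrightarrow> B \<subseteq> carrier V \<and> \<not> lindep V B \<and> lspan V B = carrier V"

text \<open>The dimension as a cardinal, so that infinite dimensions are distinguished.\<close>

definition cdim :: "(complex, 'v, 'm) module_scheme \<Rightarrow> 'v rel" where
  "cdim V = |SOME B. is_basis V B|"

definition underlying :: "'g::ab_group_add superalg \<Rightarrow> ('g uel, 'v) smod \<Rightarrow> (complex, 'v) module" where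
  "underlying L M = \<lparr>carrier = carrier M, mult = undefined, one = undefined,
     zero = zero M, add = add M, smult = csc L M\<rparr>"

definition hom_space :: "bool \<Rightarrow> 'g::ab_group_add superalg \<Rightarrow>
    ('g uel, 'v) smod \<Rightarrow> ('g uel, 'w) smod \<Rightarrow> (complex, 'v \<Rightarrow> 'w) module" where
  "hom_space super L M N = \<lparr>carrier = lie_hom super L M N, mult = undefined, one = undefined,
     zero = (\<lambda>v\<in>carrier M. \<zero>\<^bsub>N\<^esub>),
     add = (\<lambda>\<phi> \<psi>. \<lambda>v\<in>carrier M. \<phi> v \<oplus>\<^bsub>N\<^esub> \<psi> v),
     smult = (\<lambda>c \<phi>. \<lambda>v\<in>carrier M. csc L N c (\<phi> v))\<rparr>"

subsection \<open>The conditions defining the module categories\<close>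

definition weight_space :: "'g::ab_group_add superalg \<Rightarrow> 'g \<Rightarrow> ('g uel, 'v) smod \<Rightarrow> complex \<Rightarrow> 'v set" where
  "weight_space L h M c = {v \<in> carrier M. act L M h v = csc L M c v}"

definition diagonal_in :: "'g::ab_group_add superalg \<Rightarrow> 'g \<Rightarrow> complex \<Rightarrow> ('g uel, 'v) smod \<Rightarrow> bool" where
  "diagonal_in L h b M \<longleftrightarrow>
     lspan (underlying L M) (\<Union>k::int. weight_space L h M (b + of_int k)) = carrier M"

definition torsion :: "'g::ab_group_add superalg \<Rightarrow> 'g \<Rightarrow> ('g uel, 'v) smod \<Rightarrow> 'v set" where
  "torsion L x M = {v \<in> carrier M. \<exists>n. (act L M x ^^ n) v = \<zero>\<^bsub>M\<^esub>}"

definition locally_nilpotent :: "'g::ab_group_add superalg \<Rightarrow> 'g \<Rightarrow> ('g uel, 'v) smod \<Rightarrow> bool" where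
  "locally_nilpotent L x M \<longleftrightarrow> torsion L x M = carrier M"

text \<open>The \<open>\<complex>[x]\<close>-submodule generated by \<open>v\<close>, and the vectors for which it is finite dimensional.\<close>

definition cyclic :: "'g::ab_group_add superalg \<Rightarrow> 'g \<Rightarrow> ('g uel, 'v) smod \<Rightarrow> 'v \<Rightarrow> 'v set" where
  "cyclic L x M v = lspan (underlying L M) (range (\<lambda>k. (act L M x ^^ k) v))"

definition finite_vectors :: "'g::ab_group_add superalg \<Rightarrow> 'g \<Rightarrow> ('g uel, 'v) smod \<Rightarrow> 'v set" where
  "finite_vectors L x M = {v \<in> carrier M.
     \<exists>B. finite B \<and> B \<subseteq> carrier M \<and> cyclic L x M v = lspan (underlying L M) B}"


section \<open>Tensor products\<close>

record ('l, 'r, 'b) bimod = "'b ring" +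
  lact :: "'l \<Rightarrow> 'b \<Rightarrow> 'b"
  ract :: "'b \<Rightarrow> 'r \<Rightarrow> 'b"
  bpart :: "bit \<Rightarrow> 'b set"

text \<open>Elements of \<open>B \<otimes>\<^sub>R N\<close> are classes of formal sums of pairs, written as lists; \<open>tens_eq\<close> is the
  congruence of the tensor product relations. Negatives need no separate treatment because
  \<open>- (b \<otimes> n) = (- b) \<otimes> n\<close>.\<close>

inductive tens_eq :: "('r, 'm) ring_scheme \<Rightarrow> ('l, 'r, 'b) bimod \<Rightarrow> ('r, 'v) smod \<Rightarrow>
    ('b \<times> 'v) list \<Rightarrow> ('b \<times> 'v) list \<Rightarrow> bool"
  for R and B and N where
  refl: "set p \<subseteq> carrier B \<times> carrier N \<Longrightarrow> tens_eq R B N p p"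
| sym: "tens_eq R B N p q \<Longrightarrow> tens_eq R B N q p"
| trans: "tens_eq R B N p q \<Longrightarrow> tens_eq R B N q r \<Longrightarrow> tens_eq R B N p r"
| append: "tens_eq R B N p q \<Longrightarrow> tens_eq R B N p' q' \<Longrightarrow> tens_eq R B N (p @ p') (q @ q')"
| commute: "set p \<subseteq> carrier B \<times> carrier N \<Longrightarrow> set q \<subseteq> carrier B \<times> carrier N \<Longrightarrow>
    tens_eq R B N (p @ q) (q @ p)"
| zero: "n \<in> carrier N \<Longrightarrow> tens_eq R B N [(\<zero>\<^bsub>B\<^esub>, n)] []"
| add_left: "b \<in> carrier B \<Longrightarrow> b' \<in> carrier B \<Longrightarrow> n \<in> carrier N \<Longrightarrow>
    tens_eq R B N [(b \<oplus>\<^bsub>B\<^esub> b', n)] [(b, n), (b', n)]"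
| add_right: "b \<in> carrier B \<Longrightarrow> n \<in> carrier N \<Longrightarrow> n' \<in> carrier N \<Longrightarrow>
    tens_eq R B N [(b, n \<oplus>\<^bsub>N\<^esub> n')] [(b, n), (b, n')]"
| balanced: "b \<in> carrier B \<Longrightarrow> r \<in> carrier R \<Longrightarrow> n \<in> carrier N \<Longrightarrow>
    tens_eq R B N [(ract B b r, n)] [(b, r \<odot>\<^bsub>N\<^esub> n)]"

text \<open>Categories of modules live in a type of vectors that is closed under tensoring with a ring of
  type \<open>'b\<close>: an element of a tensor product is named by a chosen representative of its class. As
  \<open>'m\<close> is arbitrary, any module is isomorphic to one with carrier in \<open>range Atom\<close> for some \<open>'m\<close>.\<close>

datatype ('b, 'm) vec = Atom 'm | Tens "('b \<times> ('b, 'm) vec) list"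

definition tens :: "('r, 'k) ring_scheme \<Rightarrow> ('l, 'r, 'b) bimod \<Rightarrow> ('r, ('b, 'm) vec) smod \<Rightarrow>
    ('b \<times> ('b, 'm) vec) list \<Rightarrow> ('b, 'm) vec" where
  "tens R B N p = Tens (SOME q. tens_eq R B N p q)"

definition summands :: "('b, 'm) vec \<Rightarrow> ('b \<times> ('b, 'm) vec) list" where
  "summands x = (case x of Atom m \<Rightarrow> [] | Tens p \<Rightarrow> p)"

definition tensor :: "('r, 'k) ring_scheme \<Rightarrow> ('l, 'r, 'b) bimod \<Rightarrow> ('r, ('b, 'm) vec) smod \<Rightarrow>
    ('l, ('b, 'm) vec) smod" where
  "tensor R B N = \<lparr>carrier = {tens R B N p |p. set p \<subseteq> carrier B \<times> carrier N},
     mult = undefined, one = undefined,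
     zero = tens R B N [],
     add = (\<lambda>x y. tens R B N (summands x @ summands y)),
     smult = (\<lambda>l x. tens R B N (map (\<lambda>(b, n). (lact B l b, n)) (summands x))),
     mpart = (\<lambda>i. {tens R B N p |p. set p \<subseteq> (\<Union>j. bpart B j \<times> mpart N (i + j))})\<rparr>"

definition tensor_map :: "('r, 'k) ring_scheme \<Rightarrow> ('l, 'r, 'b) bimod \<Rightarrow>
    ('r, ('b, 'm) vec) smod \<Rightarrow> ('r, ('b, 'm) vec) smod \<Rightarrow>
    (('b, 'm) vec \<Rightarrow> ('b, 'm) vec) \<Rightarrow> ('b, 'm) vec \<Rightarrow> ('b, 'm) vec" where
  "tensor_map R B M N \<phi> =
     (\<lambda>x\<in>carrier (tensor R B M). tens R B N (map (\<lambda>(b, n). (b, \<phi> n)) (summands x)))"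


section \<open>Twisted localization and the Enright functor\<close>

definition lenv_bimod :: "'g::ab_group_add superalg \<Rightarrow> 'g \<Rightarrow> ('g lel, 'g uel, 'g lel) bimod" where
  "lenv_bimod L f = \<lparr>carrier = carrier (lenv L f), mult = mult (lenv L f), one = one (lenv L f),
     zero = zero (lenv L f), add = add (lenv L f),
     lact = mult (lenv L f), ract = (\<lambda>u r. u \<otimes>\<^bsub>lenv L f\<^esub> to_lenv L f r),
     bpart = lenv_part L f\<rparr>"

text \<open>The bimodule \<open>U'f\<^sup>a\<close>: the element \<open>u f\<^sup>a\<close> is represented by \<open>u\<close>.\<close>

definition twist_bimod :: "'g::ab_group_add superalg \<Rightarrow> 'g \<Rightarrow> complex \<Rightarrow> ('g lel, 'g lel, 'g lel) bimod" where
  "twist_bimod L f a = \<lparr>carrier = carrier (lenv L f), mult = mult (lenv L f), one = one (lenv L f),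
     zero = zero (lenv L f), add = add (lenv L f),
     lact = mult (lenv L f), ract = (\<lambda>u r. u \<otimes>\<^bsub>lenv L f\<^esub> twist L f a r),
     bpart = lenv_part L f\<rparr>"

type_synonym ('g, 'm) gvec = "('g lel, 'm) vec"
type_synonym ('g, 'm) gmod = "('g uel, ('g, 'm) gvec) smod"

definition loc_mod :: "'g::ab_group_add superalg \<Rightarrow> 'g \<Rightarrow> ('g, 'm) gmod \<Rightarrow>
    ('g lel, ('g, 'm) gvec) smod" where
  "loc_mod L f N = tensor (env L) (lenv_bimod L f) N"

definition loc_map :: "'g::ab_group_add superalg \<Rightarrow> 'g \<Rightarrow> ('g, 'm) gmod \<Rightarrow> ('g, 'm) gmod \<Rightarrow>
    (('g, 'm) gvec \<Rightarrow> ('g, 'm) gvec) \<Rightarrow> ('g, 'm) gvec \<Rightarrow> ('g, 'm) gvec" where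
  "loc_map L f = tensor_map (env L) (lenv_bimod L f)"

definition restrict_scalars :: "'g::ab_group_add superalg \<Rightarrow> 'g \<Rightarrow> ('g lel, 'v) smod \<Rightarrow>
    ('g uel, 'v) smod" where
  "restrict_scalars L f M = \<lparr>carrier = carrier M, mult = mult M, one = one M,
     zero = zero M, add = add M, smult = (\<lambda>u v. to_lenv L f u \<odot>\<^bsub>M\<^esub> v), mpart = mpart M\<rparr>"

definition D_mod :: "'g::ab_group_add superalg \<Rightarrow> 'g \<Rightarrow> complex \<Rightarrow> ('g, 'm) gmod \<Rightarrow> ('g, 'm) gmod" where
  "D_mod L f a N = restrict_scalars L f (tensor (lenv L f) (twist_bimod L f a) (loc_mod L f N))"

definition D_map :: "'g::ab_group_add superalg \<Rightarrow> 'g \<Rightarrow> complex \<Rightarrow> ('g, 'm) gmod \<Rightarrow> ('g, 'm) gmod \<Rightarrow>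
    (('g, 'm) gvec \<Rightarrow> ('g, 'm) gvec) \<Rightarrow> ('g, 'm) gvec \<Rightarrow> ('g, 'm) gvec" where
  "D_map L f a M N \<phi> = tensor_map (lenv L f) (twist_bimod L f a) (loc_mod L f M) (loc_mod L f N)
     (loc_map L f M N \<phi>)"

definition enright_mod :: "'g::ab_group_add superalg \<Rightarrow> 'g \<Rightarrow> 'g \<Rightarrow> complex \<Rightarrow>
    ('g, 'm) gmod \<Rightarrow> ('g, 'm) gmod" where
  "enright_mod L e f a N = (let D = D_mod L f a N in
     D\<lparr>carrier := finite_vectors L e D, mpart := \<lambda>i. mpart D i \<inter> finite_vectors L e D\<rparr>)"

definition enright_map :: "'g::ab_group_add superalg \<Rightarrow> 'g \<Rightarrow> 'g \<Rightarrow> complex \<Rightarrow>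
    ('g, 'm) gmod \<Rightarrow> ('g, 'm) gmod \<Rightarrow>
    (('g, 'm) gvec \<Rightarrow> ('g, 'm) gvec) \<Rightarrow> ('g, 'm) gvec \<Rightarrow> ('g, 'm) gvec" where
  "enright_map L e f a M N \<phi> = restrict (D_map L f a M N \<phi>) (carrier (enright_mod L e f a M))"


section \<open>Categories\<close>

record ('o, 'a) cat =
  obj :: "'o set"
  homs :: "'o \<Rightarrow> 'o \<Rightarrow> 'a set"
  ident :: "'o \<Rightarrow> 'a"
  comp :: "'o \<Rightarrow> 'o \<Rightarrow> 'o \<Rightarrow> 'a \<Rightarrow> 'a \<Rightarrow> 'a"  \<comment> \<open>\<open>comp C X Y Z g f\<close> is \<open>g \<circ> f\<close> for \<open>f: X \<rightarrow> Y\<close>, \<open>g: Y \<rightarrow> Z\<close>\<close>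

definition category :: "('o, 'a) cat \<Rightarrow> bool" where
  "category C \<longleftrightarrow>
     (\<forall>X\<in>obj C. ident C X \<in> homs C X X) \<and>
     (\<forall>X\<in>obj C. \<forall>Y\<in>obj C. \<forall>Z\<in>obj C. \<forall>f\<in>homs C X Y. \<forall>g\<in>homs C Y Z.
        comp C X Y Z g f \<in> homs C X Z) \<and>
     (\<forall>X\<in>obj C. \<forall>Y\<in>obj C. \<forall>f\<in>homs C X Y.
        comp C X X Y f (ident C X) = f \<and> comp C X Y Y (ident C Y) f = f) \<and>
     (\<forall>W\<in>obj C. \<forall>X\<in>obj C. \<forall>Y\<in>obj C. \<forall>Z\<in>obj C.
        \<forall>f\<in>homs C W X. \<forall>g\<in>homs C X Y. \<forall>k\<in>homs C Y Z.
        comp C W X Z (comp C X Y Z k g) f = comp C W Y Z k (comp C W X Y g f))"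

record ('o, 'a, 'p, 'b) ftor =
  fobj :: "'o \<Rightarrow> 'p"
  fmap :: "'o \<Rightarrow> 'o \<Rightarrow> 'a \<Rightarrow> 'b"

definition is_functor :: "('o, 'a) cat \<Rightarrow> ('p, 'b) cat \<Rightarrow> ('o, 'a, 'p, 'b) ftor \<Rightarrow> bool" where
  "is_functor C D F \<longleftrightarrow> category C \<and> category D \<and>
     (\<forall>X\<in>obj C. fobj F X \<in> obj D \<and> fmap F X X (ident C X) = ident D (fobj F X)) \<and>
     (\<forall>X\<in>obj C. \<forall>Y\<in>obj C. \<forall>f\<in>homs C X Y. fmap F X Y f \<in> homs D (fobj F X) (fobj F Y)) \<and>
     (\<forall>X\<in>obj C. \<forall>Y\<in>obj C. \<forall>Z\<in>obj C. \<forall>f\<in>homs C X Y. \<forall>g\<in>homs C Y Z.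
        fmap F X Z (comp C X Y Z g f) =
        comp D (fobj F X) (fobj F Y) (fobj F Z) (fmap F Y Z g) (fmap F X Y f))"

definition id_functor :: "('o, 'a, 'o, 'a) ftor" where
  "id_functor = \<lparr>fobj = (\<lambda>X. X), fmap = (\<lambda>X Y f. f)\<rparr>"

definition comp_functor :: "('p, 'b, 'q, 'c) ftor \<Rightarrow> ('o, 'a, 'p, 'b) ftor \<Rightarrow> ('o, 'a, 'q, 'c) ftor" where
  "comp_functor G F = \<lparr>fobj = (\<lambda>X. fobj G (fobj F X)),
     fmap = (\<lambda>X Y f. fmap G (fobj F X) (fobj F Y) (fmap F X Y f))\<rparr>"

definition nat_trans :: "('o, 'a) cat \<Rightarrow> ('p, 'b) cat \<Rightarrow>
    ('o, 'a, 'p, 'b) ftor \<Rightarrow> ('o, 'a, 'p, 'b) ftor \<Rightarrow> ('o \<Rightarrow> 'b) \<Rightarrow> bool" where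
  "nat_trans C D F G \<eta> \<longleftrightarrow> is_functor C D F \<and> is_functor C D G \<and>
     (\<forall>X\<in>obj C. \<eta> X \<in> homs D (fobj F X) (fobj G X)) \<and>
     (\<forall>X\<in>obj C. \<forall>Y\<in>obj C. \<forall>f\<in>homs C X Y.
        comp D (fobj F X) (fobj F Y) (fobj G Y) (\<eta> Y) (fmap F X Y f) =
        comp D (fobj F X) (fobj G X) (fobj G Y) (fmap G X Y f) (\<eta> X))"

definition nat_iso :: "('o, 'a) cat \<Rightarrow> ('p, 'b) cat \<Rightarrow>
    ('o, 'a, 'p, 'b) ftor \<Rightarrow> ('o, 'a, 'p, 'b) ftor \<Rightarrow> ('o \<Rightarrow> 'b) \<Rightarrow> bool" where
  "nat_iso C D F G \<eta> \<longleftrightarrow> nat_trans C D F G \<eta> \<and>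
     (\<forall>X\<in>obj C. \<exists>\<theta>\<in>homs D (fobj G X) (fobj F X).
        comp D (fobj F X) (fobj G X) (fobj F X) \<theta> (\<eta> X) = ident D (fobj F X) \<and>
        comp D (fobj G X) (fobj F X) (fobj G X) (\<eta> X) \<theta> = ident D (fobj G X))"

definition equivalence :: "('o, 'a) cat \<Rightarrow> ('p, 'b) cat \<Rightarrow> ('o, 'a, 'p, 'b) ftor \<Rightarrow> bool" where
  "equivalence C D F \<longleftrightarrow> is_functor C D F \<and>
     (\<exists>G \<eta> \<epsilon>. is_functor D C G \<and>
        nat_iso C C id_functor (comp_functor G F) \<eta> \<and>
        nat_iso D D (comp_functor F G) id_functor \<epsilon>)"

text \<open>The category \<open>\<M>(b)\<^sup>e\<close>.\<close>

definition M_e :: "bool \<Rightarrow> 'g::ab_group_add superalg \<Rightarrow> 'g \<Rightarrow> 'g \<Rightarrow> complex \<Rightarrow>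
    (('g, 'm) gmod, ('g, 'm) gvec \<Rightarrow> ('g, 'm) gvec) cat" where
  "M_e super L e h b = \<lparr>
     obj = {M. lie_module super L M \<and> diagonal_in L h b M \<and> locally_nilpotent L e M},
     homs = lie_hom super L,
     ident = (\<lambda>M. \<lambda>v\<in>carrier M. v),
     comp = (\<lambda>X Y Z \<psi> \<phi>. compose (carrier X) \<psi> \<phi>)\<rparr>"

definition enright :: "'g::ab_group_add superalg \<Rightarrow> 'g \<Rightarrow> 'g \<Rightarrow> complex \<Rightarrow>
    (('g, 'm) gmod, ('g, 'm) gvec \<Rightarrow> ('g, 'm) gvec, ('g, 'm) gmod, ('g, 'm) gvec \<Rightarrow> ('g, 'm) gvec) ftor"
  where "enright L e f a = \<lparr>fobj = enright_mod L e f a, fmap = enright_map L e f a\<rparr>"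

end

(*
  For natural a the map phi_a is conjugation by f^a, hence multiplicative, and phi_a phi_b =
  phi_(a+b). On a given element phi_a is polynomial in a, because ad f is locally nilpotent, so
  these identities, true for all natural numbers, persist for all complex a. Local nilpotency
  of ad f itself holds because ad h has finitely many eigenvalues on a finite dimensional
  sl_2-stable space and ad f shifts them.

  The kernel of N -> D_a(N) is the f-torsion of N: U(g)[f^(-1)] acts on the germs at infinity
  of sequences in N, with f^(-1) acting by a shift, and n goes to the germ of s |-> f^s n.
  Every element of D_a(N) is a fraction f^(-s) j(n), where j is the canonical map.

  On a weight space f^k e^k is a polynomial in fe, and j intertwines fe with fe plus a scalar.
  Comparing eigenvalues, for N in M(a)^e each f^s j(n) with s large is killed by a power of e,
  uniformly in a. So D_a(N) is the localization of C_a(N), and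
  D_(-a)(C_a(N)) = D_(-a)(D_a(N)) = N[f^(-1)], which gives the unit N -> C_(-a)C_a(N), the
  element n being f^(-s) j(f^s j(n)). For non-integral weights, f is injective modulo any submodule
  of a module with locally nilpotent e, since there fe has nonzero eigenvalues on the
  vectors killed by powers of e; this makes the unit bijective. For a = 0 the map j is
  injective when N has no f-torsion, so a homomorphism is recovered from its image under C_0.
*)
theory Submission
  imports Defs "HOL-Computational_Algebra.Fundamental_Theorem_Algebra"
begin

section \<open>Complex powers of a locally unipotent conjugation\<close>

text \<open>The localized algebra is given only by generators and relations, so it comes with no
  normal form and with no injectivity of \<open>to_lenv\<close>. What has to be nonzero in a
  localization must be detected on a module, which is why an action on germs is built by hand. In
  the other direction the existence of denominators is enough, never their uniqueness.

  The sign in M(a) -> M(-a) comes from phi_a(h) = h + 2a: the map j lowers weights by 2a, and a - 2a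
  = -a. That the weights of N lie in a + Z enters a second time for the torsion of f^s j(n): the
  shifted eigenvalues of fe take the form q(l+q+1), and q is an integer because the weight differs
  from a by an integer.

  In general j is not a homomorphism over g but is twisted by phi_a, and j(n) need not lie in
  C_a(N). Hence the unit is characterized by an equation that holds after multiplication by a power
  of f, and its linearity rests on the cancellation of phi_a against phi_(-a).\<close>

locale unipotent_ring = ring S for S (structure) +
  fixes F Fi :: 'a and K :: "complex \<Rightarrow> 'a"
  assumes F_closed [simp]: "F \<in> carrier S" and Fi_closed [simp]: "Fi \<in> carrier S"
    and F_Fi [simp]: "F \<otimes> Fi = \<one>" and Fi_F [simp]: "Fi \<otimes> F = \<one>"
    and K_closed [simp]: "K c \<in> carrier S"
    and K_add: "K (c + d) = K c \<oplus> K d"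
    and K_mult: "K (c * d) = K c \<otimes> K d"
    and K_one [simp]: "K 1 = \<one>"
    and K_central: "u \<in> carrier S \<Longrightarrow> K c \<otimes> u = u \<otimes> K c"
    and ad_nilpotent: "u \<in> carrier S \<Longrightarrow> \<exists>n. ((\<lambda>u. F \<otimes> u \<ominus> u \<otimes> F) ^^ n) u = \<zero>"
begin

definition ad :: "'a \<Rightarrow> 'a" where "ad u = F \<otimes> u \<ominus> u \<otimes> F"
definition Ad :: "'a \<Rightarrow> 'a" where "Ad u = F \<otimes> u \<otimes> Fi"
text \<open>By \<open>Ad_eq\<close>, conjugation by F is 1 + \<open>nl\<close>, and by
  \<open>nl_pow\<close> the powers of \<open>nl\<close> are (ad f)^i(u) f^(-i). So the series of the
  twist is the binomial series of (1 + \<open>nl\<close>)^a.\<close>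

definition nl :: "'a \<Rightarrow> 'a" where "nl u = ad u \<otimes> Fi"

lemma ad_closed [simp]: "u \<in> carrier S \<Longrightarrow> ad u \<in> carrier S"
  by (simp add: ad_def)

lemma ad_pow_closed [simp]: "u \<in> carrier S \<Longrightarrow> (ad ^^ n) u \<in> carrier S"
  by (induction n) auto

lemma Ad_closed [simp]: "u \<in> carrier S \<Longrightarrow> Ad u \<in> carrier S"
  by (simp add: Ad_def)

lemma nl_closed [simp]: "u \<in> carrier S \<Longrightarrow> nl u \<in> carrier S"
  by (simp add: nl_def)

lemma nl_pow_closed [simp]: "u \<in> carrier S \<Longrightarrow> (nl ^^ n) u \<in> carrier S"
  by (induction n) auto

lemma K_zero [simp]: "K 0 = \<zero>"
proof -
  have "K 0 = K 0 \<oplus> K 0" using K_add[of 0 0] by simp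
  then show ?thesis using K_closed[of 0] by (metis add.l_cancel_one')
qed

lemma K_minus: "K (- c) = \<ominus> K c"
  using K_add[of "-c" c] by (simp add: minus_equality)

lemma Fi_pow_closed [simp]: "Fi [^] (n::nat) \<in> carrier S" by simp

lemma Fi_F_cancel [simp]: "u \<in> carrier S \<Longrightarrow> Fi \<otimes> (F \<otimes> u) = u"
  by (metis F_closed Fi_closed Fi_F m_assoc l_one)

lemma F_Fi_cancel [simp]: "u \<in> carrier S \<Longrightarrow> F \<otimes> (Fi \<otimes> u) = u"
  by (metis F_closed Fi_closed F_Fi m_assoc l_one)

lemma Ad_eq: "u \<in> carrier S \<Longrightarrow> Ad u = u \<oplus> nl u"
proof -
  assume u: "u \<in> carrier S"
  have "nl u = F \<otimes> u \<otimes> Fi \<ominus> u"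
    using u by (simp add: nl_def ad_def minus_eq l_distr l_minus m_assoc)
  then have "u \<oplus> nl u = u \<oplus> (\<ominus> u \<oplus> F \<otimes> u \<otimes> Fi)"
    using u by (simp add: minus_eq a_comm)
  then show ?thesis using u by (simp add: Ad_def r_neg2)
qed

lemma Ad_mult: "u \<in> carrier S \<Longrightarrow> v \<in> carrier S \<Longrightarrow> Ad (u \<otimes> v) = Ad u \<otimes> Ad v"
  by (simp add: Ad_def m_assoc)

lemma ad_add: "u \<in> carrier S \<Longrightarrow> v \<in> carrier S \<Longrightarrow> ad (u \<oplus> v) = ad u \<oplus> ad v"
  by (simp add: ad_def r_distr l_distr minus_eq minus_add a_ac)

lemma nl_add: "u \<in> carrier S \<Longrightarrow> v \<in> carrier S \<Longrightarrow> nl (u \<oplus> v) = nl u \<oplus> nl v"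
  by (simp add: nl_def ad_add l_distr)

lemma ad_K: "u \<in> carrier S \<Longrightarrow> ad (K c \<otimes> u) = K c \<otimes> ad u"
  by (simp add: ad_def minus_eq r_distr r_minus m_assoc[symmetric] K_central[of F])

lemma nl_K: "u \<in> carrier S \<Longrightarrow> nl (K c \<otimes> u) = K c \<otimes> nl u"
  by (simp add: nl_def ad_K m_assoc)

lemma ad_zero [simp]: "ad \<zero> = \<zero>" by (simp add: ad_def minus_eq)
lemma nl_zero [simp]: "nl \<zero> = \<zero>" by (simp add: nl_def)
lemma ad_pow_zero [simp]: "(ad ^^ n) \<zero> = \<zero>" by (induction n) auto
lemma nl_pow_add: "u \<in> carrier S \<Longrightarrow> v \<in> carrier S \<Longrightarrow> (nl ^^ n) (u \<oplus> v) = (nl ^^ n) u \<oplus> (nl ^^ n) v"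
  by (induction n) (auto simp: nl_add)

lemma ad_Fi: "u \<in> carrier S \<Longrightarrow> ad (u \<otimes> Fi) = ad u \<otimes> Fi"
  by (simp add: ad_def minus_eq l_distr l_minus m_assoc)

lemma nl_pow: "u \<in> carrier S \<Longrightarrow> (nl ^^ n) u = (ad ^^ n) u \<otimes> Fi [^] n"
proof (induction n)
  case (Suc n)
  have "ad (v \<otimes> Fi [^] m) = ad v \<otimes> Fi [^] (m::nat)" if "v \<in> carrier S" for v m
    using that by (induction m arbitrary: v) (auto simp: m_assoc[symmetric] ad_Fi)
  then show ?case using Suc by (simp add: nl_def m_assoc)
qed auto

lemma ad_pow_zero_mono:
  assumes "(ad ^^ n) u = \<zero>" "n \<le> m" shows "(ad ^^ m) u = \<zero>"
proof -
  have "(ad ^^ m) u = (ad ^^ (m - n)) ((ad ^^ n) u)"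
    using assms(2) by (metis funpow_add comp_apply le_add_diff_inverse2)
  then show ?thesis using assms by simp
qed

lemma nilpotent: "u \<in> carrier S \<Longrightarrow> \<exists>n. (ad ^^ n) u = \<zero>"
  using ad_nilpotent[of u] unfolding ad_def[abs_def] .

definition twst :: "complex \<Rightarrow> 'a \<Rightarrow> 'a" where
  "twst a u = finsum S (\<lambda>i. K (a gchoose i) \<otimes> (ad ^^ i) u \<otimes> Fi [^] i) {i. (ad ^^ i) u \<noteq> \<zero>}"

text \<open>Any n beyond the order of nilpotency gives an admissible range. The set of nonzero terms
  varies with \<open>u\<close>, whereas a common range lets two series be added or compared term by
  term.\<close>

lemma twst_eq:
  assumes u: "u \<in> carrier S" and n: "(ad ^^ n) u = \<zero>"
  shows "twst a u = finsum S (\<lambda>i. K (a gchoose i) \<otimes> (nl ^^ i) u) {..<n}"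
proof -
  have sub: "{i. (ad ^^ i) u \<noteq> \<zero>} \<subseteq> {..<n}"
    using ad_pow_zero_mono[OF n] by (force simp: not_less[symmetric])
  have "twst a u = finsum S (\<lambda>i. K (a gchoose i) \<otimes> (nl ^^ i) u) {i. (ad ^^ i) u \<noteq> \<zero>}"
    unfolding twst_def using u by (intro add.finprod_cong') (auto simp: nl_pow m_assoc)
  also have "\<dots> = finsum S (\<lambda>i. K (a gchoose i) \<otimes> (nl ^^ i) u) {..<n}"
    using u sub by (intro add.finprod_mono_neutral_cong_left) (auto simp: nl_pow)
  finally show ?thesis .
qed

lemma twst_closed [simp]: "u \<in> carrier S \<Longrightarrow> twst a u \<in> carrier S"
  unfolding twst_def by (intro finsum_closed) auto

section \<open>Polynomial functions of the exponent\<close>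

text \<open>\<open>Pol n\<close> consists of the polynomial functions of degree \<open>< n\<close> in Horner form.\<close>

inductive Pol :: "nat \<Rightarrow> (complex \<Rightarrow> 'a) \<Rightarrow> bool" where
  Pol_0: "Pol 0 (\<lambda>_. \<zero>)"
| Pol_Suc: "v \<in> carrier S \<Longrightarrow> Pol n g \<Longrightarrow> Pol (Suc n) (\<lambda>a. v \<oplus> K a \<otimes> g a)"

lemma Pol_SucE:
  assumes "Pol (Suc n) g"
  obtains v g' where "g = (\<lambda>a. v \<oplus> K a \<otimes> g' a)" "v \<in> carrier S" "Pol n g'"
  using assms by cases (rule that)

lemma Pol_0E: assumes "Pol 0 g" obtains "g = (\<lambda>_. \<zero>)"
  using assms by cases (rule that)

lemma Pol_closed: "Pol n g \<Longrightarrow> g a \<in> carrier S"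
  by (induction rule: Pol.induct) auto

lemma Pol_zero: "Pol n (\<lambda>_. \<zero>)"
proof (induction n)
  case (Suc n)
  from Pol_Suc[OF zero_closed this] show ?case by simp
qed (rule Pol_0)

lemma Pol_mono: "Pol n g \<Longrightarrow> n \<le> m \<Longrightarrow> Pol m g"
proof (induction arbitrary: m rule: Pol.induct)
  case Pol_0
  then show ?case by (simp add: Pol_zero)
next
  case (Pol_Suc v n g)
  then obtain k where "m = Suc k" "n \<le> k" by (cases m) auto
  then show ?case using Pol_Suc Pol.Pol_Suc by blast
qed

lemma Pol_add: "Pol n g \<Longrightarrow> Pol n k \<Longrightarrow> Pol n (\<lambda>a. g a \<oplus> k a)"
proof (induction arbitrary: k rule: Pol.induct)
  case Pol_0
  then have "k = (\<lambda>_. \<zero>)" by (auto elim: Pol_0E)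
  then show ?case by (simp add: Pol_zero)
next
  case (Pol_Suc v n g)
  from Pol_Suc.prems obtain w k' where k: "k = (\<lambda>a. w \<oplus> K a \<otimes> k' a)" and w: "w \<in> carrier S" "Pol n k'"
    by (rule Pol_SucE)
  have "(\<lambda>a. v \<oplus> K a \<otimes> g a \<oplus> k a) = (\<lambda>a. (v \<oplus> w) \<oplus> K a \<otimes> (g a \<oplus> k' a))"
    using Pol_Suc.hyps w Pol_closed by (intro ext) (simp add: k r_distr a_ac)
  then show ?case using Pol.Pol_Suc[OF _ Pol_Suc.IH[OF w(2)], of "v \<oplus> w"] Pol_Suc.hyps w by simp
qed

lemma Pol_lmult: "Pol n g \<Longrightarrow> w \<in> carrier S \<Longrightarrow> Pol n (\<lambda>a. w \<otimes> g a)"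
proof (induction rule: Pol.induct)
  case Pol_0
  then show ?case by (simp add: Pol.Pol_0)
next
  case (Pol_Suc v n g)
  have "(\<lambda>a. w \<otimes> (v \<oplus> K a \<otimes> g a)) = (\<lambda>a. w \<otimes> v \<oplus> K a \<otimes> (w \<otimes> g a))"
    using Pol_Suc Pol_closed[OF Pol_Suc.hyps(2)]
    by (intro ext) (simp add: r_distr m_assoc[symmetric] K_central[of w])
  then show ?case using Pol.Pol_Suc[OF _ Pol_Suc.IH, of "w \<otimes> v"] Pol_Suc by simp
qed

definition poly_fun :: "(complex \<Rightarrow> 'a) \<Rightarrow> bool" where "poly_fun g \<longleftrightarrow> (\<exists>n. Pol n g)"

lemma poly_fun_const: "v \<in> carrier S \<Longrightarrow> poly_fun (\<lambda>_. v)"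
  using Pol_Suc[OF _ Pol_0, of v] by (auto simp: poly_fun_def)

lemma poly_fun_add: "poly_fun g \<Longrightarrow> poly_fun k \<Longrightarrow> poly_fun (\<lambda>a. g a \<oplus> k a)"
  unfolding poly_fun_def using Pol_add Pol_mono by (meson nle_le)

lemma poly_fun_K: "poly_fun g \<Longrightarrow> poly_fun (\<lambda>a. K a \<otimes> g a)"
proof -
  assume "poly_fun g"
  then obtain n where n: "Pol n g" by (auto simp: poly_fun_def)
  from Pol_Suc[OF zero_closed this] have "Pol (Suc n) (\<lambda>a. \<zero> \<oplus> K a \<otimes> g a)" .
  moreover have "(\<lambda>a. \<zero> \<oplus> K a \<otimes> g a) = (\<lambda>a. K a \<otimes> g a)"
    using Pol_closed[OF n] by simp
  ultimately show ?thesis by (auto simp: poly_fun_def)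
qed

lemma poly_fun_lmult: "poly_fun g \<Longrightarrow> w \<in> carrier S \<Longrightarrow> poly_fun (\<lambda>a. w \<otimes> g a)"
  unfolding poly_fun_def using Pol_lmult by blast

text \<open>The variable enters only through the central elements \<open>K a\<close>, so polynomials
  with noncommuting coefficients are closed under pointwise products. Recursion on the Horner form
  of the left factor keeps each \<open>K a\<close> in front.\<close>

lemma poly_fun_mult:
  assumes "poly_fun g" "poly_fun k" shows "poly_fun (\<lambda>a. g a \<otimes> k a)"
proof -
  obtain n where "Pol n g" using assms by (auto simp: poly_fun_def)
  moreover have kc: "k a \<in> carrier S" for a using assms Pol_closed by (auto simp: poly_fun_def)
  ultimately show ?thesis
  proof (induction rule: Pol.induct)
    case Pol_0
    then show ?case by (simp add: poly_fun_const)
  next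
    case (Pol_Suc v n g)
    have "(\<lambda>a. (v \<oplus> K a \<otimes> g a) \<otimes> k a) = (\<lambda>a. v \<otimes> k a \<oplus> K a \<otimes> (g a \<otimes> k a))"
      using Pol_Suc.hyps Pol_closed kc by (intro ext) (simp add: l_distr m_assoc)
    moreover have "poly_fun (\<lambda>a. v \<otimes> k a \<oplus> K a \<otimes> (g a \<otimes> k a))"
      using Pol_Suc assms by (intro poly_fun_add poly_fun_lmult poly_fun_K) auto
    ultimately show ?case by simp
  qed
qed

lemma poly_fun_closed: "poly_fun g \<Longrightarrow> g a \<in> carrier S"
  by (auto simp: poly_fun_def Pol_closed)

lemma poly_fun_shift: "poly_fun g \<Longrightarrow> poly_fun (\<lambda>a. g (a + b))"
proof -
  assume "poly_fun g"
  then obtain n where "Pol n g" by (auto simp: poly_fun_def)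
  then show ?thesis
  proof (induction rule: Pol.induct)
    case Pol_0
    then show ?case by (simp add: poly_fun_const)
  next
    case (Pol_Suc v n g)
    have "(\<lambda>a. v \<oplus> K (a + b) \<otimes> g (a + b)) = (\<lambda>a. v \<oplus> (K a \<otimes> g (a + b) \<oplus> K b \<otimes> g (a + b)))"
      using Pol_closed[OF Pol_Suc.hyps(2)] by (simp add: K_add l_distr)
    moreover have "poly_fun (\<lambda>a. v \<oplus> (K a \<otimes> g (a + b) \<oplus> K b \<otimes> g (a + b)))"
      using Pol_Suc by (intro poly_fun_add poly_fun_const poly_fun_K poly_fun_lmult) auto
    ultimately show ?case by simp
  qed
qed

text \<open>The recursion (i+1) binom(a,i+1) = (a-i) binom(a,i) adds one linear factor at a time;
  the division by i+1 is possible because \<open>K\<close> is defined on all complex numbers and not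
  only on integers.\<close>

lemma poly_fun_binomial: "poly_fun (\<lambda>a. K (a gchoose i))"
proof (induction i)
  case 0
  then show ?case using poly_fun_const[OF one_closed] by simp
next
  case (Suc i)
  let ?c = "inverse (of_nat (Suc i)) :: complex"
  have "K (a gchoose Suc i) = K ?c \<otimes> (K a \<otimes> K (a gchoose i) \<oplus> K (- of_nat i) \<otimes> K (a gchoose i))" for a
  proof -
    have "of_nat (Suc i) * (a gchoose Suc i) = (a - of_nat i) * (a gchoose i)"
      using gbinomial_absorb_comp[of a i] gbinomial_absorption[of i a] by simp
    then have "(a gchoose Suc i) = ?c * (a * (a gchoose i) + (- of_nat i) * (a gchoose i))"
      by (simp add: field_simps del: of_nat_Suc)
    then show ?thesis by (simp only: K_mult K_add)
  qed
  then show ?case using Suc by (auto intro!: poly_fun_lmult poly_fun_add poly_fun_K)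
qed

lemma poly_fun_finsum:
  assumes "\<And>i. i < (n::nat) \<Longrightarrow> poly_fun (g i)"
  shows "poly_fun (\<lambda>a. finsum S (\<lambda>i. g i a) {..<n})"
  using assms
proof (induction n)
  case (Suc n)
  have "finsum S (\<lambda>i. g i a) {..<Suc n} = g n a \<oplus> finsum S (\<lambda>i. g i a) {..<n}" for a
    using Suc.prems poly_fun_closed by (simp add: lessThan_Suc Pi_iff)
  then show ?case using Suc by (auto intro: poly_fun_add)
qed (simp add: poly_fun_const)

lemma poly_fun_twst: "u \<in> carrier S \<Longrightarrow> poly_fun (\<lambda>a. twst a u)"
proof -
  assume u: "u \<in> carrier S"
  then obtain n where n: "(ad ^^ n) u = \<zero>" using nilpotent by blast
  show ?thesis unfolding twst_eq[OF u n]
    using u by (intro poly_fun_finsum poly_fun_mult poly_fun_binomial poly_fun_const) auto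
qed

text \<open>Division by the linear polynomial a - m, carried out on the Horner form. The quotient
  has one coefficient less, which is what the induction of \<open>Pol_zero_on_nat\<close>
  consumes.\<close>

lemma Pol_factor: "Pol (Suc n) g \<Longrightarrow> \<exists>k. Pol n k \<and> (\<forall>a. g a = g m \<oplus> K (a - m) \<otimes> k a)"
proof (induction n arbitrary: g)
  case 0
  then obtain v where "g = (\<lambda>a. v \<oplus> K a \<otimes> \<zero>)" "v \<in> carrier S"
    by (elim Pol_SucE Pol_0E) auto
  then have "\<forall>a. g a = g m \<oplus> K (a - m) \<otimes> \<zero>" by simp
  then show ?case using Pol_0 by blast
next
  case (Suc n)
  from Suc.prems obtain v g' where g: "g = (\<lambda>a. v \<oplus> K a \<otimes> g' a)" and v: "v \<in> carrier S" "Pol (Suc n) g'"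
    by (rule Pol_SucE)
  obtain k where k0: "Pol n k \<and> (\<forall>a. g' a = g' m \<oplus> K (a - m) \<otimes> k a)"
    using Suc.IH[OF v(2)] ..
  from conjunct1[OF k0] spec[OF conjunct2[OF k0]]
  have k: "Pol n k" "\<And>a. g' a = g' m \<oplus> K (a - m) \<otimes> k a" .
  have kc: "k a \<in> carrier S" and gc: "g' a \<in> carrier S" for a
    using Pol_closed[OF k(1)] Pol_closed[OF v(2)] by blast+
  have "g a = g m \<oplus> K (a - m) \<otimes> (g' m \<oplus> K a \<otimes> k a)" for a
  proof -
    have e: "g a = v \<oplus> K a \<otimes> g' a" by (simp only: g)
    have "g a = v \<oplus> K a \<otimes> (g' m \<oplus> K (a - m) \<otimes> k a)"
      by (rule HOL.trans[OF e]) (rule arg_cong[OF k(2)])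
    also have "\<dots> = v \<oplus> (K a \<otimes> g' m \<oplus> K a \<otimes> (K (a - m) \<otimes> k a))"
      by (simp only: r_distr gc kc K_closed m_closed)
    also have "K a \<otimes> g' m = K m \<otimes> g' m \<oplus> K (a - m) \<otimes> g' m"
    proof -
      have "K a = K m \<oplus> K (a - m)" by (simp only: K_add[symmetric]) simp
      then show ?thesis by (simp only: l_distr gc K_closed)
    qed
    also have "K a \<otimes> (K (a - m) \<otimes> k a) = K (a - m) \<otimes> (K a \<otimes> k a)"
    proof -
      have "K a \<otimes> K (a - m) = K (a - m) \<otimes> K a" by (rule K_central) simp
      then show ?thesis using kc by (metis K_closed m_assoc)
    qed
    also have "v \<oplus> (K m \<otimes> g' m \<oplus> K (a - m) \<otimes> g' m \<oplus> K (a - m) \<otimes> (K a \<otimes> k a)) =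
        (v \<oplus> K m \<otimes> g' m) \<oplus> K (a - m) \<otimes> (g' m \<oplus> K a \<otimes> k a)"
      by (simp only: r_distr gc kc v K_closed m_closed a_assoc a_closed)
    finally show ?thesis by (simp only: g)
  qed
  moreover have "Pol (Suc n) (\<lambda>a. g' m \<oplus> K a \<otimes> k a)" using Pol_Suc[OF gc k(1)] .
  ultimately show ?case by blast
qed

text \<open>Once the root \<open>m0\<close> is divided out, the quotient is known to vanish only at
  larger integers; so the hypothesis speaks about all m beyond an arbitrary bound instead of all
  natural numbers. Zero divisors of the ring do no harm, since m - m0 is an invertible
  scalar.\<close>

lemma Pol_zero_on_nat:
  "Pol n g \<Longrightarrow> (\<And>m. m \<ge> m0 \<Longrightarrow> g (of_nat m) = \<zero>) \<Longrightarrow> g a = \<zero>"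
proof (induction n arbitrary: g m0 a)
  case 0
  then show ?case by (auto elim: Pol_0E)
next
  case (Suc n)
  obtain k where k0: "Pol n k \<and> (\<forall>a. g a = g (of_nat m0) \<oplus> K (a - of_nat m0) \<otimes> k a)"
    using Pol_factor[OF Suc.prems(1)] ..
  have gm0: "g (of_nat m0) = \<zero>" by (rule Suc.prems(2)) simp
  from conjunct1[OF k0] spec[OF conjunct2[OF k0]]
  have k: "Pol n k" "\<And>a. g a = \<zero> \<oplus> K (a - of_nat m0) \<otimes> k a" unfolding gm0 .
  have kc: "k a \<in> carrier S" for a using k Pol_closed by auto
  have "k (of_nat m) = \<zero>" if "m \<ge> Suc m0" for m
  proof -
    let ?d = "of_nat m - of_nat m0 :: complex"
    have d: "?d \<noteq> 0" using that by simp
    have "K ?d \<otimes> k (of_nat m) = \<zero>" using k(2)[of "of_nat m"] Suc.prems(2)[of m] that kc by simp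
    then have "K (inverse ?d) \<otimes> (K ?d \<otimes> k (of_nat m)) = \<zero>" by simp
    then have "K (inverse ?d * ?d) \<otimes> k (of_nat m) = \<zero>"
      using kc by (simp only: K_mult m_assoc K_closed)
    then show ?thesis using d kc by simp
  qed
  then have "k a = \<zero>" using Suc.IH[OF k(1)] by blast
  then show ?case using k(2)[of a] by simp
qed

lemma poly_fun_eqI:
  assumes "poly_fun g" "poly_fun k" "\<And>m. g (of_nat m) = k (of_nat m)"
  shows "g a = k a"
proof -
  have c: "g x \<in> carrier S" "k x \<in> carrier S" for x using assms poly_fun_closed by auto
  have "poly_fun (\<lambda>a. g a \<oplus> K (- 1) \<otimes> k a)"
    using assms by (intro poly_fun_add poly_fun_lmult) auto
  then obtain n where n: "Pol n (\<lambda>a. g a \<oplus> K (- 1) \<otimes> k a)" by (auto simp: poly_fun_def)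
  have e: "g x \<oplus> K (- 1) \<otimes> k x = g x \<ominus> k x" for x using c by (simp add: K_minus l_minus minus_eq)
  have "k x \<ominus> k x = \<zero>" for x using c by (simp add: minus_eq r_neg)
  then have "g a \<ominus> k a = \<zero>" using Pol_zero_on_nat[OF n, of 0 a] assms(3) unfolding e by simp
  then show ?thesis using c by (metis minus_eq minus_minus a_inv_closed minus_equality)
qed

section \<open>The twists as a one-parameter group of ring automorphisms\<close>

lemma twst_add: assumes "u \<in> carrier S" "v \<in> carrier S" shows "twst a (u \<oplus> v) = twst a u \<oplus> twst a v"
proof -
  obtain n m where "(ad ^^ n) u = \<zero>" "(ad ^^ m) v = \<zero>" using nilpotent assms by blast
  then have n: "(ad ^^ (n + m)) u = \<zero>" "(ad ^^ (n + m)) v = \<zero>"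
    using ad_pow_zero_mono le_add1 le_add2 by blast+
  have "(ad ^^ k) (u \<oplus> v) = (ad ^^ k) u \<oplus> (ad ^^ k) v" for k
    using assms by (induction k) (auto simp: ad_add)
  with n have "(ad ^^ (n + m)) (u \<oplus> v) = \<zero>" by simp
  then show ?thesis
    using assms by (simp add: twst_eq[OF _ n(1)] twst_eq[OF _ n(2)] twst_eq[OF _ \<open>(ad ^^ (n + m)) (u \<oplus> v) = \<zero>\<close>]
        nl_pow_add r_distr finsum_addf Pi_iff)
qed

lemma Ad_finsum: "finite A \<Longrightarrow> g \<in> A \<rightarrow> carrier S \<Longrightarrow> nl (finsum S g A) = finsum S (\<lambda>i. nl (g i)) A"
  by (induction rule: finite_induct) (auto simp: nl_add Pi_iff)

text \<open>Pascal's rule, read as (1 + \<open>nl\<close>)^(a+1) = (1 + \<open>nl\<close>)(1 +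
  \<open>nl\<close>)^a. It is the bridge from the series, meaningful for all complex exponents, to
  conjugation by powers of F at the natural ones.\<close>

lemma twst_plus_one:
  assumes u: "u \<in> carrier S" shows "twst (a + 1) u = Ad (twst a u)"
proof -
  obtain n where n: "(ad ^^ n) u = \<zero>" using nilpotent u by blast
  let ?g = "\<lambda>c i. K (c gchoose i) \<otimes> (nl ^^ i) u"
  have sn: "(ad ^^ Suc n) u = \<zero>" using n by simp
  have g: "?g c i \<in> carrier S" for c i using u by simp
  have *: "finsum S (?g c) {..<Suc n} = u \<oplus> finsum S (\<lambda>i. ?g c (Suc i)) {..<n}" for c
  proof -
    have "finsum S (?g c) {..<Suc n} = ?g c 0 \<oplus> finsum S (?g c) (Suc ` {..<n})"
      unfolding lessThan_Suc_eq_insert_0 by (rule finsum_insert) (use g in blast)+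
    also have "finsum S (?g c) (Suc ` {..<n}) = finsum S (\<lambda>i. ?g c (Suc i)) {..<n}"
      using g u by (subst finsum_reindex) (auto simp: Pi_iff)
    finally show ?thesis using u by simp
  qed
  have 1: "finsum S (\<lambda>i. ?g a (Suc i)) {..<n} \<in> carrier S" "finsum S (\<lambda>i. nl (?g a i)) {..<n} \<in> carrier S"
    using g u by (auto intro!: finsum_closed)
  have "twst (a + 1) u = u \<oplus> finsum S (\<lambda>i. ?g (a + 1) (Suc i)) {..<n}"
    by (simp only: twst_eq[OF u sn] *)
  also have "finsum S (\<lambda>i. ?g (a + 1) (Suc i)) {..<n} = finsum S (\<lambda>i. ?g a (Suc i) \<oplus> nl (?g a i)) {..<n}"
  proof (intro finsum_cong' refl)
    fix i
    have "(a + 1) gchoose (Suc i) = (a gchoose Suc i) + (a gchoose i)"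
      using gbinomial_Suc_Suc[of a i] by simp
    then show "?g (a + 1) (Suc i) = ?g a (Suc i) \<oplus> nl (?g a i)" using u by (simp add: K_add l_distr nl_K)
  qed (use g u in auto)
  also have "\<dots> = finsum S (\<lambda>i. ?g a (Suc i)) {..<n} \<oplus> finsum S (\<lambda>i. nl (?g a i)) {..<n}"
    using g u by (intro finsum_addf) auto
  also have "finsum S (\<lambda>i. nl (?g a i)) {..<n} = nl (twst a u)"
    unfolding twst_eq[OF u n] using g u by (intro Ad_finsum[symmetric]) auto
  also have "u \<oplus> (finsum S (\<lambda>i. ?g a (Suc i)) {..<n} \<oplus> nl (twst a u)) = twst a u \<oplus> nl (twst a u)"
    using u 1 by (simp add: a_assoc twst_eq[OF u sn, of a] *[of a])
  finally show ?thesis using u by (simp add: Ad_eq)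
qed

lemma twst_zero_exp: assumes u: "u \<in> carrier S" shows "twst 0 u = u"
proof -
  obtain n where n: "(ad ^^ n) u = \<zero>" using nilpotent u by blast
  then have n: "(ad ^^ Suc n) u = \<zero>" by simp
  have "twst 0 u = finsum S (\<lambda>i. if 0 = i then (nl ^^ i) u else \<zero>) {..<Suc n}"
    unfolding twst_eq[OF u n] using u by (intro finsum_cong') (auto simp: gbinomial_0_left)
  also have "\<dots> = u"
    using finsum_singleton[of 0 "{..<Suc n}" "\<lambda>i. (nl ^^ i) u"] u by (simp add: Pi_iff)
  finally show ?thesis .
qed

lemma twst_add_nat: "u \<in> carrier S \<Longrightarrow> twst (of_nat m + b) u = (Ad ^^ m) (twst b u)"
proof (induction m)
  case (Suc m)
  then show ?case using twst_plus_one[of u "of_nat m + b"] by (simp add: ac_simps)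
qed auto

lemma twst_nat: "u \<in> carrier S \<Longrightarrow> twst (of_nat m) u = (Ad ^^ m) u"
  using twst_add_nat[of u m 0] by (simp add: twst_zero_exp)

text \<open>Only the outer exponent is interpolated. For natural \<open>a\<close> the identity is
  \<open>twst_add_nat\<close>, where \<open>b\<close> is already an arbitrary complex
  number.\<close>

lemma twst_twst: assumes u: "u \<in> carrier S" shows "twst a (twst b u) = twst (a + b) u"
  by (rule poly_fun_eqI[where g = "\<lambda>a. twst a (twst b u)" and k = "\<lambda>a. twst (a + b) u"])
    (use u in \<open>auto intro: poly_fun_twst poly_fun_shift simp: twst_nat twst_add_nat\<close>)

lemma twst_mult:
  assumes u: "u \<in> carrier S" "v \<in> carrier S" shows "twst a (u \<otimes> v) = twst a u \<otimes> twst a v"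
proof (rule poly_fun_eqI[where g = "\<lambda>a. twst a (u \<otimes> v)" and k = "\<lambda>a. twst a u \<otimes> twst a v"])
  have "w \<in> carrier S \<Longrightarrow> (Ad ^^ m) w \<in> carrier S" for w m by (induction m) auto
  then have "(Ad ^^ m) (u \<otimes> v) = (Ad ^^ m) u \<otimes> (Ad ^^ m) v" for m
    by (induction m) (use u in \<open>auto simp: Ad_mult\<close>)
  then show "twst (of_nat m) (u \<otimes> v) = twst (of_nat m) u \<otimes> twst (of_nat m) v" for m
    using u by (simp add: twst_nat)
qed (use u in \<open>auto intro: poly_fun_twst poly_fun_mult\<close>)

lemma twst_fixed: assumes u: "u \<in> carrier S" "F \<otimes> u = u \<otimes> F" shows "twst a u = u"
proof -
  have "ad u = \<zero>" using u by (simp add: ad_def minus_eq r_neg)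
  then have n: "(ad ^^ 1) u = \<zero>" by simp
  show ?thesis unfolding twst_eq[OF u(1) n] using u by (simp add: lessThan_Suc)
qed

lemma twst_F: "twst a F = F" by (rule twst_fixed) auto
lemma twst_Fi: "twst a Fi = Fi" by (rule twst_fixed) auto
lemma twst_K: "twst a (K c) = K c" by (rule twst_fixed) (auto simp: K_central)
lemma twst_one: "twst a \<one> = \<one>" using twst_K[of a 1] by simp
lemma twst_inverse: "u \<in> carrier S \<Longrightarrow> twst (- a) (twst a u) = u"
  "u \<in> carrier S \<Longrightarrow> twst a (twst (- a) u) = u"
  by (simp_all add: twst_twst twst_zero_exp)

end

section \<open>Nilpotency of eigenvalue shifting operators\<close>

text \<open>Applied with \<open>A\<close> = ad h and \<open>G\<close> = ad f or ad e, where
  \<open>c\<close> is -2 or 2. The argument works with annihilating polynomials of \<open>A\<close>,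
  so ad h may have Jordan blocks.\<close>

locale shifted_operators = vector_space scale
  for scale :: "complex \<Rightarrow> 'b::ab_group_add \<Rightarrow> 'b" +
  fixes A G :: "'b \<Rightarrow> 'b" and c :: complex
  assumes A_add: "A (x + y) = A x + A y" and A_scale: "A (scale r x) = scale r (A x)"
    and G_add: "G (x + y) = G x + G y" and G_scale: "G (scale r x) = scale r (G x)"
    and A_G: "A (G x) = G (A x) + scale c (G x)" and c: "c \<noteq> 0"
begin

lemma A_zero: "A 0 = 0" using A_scale[of 0 0] by simp
lemma G_zero: "G 0 = 0" using G_scale[of 0 0] by simp
lemma A_diff: "A (x - y) = A x - A y" using A_add[of "x - y" y] by (simp add: algebra_simps)
lemma G_diff: "G (x - y) = G x - G y" using G_add[of "x - y" y] by (simp add: algebra_simps)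

text \<open>The product of the operators A - l over a list. A list of roots records an annihilating
  polynomial already split into linear factors, the form in which it can be shifted by
  \<open>c\<close> and compared with another one.\<close>

fun ann :: "complex list \<Rightarrow> 'b \<Rightarrow> 'b" where
  "ann [] v = v"
| "ann (l # ls) v = ann ls (A v - scale l v)"

lemma ann_append: "ann (xs @ ys) v = ann ys (ann xs v)"
  by (induction xs arbitrary: v) auto

lemma ann_add: "ann xs (v + w) = ann xs v + ann xs w"
proof (induction xs arbitrary: v w)
  case (Cons l xs)
  have "A (v + w) - scale l (v + w) = (A v - scale l v) + (A w - scale l w)"
    by (simp add: A_add scale_right_distrib)
  then show ?case by (simp only: ann.simps Cons.IH)
qed simp

lemma ann_scale: "ann xs (scale r v) = scale r (ann xs v)"
proof (induction xs arbitrary: v)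
  case (Cons l xs)
  have "A (scale r v) - scale l (scale r v) = scale r (A v - scale l v)"
    by (simp add: A_scale scale_right_diff_distrib mult.commute)
  then show ?case by (simp only: ann.simps Cons.IH)
qed simp

lemma ann_zero: "ann xs 0 = 0" using ann_scale[of xs 0 0] by simp

lemma ann_diff: "ann xs (v - w) = ann xs v - ann xs w"
  using ann_add[of xs "v - w" w] by (simp add: algebra_simps)

lemma ann_A: "ann xs (A v) = A (ann xs v)"
proof (induction xs arbitrary: v)
  case (Cons x xs)
  then show ?case by (simp add: ann_diff ann_scale A_diff A_scale)
qed simp

lemma ann_eigen: "A u = scale l u \<Longrightarrow> ann xs u = scale (prod_list (map (\<lambda>x. l - x) xs)) u"
proof (induction xs)
  case (Cons x xs)
  then show ?case by (simp add: ann_diff ann_scale scale_left_diff_distrib[symmetric] mult.commute)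
qed simp

text \<open>Coprimality of two annihilators, used without a Bezout identity: by the induction
  hypothesis \<open>w\<close> is an eigenvector for a root \<open>l\<close> of the second list, and
  on it the first product is the scalar prod (l - x), which is nonzero.\<close>

lemma ann_disjoint:
  "set xs \<inter> set ys = {} \<Longrightarrow> ann xs w = 0 \<Longrightarrow> ann ys w = 0 \<Longrightarrow> w = 0"
proof (induction ys arbitrary: w)
  case (Cons l ys)
  have "ann xs (A w - scale l w) = 0"
    using Cons.prems by (simp add: ann_diff ann_scale ann_A A_zero)
  moreover have "ann ys (A w - scale l w) = 0" "set xs \<inter> set ys = {}" using Cons.prems by auto
  ultimately have "A w - scale l w = 0" using Cons.IH by blast
  then have "ann xs w = scale (prod_list (map (\<lambda>x. l - x) xs)) w" by (intro ann_eigen) simp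
  moreover have "prod_list (map (\<lambda>x. l - x) xs) \<noteq> 0"
    using Cons.prems(1) by (auto simp: prod_list_zero_iff)
  ultimately show ?case using Cons.prems(2) by simp
qed simp

text \<open>\<open>G\<close> raises every eigenvalue of \<open>A\<close> by \<open>c\<close>, so
  after k applications an annihilator with roots l has to be replaced by one with roots l +
  kc.\<close>

lemma ann_shift: "ann (map (\<lambda>l. l + of_nat k * c) xs) ((G ^^ k) w) = (G ^^ k) (ann xs w)"
proof (induction xs arbitrary: w)
  case (Cons l xs)
  have "A ((G ^^ k) w) = (G ^^ k) (A w) + scale (of_nat k * c) ((G ^^ k) w)"
    by (induction k) (simp_all add: A_G G_add G_scale scale_left_distrib distrib_right add_ac)
  moreover have "(G ^^ k) (x - scale l y) = (G ^^ k) x - scale l ((G ^^ k) y)" for x y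
    by (induction k) (auto simp: G_diff G_scale)
  ultimately have "A ((G ^^ k) w) - scale (l + of_nat k * c) ((G ^^ k) w) = (G ^^ k) (A w - scale l w)"
    by (simp add: scale_left_distrib)
  then show ?case by (simp only: ann.simps list.map Cons.IH)
qed simp

definition peval :: "complex poly \<Rightarrow> 'b \<Rightarrow> 'b" where
  "peval p w = (\<Sum>i\<le>degree p. scale (coeff p i) ((A ^^ i) w))"

lemma peval_eq: "degree p \<le> n \<Longrightarrow> peval p w = (\<Sum>i\<le>n. scale (coeff p i) ((A ^^ i) w))"
  unfolding peval_def by (rule sum.mono_neutral_left) (auto simp: coeff_eq_0)

lemma peval_linear_factor: "peval ([:- z, 1:] * q) w = peval q (A w - scale z w)"
proof -
  have A_sub: "(A ^^ i) (x - scale z y) = (A ^^ i) x - scale z ((A ^^ i) y)" for x y i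
    by (induction i) (auto simp: A_diff A_scale)
  let ?n = "degree q" and ?s = "\<lambda>i v. scale (coeff q i) ((A ^^ i) v)"
  have "[:- z, 1:] * q = pCons 0 q - smult z q" by simp
  moreover have "degree (pCons 0 q - smult z q) \<le> Suc ?n"
    by (intro degree_diff_le) (auto simp: degree_pCons_le intro: le_SucI)
  ultimately have "peval ([:- z, 1:] * q) w
      = (\<Sum>i\<le>Suc ?n. scale (coeff (pCons 0 q) i - z * coeff q i) ((A ^^ i) w))"
    by (simp add: peval_eq[of _ "Suc ?n"])
  also have "\<dots> = (\<Sum>i\<le>Suc ?n. scale (coeff (pCons 0 q) i) ((A ^^ i) w)) -
      (\<Sum>i\<le>Suc ?n. scale z (?s i w))"
    by (simp add: scale_left_diff_distrib sum_subtractf)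
  also have "(\<Sum>i\<le>Suc ?n. scale (coeff (pCons 0 q) i) ((A ^^ i) w)) = (\<Sum>i\<le>?n. ?s i (A w))"
    by (simp add: sum.atMost_Suc_shift funpow_swap1 del: sum.atMost_Suc)
  also have "(\<Sum>i\<le>Suc ?n. scale z (?s i w)) = (\<Sum>i\<le>?n. scale z (?s i w))"
    by (simp add: coeff_eq_0)
  finally show ?thesis
    by (simp add: peval_def A_sub scale_right_diff_distrib sum_subtractf mult.commute)
qed

text \<open>Over the complex numbers the polynomial splits; each root becomes one entry of the
  list.\<close>

lemma ann_of_peval: "p \<noteq> 0 \<Longrightarrow> peval p w = 0 \<Longrightarrow> \<exists>ls. ann ls w = 0"
proof (induction "degree p" arbitrary: p w)
  case 0
  then have "w = 0" by (auto simp: peval_def elim!: degree_eq_zeroE)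
  then show ?case by (intro exI[of _ "[]"]) simp
next
  case (Suc n)
  then obtain z where "poly p z = 0"
    using fundamental_theorem_of_algebra[of p] by (auto simp: constant_degree)
  then obtain q where p: "p = [:- z, 1:] * q" by (auto simp: poly_eq_0_iff_dvd)
  then have q: "q \<noteq> 0" using Suc by auto
  then have "degree p = Suc (degree q)" unfolding p by (subst degree_mult_eq) auto
  then obtain ls where "ann ls (A w - scale z w) = 0"
    using Suc.hyps(1)[of q "A w - scale z w"] Suc.hyps(2) Suc.prems(2) q
    unfolding p peval_linear_factor by auto
  then show ?case by (intro exI[of _ "z # ls"]) simp
qed

lemma ann_exists:
  assumes B: "finite B" and W: "\<And>w. w \<in> span B \<Longrightarrow> A w \<in> span B" and w: "w \<in> span B"
  shows "\<exists>ls. ann ls w = 0"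
proof -
  let ?v = "\<lambda>i. (A ^^ i) w"
  have v: "?v i \<in> span B" for i by (induction i) (auto simp: w W)
  have "\<exists>p. p \<noteq> 0 \<and> peval p w = 0"
  \<comment> \<open>Repeated iterates are a separate case: the set of iterates does not record a
    relation A^i w = A^j w, and a dependence between its elements becomes a polynomial only when
    distinct exponents give distinct vectors.\<close>
  proof (cases "inj ?v")
    case False
    then obtain i j where ij: "i < j" "?v i = ?v j"
      unfolding inj_def by (metis linorder_neqE_nat)
    let ?p = "monom 1 j - monom 1 i :: complex poly"
    have "peval ?p w = (\<Sum>k\<le>j. scale (coeff ?p k) (?v k))"
      by (rule peval_eq) (use ij in \<open>auto intro!: degree_diff_le simp: degree_monom_eq\<close>)
    also have "\<dots> = (\<Sum>k\<le>j. (if j = k then ?v k else 0)) - (\<Sum>k\<le>j. (if i = k then ?v k else 0))"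
      unfolding sum_subtractf[symmetric] by (intro sum.cong) auto
    also have "\<dots> = 0" using ij by simp
    finally have "peval ?p w = 0" .
    moreover have "coeff ?p j \<noteq> coeff 0 j" using ij by simp
    then have "?p \<noteq> 0" by metis
    ultimately show ?thesis by blast
  next
    case True
    then have "infinite (range ?v)" by (simp add: finite_image_iff)
    then have "dependent (range ?v)"
      using independent_span_bound[OF B, of "range ?v"] v by auto
    then obtain t u where t: "finite t" "t \<subseteq> range ?v" and u: "(\<Sum>x\<in>t. scale (u x) x) = 0"
      and nz: "\<exists>x\<in>t. u x \<noteq> 0" unfolding dependent_explicit by blast
    define I where "I = ?v -` t"
    have I: "finite I" "?v ` I = t" unfolding I_def using t True by (auto intro: finite_vimageI)
    define p where "p = (\<Sum>i\<in>I. monom (u (?v i)) i)"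
    have cp: "coeff p k = (if k \<in> I then u (?v k) else 0)" for k
    proof -
      have "coeff p k = (\<Sum>i\<in>I. if i = k then u (?v k) else 0)"
        unfolding p_def coeff_sum by (intro sum.cong) auto
      then show ?thesis using I by simp
    qed
    from nz obtain x where x: "x \<in> t" "u x \<noteq> 0" by blast
    then obtain i where "i \<in> I" "x = ?v i" using I(2) by blast
    then have "coeff p i \<noteq> 0" using cp[of i] x(2) by simp
    then have "p \<noteq> 0" by auto
    define n where "n = Max (insert (degree p) I)"
    have n: "degree p \<le> n" "I \<subseteq> {..n}" unfolding n_def using I(1) by auto
    have "peval p w = (\<Sum>i\<le>n. scale (coeff p i) (?v i))" by (rule peval_eq[OF n(1)])
    also have "\<dots> = (\<Sum>i\<in>I. scale (u (?v i)) (?v i))"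
      by (rule sum.mono_neutral_cong_right) (use n cp in auto)
    also have "\<dots> = (\<Sum>x\<in>t. scale (u x) x)"
      unfolding I(2)[symmetric] using True by (subst sum.reindex) (auto intro: inj_on_subset)
    finally show ?thesis using u \<open>p \<noteq> 0\<close> by auto
  qed
  then show ?thesis using ann_of_peval by blast
qed

text \<open>One list annihilates the whole space. Since \<open>c\<close> is nonzero, its translate
  by kc meets it for only finitely many k; for any other k a vector in the image of
  \<open>G ^^ k\<close> is killed by both lists and \<open>ann_disjoint\<close> applies.\<close>

lemma nilpotent_on_span:
  assumes B: "finite B" and WA: "\<And>w. w \<in> span B \<Longrightarrow> A w \<in> span B"
    and WG: "\<And>w. w \<in> span B \<Longrightarrow> G w \<in> span B"
  shows "\<exists>k. \<forall>w\<in>span B. (G ^^ k) w = 0"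
proof -
  have ex: "\<exists>ls. \<forall>b\<in>C. ann ls b = 0" if "finite C" "C \<subseteq> B" for C
    using that
  proof (induction C rule: finite_induct)
    case (insert b C)
    then obtain ls where ls: "\<And>b. b \<in> C \<Longrightarrow> ann ls b = 0" by auto
    obtain ms where ms: "ann ms b = 0"
      using ann_exists[OF B WA, of b] insert.prems span_base by auto
    have com: "ann ls (ann ms v) = ann ms (ann ls v)" for v
      by (induction ms arbitrary: v) (simp_all add: ann_A[symmetric] ann_diff[symmetric] ann_scale[symmetric])
    have "ann (ms @ ls) x = 0" if "x \<in> insert b C" for x
    proof (cases "x = b")
      case True
      then show ?thesis by (simp only: ann_append ms ann_zero)
    next
      case False
      with that have "ann ls x = 0" using ls by blast
      then show ?thesis by (simp only: ann_append com ann_zero)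
    qed
    then show ?case by blast
  qed auto
  obtain ls where "\<forall>b\<in>B. ann ls b = 0" using ex[OF B order.refl] ..
  then have ls: "\<And>b. b \<in> B \<Longrightarrow> ann ls b = 0" by blast
  have W0: "ann ls w = 0" if "w \<in> span B" for w
    using that by (induction rule: span_induct_alt) (auto simp: ann_add ann_scale ls ann_zero)
  have "finite {k. \<exists>l\<in>set ls. \<exists>l'\<in>set ls. l = l' + of_nat k * c}"
  proof (rule finite_subset)
    show "{k. \<exists>l\<in>set ls. \<exists>l'\<in>set ls. l = l' + of_nat k * c} \<subseteq>
      of_nat -` (\<lambda>(l, l'). (l - l') / c) ` (set ls \<times> set ls)"
    proof
      fix k
      assume "k \<in> {k. \<exists>l\<in>set ls. \<exists>l'\<in>set ls. l = l' + of_nat k * c}"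
      then obtain l l' where "l \<in> set ls" "l' \<in> set ls" "l = l' + of_nat k * c" by blast
      then have "of_nat k = (\<lambda>(l, l'). (l - l') / c) (l, l')" "(l, l') \<in> set ls \<times> set ls"
        using c by auto
      then show "k \<in> of_nat -` (\<lambda>(l, l'). (l - l') / c) ` (set ls \<times> set ls)" by blast
    qed
    show "finite (of_nat -` (\<lambda>(l, l'). (l - l') / c) ` (set ls \<times> set ls) :: nat set)"
      by (intro finite_vimageI finite_imageI finite_cartesian_product finite_set inj_of_nat)
  qed
  from ex_new_if_finite[OF infinite_UNIV_nat this]
  obtain k where "k \<notin> {k. \<exists>l\<in>set ls. \<exists>l'\<in>set ls. l = l' + of_nat k * c}" ..
  then have disj: "set ls \<inter> set (map (\<lambda>l. l + of_nat k * c) ls) = {}" unfolding set_map by blast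
  have "(G ^^ k) w = 0" if w: "w \<in> span B" for w
  proof (rule ann_disjoint[OF disj])
    have "(G ^^ j) w \<in> span B" for j by (induction j) (auto simp: w WG)
    then show "ann ls ((G ^^ k) w) = 0" by (rule W0)
    have "(G ^^ k) 0 = 0" by (induction k) (auto simp: G_zero)
    then show "ann (map (\<lambda>l. l + of_nat k * c) ls) ((G ^^ k) w) = 0"
      using W0[OF w] by (simp add: ann_shift)
  qed
  then show ?thesis by blast
qed

end

lemma (in lie_superalgebra) ad_shift_nilpotent:
  assumes h: "h \<in> prt L 0" and g: "g \<in> prt L 0" and hg: "brk L h g = scl L c g" "c \<noteq> 0"
    and fin: "acts_locally_finitely L S" and S: "h \<in> S" "g \<in> S"
  shows "\<exists>n. (brk L g ^^ n) x = 0"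
proof -
  interpret vector_space "scl L" by (rule vector_space)
  interpret shifted_operators "scl L" "brk L h" "brk L g" c
    by unfold_locales
      (use hg super_jacobi[OF h g] in \<open>auto simp: brk_add_right brk_scl_right brk_scl_left koszul_def\<close>)
  obtain W B where "finite B" "W = span B" "x \<in> W" "\<forall>s\<in>S. \<forall>w\<in>W. brk L s w \<in> W"
    using fin unfolding acts_locally_finitely_def by metis
  then show ?thesis using nilpotent_on_span[of B] S by auto
qed

section \<open>Quotients of free algebras\<close>

lemma free_alg_simps [simp]:
  "carrier free_alg = UNIV" "monoid.mult free_alg = (*)" "one free_alg = 1" "zero free_alg = 0"
  "add free_alg = (+)"
  by (simp_all add: free_alg_def)

lemma ring_free_alg: "ring (free_alg :: ('x, 'k::comm_ring_1) falg ring)"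
  by (intro ringI abelian_groupI monoidI)
    (auto simp: algebra_simps intro: exI[of _ "- x" for x] exI[of "\<lambda>y. y + x = 0" "- x" for x])

interpretation free_alg: ring "free_alg :: ('x, 'k::comm_ring_1) falg ring"
  by (rule ring_free_alg)

lemma free_alg_a_inv [simp]: "a_inv free_alg (p :: ('x, 'k::comm_ring_1) falg) = - p"
  by (rule free_alg.minus_equality) auto

lemma free_alg_a_minus [simp]: "a_minus free_alg (p :: ('x, 'k::comm_ring_1) falg) q = p - q"
  by (simp add: a_minus_def)

lemma const_add: "const (c + d) = const c + const d"
  by (simp add: const_def single_add)

lemma const_mult: "const (c * d) = const c * const d"
  by (simp add: const_def mult_single)

lemma const_one: "const 1 = 1" by (simp add: const_def)
lemma const_zero: "const 0 = 0" by (simp add: const_def)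

lemma const_gen_commute: "const c * gen x = gen x * const c"
  by (simp add: const_def gen_def mult_single mult.commute)

lemma falg_induct [case_names const gen mult add]:
  assumes const: "\<And>c. P (const c)" and gen: "\<And>x. P (gen x)"
    and mult: "\<And>p q. P p \<Longrightarrow> P q \<Longrightarrow> P (p * q)" and add: "\<And>p q. P p \<Longrightarrow> P q \<Longrightarrow> P (p + q)"
  shows "P (p :: ('x, 'k::comm_ring_1) falg)"
proof (induction p rule: update_induct)
  case const
  then show ?case using assms(1)[of 0] by (simp add: const_zero)
next
  case (update f w b)
  have "P (Poly_Mapping.single (Mon xs) b)" for xs
  proof (induction xs)
    case Nil
    then show ?case using assms(1)[of b] by (simp add: const_def zero_mon_def)
  next
    case (Cons x xs)
    have "Poly_Mapping.single (Mon (x # xs)) b = gen x * Poly_Mapping.single (Mon xs) b"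
      by (simp add: gen_def mult_single plus_mon_def)
    then show ?case using mult gen Cons by metis
  qed
  then have "P (Poly_Mapping.single w b)" by (cases w) simp
  moreover have "Poly_Mapping.update w b f = f + Poly_Mapping.single w b"
    using update by (intro poly_mapping_eqI)
      (auto simp: lookup_update lookup_add lookup_single when_def in_keys_iff)
  ultimately show ?case using add update by metis
qed

text \<open>The flag \<open>s\<close> allows graded and ungraded modules to be treated together.\<close>

lemma parity_induct [consumes 1, case_names const gen mult add]:
  assumes "s \<longrightarrow> homog P i (p :: ('x, 'k::comm_ring_1) falg)"
    and const: "\<And>i c. (s \<longrightarrow> i = 0) \<Longrightarrow> Q i (const c)"
    and gen: "\<And>i x. (s \<longrightarrow> x \<in> P i) \<Longrightarrow> Q i (gen x)"
    and mult: "\<And>i j p q. Q i p \<Longrightarrow> Q j q \<Longrightarrow> Q (i + j) (p * q)"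
    and add: "\<And>i p q. Q i p \<Longrightarrow> Q i q \<Longrightarrow> Q i (p + q)"
  shows "Q i p"
proof (cases s)
  case True
  then have "homog P i p" using assms(1) by blast
  then show ?thesis
  proof (induction rule: homog.induct)
    case (3 i p j q)
    then show ?case by (intro mult)
  qed (simp_all add: const gen add)
next
  case False
  show ?thesis
  proof (induction p arbitrary: i rule: falg_induct)
    case (mult p q)
    show ?case using assms(4)[of 0 p i q, OF mult.IH(1) mult.IH(2)] by (simp only: add_0_left)
  qed (use False assms in auto)
qed

lemma quot_free_alg:
  assumes "ideal I (free_alg :: ('x, 'k::comm_ring_1) falg ring)"
  shows "ring (free_alg Quot I)"
    and "carrier (free_alg Quot I) = range (\<lambda>p. I +>\<^bsub>free_alg\<^esub> p)"
    and "(I +>\<^bsub>free_alg\<^esub> p) \<otimes>\<^bsub>free_alg Quot I\<^esub> (I +>\<^bsub>free_alg\<^esub> q) = I +>\<^bsub>free_alg\<^esub> (p * q)"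
    and "(I +>\<^bsub>free_alg\<^esub> p) \<oplus>\<^bsub>free_alg Quot I\<^esub> (I +>\<^bsub>free_alg\<^esub> q) = I +>\<^bsub>free_alg\<^esub> (p + q)"
    and "\<one>\<^bsub>free_alg Quot I\<^esub> = I +>\<^bsub>free_alg\<^esub> 1"
    and "\<zero>\<^bsub>free_alg Quot I\<^esub> = I +>\<^bsub>free_alg\<^esub> 0"
    and "I +>\<^bsub>free_alg\<^esub> p = I +>\<^bsub>free_alg\<^esub> q \<longleftrightarrow> p - q \<in> I"
proof -
  interpret ideal I "free_alg :: ('x, 'k::comm_ring_1) falg ring" by fact
  show "ring (free_alg Quot I)" by (rule quotient_is_ring)
  then interpret Q: ring "free_alg Quot I" .
  interpret \<pi>: ring_hom_ring free_alg "free_alg Quot I" "\<lambda>p. I +>\<^bsub>free_alg\<^esub> p"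
    by (rule rcos_ring_hom_ring)
  show "carrier (free_alg Quot I) = range (\<lambda>p. I +>\<^bsub>free_alg\<^esub> p)"
    by (auto simp: FactRing_def A_RCOSETS_def RCOSETS_def a_r_coset_def)
  show "(I +>\<^bsub>free_alg\<^esub> p) \<otimes>\<^bsub>free_alg Quot I\<^esub> (I +>\<^bsub>free_alg\<^esub> q) = I +>\<^bsub>free_alg\<^esub> (p * q)"
    using \<pi>.hom_mult[of p q] by simp
  show "(I +>\<^bsub>free_alg\<^esub> p) \<oplus>\<^bsub>free_alg Quot I\<^esub> (I +>\<^bsub>free_alg\<^esub> q) = I +>\<^bsub>free_alg\<^esub> (p + q)"
    using \<pi>.hom_add[of p q] by simp
  show "\<one>\<^bsub>free_alg Quot I\<^esub> = I +>\<^bsub>free_alg\<^esub> 1" using \<pi>.hom_one by simp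
  show "\<zero>\<^bsub>free_alg Quot I\<^esub> = I +>\<^bsub>free_alg\<^esub> 0" using \<pi>.hom_zero by simp
  show "I +>\<^bsub>free_alg\<^esub> p = I +>\<^bsub>free_alg\<^esub> q \<longleftrightarrow> p - q \<in> I"
    using free_alg.quotient_eq_iff_same_a_r_cos[OF ideal_axioms, of p q] by simp
qed

section \<open>Nilpotent commutators\<close>

context ring
begin

definition comm :: "'a \<Rightarrow> 'a \<Rightarrow> 'a" where "comm x u = x \<otimes> u \<ominus> u \<otimes> x"

lemma comm_closed [simp]: "x \<in> carrier R \<Longrightarrow> u \<in> carrier R \<Longrightarrow> comm x u \<in> carrier R"
  by (simp add: comm_def)

lemma comm_pow_closed [simp]: "x \<in> carrier R \<Longrightarrow> u \<in> carrier R \<Longrightarrow> (comm x ^^ n) u \<in> carrier R"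
  by (induction n) auto

lemma comm_add: "x \<in> carrier R \<Longrightarrow> u \<in> carrier R \<Longrightarrow> v \<in> carrier R \<Longrightarrow>
    comm x (u \<oplus> v) = comm x u \<oplus> comm x v"
  by (simp add: comm_def r_distr l_distr minus_eq minus_add a_ac)

lemma comm_mult:
  assumes "x \<in> carrier R" "u \<in> carrier R" "v \<in> carrier R"
  shows "comm x (u \<otimes> v) = comm x u \<otimes> v \<oplus> u \<otimes> comm x v"
proof -
  have "comm x u \<otimes> v \<oplus> u \<otimes> comm x v
      = x \<otimes> u \<otimes> v \<oplus> (\<ominus> (u \<otimes> x \<otimes> v) \<oplus> (u \<otimes> x \<otimes> v \<ominus> u \<otimes> v \<otimes> x))"
    using assms by (simp add: comm_def minus_eq l_distr r_distr l_minus r_minus m_assoc a_assoc)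
  then show ?thesis using assms by (simp add: comm_def minus_eq m_assoc r_neg2 r_neg1)
qed

lemma comm_zero [simp]: "x \<in> carrier R \<Longrightarrow> comm x \<zero> = \<zero>" by (simp add: comm_def minus_eq)

lemma comm_pow_zero [simp]: "x \<in> carrier R \<Longrightarrow> (comm x ^^ n) \<zero> = \<zero>" by (induction n) auto

lemma comm_pow_add: "x \<in> carrier R \<Longrightarrow> u \<in> carrier R \<Longrightarrow> v \<in> carrier R \<Longrightarrow>
    (comm x ^^ n) (u \<oplus> v) = (comm x ^^ n) u \<oplus> (comm x ^^ n) v"
  by (induction n) (auto simp: comm_add)

lemma comm_pow_zero_mono:
  assumes "x \<in> carrier R" "(comm x ^^ n) u = \<zero>" "n \<le> m" shows "(comm x ^^ m) u = \<zero>"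
proof -
  have "(comm x ^^ m) u = (comm x ^^ (m - n)) ((comm x ^^ n) u)"
    using assms(3) by (metis funpow_add comp_apply le_add_diff_inverse2)
  then show ?thesis using assms by simp
qed

lemma comm_nilpotent_add:
  assumes "x \<in> carrier R" "u \<in> carrier R" "v \<in> carrier R"
    and "\<exists>n. (comm x ^^ n) u = \<zero>" "\<exists>n. (comm x ^^ n) v = \<zero>"
  shows "\<exists>n. (comm x ^^ n) (u \<oplus> v) = \<zero>"
proof -
  obtain n m where "(comm x ^^ n) u = \<zero>" "(comm x ^^ m) v = \<zero>" using assms by blast
  then have "(comm x ^^ (n + m)) u = \<zero>" "(comm x ^^ (n + m)) v = \<zero>"
    using comm_pow_zero_mono[OF assms(1)] le_add1 le_add2 by blast+
  then show ?thesis using assms by (intro exI[of _ "n + m"]) (simp add: comm_pow_add)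
qed

text \<open>By the Leibniz rule every application of the commutator hits one of the two factors.
  Induction on n + m replaces the binomial expansion; if n = 0 or m = 0, a factor is already
  zero.\<close>

lemma comm_nilpotent_mult:
  assumes "x \<in> carrier R" "u \<in> carrier R" "v \<in> carrier R"
    and "\<exists>n. (comm x ^^ n) u = \<zero>" "\<exists>n. (comm x ^^ n) v = \<zero>"
  shows "\<exists>n. (comm x ^^ n) (u \<otimes> v) = \<zero>"
proof -
  obtain n m where "(comm x ^^ n) u = \<zero>" "(comm x ^^ m) v = \<zero>" using assms by blast
  then have "(comm x ^^ (n + m)) (u \<otimes> v) = \<zero>" using assms(2,3)
  proof (induction "n + m" arbitrary: n m u v)
    case 0
    then show ?case by simp
  next
    case (Suc k)
    have "(comm x ^^ k) (comm x u \<otimes> v) = \<zero>"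
    proof (cases n)
      case 0
      then show ?thesis using Suc.prems assms(1) by simp
    next
      case (Suc n')
      then show ?thesis
        using Suc.hyps(1)[of n' m "comm x u" v] Suc.hyps(2) Suc.prems assms(1) by (simp add: funpow_swap1)
    qed
    moreover have "(comm x ^^ k) (u \<otimes> comm x v) = \<zero>"
    proof (cases m)
      case 0
      then show ?thesis using Suc.prems assms(1) by simp
    next
      case (Suc m')
      then show ?thesis
        using Suc.hyps(1)[of n m' u "comm x v"] Suc.hyps(2) Suc.prems assms(1) by (simp add: funpow_swap1)
    qed
    moreover have "(comm x ^^ Suc k) (u \<otimes> v) = (comm x ^^ k) (comm x u \<otimes> v) \<oplus> (comm x ^^ k) (u \<otimes> comm x v)"
      using Suc.prems assms(1) by (simp only: funpow_Suc_right comp_apply comm_mult comm_pow_add comm_closed m_closed)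
    ultimately show ?case using Suc.hyps(2) by simp
  qed
  then show ?thesis by blast
qed

end

section \<open>The enveloping algebra\<close>

context lie_superalgebra
begin

lemma env_ideal: "ideal (env_ideal L) free_alg"
  unfolding env_ideal_def by (rule free_alg.genideal_ideal) simp

lemmas env_quot = quot_free_alg[OF env_ideal, folded env_def]

sublocale env: ring "env L" by (rule env_quot(1))

lemma env_ideal_rel:
  "gen (x + y) - gen x - gen y \<in> env_ideal L"
  "gen (scl L c x) - const c * gen x \<in> env_ideal L"
  "x \<in> prt L i \<Longrightarrow> y \<in> prt L j \<Longrightarrow>
    gen x * gen y - const (koszul i j) * gen y * gen x - gen (brk L x y) \<in> env_ideal L"
  unfolding env_ideal_def by (rule subsetD[OF free_alg.genideal_self], simp, blast)+

lemma env_cls_closed [simp]: "env_ideal L +>\<^bsub>free_alg\<^esub> p \<in> carrier (env L)"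
  by (auto simp: env_quot)

lemma in_env_closed [simp]: "in_env L x \<in> carrier (env L)" by (simp add: in_env_def)
lemma sc_env_closed [simp]: "sc_env L c \<in> carrier (env L)" by (simp add: sc_env_def)

lemma in_env_add: "in_env L (x + y) = in_env L x \<oplus>\<^bsub>env L\<^esub> in_env L y"
  using env_ideal_rel(1)[of x y] by (simp add: in_env_def env_quot algebra_simps)

lemma in_env_scl: "in_env L (scl L c x) = sc_env L c \<otimes>\<^bsub>env L\<^esub> in_env L x"
  using env_ideal_rel(2)[of c x] by (simp add: in_env_def sc_env_def env_quot)

lemma in_env_brk: "x \<in> prt L i \<Longrightarrow> y \<in> prt L j \<Longrightarrow> in_env L x \<otimes>\<^bsub>env L\<^esub> in_env L y =
    sc_env L (koszul i j) \<otimes>\<^bsub>env L\<^esub> in_env L y \<otimes>\<^bsub>env L\<^esub> in_env L x \<oplus>\<^bsub>env L\<^esub> in_env L (brk L x y)"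
  using env_ideal_rel(3)[of x i y j] by (simp add: in_env_def sc_env_def env_quot algebra_simps)

lemma sc_env_add: "sc_env L (c + d) = sc_env L c \<oplus>\<^bsub>env L\<^esub> sc_env L d"
  by (simp add: sc_env_def env_quot const_add)

lemma sc_env_mult: "sc_env L (c * d) = sc_env L c \<otimes>\<^bsub>env L\<^esub> sc_env L d"
  by (simp add: sc_env_def env_quot const_mult)

lemma sc_env_one [simp]: "sc_env L 1 = \<one>\<^bsub>env L\<^esub>"
  by (simp add: sc_env_def env_quot const_one)

lemma sc_env_zero [simp]: "sc_env L 0 = \<zero>\<^bsub>env L\<^esub>"
  by (simp add: sc_env_def env_quot const_zero)

text \<open>With the flag off, every element counts as homogeneous of every parity. A closure
  statement about \<open>env_comp s\<close> then contains both the graded and the ungraded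
  version.\<close>

definition env_comp :: "bool \<Rightarrow> bit \<Rightarrow> 'g uel set" where
  "env_comp s i = (if s then env_part L i else carrier (env L))"

lemma env_comp_eq: "env_comp s i = {env_ideal L +>\<^bsub>free_alg\<^esub> p |p. s \<longrightarrow> homog (prt L) i p}"
  by (auto simp: env_comp_def env_part_def env_quot)

lemma env_comp_closed: "u \<in> env_comp s i \<Longrightarrow> u \<in> carrier (env L)"
  by (auto simp: env_comp_eq)

lemma env_comp_False [simp]: "env_comp False i = carrier (env L)"
  by (simp add: env_comp_def)

lemma env_comp_intros:
  "sc_env L c \<in> env_comp s 0"
  "x \<in> prt L i \<Longrightarrow> in_env L x \<in> env_comp s i"
  "u \<in> env_comp s i \<Longrightarrow> v \<in> env_comp s j \<Longrightarrow> u \<otimes>\<^bsub>env L\<^esub> v \<in> env_comp s (i + j)"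
  "u \<in> env_comp s i \<Longrightarrow> v \<in> env_comp s i \<Longrightarrow> u \<oplus>\<^bsub>env L\<^esub> v \<in> env_comp s i"
proof -
  show "sc_env L c \<in> env_comp s 0" and "x \<in> prt L i \<Longrightarrow> in_env L x \<in> env_comp s i"
    and "u \<in> env_comp s i \<Longrightarrow> v \<in> env_comp s i \<Longrightarrow> u \<oplus>\<^bsub>env L\<^esub> v \<in> env_comp s i"
    by (auto simp: env_comp_eq sc_env_def in_env_def env_quot(4) intro: homog.intros)
  assume "u \<in> env_comp s i" "v \<in> env_comp s j"
  then obtain p q where pq: "u = env_ideal L +>\<^bsub>free_alg\<^esub> p" "v = env_ideal L +>\<^bsub>free_alg\<^esub> q"
    "s \<longrightarrow> homog (prt L) i p" "s \<longrightarrow> homog (prt L) j q" unfolding env_comp_eq by blast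
  then have "s \<longrightarrow> homog (prt L) (i + j) (p * q)" by (blast intro: homog.intros(3))
  then show "u \<otimes>\<^bsub>env L\<^esub> v \<in> env_comp s (i + j)"
    unfolding env_comp_eq pq(1,2) env_quot(3) by blast
qed

lemma env_comp_induct [consumes 1, case_names sc in_env mult add]:
  assumes "u \<in> env_comp s i"
    and sc: "\<And>i c. (s \<longrightarrow> i = 0) \<Longrightarrow> Q i (sc_env L c)"
    and gen: "\<And>i x. (s \<longrightarrow> x \<in> prt L i) \<Longrightarrow> Q i (in_env L x)"
    and mult: "\<And>i j u v. u \<in> carrier (env L) \<Longrightarrow> v \<in> carrier (env L) \<Longrightarrow>
      Q i u \<Longrightarrow> Q j v \<Longrightarrow> Q (i + j) (u \<otimes>\<^bsub>env L\<^esub> v)"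
    and add: "\<And>i u v. u \<in> carrier (env L) \<Longrightarrow> v \<in> carrier (env L) \<Longrightarrow>
      Q i u \<Longrightarrow> Q i v \<Longrightarrow> Q i (u \<oplus>\<^bsub>env L\<^esub> v)"
  shows "Q i u"
proof -
  obtain p where p: "s \<longrightarrow> homog (prt L) i p" "u = env_ideal L +>\<^bsub>free_alg\<^esub> p"
    using assms(1) by (auto simp: env_comp_eq)
  from p(1) have "Q i (env_ideal L +>\<^bsub>free_alg\<^esub> p)"
  proof (induction rule: parity_induct)
    case (mult i j p q)
    then show ?case using assms(4)[OF env_cls_closed env_cls_closed] by (simp add: env_quot)
  next
    case (add i p q)
    then show ?case using assms(5)[OF env_cls_closed env_cls_closed] by (simp add: env_quot)
  qed (use sc gen in \<open>auto simp: sc_env_def in_env_def\<close>)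
  then show ?thesis using p by simp
qed

lemma env_induct [consumes 1, case_names sc in_env mult add]:
  assumes "u \<in> carrier (env L)"
    and "\<And>c. Q (sc_env L c)" and "\<And>x. Q (in_env L x)"
    and "\<And>u v. u \<in> carrier (env L) \<Longrightarrow> v \<in> carrier (env L) \<Longrightarrow> Q u \<Longrightarrow> Q v \<Longrightarrow> Q (u \<otimes>\<^bsub>env L\<^esub> v)"
    and "\<And>u v. u \<in> carrier (env L) \<Longrightarrow> v \<in> carrier (env L) \<Longrightarrow> Q u \<Longrightarrow> Q v \<Longrightarrow> Q (u \<oplus>\<^bsub>env L\<^esub> v)"
  shows "Q u"
  using env_comp_induct[of u False 0 "\<lambda>_. Q"] assms by auto

lemma sc_env_central: "u \<in> carrier (env L) \<Longrightarrow> sc_env L c \<otimes>\<^bsub>env L\<^esub> u = u \<otimes>\<^bsub>env L\<^esub> sc_env L c"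
proof (induction rule: env_induct)
  case (sc d)
  then show ?case by (simp add: sc_env_mult[symmetric] mult.commute)
next
  case (in_env x)
  then show ?case by (simp add: sc_env_def in_env_def env_quot const_gen_commute)
next
  case (mult u v)
  then show ?case by (metis env.m_assoc sc_env_closed)
next
  case (add u v)
  then show ?case by (simp add: env.r_distr env.l_distr)
qed

text \<open>The defining relations concern homogeneous pairs only. For even \<open>x\<close> the
  sign is 1 against both parities of \<open>y\<close>, so the two relations add up to one for
  arbitrary \<open>y\<close>.\<close>

lemma even_comm:
  assumes x: "x \<in> prt L 0"
  shows "env.comm (in_env L x) (in_env L y) = in_env L (brk L x y)"
proof -
  have *: "env.comm (in_env L x) (in_env L y) = in_env L (brk L x y)" if "y \<in> prt L i" for y i
  proof -
    have "koszul 0 i = 1" by (simp add: koszul_def)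
    then have "in_env L x \<otimes>\<^bsub>env L\<^esub> in_env L y =
      in_env L y \<otimes>\<^bsub>env L\<^esub> in_env L x \<oplus>\<^bsub>env L\<^esub> in_env L (brk L x y)"
      using in_env_brk[OF x that] by simp
    then show ?thesis
      by (simp add: env.comm_def env.minus_eq env.a_comm[of _ "in_env L (brk L x y)"] env.a_assoc env.r_neg)
  qed
  obtain a b where "y = a + b" "a \<in> prt L 0" "b \<in> prt L 1" using prt_sum by blast
  then show ?thesis by (simp add: in_env_add env.comm_add * brk_add_right)
qed

lemma even_comm_pow: "x \<in> prt L 0 \<Longrightarrow>
    (env.comm (in_env L x) ^^ n) (in_env L y) = in_env L ((brk L x ^^ n) y)"
  by (induction n) (auto simp: even_comm)

lemma in_env_zero: "in_env L 0 = \<zero>\<^bsub>env L\<^esub>"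
proof -
  have "in_env L 0 = in_env L 0 \<oplus>\<^bsub>env L\<^esub> in_env L 0" using in_env_add[of 0 0] by simp
  then show ?thesis by (metis env.add.l_cancel_one' in_env_closed)
qed

text \<open>Local nilpotency passes from the Lie superalgebra to sums and products by the Leibniz
  rule; scalars are central and vanish at the first commutator.\<close>

lemma env_comm_nilpotent:
  assumes x: "x \<in> prt L 0" and nil: "\<And>y. \<exists>n. (brk L x ^^ n) y = 0" and u: "u \<in> carrier (env L)"
  shows "\<exists>n. (env.comm (in_env L x) ^^ n) u = \<zero>\<^bsub>env L\<^esub>"
  using u
proof (induction rule: env_induct)
  case (sc c)
  have "(env.comm (in_env L x) ^^ 1) (sc_env L c) = \<zero>\<^bsub>env L\<^esub>"
    by (simp add: env.comm_def sc_env_central env.minus_eq env.r_neg)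
  then show ?case ..
next
  case (in_env y)
  obtain n where "(brk L x ^^ n) y = 0" using nil by blast
  then have "(env.comm (in_env L x) ^^ n) (in_env L y) = \<zero>\<^bsub>env L\<^esub>"
    using x by (simp add: even_comm_pow in_env_zero)
  then show ?case ..
qed (simp_all add: env.comm_nilpotent_mult env.comm_nilpotent_add)

end

section \<open>The localized enveloping algebra\<close>

locale sl2_superalgebra = lie_superalgebra L for L :: "'g::ab_group_add superalg" +
  fixes e h f :: 'g
  assumes triple: "sl2_triple L e h f" and fin: "acts_locally_finitely L {e, h, f}"
begin

abbreviation U where "U \<equiv> env L"
abbreviation V where "V \<equiv> lenv L f"
abbreviation iota ("\<iota>") where "\<iota> \<equiv> to_lenv L f"
abbreviation F where "F \<equiv> \<iota> (in_env L f)"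
abbreviation Fi where "Fi \<equiv> f_inv L f"
abbreviation K where "K c \<equiv> \<iota> (sc_env L c)"

lemma even: "e \<in> prt L 0" "h \<in> prt L 0" "f \<in> prt L 0"
  and brk: "brk L h e = scl L 2 e" "brk L h f = scl L (- 2) f" "brk L e f = h"
  using triple by (auto simp: sl2_triple_def)

lemma brk_swap: "x \<in> prt L 0 \<Longrightarrow> y \<in> prt L 0 \<Longrightarrow> brk L x y = - brk L y x"
proof -
  interpret vector_space "scl L" by (rule vector_space)
  show "x \<in> prt L 0 \<Longrightarrow> y \<in> prt L 0 \<Longrightarrow> brk L x y = - brk L y x"
    using super_skew[of x 0 y 0] by (simp add: koszul_def)
qed

lemma prt_zero: "0 \<in> prt L i"
proof -
  interpret vector_space "scl L" by (rule vector_space)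
  show ?thesis by (rule subspace_0[OF subspace_prt])
qed

lemma brk_nilpotent: "\<exists>n. (brk L f ^^ n) x = 0" "\<exists>n. (brk L e ^^ n) x = 0"
  using ad_shift_nilpotent[OF even(2,3) brk(2) _ fin] ad_shift_nilpotent[OF even(2,1) brk(1) _ fin] by auto

section \<open>Generators and relations of the localization\<close>

abbreviation "J \<equiv> loc_ideal (env L) (in_env L f)"

lemma loc_ideal: "ideal J free_alg"
  unfolding loc_ideal_def by (rule free_alg.genideal_ideal) simp

lemmas lenv_quot = quot_free_alg[OF loc_ideal, folded localization_def, folded lenv_def]

sublocale lenv: ring V by (rule lenv_quot(1))

lemma loc_ideal_rel:
  "u \<in> carrier U \<Longrightarrow> v \<in> carrier U \<Longrightarrow> gen (Some (u \<oplus>\<^bsub>U\<^esub> v)) - gen (Some u) - gen (Some v) \<in> J"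
  "u \<in> carrier U \<Longrightarrow> v \<in> carrier U \<Longrightarrow> gen (Some (u \<otimes>\<^bsub>U\<^esub> v)) - gen (Some u) * gen (Some v) \<in> J"
  "gen (Some \<one>\<^bsub>U\<^esub>) - 1 \<in> J"
  "x \<notin> carrier U \<Longrightarrow> gen (Some x) \<in> J"
  "gen (Some (in_env L f)) * gen None - 1 \<in> J" "gen None * gen (Some (in_env L f)) - 1 \<in> J"
  unfolding loc_ideal_def by (rule subsetD[OF free_alg.genideal_self], simp, blast)+

lemma lenv_cls_closed [simp]: "J +>\<^bsub>free_alg\<^esub> p \<in> carrier V"
  by (auto simp: lenv_quot)

lemma iota_closed [simp]: "\<iota> u \<in> carrier V" by (simp add: to_lenv_def)
lemma Fi_closed [simp]: "Fi \<in> carrier V" by (simp add: f_inv_def)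

lemma iota_add: "u \<in> carrier U \<Longrightarrow> v \<in> carrier U \<Longrightarrow> \<iota> (u \<oplus>\<^bsub>U\<^esub> v) = \<iota> u \<oplus>\<^bsub>V\<^esub> \<iota> v"
  using loc_ideal_rel(1)[of u v] by (simp add: to_lenv_def lenv_quot algebra_simps)

lemma iota_mult: "u \<in> carrier U \<Longrightarrow> v \<in> carrier U \<Longrightarrow> \<iota> (u \<otimes>\<^bsub>U\<^esub> v) = \<iota> u \<otimes>\<^bsub>V\<^esub> \<iota> v"
  using loc_ideal_rel(2)[of u v] by (simp add: to_lenv_def lenv_quot)

lemma iota_one: "\<iota> \<one>\<^bsub>U\<^esub> = \<one>\<^bsub>V\<^esub>"
  using loc_ideal_rel(3) by (simp add: to_lenv_def lenv_quot)

sublocale iota: ring_hom_ring U V \<iota>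
  by (rule ring_hom_ringI) (auto simp: iota_add iota_mult iota_one env.ring_axioms lenv.ring_axioms)

lemma iota_outside: "x \<notin> carrier U \<Longrightarrow> \<iota> x = \<zero>\<^bsub>V\<^esub>"
  using loc_ideal_rel(4)[of x] by (simp add: to_lenv_def lenv_quot)

lemma F_Fi: "F \<otimes>\<^bsub>V\<^esub> Fi = \<one>\<^bsub>V\<^esub>" and Fi_F: "Fi \<otimes>\<^bsub>V\<^esub> F = \<one>\<^bsub>V\<^esub>"
  using loc_ideal_rel(5,6) by (simp_all add: to_lenv_def f_inv_def lenv_quot)

lemma K_one: "K 1 = \<one>\<^bsub>V\<^esub>" by (simp add: iota_one)
lemma K_add: "K (c + d) = K c \<oplus>\<^bsub>V\<^esub> K d" by (simp add: sc_env_add)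
lemma K_mult: "K (c * d) = K c \<otimes>\<^bsub>V\<^esub> K d" by (simp add: sc_env_mult)

text \<open>The free algebra behind the localization has integer coefficients. Identifying an
  integer constant with the complex scalar coming from \<open>U\<close> lets inductions treat
  constants as elements in the image of \<open>to_lenv\<close>.\<close>

lemma cls_const: "J +>\<^bsub>free_alg\<^esub> const c = K (of_int c)"
proof -
  have nat: "J +>\<^bsub>free_alg\<^esub> const (int n) = K (of_nat n)" for n
  proof (induction n)
    case 0
    then show ?case by (simp add: const_zero lenv_quot(6)[symmetric])
  next
    case (Suc n)
    have "J +>\<^bsub>free_alg\<^esub> const (int (Suc n)) = \<one>\<^bsub>V\<^esub> \<oplus>\<^bsub>V\<^esub> K (of_nat n)"
      by (simp add: const_add const_one lenv_quot(4,5)[symmetric] Suc)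
    then show ?case by (simp only: of_nat_Suc K_add K_one)
  qed
  show ?thesis
  proof (cases c rule: int_cases2)
    case (nonneg n)
    then show ?thesis by (simp add: nat)
  next
    case (nonpos n)
    have "(J +>\<^bsub>free_alg\<^esub> const c) \<oplus>\<^bsub>V\<^esub> (J +>\<^bsub>free_alg\<^esub> const (int n)) = \<zero>\<^bsub>V\<^esub>"
      by (simp add: lenv_quot(4,6) const_add[symmetric] nonpos const_zero)
    then have "J +>\<^bsub>free_alg\<^esub> const c = \<ominus>\<^bsub>V\<^esub> K (of_nat n)"
      by (simp add: nat lenv.minus_equality)
    moreover have "K (of_int c) = \<ominus>\<^bsub>V\<^esub> K (of_nat n)"
      by (rule lenv.minus_equality[symmetric]) (simp_all add: K_add[symmetric] nonpos)
    ultimately show ?thesis by simp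
  qed
qed

definition lenv_comp :: "bool \<Rightarrow> bit \<Rightarrow> 'g lel set" where
  "lenv_comp s i = (if s then lenv_part L f i else carrier V)"

lemma lenv_comp_eq: "lenv_comp s i = {J +>\<^bsub>free_alg\<^esub> p |p. s \<longrightarrow>
    homog (\<lambda>j. Some ` env_part L j \<union> (if j = 0 then {None} else {})) i p}"
  by (auto simp: lenv_comp_def lenv_part_def lenv_quot)

lemma lenv_comp_closed: "u \<in> lenv_comp s i \<Longrightarrow> u \<in> carrier V"
  by (auto simp: lenv_comp_eq)

lemma lenv_comp_False [simp]: "lenv_comp False i = carrier V" by (simp add: lenv_comp_def)
lemma lenv_comp_True [simp]: "lenv_comp True i = lenv_part L f i" by (simp add: lenv_comp_def)

lemma lenv_comp_iota: "r \<in> env_comp s i \<Longrightarrow> \<iota> r \<in> lenv_comp s i"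
  and lenv_comp_Fi: "Fi \<in> lenv_comp s 0"
  and lenv_comp_add: "u \<in> lenv_comp s i \<Longrightarrow> v \<in> lenv_comp s i \<Longrightarrow> u \<oplus>\<^bsub>V\<^esub> v \<in> lenv_comp s i"
  and lenv_comp_mult: "u \<in> lenv_comp s i \<Longrightarrow> v \<in> lenv_comp s j \<Longrightarrow> u \<otimes>\<^bsub>V\<^esub> v \<in> lenv_comp s (i + j)"
proof -
  show "r \<in> env_comp s i \<Longrightarrow> \<iota> r \<in> lenv_comp s i"
    unfolding lenv_comp_eq env_comp_def to_lenv_def
    by (auto intro!: exI[of _ "gen (Some r)"] homog.intros(2) split: if_splits)
  show "Fi \<in> lenv_comp s 0"
    unfolding lenv_comp_eq f_inv_def by (auto intro!: exI[of _ "gen None"] homog.intros(2))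
  show "u \<in> lenv_comp s i \<Longrightarrow> v \<in> lenv_comp s i \<Longrightarrow> u \<oplus>\<^bsub>V\<^esub> v \<in> lenv_comp s i"
    unfolding lenv_comp_eq by (auto simp: lenv_quot(4) intro: homog.intros(4))
  assume "u \<in> lenv_comp s i" "v \<in> lenv_comp s j"
  then obtain p q where pq: "u = J +>\<^bsub>free_alg\<^esub> p" "v = J +>\<^bsub>free_alg\<^esub> q"
    and "s \<longrightarrow> homog (\<lambda>j. Some ` env_part L j \<union> (if j = 0 then {None} else {})) i p"
      "s \<longrightarrow> homog (\<lambda>j. Some ` env_part L j \<union> (if j = 0 then {None} else {})) j q"
    unfolding lenv_comp_eq by blast
  then have "s \<longrightarrow> homog (\<lambda>j. Some ` env_part L j \<union> (if j = 0 then {None} else {})) (i + j) (p * q)"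
    by (blast intro: homog.intros(3))
  then show "u \<otimes>\<^bsub>V\<^esub> v \<in> lenv_comp s (i + j)"
    unfolding lenv_comp_eq pq lenv_quot(3) by blast
qed

lemma lenv_comp_induct [consumes 1, case_names iota Fi mult add]:
  assumes "u \<in> lenv_comp s i"
    and io: "\<And>i u. u \<in> env_comp s i \<Longrightarrow> Q i (\<iota> u)" and Fi: "\<And>i. (s \<longrightarrow> i = 0) \<Longrightarrow> Q i Fi"
    and mult: "\<And>i j u v. u \<in> carrier V \<Longrightarrow> v \<in> carrier V \<Longrightarrow> Q i u \<Longrightarrow> Q j v \<Longrightarrow> Q (i + j) (u \<otimes>\<^bsub>V\<^esub> v)"
    and add: "\<And>i u v. u \<in> carrier V \<Longrightarrow> v \<in> carrier V \<Longrightarrow> Q i u \<Longrightarrow> Q i v \<Longrightarrow> Q i (u \<oplus>\<^bsub>V\<^esub> v)"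
  shows "Q i u"
proof -
  obtain p where p: "s \<longrightarrow> homog (\<lambda>j. Some ` env_part L j \<union> (if j = 0 then {None} else {})) i p"
    and u: "u = J +>\<^bsub>free_alg\<^esub> p"
    using assms(1) by (auto simp: lenv_comp_eq)
  from p have "Q i (J +>\<^bsub>free_alg\<^esub> p)"
  proof (induction rule: parity_induct)
    case (const i c)
    then have "sc_env L (of_int c) \<in> env_comp s i"
      using env_comp_intros(1)[of "of_int c" s] by (cases s) auto
    then show ?case using io by (simp add: cls_const)
  next
    case (gen i x)
    show ?case
    proof (cases x)
      case None
      with gen have "s \<longrightarrow> i = 0" by (auto split: if_splits)
      then show ?thesis using Fi None by (simp add: f_inv_def)
    next
      case (Some y)
      show ?thesis
      proof (cases "y \<in> env_comp s i")
        case True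
        then show ?thesis using io[of y i] Some by (simp add: to_lenv_def)
      next
        case False
        \<comment> \<open>This occurs only without grading, for a generator outside the carrier of
          \<open>U\<close>; its class is zero, hence equal to that of the element 0 of
          \<open>U\<close>.\<close>
        with gen Some have s: "\<not> s" "y \<notin> carrier U" by (auto simp: env_comp_def split: if_splits)
        then have "Q i (\<iota> \<zero>\<^bsub>U\<^esub>)" by (intro io) (simp add: env_comp_def)
        moreover have "J +>\<^bsub>free_alg\<^esub> gen (Some y) = \<iota> \<zero>\<^bsub>U\<^esub>"
          using iota_outside[OF s(2)] iota.hom_zero by (simp only: to_lenv_def)
        ultimately show ?thesis by (simp add: Some)
      qed
    qed
  next
    case (mult i j p q)
    then show ?case using assms(4)[OF lenv_cls_closed lenv_cls_closed] by (simp only: lenv_quot(3))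
  next
    case (add i p q)
    then show ?case using assms(5)[OF lenv_cls_closed lenv_cls_closed] by (simp only: lenv_quot(4))
  qed
  then show ?thesis using u by simp
qed

lemma lenv_induct [consumes 1, case_names iota Fi mult add]:
  assumes "u \<in> carrier V"
    and "\<And>u. u \<in> carrier U \<Longrightarrow> Q (\<iota> u)" and "Q Fi"
    and "\<And>u v. u \<in> carrier V \<Longrightarrow> v \<in> carrier V \<Longrightarrow> Q u \<Longrightarrow> Q v \<Longrightarrow> Q (u \<otimes>\<^bsub>V\<^esub> v)"
    and "\<And>u v. u \<in> carrier V \<Longrightarrow> v \<in> carrier V \<Longrightarrow> Q u \<Longrightarrow> Q v \<Longrightarrow> Q (u \<oplus>\<^bsub>V\<^esub> v)"
  shows "Q u"
  using lenv_comp_induct[of u False 0 "\<lambda>_. Q"] assms by auto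

lemma Fi_commute:
  assumes "u \<in> carrier V" "u \<otimes>\<^bsub>V\<^esub> F = F \<otimes>\<^bsub>V\<^esub> u" shows "u \<otimes>\<^bsub>V\<^esub> Fi = Fi \<otimes>\<^bsub>V\<^esub> u"
proof -
  have "u \<otimes>\<^bsub>V\<^esub> Fi = Fi \<otimes>\<^bsub>V\<^esub> (F \<otimes>\<^bsub>V\<^esub> u) \<otimes>\<^bsub>V\<^esub> Fi"
    using assms by (simp add: lenv.m_assoc[symmetric] Fi_F)
  also have "\<dots> = Fi \<otimes>\<^bsub>V\<^esub> u \<otimes>\<^bsub>V\<^esub> (F \<otimes>\<^bsub>V\<^esub> Fi)"
    using assms by (simp only: assms(2)[symmetric] lenv.m_assoc iota_closed Fi_closed lenv.m_closed)
  finally show ?thesis using assms by (simp add: F_Fi)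
qed

lemma K_central: "u \<in> carrier V \<Longrightarrow> K c \<otimes>\<^bsub>V\<^esub> u = u \<otimes>\<^bsub>V\<^esub> K c"
proof (induction rule: lenv_induct)
  case (iota u)
  then show ?case using sc_env_central by (metis iota_mult sc_env_closed)
next
  case Fi
  have "K c \<otimes>\<^bsub>V\<^esub> F = F \<otimes>\<^bsub>V\<^esub> K c"
    using sc_env_central by (metis iota_mult sc_env_closed in_env_closed)
  then show ?case by (intro Fi_commute iota_closed)
next
  case (mult u v)
  then show ?case by (metis lenv.m_assoc iota_closed)
next
  case (add u v)
  then show ?case by (simp add: lenv.r_distr lenv.l_distr)
qed

section \<open>Local nilpotency of ad f and the twist on the localization\<close>

lemma env_comm_f_nilpotent: "u \<in> carrier U \<Longrightarrow> \<exists>n. (env.comm (in_env L f) ^^ n) u = \<zero>\<^bsub>U\<^esub>"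
  by (rule env_comm_nilpotent[OF even(3) brk_nilpotent(1)])

lemma iota_comm_pow: "u \<in> carrier U \<Longrightarrow>
    (lenv.comm F ^^ n) (\<iota> u) = \<iota> ((env.comm (in_env L f) ^^ n) u)"
proof (induction n)
  case (Suc n)
  have "lenv.comm F (\<iota> v) = \<iota> (env.comm (in_env L f) v)" if "v \<in> carrier U" for v
    using that by (simp add: lenv.comm_def env.comm_def lenv.minus_eq env.minus_eq)
  then show ?case using Suc by simp
qed simp

lemma lenv_comm_nilpotent: "u \<in> carrier V \<Longrightarrow> \<exists>n. (lenv.comm F ^^ n) u = \<zero>\<^bsub>V\<^esub>"
proof (induction rule: lenv_induct)
  case (iota u)
  then obtain n where "(env.comm (in_env L f) ^^ n) u = \<zero>\<^bsub>U\<^esub>" using env_comm_f_nilpotent by blast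
  then have "(lenv.comm F ^^ n) (\<iota> u) = \<zero>\<^bsub>V\<^esub>" using iota by (simp add: iota_comm_pow)
  then show ?case ..
next
  case Fi
  have "(lenv.comm F ^^ 1) Fi = \<zero>\<^bsub>V\<^esub>" by (simp add: lenv.comm_def F_Fi Fi_F lenv.minus_eq lenv.r_neg)
  then show ?case ..
qed (simp_all add: lenv.comm_nilpotent_mult lenv.comm_nilpotent_add)

sublocale tw: unipotent_ring V F Fi K
proof
  show "\<exists>n. ((\<lambda>u. F \<otimes>\<^bsub>V\<^esub> u \<ominus>\<^bsub>V\<^esub> u \<otimes>\<^bsub>V\<^esub> F) ^^ n) u = \<zero>\<^bsub>V\<^esub>" if "u \<in> carrier V" for u
    using lenv_comm_nilpotent[OF that] unfolding lenv.comm_def[abs_def] .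
qed (rule iota_closed Fi_closed F_Fi Fi_F K_add K_mult K_one K_central | assumption)+

lemma twist_eq: "twist L f a = tw.twst a"
  unfolding twist_def tw.twst_def ad_f_def tw.ad_def[abs_def] Let_def by simp

section \<open>Parity of twisted elements and left denominators\<close>

lemma lenv_comp_uminus: "u \<in> lenv_comp s i \<Longrightarrow> \<ominus>\<^bsub>V\<^esub> u \<in> lenv_comp s i"
proof -
  assume u: "u \<in> lenv_comp s i"
  then have "\<ominus>\<^bsub>V\<^esub> u = K (- 1) \<otimes>\<^bsub>V\<^esub> u"
    using lenv_comp_closed[OF u] by (simp only: tw.K_minus K_one lenv.l_minus lenv.l_one lenv.one_closed)
  moreover have "K (- 1) \<otimes>\<^bsub>V\<^esub> u \<in> lenv_comp s (0 + i)"
    by (intro lenv_comp_mult lenv_comp_iota env_comp_intros u)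
  ultimately show ?thesis by (simp only: add_0_left)
qed

lemma lenv_comp_F: "F \<in> lenv_comp s 0"
  by (intro lenv_comp_iota env_comp_intros even)

lemma lenv_comp_mult0: "u \<in> lenv_comp s 0 \<Longrightarrow> v \<in> lenv_comp s i \<Longrightarrow> u \<otimes>\<^bsub>V\<^esub> v \<in> lenv_comp s i"
  "u \<in> lenv_comp s i \<Longrightarrow> v \<in> lenv_comp s 0 \<Longrightarrow> u \<otimes>\<^bsub>V\<^esub> v \<in> lenv_comp s i"
  using lenv_comp_mult[of u s 0 v i] lenv_comp_mult[of u s i v 0] by (simp_all only: add_0_left add_0_right)

text \<open>\<open>homog\<close> places constants in parity 0 only. The zero of parity
  \<open>i\<close> is obtained as zero times some element of parity \<open>i\<close>: the image of
  f, or of the zero vector of \<open>prt L i\<close> in the odd case.\<close>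

lemma lenv_comp_zero: "\<zero>\<^bsub>V\<^esub> \<in> lenv_comp s i"
proof -
  have "\<zero>\<^bsub>V\<^esub> \<in> lenv_comp s 0" using lenv_comp_iota[OF env_comp_intros(1)[of 0]] by simp
  moreover have "\<exists>u. u \<in> lenv_comp s i"
  proof (cases i rule: bit.exhaust)
    case zero
    then show ?thesis using lenv_comp_F by blast
  next
    case one
    have "0 \<in> prt L i" by (rule prt_zero)
    from lenv_comp_iota[OF env_comp_intros(2)[OF this]] show ?thesis ..
  qed
  ultimately show ?thesis using lenv_comp_mult0(1)[of "\<zero>\<^bsub>V\<^esub>"] lenv_comp_closed lenv.l_null by metis
qed

lemma twist_comp: assumes u: "u \<in> lenv_comp s i" shows "tw.twst a u \<in> lenv_comp s i"
proof -
  note uc = lenv_comp_closed[OF u]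
  obtain n where n: "(tw.ad ^^ n) u = \<zero>\<^bsub>V\<^esub>" using tw.nilpotent uc by blast
  have nl: "(tw.nl ^^ k) u \<in> lenv_comp s i" for k
  proof (induction k)
    case (Suc k)
    have "tw.nl v \<in> lenv_comp s i" if "v \<in> lenv_comp s i" for v
      unfolding tw.nl_def tw.ad_def lenv.minus_eq
      by (rule lenv_comp_mult0(2)[OF lenv_comp_add[OF lenv_comp_mult0(1)[OF lenv_comp_F that]
          lenv_comp_uminus[OF lenv_comp_mult0(2)[OF that lenv_comp_F]]] lenv_comp_Fi])
    with Suc show ?case by simp
  qed (use u in simp)
  have t: "K c \<otimes>\<^bsub>V\<^esub> (tw.nl ^^ k) u \<in> lenv_comp s i" for c k
    by (intro lenv_comp_mult0(1) nl lenv_comp_iota env_comp_intros)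
  have "finsum V (\<lambda>k. K (a gchoose k) \<otimes>\<^bsub>V\<^esub> (tw.nl ^^ k) u) {..<m} \<in> lenv_comp s i" for m
  proof (induction m)
    case (Suc m)
    then show ?case using t uc by (simp add: lessThan_Suc Pi_iff lenv_comp_add del: iota_mult)
  qed (simp add: lenv_comp_zero)
  then show ?thesis by (simp only: tw.twst_eq[OF uc n])
qed

text \<open>The Ore condition, with parities. By f r = [f, r] + r f one factor f is carried across
  \<open>r\<close> at the cost of a commutator; iterated commutators end in zero, which gives the
  case of one factor, and \<open>t\<close> factors are carried across one at a time.\<close>

lemma env_ore:
  assumes "r \<in> env_comp s i"
  shows "\<exists>k::nat. \<exists>r'\<in>env_comp s i. in_env L f [^]\<^bsub>U\<^esub> k \<otimes>\<^bsub>U\<^esub> r = r' \<otimes>\<^bsub>U\<^esub> in_env L f [^]\<^bsub>U\<^esub> (t::nat)"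
proof -
  let ?f = "in_env L f"
  have fmult: "?f [^]\<^bsub>U\<^esub> k \<otimes>\<^bsub>U\<^esub> x \<in> env_comp s i" "x \<otimes>\<^bsub>U\<^esub> ?f \<in> env_comp s i" if "x \<in> env_comp s i" for k :: nat and x
  proof -
    have c: "x \<in> carrier U" using that env_comp_closed by blast
    show "x \<otimes>\<^bsub>U\<^esub> ?f \<in> env_comp s i"
      using env_comp_intros(3)[OF that env_comp_intros(2)[OF even(3)]] by (simp only: add_0_right)
    show "?f [^]\<^bsub>U\<^esub> k \<otimes>\<^bsub>U\<^esub> x \<in> env_comp s i"
    proof (induction k)
      case (Suc k)
      have "?f [^]\<^bsub>U\<^esub> Suc k \<otimes>\<^bsub>U\<^esub> x = ?f \<otimes>\<^bsub>U\<^esub> (?f [^]\<^bsub>U\<^esub> k \<otimes>\<^bsub>U\<^esub> x)"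
        using c by (simp add: env.m_assoc[symmetric] env.nat_pow_Suc2[symmetric])
      then show ?case using env_comp_intros(3)[OF env_comp_intros(2)[OF even(3)] Suc] by (simp only: add_0_left)
    qed (use that c in simp)
  qed
  have one: "\<exists>k::nat. \<exists>r'\<in>env_comp s i. ?f [^]\<^bsub>U\<^esub> k \<otimes>\<^bsub>U\<^esub> r = r' \<otimes>\<^bsub>U\<^esub> ?f"
    if "(env.comm ?f ^^ n) r = \<zero>\<^bsub>U\<^esub>" "r \<in> env_comp s i" for n r
    using that
  proof (induction n arbitrary: r)
    case 0
    then have "in_env L f [^]\<^bsub>U\<^esub> (0::nat) \<otimes>\<^bsub>U\<^esub> r = r \<otimes>\<^bsub>U\<^esub> in_env L f" by simp
    then have "\<exists>r'\<in>env_comp s i. in_env L f [^]\<^bsub>U\<^esub> (0::nat) \<otimes>\<^bsub>U\<^esub> r = r' \<otimes>\<^bsub>U\<^esub> in_env L f"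
      by (rule bexI[OF _ 0(2)])
    then show ?case by (rule exI)
  next
    case (Suc n)
    have rc: "r \<in> carrier U" using Suc.prems env_comp_closed by blast
    have "x \<in> env_comp s i \<Longrightarrow> sc_env L (- 1) \<otimes>\<^bsub>U\<^esub> x \<in> env_comp s i" for x
      using env_comp_intros(3)[OF env_comp_intros(1)[of "-1" s], of x i] by (simp only: add_0_left)
    moreover have "env.comm ?f r = ?f [^]\<^bsub>U\<^esub> (1::nat) \<otimes>\<^bsub>U\<^esub> r \<oplus>\<^bsub>U\<^esub> sc_env L (- 1) \<otimes>\<^bsub>U\<^esub> (r \<otimes>\<^bsub>U\<^esub> ?f)"
    proof -
      have "sc_env L (- 1) = \<ominus>\<^bsub>U\<^esub> \<one>\<^bsub>U\<^esub>"
        using sc_env_add[of "-1" 1] by (simp add: env.minus_equality)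
      then show ?thesis using rc by (simp add: env.comm_def env.minus_eq env.l_minus)
    qed
    ultimately have cc: "env.comm ?f r \<in> env_comp s i"
      using fmult[OF Suc.prems(2)] env_comp_intros(4) by metis
    then obtain k :: nat and r' where k: "r' \<in> env_comp s i" "?f [^]\<^bsub>U\<^esub> k \<otimes>\<^bsub>U\<^esub> env.comm ?f r = r' \<otimes>\<^bsub>U\<^esub> ?f"
      using Suc.IH[of "env.comm ?f r"] Suc.prems(1) by (auto simp: funpow_swap1)
    have k': "r' \<in> carrier U" using k env_comp_closed by blast
    have "?f \<otimes>\<^bsub>U\<^esub> r = env.comm ?f r \<oplus>\<^bsub>U\<^esub> r \<otimes>\<^bsub>U\<^esub> ?f"
      using rc by (simp add: env.comm_def env.minus_eq env.a_assoc env.l_neg)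
    then have "?f [^]\<^bsub>U\<^esub> Suc k \<otimes>\<^bsub>U\<^esub> r = (r' \<oplus>\<^bsub>U\<^esub> ?f [^]\<^bsub>U\<^esub> k \<otimes>\<^bsub>U\<^esub> r) \<otimes>\<^bsub>U\<^esub> ?f"
      using rc k k' by (simp add: env.m_assoc env.r_distr env.l_distr)
    moreover have "r' \<oplus>\<^bsub>U\<^esub> ?f [^]\<^bsub>U\<^esub> k \<otimes>\<^bsub>U\<^esub> r \<in> env_comp s i"
      by (intro env_comp_intros k fmult Suc.prems)
    ultimately show ?case by (intro exI bexI)
  qed
  show ?thesis
    using assms
  proof (induction t)
    case 0
    then show ?case using env_comp_closed by (intro exI[of _ 0] bexI[of _ r]) auto
  next
    case (Suc t)
    then obtain k :: nat and r' where r': "r' \<in> env_comp s i" "?f [^]\<^bsub>U\<^esub> k \<otimes>\<^bsub>U\<^esub> r = r' \<otimes>\<^bsub>U\<^esub> ?f [^]\<^bsub>U\<^esub> t" by blast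
    have c: "r' \<in> carrier U" "r \<in> carrier U" using r' Suc.prems env_comp_closed by blast+
    obtain n where "(env.comm ?f ^^ n) r' = \<zero>\<^bsub>U\<^esub>" using env_comm_f_nilpotent c by blast
    from one[OF this r'(1)] obtain l :: nat and r'' where
      r'': "r'' \<in> env_comp s i" "?f [^]\<^bsub>U\<^esub> l \<otimes>\<^bsub>U\<^esub> r' = r'' \<otimes>\<^bsub>U\<^esub> ?f" by blast
    have c'': "r'' \<in> carrier U" using r'' env_comp_closed by blast
    have "?f [^]\<^bsub>U\<^esub> (l + k) \<otimes>\<^bsub>U\<^esub> r = ?f [^]\<^bsub>U\<^esub> l \<otimes>\<^bsub>U\<^esub> (?f [^]\<^bsub>U\<^esub> k \<otimes>\<^bsub>U\<^esub> r)"
      using c by (simp add: env.nat_pow_mult[symmetric] env.m_assoc)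
    also have "\<dots> = (?f [^]\<^bsub>U\<^esub> l \<otimes>\<^bsub>U\<^esub> r') \<otimes>\<^bsub>U\<^esub> ?f [^]\<^bsub>U\<^esub> t"
      using c by (simp add: r' env.m_assoc)
    also have "\<dots> = r'' \<otimes>\<^bsub>U\<^esub> ?f [^]\<^bsub>U\<^esub> Suc t"
      using c'' by (simp only: r'' env.m_assoc env.nat_pow_Suc2 in_env_closed env.nat_pow_closed)
    finally show ?case by (intro exI bexI[OF _ r''(1)])
  qed
qed

text \<open>For a product, the denominator of the second factor must pass the numerator of the
  first, which is \<open>env_ore\<close>; a sum is brought to the common exponent k + l. The
  numerator keeps the parity because f is even.\<close>

lemma lenv_fraction:
  assumes "w \<in> lenv_comp s i"
  shows "\<exists>k::nat. \<exists>r\<in>env_comp s i. F [^]\<^bsub>V\<^esub> k \<otimes>\<^bsub>V\<^esub> w = \<iota> r"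
  using assms
proof (induction rule: lenv_comp_induct)
  case (iota i u)
  then show ?case by (intro exI[of _ 0] bexI[of _ u]) simp_all
next
  case (Fi i)
  then have "\<one>\<^bsub>U\<^esub> \<in> env_comp s i" using env_comp_intros(1)[of 1 s] by (cases s) simp_all
  then show ?case by (intro exI[of _ 1] bexI[of _ "\<one>\<^bsub>U\<^esub>"]) (simp_all add: F_Fi iota_one)
next
  case (mult i j u v)
  then obtain k r l r' where r: "r \<in> env_comp s i" "F [^]\<^bsub>V\<^esub> (k::nat) \<otimes>\<^bsub>V\<^esub> u = \<iota> r"
    and r': "r' \<in> env_comp s j" "F [^]\<^bsub>V\<^esub> (l::nat) \<otimes>\<^bsub>V\<^esub> v = \<iota> r'" by blast
  obtain m q where q: "q \<in> env_comp s i" "in_env L f [^]\<^bsub>U\<^esub> (m::nat) \<otimes>\<^bsub>U\<^esub> r = q \<otimes>\<^bsub>U\<^esub> in_env L f [^]\<^bsub>U\<^esub> l"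
    using env_ore[OF r(1)] by blast
  have c: "r \<in> carrier U" "r' \<in> carrier U" "q \<in> carrier U" using r r' q env_comp_closed by blast+
  have "F [^]\<^bsub>V\<^esub> (m + k) \<otimes>\<^bsub>V\<^esub> (u \<otimes>\<^bsub>V\<^esub> v) = F [^]\<^bsub>V\<^esub> m \<otimes>\<^bsub>V\<^esub> (F [^]\<^bsub>V\<^esub> k \<otimes>\<^bsub>V\<^esub> u) \<otimes>\<^bsub>V\<^esub> v"
    using mult by (simp add: lenv.nat_pow_mult[symmetric] lenv.m_assoc)
  also have "\<dots> = \<iota> (in_env L f [^]\<^bsub>U\<^esub> m \<otimes>\<^bsub>U\<^esub> r) \<otimes>\<^bsub>V\<^esub> v"
    using c by (simp add: r iota.hom_nat_pow)
  also have "\<dots> = \<iota> q \<otimes>\<^bsub>V\<^esub> (F [^]\<^bsub>V\<^esub> l \<otimes>\<^bsub>V\<^esub> v)"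
    using c mult by (simp add: q iota.hom_nat_pow lenv.m_assoc)
  also have "\<dots> = \<iota> (q \<otimes>\<^bsub>U\<^esub> r')" using c by (simp add: r')
  finally show ?case by (intro exI bexI[OF _ env_comp_intros(3)[OF q(1) r'(1)]])
next
  case (add i u v)
  have up: "\<exists>r\<in>env_comp s i. F [^]\<^bsub>V\<^esub> (m + k) \<otimes>\<^bsub>V\<^esub> w = \<iota> r"
    if "r \<in> env_comp s i" "F [^]\<^bsub>V\<^esub> (k::nat) \<otimes>\<^bsub>V\<^esub> w = \<iota> r" "w \<in> carrier V" for m k r w
  proof (induction m)
    case (Suc m)
    then obtain q where q: "q \<in> env_comp s i" "F [^]\<^bsub>V\<^esub> (m + k) \<otimes>\<^bsub>V\<^esub> w = \<iota> q" by blast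
    have "F [^]\<^bsub>V\<^esub> (Suc m + k) \<otimes>\<^bsub>V\<^esub> w = F \<otimes>\<^bsub>V\<^esub> (F [^]\<^bsub>V\<^esub> (m + k) \<otimes>\<^bsub>V\<^esub> w)"
      using that(3) by (simp add: lenv.m_assoc[symmetric] lenv.nat_pow_Suc2[symmetric])
    also have "\<dots> = \<iota> (in_env L f \<otimes>\<^bsub>U\<^esub> q)" using q env_comp_closed by simp
    finally show ?case
      using env_comp_intros(3)[OF env_comp_intros(2)[OF even(3)] q(1)] by (metis add_0_left)
  qed (use that in auto)
  from add obtain k r l r' where r: "r \<in> env_comp s i" "F [^]\<^bsub>V\<^esub> (k::nat) \<otimes>\<^bsub>V\<^esub> u = \<iota> r"
    and r': "r' \<in> env_comp s i" "F [^]\<^bsub>V\<^esub> (l::nat) \<otimes>\<^bsub>V\<^esub> v = \<iota> r'" by blast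
  obtain q q' where q: "q \<in> env_comp s i" "F [^]\<^bsub>V\<^esub> (k + l) \<otimes>\<^bsub>V\<^esub> u = \<iota> q"
      "q' \<in> env_comp s i" "F [^]\<^bsub>V\<^esub> (k + l) \<otimes>\<^bsub>V\<^esub> v = \<iota> q'"
    using up[OF r add(1), of l] up[OF r' add(2), of k] by (auto simp: add.commute)
  then have "F [^]\<^bsub>V\<^esub> (k + l) \<otimes>\<^bsub>V\<^esub> (u \<oplus>\<^bsub>V\<^esub> v) = \<iota> (q \<oplus>\<^bsub>U\<^esub> q')"
    using add env_comp_closed by (simp add: lenv.r_distr)
  then show ?case by (intro exI bexI[OF _ env_comp_intros(4)[OF q(1,3)]])
qed

end

section \<open>Modules on which \<open>f\<close> acts bijectively\<close>

lemma left_moduleI: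
  assumes "ring R" "abelian_group M"
    and "\<And>r v. r \<in> carrier R \<Longrightarrow> v \<in> carrier M \<Longrightarrow> r \<odot>\<^bsub>M\<^esub> v \<in> carrier M"
    and "\<And>r s v. r \<in> carrier R \<Longrightarrow> s \<in> carrier R \<Longrightarrow> v \<in> carrier M \<Longrightarrow>
      (r \<oplus>\<^bsub>R\<^esub> s) \<odot>\<^bsub>M\<^esub> v = r \<odot>\<^bsub>M\<^esub> v \<oplus>\<^bsub>M\<^esub> s \<odot>\<^bsub>M\<^esub> v"
    and "\<And>r v w. r \<in> carrier R \<Longrightarrow> v \<in> carrier M \<Longrightarrow> w \<in> carrier M \<Longrightarrow>
      r \<odot>\<^bsub>M\<^esub> (v \<oplus>\<^bsub>M\<^esub> w) = r \<odot>\<^bsub>M\<^esub> v \<oplus>\<^bsub>M\<^esub> r \<odot>\<^bsub>M\<^esub> w"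
    and "\<And>r s v. r \<in> carrier R \<Longrightarrow> s \<in> carrier R \<Longrightarrow> v \<in> carrier M \<Longrightarrow>
      (r \<otimes>\<^bsub>R\<^esub> s) \<odot>\<^bsub>M\<^esub> v = r \<odot>\<^bsub>M\<^esub> (s \<odot>\<^bsub>M\<^esub> v)"
    and "\<And>v. v \<in> carrier M \<Longrightarrow> \<one>\<^bsub>R\<^esub> \<odot>\<^bsub>M\<^esub> v = v"
  shows "left_module R M"
  using assms by (intro left_module.intro left_module_axioms.intro)

lemma abelian_group_cong:
  assumes "abelian_group M" "carrier N = carrier M" "add N = add M" "zero N = zero M"
  shows "abelian_group N"
proof -
  interpret M: abelian_group M by fact
  show ?thesis
    by (rule abelian_groupI) (auto simp: assms(2-4) M.a_ac intro: M.l_neg bexI[of _ "\<ominus>\<^bsub>M\<^esub> x" for x])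
qed

context left_module
begin

lemma smult_zero_right [simp]: "r \<in> carrier R \<Longrightarrow> r \<odot>\<^bsub>M\<^esub> \<zero>\<^bsub>M\<^esub> = \<zero>\<^bsub>M\<^esub>"
  using smult_r_distr[of r "\<zero>\<^bsub>M\<^esub>" "\<zero>\<^bsub>M\<^esub>"] smult_closed[of r "\<zero>\<^bsub>M\<^esub>"]
  by (metis M.add.l_cancel_one' M.zero_closed M.r_zero)

lemma smult_zero_left [simp]: "v \<in> carrier M \<Longrightarrow> \<zero>\<^bsub>R\<^esub> \<odot>\<^bsub>M\<^esub> v = \<zero>\<^bsub>M\<^esub>"
  using smult_l_distr[of "\<zero>\<^bsub>R\<^esub>" "\<zero>\<^bsub>R\<^esub>" v] smult_closed[of "\<zero>\<^bsub>R\<^esub>" v]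
  by (metis M.add.l_cancel_one' R.zero_closed R.r_zero)

lemma smult_finsum: "finite A \<Longrightarrow> r \<in> carrier R \<Longrightarrow> g \<in> A \<rightarrow> carrier M \<Longrightarrow>
    r \<odot>\<^bsub>M\<^esub> finsum M g A = finsum M (\<lambda>i. r \<odot>\<^bsub>M\<^esub> g i) A"
  by (induction rule: finite_induct) (auto simp: smult_r_distr smult_closed Pi_iff)

end

context sl2_superalgebra
begin

context
  fixes M :: "('g uel, 'v, 'k) module_scheme"
  assumes lm: "left_module U M"
    and bij: "bij_betw (\<lambda>v. in_env L f \<odot>\<^bsub>M\<^esub> v) (carrier M) (carrier M)"
begin

interpretation M: left_module U M by (rule lm)

declare M.smult_closed [simp]

definition letter_act :: "'g uel option \<Rightarrow> 'v \<Rightarrow> 'v" where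
  "letter_act x v = (case x of
     None \<Rightarrow> inv_into (carrier M) (\<lambda>v. in_env L f \<odot>\<^bsub>M\<^esub> v) v
   | Some u \<Rightarrow> if u \<in> carrier U then u \<odot>\<^bsub>M\<^esub> v else \<zero>\<^bsub>M\<^esub>)"

definition word_act :: "'g uel option mon \<Rightarrow> 'v \<Rightarrow> 'v" where
  "word_act w = foldr letter_act (letters w)"

definition poly_act :: "('g uel option, int) falg \<Rightarrow> 'v \<Rightarrow> 'v" where
  "poly_act p v = finsum M (\<lambda>w. sc_env L (of_int (Poly_Mapping.lookup p w)) \<odot>\<^bsub>M\<^esub> word_act w v)
     (Poly_Mapping.keys p)"

lemma f_inverse:
  assumes "v \<in> carrier M"
  shows "letter_act None v \<in> carrier M" "in_env L f \<odot>\<^bsub>M\<^esub> letter_act None v = v"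
    "letter_act None (in_env L f \<odot>\<^bsub>M\<^esub> v) = v"
  using assms bij by (auto simp: letter_act_def bij_betw_def f_inv_into_f inv_into_into inv_into_f_f)

lemma letter_act_closed: "v \<in> carrier M \<Longrightarrow> letter_act x v \<in> carrier M"
  using f_inverse(1)[of v] by (cases x) (auto simp: letter_act_def)

lemma letter_act_add:
  assumes "v \<in> carrier M" "w \<in> carrier M"
  shows "letter_act x (v \<oplus>\<^bsub>M\<^esub> w) = letter_act x v \<oplus>\<^bsub>M\<^esub> letter_act x w"
proof (cases x)
  case None
  let ?i = "letter_act None"
  have "?i (v \<oplus>\<^bsub>M\<^esub> w) = ?i (in_env L f \<odot>\<^bsub>M\<^esub> (?i v \<oplus>\<^bsub>M\<^esub> ?i w))"
    using assms by (simp add: M.smult_r_distr f_inverse)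
  then show ?thesis using assms None by (simp add: f_inverse)
qed (use assms in \<open>auto simp: letter_act_def M.smult_r_distr\<close>)

lemma word_act_closed: "v \<in> carrier M \<Longrightarrow> word_act w v \<in> carrier M"
proof -
  assume "v \<in> carrier M"
  then have "foldr letter_act xs v \<in> carrier M" for xs by (induction xs) (auto simp: letter_act_closed)
  then show ?thesis by (simp add: word_act_def)
qed

lemma word_act_add: "v \<in> carrier M \<Longrightarrow> v' \<in> carrier M \<Longrightarrow>
    word_act w (v \<oplus>\<^bsub>M\<^esub> v') = word_act w v \<oplus>\<^bsub>M\<^esub> word_act w v'"
proof -
  assume *: "v \<in> carrier M" "v' \<in> carrier M"
  have c: "u \<in> carrier M \<Longrightarrow> foldr letter_act xs u \<in> carrier M" for xs u
    by (induction xs) (auto simp: letter_act_closed)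
  have "foldr letter_act xs (v \<oplus>\<^bsub>M\<^esub> v') = foldr letter_act xs v \<oplus>\<^bsub>M\<^esub> foldr letter_act xs v'" for xs
    using * by (induction xs) (auto simp: letter_act_add c)
  then show ?thesis by (simp add: word_act_def)
qed

lemma word_act_plus: "word_act (w + w') v = word_act w (word_act w' v)"
  by (simp add: word_act_def plus_mon_def)

text \<open>Coefficients in the presentation of the localization are integers, and multiplication by
  an integer commutes with every additive map. For words containing the inverse of f, additivity is
  all that has been shown.\<close>

lemma additive_scalar:
  assumes add: "\<And>v v'. v \<in> carrier M \<Longrightarrow> v' \<in> carrier M \<Longrightarrow> t (v \<oplus>\<^bsub>M\<^esub> v') = t v \<oplus>\<^bsub>M\<^esub> t v'"
    and c: "\<And>v. v \<in> carrier M \<Longrightarrow> t v \<in> carrier M" and v: "v \<in> carrier M"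
  shows "t (sc_env L (of_int k) \<odot>\<^bsub>M\<^esub> v) = sc_env L (of_int k) \<odot>\<^bsub>M\<^esub> t v"
proof -
  have z: "t \<zero>\<^bsub>M\<^esub> = \<zero>\<^bsub>M\<^esub>"
    using add[of "\<zero>\<^bsub>M\<^esub>" "\<zero>\<^bsub>M\<^esub>"] c[of "\<zero>\<^bsub>M\<^esub>"] by (metis M.add.l_cancel_one' M.zero_closed M.r_zero)
  have nat: "t (sc_env L (of_nat n) \<odot>\<^bsub>M\<^esub> v) = sc_env L (of_nat n) \<odot>\<^bsub>M\<^esub> t v" for n
    using v by (induction n) (auto simp: z c add sc_env_add M.smult_l_distr M.smult_one)
  show ?thesis
  proof (cases k rule: int_cases2)
    case (nonneg n)
    then show ?thesis using nat by simp
  next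
    case (nonpos n)
    let ?s = "\<lambda>w. sc_env L (of_int k) \<odot>\<^bsub>M\<^esub> w" and ?r = "\<lambda>w. sc_env L (of_nat n) \<odot>\<^bsub>M\<^esub> w"
    have sr: "?s w \<oplus>\<^bsub>M\<^esub> ?r w = \<zero>\<^bsub>M\<^esub>" if "w \<in> carrier M" for w
      using that nonpos by (simp add: M.smult_l_distr[symmetric] sc_env_add[symmetric])
    have "t (?s v) \<oplus>\<^bsub>M\<^esub> ?r (t v) = \<zero>\<^bsub>M\<^esub>"
      using add[of "?s v" "?r v"] sr[OF v] v by (simp add: z nat)
    moreover have "?s (t v) \<oplus>\<^bsub>M\<^esub> ?r (t v) = \<zero>\<^bsub>M\<^esub>" using sr c v by blast
    ultimately show ?thesis using c v M.add.right_cancel[of "?r (t v)" "t (?s v)" "?s (t v)"] by simp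
  qed
qed

lemma poly_act_superset:
  assumes "finite A" "Poly_Mapping.keys p \<subseteq> A" "v \<in> carrier M"
  shows "poly_act p v = finsum M (\<lambda>w. sc_env L (of_int (Poly_Mapping.lookup p w)) \<odot>\<^bsub>M\<^esub> word_act w v) A"
  unfolding poly_act_def
  by (rule M.add.finprod_mono_neutral_cong_left) (use assms in \<open>auto simp: word_act_closed in_keys_iff\<close>)

lemma poly_act_closed: "v \<in> carrier M \<Longrightarrow> poly_act p v \<in> carrier M"
  unfolding poly_act_def by (rule M.finsum_closed) (auto simp: word_act_closed)

lemma poly_act_plus:
  assumes "v \<in> carrier M" shows "poly_act (p + q) v = poly_act p v \<oplus>\<^bsub>M\<^esub> poly_act q v"
proof -
  let ?A = "Poly_Mapping.keys p \<union> Poly_Mapping.keys q"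
  have "Poly_Mapping.keys (p + q) \<subseteq> ?A" by (rule Poly_Mapping.keys_add)
  then show ?thesis
    using assms by (simp add: poly_act_superset[of ?A] lookup_add sc_env_add M.smult_l_distr
        word_act_closed M.finsum_addf Pi_iff)
qed

lemma poly_act_single: "v \<in> carrier M \<Longrightarrow>
    poly_act (Poly_Mapping.single w c) v = sc_env L (of_int c) \<odot>\<^bsub>M\<^esub> word_act w v"
  by (subst poly_act_superset[of "{w}"]) (auto simp: word_act_closed)

lemma poly_act_add:
  assumes "v \<in> carrier M" "v' \<in> carrier M"
  shows "poly_act p (v \<oplus>\<^bsub>M\<^esub> v') = poly_act p v \<oplus>\<^bsub>M\<^esub> poly_act p v'"
  using assms by (simp add: poly_act_def word_act_add word_act_closed M.smult_r_distr M.finsum_addf Pi_iff)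

lemma poly_act_const: "v \<in> carrier M \<Longrightarrow> poly_act (const c) v = sc_env L (of_int c) \<odot>\<^bsub>M\<^esub> v"
  by (simp add: const_def poly_act_single word_act_def zero_mon_def)

lemma poly_act_gen: "v \<in> carrier M \<Longrightarrow> poly_act (gen x) v = letter_act x v"
  by (simp add: gen_def poly_act_single word_act_def letter_act_closed M.smult_one)

lemma poly_act_zero: "v \<in> carrier M \<Longrightarrow> poly_act 0 v = \<zero>\<^bsub>M\<^esub>"
  by (simp add: poly_act_def)

lemma poly_act_one: "v \<in> carrier M \<Longrightarrow> poly_act 1 v = v"
  using poly_act_const[of v 1] by (simp add: const_one M.smult_one)

lemma poly_act_single_times:
  assumes "v \<in> carrier M"
  shows "poly_act (Poly_Mapping.single w c * q) v = poly_act (Poly_Mapping.single w c) (poly_act q v)"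
proof (induction q rule: update_induct)
  case const
  have "word_act w \<zero>\<^bsub>M\<^esub> = \<zero>\<^bsub>M\<^esub>"
    using word_act_add[of "\<zero>\<^bsub>M\<^esub>" "\<zero>\<^bsub>M\<^esub>" w] word_act_closed[of "\<zero>\<^bsub>M\<^esub>" w]
    by (metis M.add.l_cancel_one' M.zero_closed M.r_zero)
  then show ?case using assms by (simp add: poly_act_zero poly_act_single)
next
  case (update g w' b)
  have u: "Poly_Mapping.update w' b g = g + Poly_Mapping.single w' b"
    using update by (intro poly_mapping_eqI)
      (auto simp: lookup_update lookup_add lookup_single when_def in_keys_iff)
  have "poly_act (Poly_Mapping.single w c * Poly_Mapping.single w' b) v =
      poly_act (Poly_Mapping.single w c) (poly_act (Poly_Mapping.single w' b) v)"
    using assms additive_scalar[of "word_act w" "word_act w' v" b]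
    by (simp add: mult_single poly_act_single word_act_closed word_act_plus word_act_add
        sc_env_mult M.smult_assoc)
  then show ?case using update assms
    by (simp add: u distrib_left poly_act_plus poly_act_closed poly_act_add)
qed

lemma poly_act_times:
  assumes "v \<in> carrier M" shows "poly_act (p * q) v = poly_act p (poly_act q v)"
proof (induction p rule: update_induct)
  case const
  then show ?case using assms by (simp add: poly_act_zero poly_act_closed)
next
  case (update g w b)
  have u: "Poly_Mapping.update w b g = g + Poly_Mapping.single w b"
    using update by (intro poly_mapping_eqI)
      (auto simp: lookup_update lookup_add lookup_single when_def in_keys_iff)
  show ?case using update assms
    by (simp add: u distrib_right poly_act_plus poly_act_closed poly_act_single_times)
qed

lemma poly_act_uminus: assumes "v \<in> carrier M" shows "poly_act (- p) v = \<ominus>\<^bsub>M\<^esub> poly_act p v"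
  using poly_act_plus[OF assms, of "- p" p] assms
  by (simp add: poly_act_zero poly_act_closed M.minus_equality)

text \<open>The elements acting by zero form a two-sided ideal, so only the generating relations
  have to be tested on \<open>M\<close>.\<close>

lemma poly_act_loc_ideal: assumes "p \<in> J" "v \<in> carrier M" shows "poly_act p v = \<zero>\<^bsub>M\<^esub>"
proof -
  let ?I = "{p. \<forall>v\<in>carrier M. poly_act p v = \<zero>\<^bsub>M\<^esub>}"
  have z: "poly_act p \<zero>\<^bsub>M\<^esub> = \<zero>\<^bsub>M\<^esub>" for p
    using poly_act_add[of "\<zero>\<^bsub>M\<^esub>" "\<zero>\<^bsub>M\<^esub>" p] poly_act_closed[of "\<zero>\<^bsub>M\<^esub>" p]
    by (metis M.add.l_cancel_one' M.zero_closed M.r_zero)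
  have I: "ideal ?I (free_alg :: ('g uel option, int) falg ring)"
  proof (rule idealI[OF ring_free_alg])
    show "subgroup ?I (add_monoid (free_alg :: ('g uel option, int) falg ring))"
    proof (rule group.subgroupI[OF free_alg.add.group_axioms])
      show "?I \<noteq> {}" using poly_act_zero by blast
      show "inv\<^bsub>add_monoid free_alg\<^esub> p \<in> ?I" if "p \<in> ?I" for p
      proof -
        have "inv\<^bsub>add_monoid free_alg\<^esub> p = - p" using free_alg_a_inv[of p] unfolding a_inv_def .
        then show ?thesis unfolding \<open>inv\<^bsub>add_monoid free_alg\<^esub> p = - p\<close>
          using that by (auto simp: poly_act_uminus)
      qed
    qed (auto simp: poly_act_plus)
  qed (auto simp: poly_act_times poly_act_closed z)
  have diff: "p - q \<in> ?I" if "\<And>v. v \<in> carrier M \<Longrightarrow> poly_act p v = poly_act q v" for p q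
  proof -
    have "poly_act (p + - q) v = \<zero>\<^bsub>M\<^esub>" if "v \<in> carrier M" for v
      using that \<open>\<And>v. v \<in> carrier M \<Longrightarrow> poly_act p v = poly_act q v\<close>[of v]
      by (simp add: poly_act_plus[of v p "- q"] poly_act_uminus poly_act_closed M.r_neg del: add_uminus_conv_diff)
    then show ?thesis by simp
  qed
  have "{gen (Some (x \<oplus>\<^bsub>U\<^esub> y)) - gen (Some x) - gen (Some y) |x y. x \<in> carrier U \<and> y \<in> carrier U} \<subseteq> ?I"
  proof (rule subsetI, elim CollectE exE conjE)
    fix z :: "('g uel option, int) falg" and x y assume "x \<in> carrier U" "y \<in> carrier U" and z: "z = gen (Some (x \<oplus>\<^bsub>U\<^esub> y)) - gen (Some x) - gen (Some y)"
    then have "gen (Some (x \<oplus>\<^bsub>U\<^esub> y)) - (gen (Some x) + gen (Some y)) \<in> ?I"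
      by (intro diff) (simp add: poly_act_gen poly_act_plus letter_act_def M.smult_l_distr)
    then show "z \<in> ?I" unfolding z by (simp only: diff_diff_eq)
  qed
  moreover have "{gen (Some (x \<otimes>\<^bsub>U\<^esub> y)) - gen (Some x) * gen (Some y) |x y. x \<in> carrier U \<and> y \<in> carrier U} \<subseteq> ?I"
  proof (rule subsetI, elim CollectE exE conjE)
    fix z :: "('g uel option, int) falg" and x y assume "x \<in> carrier U" "y \<in> carrier U" and z: "z = gen (Some (x \<otimes>\<^bsub>U\<^esub> y)) - gen (Some x) * gen (Some y)"
    then show "z \<in> ?I"
      unfolding z by (intro diff) (simp add: poly_act_gen poly_act_times letter_act_def M.smult_assoc)
  qed
  moreover have "{gen (Some \<one>\<^bsub>U\<^esub>) - 1} \<subseteq> ?I"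
    using diff[of "gen (Some \<one>\<^bsub>U\<^esub>)" 1] by (simp add: poly_act_gen poly_act_one letter_act_def M.smult_one)
  \<comment> \<open>The default value of \<open>letter_act\<close> outside the carrier was chosen to
    respect this relation.\<close>
  moreover have "{gen (Some x) |x. x \<notin> carrier U} \<subseteq> ?I"
    by (auto simp: poly_act_gen letter_act_def)
  moreover have "{gen (Some (in_env L f)) * gen None - 1, gen None * gen (Some (in_env L f)) - 1} \<subseteq> ?I"
  proof -
    have "letter_act (Some (in_env L f)) w = in_env L f \<odot>\<^bsub>M\<^esub> w" for w by (simp add: letter_act_def)
    then have "gen (Some (in_env L f)) * gen None - 1 \<in> ?I" "gen None * gen (Some (in_env L f)) - 1 \<in> ?I"
      by (intro diff, simp add: poly_act_gen poly_act_times poly_act_one f_inverse)+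
    then show ?thesis by blast
  qed
  ultimately have "J \<subseteq> ?I"
    unfolding loc_ideal_def by (intro free_alg.genideal_minimal[OF I] Un_least)
  then show ?thesis using assms by blast
qed

text \<open>The universal property of the localization, applied to the additive endomorphisms of
  \<open>M\<close>: the free algebra acts, and by \<open>poly_act_loc_ideal\<close> the action does
  not depend on the representative picked by \<open>SOME\<close>.\<close>

lemma localized_action:
  "\<exists>A. left_module V \<lparr>carrier = carrier M, monoid.mult = undefined, one = undefined, zero = zero M, add = add M, module.smult = A\<rparr> \<and>
     (\<forall>u\<in>carrier U. \<forall>v\<in>carrier M. A (\<iota> u) v = u \<odot>\<^bsub>M\<^esub> v)"
proof -
  define A where "A x v = poly_act (SOME p. x = J +>\<^bsub>free_alg\<^esub> p) v" for x v
  have A: "A (J +>\<^bsub>free_alg\<^esub> p) v = poly_act p v" if v: "v \<in> carrier M" for p v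
  proof -
    let ?q = "SOME q. J +>\<^bsub>free_alg\<^esub> p = J +>\<^bsub>free_alg\<^esub> q"
    have "J +>\<^bsub>free_alg\<^esub> p = J +>\<^bsub>free_alg\<^esub> ?q" by (rule someI) (rule HOL.refl)
    then have "p - ?q \<in> J" by (simp only: lenv_quot(7))
    then have "poly_act (?q + (p - ?q)) v = poly_act ?q v"
      using v by (simp only: poly_act_plus poly_act_loc_ideal M.r_zero poly_act_closed)
    then show ?thesis by (simp add: A_def)
  qed
  let ?M = "\<lparr>carrier = carrier M, monoid.mult = undefined, one = undefined, zero = zero M, add = add M, module.smult = A\<rparr>"
  have V: "\<exists>p. x = J +>\<^bsub>free_alg\<^esub> p" if "x \<in> carrier V" for x using that by (auto simp: lenv_quot(2))
  have "abelian_group ?M"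
    by (rule abelian_group_cong[OF M.abelian_group_axioms]) simp_all
  then have "left_module V ?M"
    by (intro left_moduleI lenv.ring_axioms)
      (auto dest!: V simp: A lenv_quot(3-5) poly_act_closed poly_act_plus poly_act_add poly_act_times poly_act_one)
  moreover have "A (\<iota> u) v = u \<odot>\<^bsub>M\<^esub> v" if "u \<in> carrier U" "v \<in> carrier M" for u v
    using that by (simp add: to_lenv_def A poly_act_gen letter_act_def)
  ultimately show ?thesis by blast
qed

end

text \<open>In the colimit of \<open>M \<rightarrow> M \<rightarrow> \<dots>\<close> along \<open>f\<close>, the fraction \<open>f\<^sup>-\<^sup>1y\<close> is represented by the
  sequence \<open>s \<mapsto> f\<^sup>s\<^sup>-\<^sup>1y\<close>, and \<open>u\<close> acts through \<open>f\<^sup>s u = \<Sum>\<^sub>i (s choose i) (ad f)\<^sup>i(u) f\<^sup>s\<^sup>-\<^sup>i\<close>.\<close>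

context
  fixes M :: "('g uel, 'v, 'k) module_scheme"
  assumes lm: "left_module U M"
begin

interpretation M: left_module U M by (rule lm)

declare M.smult_closed [simp]

abbreviation (input) "fe \<equiv> in_env L f"

text \<open>The recursion encodes f^(s+1) u = f^s [f, u] + (f^s u) f, the trailing f becoming a
  shift of the sequence. Unrolled it is the binomial sum, which is never written out.\<close>

primrec seq_act :: "nat \<Rightarrow> 'g uel \<Rightarrow> (nat \<Rightarrow> 'v) \<Rightarrow> 'v" where
  "seq_act 0 u x = u \<odot>\<^bsub>M\<^esub> x 0"
| "seq_act (Suc s) u x = seq_act s (env.comm fe u) x \<oplus>\<^bsub>M\<^esub> seq_act s u (\<lambda>t. x (Suc t))"

lemma seq_act_closed [simp]: "u \<in> carrier U \<Longrightarrow> (\<And>t. x t \<in> carrier M) \<Longrightarrow> seq_act s u x \<in> carrier M"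
  by (induction s arbitrary: u x) auto

lemma seq_act_add_left: "u \<in> carrier U \<Longrightarrow> v \<in> carrier U \<Longrightarrow> (\<And>t. x t \<in> carrier M) \<Longrightarrow>
    seq_act s (u \<oplus>\<^bsub>U\<^esub> v) x = seq_act s u x \<oplus>\<^bsub>M\<^esub> seq_act s v x"
  by (induction s arbitrary: u v x) (auto simp: M.smult_l_distr env.comm_add M.a_ac)

lemma seq_act_add_right: "u \<in> carrier U \<Longrightarrow> (\<And>t. x t \<in> carrier M) \<Longrightarrow> (\<And>t. y t \<in> carrier M) \<Longrightarrow>
    seq_act s u (\<lambda>t. x t \<oplus>\<^bsub>M\<^esub> y t) = seq_act s u x \<oplus>\<^bsub>M\<^esub> seq_act s u y"
  by (induction s arbitrary: u x y) (auto simp: M.smult_r_distr M.a_ac)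

lemma seq_act_zero: "(\<And>t. x t \<in> carrier M) \<Longrightarrow> seq_act s \<zero>\<^bsub>U\<^esub> x = \<zero>\<^bsub>M\<^esub>"
  by (induction s arbitrary: x) auto

text \<open>Compatibility with products holds at each index and for arbitrary sequences, before
  coherence enters; the induction step is the Leibniz rule for the commutator with f.\<close>

lemma seq_act_mult: "u \<in> carrier U \<Longrightarrow> v \<in> carrier U \<Longrightarrow> (\<And>t. x t \<in> carrier M) \<Longrightarrow>
    seq_act s (u \<otimes>\<^bsub>U\<^esub> v) x = seq_act s u (\<lambda>t. seq_act t v x)"
proof (induction s arbitrary: u v x)
  case (Suc s)
  have "seq_act (Suc s) u (\<lambda>t. seq_act t v x) =
      seq_act s (env.comm fe u) (\<lambda>t. seq_act t v x) \<oplus>\<^bsub>M\<^esub>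
      (seq_act s u (\<lambda>t. seq_act t (env.comm fe v) x) \<oplus>\<^bsub>M\<^esub> seq_act s u (\<lambda>t. seq_act t v (\<lambda>t. x (Suc t))))"
    using Suc.prems by (simp add: seq_act_add_right)
  also have "\<dots> = seq_act (Suc s) (u \<otimes>\<^bsub>U\<^esub> v) x"
    using Suc.prems by (simp add: Suc.IH[symmetric] env.comm_mult seq_act_add_left M.a_assoc)
  finally show ?case by simp
qed (simp add: M.smult_assoc)

lemma seq_act_central: "u \<in> carrier U \<Longrightarrow> env.comm fe u = \<zero>\<^bsub>U\<^esub> \<Longrightarrow> (\<And>t. x t \<in> carrier M) \<Longrightarrow>
    seq_act s u x = u \<odot>\<^bsub>M\<^esub> x s"
  by (induction s arbitrary: x) (auto simp: seq_act_zero)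

lemma seq_act_f: "(\<And>t. x t \<in> carrier M) \<Longrightarrow> seq_act s fe x = fe \<odot>\<^bsub>M\<^esub> x s"
  by (rule seq_act_central) (auto simp: env.comm_def env.minus_eq env.r_neg)

lemma seq_act_one: "(\<And>t. x t \<in> carrier M) \<Longrightarrow> seq_act s \<one>\<^bsub>U\<^esub> x = x s"
  by (subst seq_act_central) (auto simp: env.comm_def env.minus_eq env.r_neg M.smult_one)

text \<open>In unrolled form, index s involves only the terms (ad f)^i(u) x(s-i) with i < m, and all
  these positions lie beyond k.\<close>

lemma seq_act_cong:
  assumes "(env.comm fe ^^ m) u = \<zero>\<^bsub>U\<^esub>" "u \<in> carrier U" "\<And>t. x t \<in> carrier M" "\<And>t. y t \<in> carrier M"
    "\<And>t. t \<ge> k \<Longrightarrow> x t = y t" "s \<ge> k + m"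
  shows "seq_act s u x = seq_act s u y"
  using assms
proof (induction m arbitrary: u x y s k)
  case 0
  then show ?case by (simp add: seq_act_zero)
next
  case (Suc m)
  have Suc_IH: "seq_act s u x = seq_act s u y"
    if "(env.comm fe ^^ m) u = \<zero>\<^bsub>U\<^esub>" "u \<in> carrier U" "\<And>t. x t \<in> carrier M" "\<And>t. y t \<in> carrier M"
      "\<And>t. t \<ge> k \<Longrightarrow> x t = y t" "s \<ge> k + m" for u x y s k
    using that by (rule Suc.IH)
  from Suc.prems show ?case
  proof (induction k arbitrary: x y s)
    case 0
    then have "x = y" by auto
    then show ?case by simp
  next
    case (Suc k)
    then obtain s' where s: "s = Suc s'" by (cases s) auto
    have "seq_act s' (env.comm fe u) x = seq_act s' (env.comm fe u) y"
      using Suc.prems s by (intro Suc_IH[of _ x y "Suc k" s']) (auto simp: funpow_swap1)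
    moreover have "seq_act s' u (\<lambda>t. x (Suc t)) = seq_act s' u (\<lambda>t. y (Suc t))"
      using Suc.prems s by (intro Suc.IH) auto
    ultimately show ?case by (simp add: s)
  qed
qed

lemma seq_act_f_pow: "u \<in> carrier U \<Longrightarrow> n \<in> carrier M \<Longrightarrow>
    seq_act s u (\<lambda>t. fe [^]\<^bsub>U\<^esub> t \<odot>\<^bsub>M\<^esub> n) = fe [^]\<^bsub>U\<^esub> s \<odot>\<^bsub>M\<^esub> (u \<odot>\<^bsub>M\<^esub> n)"
proof (induction s arbitrary: u n)
  case 0
  then show ?case by (simp add: M.smult_one)
next
  case (Suc s)
  have "(\<lambda>t. fe [^]\<^bsub>U\<^esub> Suc t \<odot>\<^bsub>M\<^esub> n) = (\<lambda>t. fe [^]\<^bsub>U\<^esub> t \<odot>\<^bsub>M\<^esub> (fe \<odot>\<^bsub>M\<^esub> n))"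
    using Suc.prems by (simp add: M.smult_assoc)
  then have "seq_act (Suc s) u (\<lambda>t. fe [^]\<^bsub>U\<^esub> t \<odot>\<^bsub>M\<^esub> n) =
      fe [^]\<^bsub>U\<^esub> s \<odot>\<^bsub>M\<^esub> (env.comm fe u \<odot>\<^bsub>M\<^esub> n) \<oplus>\<^bsub>M\<^esub> fe [^]\<^bsub>U\<^esub> s \<odot>\<^bsub>M\<^esub> (u \<odot>\<^bsub>M\<^esub> (fe \<odot>\<^bsub>M\<^esub> n))"
    using Suc by simp
  also have "\<dots> = fe [^]\<^bsub>U\<^esub> s \<odot>\<^bsub>M\<^esub> ((env.comm fe u \<oplus>\<^bsub>U\<^esub> u \<otimes>\<^bsub>U\<^esub> fe) \<odot>\<^bsub>M\<^esub> n)"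
    using Suc.prems by (simp add: M.smult_r_distr M.smult_l_distr M.smult_assoc)
  also have "env.comm fe u \<oplus>\<^bsub>U\<^esub> u \<otimes>\<^bsub>U\<^esub> fe = fe \<otimes>\<^bsub>U\<^esub> u"
    using Suc.prems by (simp add: env.comm_def env.minus_eq env.a_assoc env.l_neg)
  finally show ?case using Suc.prems by (simp add: M.smult_assoc)
qed

section \<open>Germs at infinity of coherent sequences\<close>

definition ev_eq :: "(nat \<Rightarrow> 'v) \<Rightarrow> (nat \<Rightarrow> 'v) \<Rightarrow> bool" where
  "ev_eq x y \<longleftrightarrow> (\<exists>k. \<forall>s\<ge>k. x s = y s)"

lemma ev_eq_refl [simp]: "ev_eq x x" by (simp add: ev_eq_def)
lemma ev_eq_sym: "ev_eq x y \<Longrightarrow> ev_eq y x" unfolding ev_eq_def by metis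

lemma ev_eq_trans: assumes "ev_eq x y" "ev_eq y z" shows "ev_eq x z"
proof -
  obtain k l where "\<And>s. s \<ge> k \<Longrightarrow> x s = y s" "\<And>s. s \<ge> l \<Longrightarrow> y s = z s"
    using assms by (auto simp: ev_eq_def)
  then have "\<forall>s\<ge>max k l. x s = z s" by simp
  then show ?thesis unfolding ev_eq_def by blast
qed

definition coherent :: "(nat \<Rightarrow> 'v) set" where
  "coherent = {x. (\<forall>t. x t \<in> carrier M) \<and> ev_eq (\<lambda>s. x (Suc s)) (\<lambda>s. fe \<odot>\<^bsub>M\<^esub> x s)}"

text \<open>A germ is named by a chosen coherent representative and not by an equivalence class, so
  germs live in the type of sequences.\<close>

definition germ :: "(nat \<Rightarrow> 'v) \<Rightarrow> nat \<Rightarrow> 'v" where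
  "germ x = (SOME y. y \<in> coherent \<and> ev_eq y x)"

lemma germ: "x \<in> coherent \<Longrightarrow> germ x \<in> coherent" "x \<in> coherent \<Longrightarrow> ev_eq (germ x) x"
  using someI[of "\<lambda>y. y \<in> coherent \<and> ev_eq y x" x] by (auto simp: germ_def)

lemma germ_eqI: "ev_eq x y \<Longrightarrow> germ x = germ y"
  unfolding germ_def using ev_eq_trans ev_eq_sym by (metis (no_types, lifting))

lemma germ_eq_iff: "x \<in> coherent \<Longrightarrow> y \<in> coherent \<Longrightarrow> germ x = germ y \<longleftrightarrow> ev_eq x y"
  using germ germ_eqI ev_eq_trans ev_eq_sym by metis

lemma coherent_closed: "x \<in> coherent \<Longrightarrow> x t \<in> carrier M" by (simp add: coherent_def)

lemma coherent_zero: "(\<lambda>_. \<zero>\<^bsub>M\<^esub>) \<in> coherent" by (simp add: coherent_def)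

lemma ev_eq_add: assumes "ev_eq x y" "ev_eq x' y'"
  shows "ev_eq (\<lambda>s. x s \<oplus>\<^bsub>M\<^esub> x' s) (\<lambda>s. y s \<oplus>\<^bsub>M\<^esub> y' s)"
proof -
  obtain k l where "\<And>s. s \<ge> k \<Longrightarrow> x s = y s" "\<And>s. s \<ge> l \<Longrightarrow> x' s = y' s"
    using assms by (auto simp: ev_eq_def)
  then have "\<forall>s\<ge>max k l. x s \<oplus>\<^bsub>M\<^esub> x' s = y s \<oplus>\<^bsub>M\<^esub> y' s" by simp
  then show ?thesis unfolding ev_eq_def by blast
qed

lemma coherent_add: assumes "x \<in> coherent" "y \<in> coherent" shows "(\<lambda>s. x s \<oplus>\<^bsub>M\<^esub> y s) \<in> coherent"
  using assms ev_eq_add[of "\<lambda>s. x (Suc s)" "\<lambda>s. fe \<odot>\<^bsub>M\<^esub> x s" "\<lambda>s. y (Suc s)" "\<lambda>s. fe \<odot>\<^bsub>M\<^esub> y s"]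
  by (simp add: coherent_def M.smult_r_distr)

lemma ev_eq_seq_act:
  assumes "ev_eq x y" "u \<in> carrier U" "\<And>t. x t \<in> carrier M" "\<And>t. y t \<in> carrier M"
  shows "ev_eq (\<lambda>s. seq_act s u x) (\<lambda>s. seq_act s u y)"
proof -
  obtain k where k: "\<And>s. s \<ge> k \<Longrightarrow> x s = y s" using assms(1) by (auto simp: ev_eq_def)
  obtain m where m: "(env.comm fe ^^ m) u = \<zero>\<^bsub>U\<^esub>" using env_comm_f_nilpotent assms(2) by blast
  have "\<forall>s\<ge>k + m. seq_act s u x = seq_act s u y"
    using seq_act_cong[OF m assms(2-4) k] by simp
  then show ?thesis unfolding ev_eq_def by blast
qed

text \<open>Shifting the sequence of \<open>u\<close> adds [f, u] x to the action of
  \<open>u\<close> on the shifted x. The latter is eventually f x, and [f, u] + u f = f u gives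
  coherence.\<close>

lemma coherent_seq_act:
  assumes u: "u \<in> carrier U" and x: "x \<in> coherent" shows "(\<lambda>s. seq_act s u x) \<in> coherent"
proof -
  note c = coherent_closed[OF x]
  have "ev_eq (\<lambda>s. seq_act s u (\<lambda>t. x (Suc t))) (\<lambda>s. seq_act s u (\<lambda>t. fe \<odot>\<^bsub>M\<^esub> x t))"
    using x u c by (intro ev_eq_seq_act) (auto simp: coherent_def)
  then have "ev_eq (\<lambda>s. seq_act (Suc s) u x)
      (\<lambda>s. seq_act s (env.comm fe u) x \<oplus>\<^bsub>M\<^esub> seq_act s u (\<lambda>t. fe \<odot>\<^bsub>M\<^esub> x t))"
    by (simp add: ev_eq_add)
  moreover have "seq_act s (env.comm fe u) x \<oplus>\<^bsub>M\<^esub> seq_act s u (\<lambda>t. fe \<odot>\<^bsub>M\<^esub> x t) = fe \<odot>\<^bsub>M\<^esub> seq_act s u x" for s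
  proof -
    have "seq_act s u (\<lambda>t. fe \<odot>\<^bsub>M\<^esub> x t) = seq_act s (u \<otimes>\<^bsub>U\<^esub> fe) x"
      using u c by (simp add: seq_act_mult seq_act_f)
    then have "seq_act s (env.comm fe u) x \<oplus>\<^bsub>M\<^esub> seq_act s u (\<lambda>t. fe \<odot>\<^bsub>M\<^esub> x t) =
        seq_act s (env.comm fe u \<oplus>\<^bsub>U\<^esub> u \<otimes>\<^bsub>U\<^esub> fe) x"
      using u c by (simp add: seq_act_add_left)
    also have "env.comm fe u \<oplus>\<^bsub>U\<^esub> u \<otimes>\<^bsub>U\<^esub> fe = fe \<otimes>\<^bsub>U\<^esub> u"
      using u by (simp add: env.comm_def env.minus_eq env.a_assoc env.l_neg)
    finally show ?thesis using u c by (simp add: seq_act_mult seq_act_f)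
  qed
  ultimately show ?thesis using u c by (simp add: coherent_def)
qed

definition germs :: "('g uel, nat \<Rightarrow> 'v) module" where
  "germs = \<lparr>carrier = germ ` coherent, monoid.mult = undefined, one = undefined,
     zero = germ (\<lambda>_. \<zero>\<^bsub>M\<^esub>), add = (\<lambda>x y. germ (\<lambda>s. x s \<oplus>\<^bsub>M\<^esub> y s)),
     module.smult = (\<lambda>u x. germ (\<lambda>s. seq_act s u x))\<rparr>"

lemma germ_add: "x \<in> coherent \<Longrightarrow> y \<in> coherent \<Longrightarrow> germ x \<oplus>\<^bsub>germs\<^esub> germ y = germ (\<lambda>s. x s \<oplus>\<^bsub>M\<^esub> y s)"
  by (auto simp: germs_def intro!: germ_eqI ev_eq_add germ)

lemma germ_smult: "u \<in> carrier U \<Longrightarrow> x \<in> coherent \<Longrightarrow> u \<odot>\<^bsub>germs\<^esub> germ x = germ (\<lambda>s. seq_act s u x)"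
  by (auto simp: germs_def intro!: germ_eqI ev_eq_seq_act germ coherent_closed)

lemma carrier_germs: "carrier germs = germ ` coherent" by (simp add: germs_def)
lemma zero_germs: "\<zero>\<^bsub>germs\<^esub> = germ (\<lambda>_. \<zero>\<^bsub>M\<^esub>)" by (simp add: germs_def)

lemma left_module_germs: "left_module U germs"
proof (rule left_moduleI[OF env.ring_axioms])
  show "abelian_group germs"
  proof (rule abelian_groupI; (unfold carrier_germs, clarify)?)
    fix x assume x: "x \<in> coherent"
    have "(\<lambda>s. seq_act s (sc_env L (- 1)) x) \<in> coherent" by (intro coherent_seq_act x) simp
    moreover have "seq_act s (sc_env L (- 1)) x \<oplus>\<^bsub>M\<^esub> x s = \<zero>\<^bsub>M\<^esub>" for s
    proof -
      have "seq_act s (sc_env L (- 1)) x \<oplus>\<^bsub>M\<^esub> seq_act s (sc_env L 1) x = \<zero>\<^bsub>M\<^esub>"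
        using coherent_closed[OF x]
        by (simp add: seq_act_add_left[symmetric] sc_env_add[symmetric] seq_act_zero del: sc_env_one)
      then show ?thesis using coherent_closed[OF x] by (simp add: seq_act_one)
    qed
    ultimately show "\<exists>y\<in>germ ` coherent. y \<oplus>\<^bsub>germs\<^esub> germ x = \<zero>\<^bsub>germs\<^esub>"
      using x by (auto simp: germ_add zero_germs intro!: bexI)
  qed (auto simp: carrier_germs germ_add zero_germs coherent_add coherent_zero coherent_closed M.a_ac)
qed (auto simp: carrier_germs germ_add germ_smult coherent_seq_act coherent_add coherent_closed
    seq_act_add_left seq_act_add_right seq_act_mult seq_act_one)

text \<open>On a coherent sequence f acts eventually as the shift, and the shift is invertible on
  germs.\<close>

lemma f_bij_germs: "bij_betw (\<lambda>v. fe \<odot>\<^bsub>germs\<^esub> v) (carrier germs) (carrier germs)"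
proof -
  have f: "fe \<odot>\<^bsub>germs\<^esub> germ x = germ (\<lambda>s. fe \<odot>\<^bsub>M\<^esub> x s)" if "x \<in> coherent" for x
    using that by (simp add: germ_smult seq_act_f coherent_closed)
  have fc: "(\<lambda>s. fe \<odot>\<^bsub>M\<^esub> x s) \<in> coherent" if "x \<in> coherent" for x
    using coherent_seq_act[OF in_env_closed that, of f] that by (simp add: seq_act_f coherent_closed)
  have "x = y" if xy: "x \<in> carrier germs" "y \<in> carrier germs" "fe \<odot>\<^bsub>germs\<^esub> x = fe \<odot>\<^bsub>germs\<^esub> y" for x y
  proof -
    obtain x' y' where x': "x = germ x'" "x' \<in> coherent" "y = germ y'" "y' \<in> coherent"
      using xy(1,2) unfolding carrier_germs by blast
    then have "ev_eq (\<lambda>s. fe \<odot>\<^bsub>M\<^esub> x' s) (\<lambda>s. fe \<odot>\<^bsub>M\<^esub> y' s)"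
      using xy(3) by (simp add: f germ_eq_iff fc)
    then have "ev_eq (\<lambda>s. x' (Suc s)) (\<lambda>s. y' (Suc s))"
      using x' ev_eq_trans ev_eq_sym unfolding coherent_def by blast
    then obtain k where "\<forall>s\<ge>k. x' (Suc s) = y' (Suc s)" by (auto simp: ev_eq_def)
    then have "\<forall>s\<ge>Suc k. x' s = y' s" by (metis Suc_le_D Suc_le_mono)
    then show ?thesis using x' by (auto simp: germ_eq_iff ev_eq_def)
  qed
  moreover have "y \<in> (\<lambda>v. fe \<odot>\<^bsub>germs\<^esub> v) ` carrier germs" if y: "y \<in> carrier germs" for y
  proof -
    obtain y' where y': "y = germ y'" "y' \<in> coherent" using y by (auto simp: carrier_germs)
    \<comment> \<open>The delayed sequence is the preimage; its entry at 0 is a filler that the germ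
      does not see.\<close>
    define x where "x = (\<lambda>s. case s of 0 \<Rightarrow> \<zero>\<^bsub>M\<^esub> | Suc s \<Rightarrow> y' s)"
    obtain k where k: "\<forall>s\<ge>k. y' (Suc s) = fe \<odot>\<^bsub>M\<^esub> y' s" using y' by (auto simp: coherent_def ev_eq_def)
    have "\<forall>s\<ge>Suc k. x (Suc s) = fe \<odot>\<^bsub>M\<^esub> x s" using k by (auto simp: x_def split: nat.split)
    then have ev: "ev_eq (\<lambda>s. x (Suc s)) (\<lambda>s. fe \<odot>\<^bsub>M\<^esub> x s)" unfolding ev_eq_def by blast
    then have x: "x \<in> coherent" using coherent_closed[OF y'(2)] by (auto simp: coherent_def x_def split: nat.split)
    have "ev_eq (\<lambda>s. fe \<odot>\<^bsub>M\<^esub> x s) y'" using ev_eq_sym[OF ev] by (simp add: x_def)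
    then have "y = fe \<odot>\<^bsub>germs\<^esub> germ x" using x y' by (simp add: f germ_eqI)
    then show ?thesis using x by (auto simp: carrier_germs)
  qed
  moreover have "fe \<odot>\<^bsub>germs\<^esub> x \<in> carrier germs" if "x \<in> carrier germs" for x
    using that by (auto simp: carrier_germs f fc)
  ultimately show ?thesis by (auto simp: bij_betw_def inj_on_def)
qed

text \<open>A test module for the localization: the germ of the orbit s -> f^s n is zero only if the
  orbit is eventually zero. As N[f^(-1)] maps to it, an element of N that vanishes in the
  localization is seen to be f-torsion.\<close>

lemma localized_module:
  "\<exists>(G :: ('g lel, nat \<Rightarrow> 'v) module) g. left_module V G \<and>
     (\<forall>n\<in>carrier M. g n \<in> carrier G \<and> (g n = \<zero>\<^bsub>G\<^esub> \<longrightarrow> (\<exists>k::nat. fe [^]\<^bsub>U\<^esub> k \<odot>\<^bsub>M\<^esub> n = \<zero>\<^bsub>M\<^esub>))) \<and>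
     (\<forall>n\<in>carrier M. \<forall>n'\<in>carrier M. g (n \<oplus>\<^bsub>M\<^esub> n') = g n \<oplus>\<^bsub>G\<^esub> g n') \<and>
     (\<forall>u\<in>carrier U. \<forall>n\<in>carrier M. g (u \<odot>\<^bsub>M\<^esub> n) = \<iota> u \<odot>\<^bsub>G\<^esub> g n)"
proof -
  obtain A where G: "left_module V \<lparr>carrier = carrier germs, monoid.mult = undefined, one = undefined,
      zero = zero germs, add = add germs, module.smult = A\<rparr>" (is "left_module V ?G")
    and A: "\<forall>u\<in>carrier U. \<forall>v\<in>carrier germs. A (\<iota> u) v = u \<odot>\<^bsub>germs\<^esub> v"
    using localized_action[OF left_module_germs f_bij_germs] by blast
  define orb where "orb n = (\<lambda>t::nat. fe [^]\<^bsub>U\<^esub> t \<odot>\<^bsub>M\<^esub> n)" for n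
  have orb: "orb n \<in> coherent" if "n \<in> carrier M" for n
  proof -
    have "fe [^]\<^bsub>U\<^esub> Suc t \<odot>\<^bsub>M\<^esub> n = fe \<odot>\<^bsub>M\<^esub> (fe [^]\<^bsub>U\<^esub> t \<odot>\<^bsub>M\<^esub> n)" for t
      by (simp only: env.nat_pow_Suc2 M.smult_assoc in_env_closed env.nat_pow_closed that)
    then show ?thesis unfolding orb_def coherent_def using that by (simp del: env.nat_pow_Suc)
  qed
  have "\<exists>k::nat. fe [^]\<^bsub>U\<^esub> k \<odot>\<^bsub>M\<^esub> n = \<zero>\<^bsub>M\<^esub>" if "n \<in> carrier M" "germ (orb n) = \<zero>\<^bsub>germs\<^esub>" for n
    using that orb[OF that(1)] by (auto simp: zero_germs germ_eq_iff coherent_zero ev_eq_def orb_def)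
  moreover have "germ (orb (n \<oplus>\<^bsub>M\<^esub> n')) = germ (orb n) \<oplus>\<^bsub>germs\<^esub> germ (orb n')"
    if "n \<in> carrier M" "n' \<in> carrier M" for n n'
    using that orb by (simp add: germ_add) (simp add: orb_def M.smult_r_distr)
  moreover have "germ (orb (u \<odot>\<^bsub>M\<^esub> n)) = A (\<iota> u) (germ (orb n))"
    if "u \<in> carrier U" "n \<in> carrier M" for u n
    using that orb[OF that(2)] A seq_act_f_pow[OF that]
    by (simp add: carrier_germs germ_smult) (simp add: orb_def)
  ultimately show ?thesis
    using G orb by (intro exI[of _ ?G] exI[of _ "\<lambda>n. germ (orb n)"]) (auto simp: carrier_germs)
qed

end

end

section \<open>Tensor products with a ring extension\<close>

text \<open>The common shape of both bimodules: \<open>S\<close> as a left module over itself, with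
  a second ring acting on the right through \<rho>. For N[f^(-1)] the map \<rho> is
  \<open>to_lenv\<close>, for the twist it is phi_a (see \<open>bimod_eq\<close>).\<close>

definition extension_bimod :: "('b, 'k) ring_scheme \<Rightarrow> ('r \<Rightarrow> 'b) \<Rightarrow> (bit \<Rightarrow> 'b set) \<Rightarrow> ('b, 'r, 'b) bimod" where
  "extension_bimod S \<rho> P = \<lparr>carrier = carrier S, monoid.mult = monoid.mult S, one = one S,
     zero = zero S, add = add S, lact = monoid.mult S, ract = (\<lambda>u r. u \<otimes>\<^bsub>S\<^esub> \<rho> r), bpart = P\<rparr>"

lemma tens_eq_closed:
  assumes "tens_eq R B N p q" "ring R" "left_module R N" "abelian_group B"
    and "\<And>b r. b \<in> carrier B \<Longrightarrow> r \<in> carrier R \<Longrightarrow> ract B b r \<in> carrier B"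
  shows "set p \<subseteq> carrier B \<times> carrier N \<and> set q \<subseteq> carrier B \<times> carrier N"
proof -
  interpret N: left_module R N by fact
  interpret B: abelian_group B by fact
  show ?thesis using assms(1)
    by (induction rule: tens_eq.induct) (auto simp: N.smult_closed assms)
qed

lemma tens_eqI: "tens_eq R B N p q \<Longrightarrow> tens R B N p = tens R B N q"
proof -
  assume pq: "tens_eq R B N p q"
  have "tens_eq R B N p r = tens_eq R B N q r" for r
    using tens_eq.trans[OF pq, of r] tens_eq.trans[OF tens_eq.sym[OF pq], of r] by (rule iffI[rotated])
  then show ?thesis by (simp add: tens_def)
qed

lemma tens_eq_summands:
  "set p \<subseteq> carrier B \<times> carrier N \<Longrightarrow> tens_eq R B N p (summands (tens R B N p))"
  unfolding tens_def summands_def vec.case by (rule someI[of _ p]) (rule tens_eq.refl)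

locale ring_extension_tensor = S: ring S + N: left_module R N
  for S :: "('b, 'k) ring_scheme" and R :: "('r, 'j) ring_scheme" and N :: "('r, ('b, 'm) vec) smod" +
  fixes \<rho> :: "'r \<Rightarrow> 'b" and P :: "bit \<Rightarrow> 'b set"
  assumes \<rho>_closed: "r \<in> carrier R \<Longrightarrow> \<rho> r \<in> carrier S"
begin

abbreviation "B \<equiv> extension_bimod S \<rho> P"
abbreviation "T \<equiv> tensor R B N"
abbreviation "closed_list p \<equiv> set p \<subseteq> carrier S \<times> carrier N"

definition pure :: "'b \<Rightarrow> ('b, 'm) vec \<Rightarrow> ('b, 'm) vec" where
  "pure u n = tens R B N [(u, n)]"

lemma B_simps [simp]: "carrier B = carrier S" "add B = add S" "zero B = zero S"
  "lact B = monoid.mult S" "ract B b r = b \<otimes>\<^bsub>S\<^esub> \<rho> r" "bpart B = P"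
  by (simp_all add: extension_bimod_def)

lemma B_group: "abelian_group B"
  by (rule abelian_group_cong[OF S.abelian_group_axioms]) simp_all

lemma tens_eq_list: "tens_eq R B N p q \<Longrightarrow> closed_list p \<and> closed_list q"
  using tens_eq_closed[OF _ N.R.ring_axioms N.left_module_axioms B_group] \<rho>_closed by simp

lemma tens_eq_map:
  assumes "tens_eq R B N p q" "l \<in> carrier S"
  shows "tens_eq R B N (map (\<lambda>(b, n). (l \<otimes>\<^bsub>S\<^esub> b, n)) p) (map (\<lambda>(b, n). (l \<otimes>\<^bsub>S\<^esub> b, n)) q)"
  using assms(1)
proof (induction rule: tens_eq.induct)
  case (refl p)
  then show ?case using assms(2) by (intro tens_eq.refl) auto
next
  case (sym p q)
  show ?case by (rule tens_eq.sym[OF sym.IH])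
next
  case (trans p q r)
  show ?case by (rule tens_eq.trans[OF trans.IH])
next
  case (append p q p' q')
  show ?case unfolding map_append by (rule tens_eq.append[OF append.IH])
next
  case (commute p q)
  then show ?case using assms(2) unfolding map_append by (intro tens_eq.commute) auto
next
  case (zero n)
  then show ?case using assms(2) tens_eq.zero[of n N R B] by simp
next
  case (add_left b b' n)
  then show ?case using assms(2) tens_eq.add_left[of "l \<otimes>\<^bsub>S\<^esub> b" B "l \<otimes>\<^bsub>S\<^esub> b'" n N R] by (simp add: S.r_distr)
next
  case (add_right b n n')
  then show ?case using assms(2) tens_eq.add_right[of "l \<otimes>\<^bsub>S\<^esub> b" B n N n' R] by simp
next
  case (balanced b r n)
  then show ?case using assms(2) \<rho>_closed[of r] tens_eq.balanced[of "l \<otimes>\<^bsub>S\<^esub> b" B r R n N] by (simp add: S.m_assoc)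
qed

lemma carrier_T: "carrier T = {tens R B N p |p. closed_list p}"
  by (simp add: tensor_def)

lemma tens_add: "closed_list p \<Longrightarrow> closed_list q \<Longrightarrow> tens R B N p \<oplus>\<^bsub>T\<^esub> tens R B N q = tens R B N (p @ q)"
  unfolding tensor_def
  by simp (intro tens_eqI tens_eq.append tens_eq.sym[OF tens_eq_summands]; simp)

lemma tens_smult: "closed_list p \<Longrightarrow> l \<in> carrier S \<Longrightarrow>
    l \<odot>\<^bsub>T\<^esub> tens R B N p = tens R B N (map (\<lambda>(b, n). (l \<otimes>\<^bsub>S\<^esub> b, n)) p)"
  unfolding tensor_def
  by simp (intro tens_eqI tens_eq_map tens_eq.sym[OF tens_eq_summands]; simp)

lemma zero_T: "\<zero>\<^bsub>T\<^esub> = tens R B N []" by (simp add: tensor_def)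

lemma pure_closed [simp]: "u \<in> carrier S \<Longrightarrow> n \<in> carrier N \<Longrightarrow> pure u n \<in> carrier T"
  unfolding carrier_T pure_def by (intro CollectI exI[of _ "[(u, n)]"]) simp

lemma comm_monoid_T: "abelian_monoid T"
proof (rule abelian_monoidI)
  fix x y z assume "x \<in> carrier T" "y \<in> carrier T" "z \<in> carrier T"
  then obtain p q r where "closed_list p" "x = tens R B N p" "closed_list q" "y = tens R B N q"
    "closed_list r" "z = tens R B N r" by (auto simp: carrier_T)
  then show "x \<oplus>\<^bsub>T\<^esub> y \<oplus>\<^bsub>T\<^esub> z = x \<oplus>\<^bsub>T\<^esub> (y \<oplus>\<^bsub>T\<^esub> z)" by (simp add: tens_add)
next
  fix x y assume "x \<in> carrier T" "y \<in> carrier T"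
  then obtain p q where pq: "closed_list p" "x = tens R B N p" "closed_list q" "y = tens R B N q"
    by (auto simp: carrier_T)
  have "tens R B N (p @ q) = tens R B N (q @ p)" using pq by (intro tens_eqI tens_eq.commute) auto
  then show "x \<oplus>\<^bsub>T\<^esub> y = y \<oplus>\<^bsub>T\<^esub> x" using pq by (simp add: tens_add)
  show "x \<oplus>\<^bsub>T\<^esub> y \<in> carrier T"
    using pq unfolding carrier_T by (auto simp: tens_add intro!: exI[of _ "p @ q"])
next
  show "\<zero>\<^bsub>T\<^esub> \<in> carrier T" unfolding carrier_T zero_T by (intro CollectI exI[of _ "[]"]) simp
  fix x assume "x \<in> carrier T"
  then obtain p where pq: "closed_list p" "x = tens R B N p" by (auto simp: carrier_T)
  then show "\<zero>\<^bsub>T\<^esub> \<oplus>\<^bsub>T\<^esub> x = x" by (simp add: zero_T tens_add)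
qed

interpretation T: abelian_monoid T by (rule comm_monoid_T)

text \<open>The set \<open>X\<close> of admissible pairs serves two purposes: all pairs for the
  whole tensor product, pairs with a fixed sum of parities for a homogeneous part.\<close>

lemma tens_induct:
  assumes "set p \<subseteq> X" "X \<subseteq> carrier S \<times> carrier N"
    and "Q \<zero>\<^bsub>T\<^esub>" and "\<And>u n. (u, n) \<in> X \<Longrightarrow> Q (pure u n)"
    and "\<And>x y. x \<in> carrier T \<Longrightarrow> y \<in> carrier T \<Longrightarrow> Q x \<Longrightarrow> Q y \<Longrightarrow> Q (x \<oplus>\<^bsub>T\<^esub> y)"
  shows "Q (tens R B N p)"
  using assms(1)
proof (induction p)
  case Nil
  then show ?case using assms(3) by (simp add: zero_T)
next
  case (Cons a p)
  obtain u n where a: "a = (u, n)" by (cases a)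
  have c: "closed_list p" "(u, n) \<in> X" using Cons.prems assms(2) by (auto simp: a)
  then have un: "u \<in> carrier S" "n \<in> carrier N" using assms(2) by auto
  have "pure u n \<oplus>\<^bsub>T\<^esub> tens R B N p = tens R B N ((u, n) # p)"
    unfolding pure_def using c un by (subst tens_add) auto
  moreover have "Q (pure u n \<oplus>\<^bsub>T\<^esub> tens R B N p)"
  proof (rule assms(5))
    show "tens R B N p \<in> carrier T" using c by (auto simp: carrier_T)
    show "Q (tens R B N p)" using Cons by simp
  qed (use c un assms(4) in auto)
  ultimately show ?case by (simp add: a)
qed

lemma T_induct [consumes 1, case_names zero pure add]:
  assumes "x \<in> carrier T" and "Q \<zero>\<^bsub>T\<^esub>"
    and "\<And>u n. u \<in> carrier S \<Longrightarrow> n \<in> carrier N \<Longrightarrow> Q (pure u n)"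
    and "\<And>x y. x \<in> carrier T \<Longrightarrow> y \<in> carrier T \<Longrightarrow> Q x \<Longrightarrow> Q y \<Longrightarrow> Q (x \<oplus>\<^bsub>T\<^esub> y)"
  shows "Q x"
proof -
  obtain p where "closed_list p" "x = tens R B N p" using assms(1) by (auto simp: carrier_T)
  then show ?thesis using tens_induct[of p "carrier S \<times> carrier N" Q] assms by auto
qed

lemma pure_add_left: "u \<in> carrier S \<Longrightarrow> v \<in> carrier S \<Longrightarrow> n \<in> carrier N \<Longrightarrow>
    pure (u \<oplus>\<^bsub>S\<^esub> v) n = pure u n \<oplus>\<^bsub>T\<^esub> pure v n"
  using tens_eqI[OF tens_eq.add_left[of u B v n N R]] by (simp add: pure_def tens_add)

lemma pure_add_right: "u \<in> carrier S \<Longrightarrow> n \<in> carrier N \<Longrightarrow> n' \<in> carrier N \<Longrightarrow>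
    pure u (n \<oplus>\<^bsub>N\<^esub> n') = pure u n \<oplus>\<^bsub>T\<^esub> pure u n'"
  using tens_eqI[OF tens_eq.add_right[of u B n N n' R]] by (simp add: pure_def tens_add)

lemma pure_balanced: "u \<in> carrier S \<Longrightarrow> r \<in> carrier R \<Longrightarrow> n \<in> carrier N \<Longrightarrow>
    pure (u \<otimes>\<^bsub>S\<^esub> \<rho> r) n = pure u (r \<odot>\<^bsub>N\<^esub> n)"
  using tens_eqI[OF tens_eq.balanced[of u B r R n N]] by (simp add: pure_def)

lemma pure_zero: "n \<in> carrier N \<Longrightarrow> pure \<zero>\<^bsub>S\<^esub> n = \<zero>\<^bsub>T\<^esub>"
  using tens_eqI[OF tens_eq.zero[of n N R B]] by (simp add: pure_def zero_T)

lemma smult_pure: "l \<in> carrier S \<Longrightarrow> u \<in> carrier S \<Longrightarrow> n \<in> carrier N \<Longrightarrow>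
    l \<odot>\<^bsub>T\<^esub> pure u n = pure (l \<otimes>\<^bsub>S\<^esub> u) n"
  by (simp add: pure_def tens_smult)

lemma abelian_group_T: "abelian_group T"
proof (rule abelian_groupI)
  fix x assume "x \<in> carrier T"
  then show "\<exists>y\<in>carrier T. y \<oplus>\<^bsub>T\<^esub> x = \<zero>\<^bsub>T\<^esub>"
  proof (induction rule: T_induct)
    case (pure u n)
    then have "pure (\<ominus>\<^bsub>S\<^esub> u) n \<oplus>\<^bsub>T\<^esub> pure u n = \<zero>\<^bsub>T\<^esub>"
      by (simp add: pure_add_left[symmetric] S.l_neg pure_zero)
    then show ?case using pure by (intro bexI) auto
  next
    case (add x y)
    then obtain x' y' where x': "x' \<in> carrier T" "x' \<oplus>\<^bsub>T\<^esub> x = \<zero>\<^bsub>T\<^esub>" and y': "y' \<in> carrier T" "y' \<oplus>\<^bsub>T\<^esub> y = \<zero>\<^bsub>T\<^esub>"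
      by blast
    have "(x' \<oplus>\<^bsub>T\<^esub> y') \<oplus>\<^bsub>T\<^esub> (x \<oplus>\<^bsub>T\<^esub> y) = (x' \<oplus>\<^bsub>T\<^esub> x) \<oplus>\<^bsub>T\<^esub> (y' \<oplus>\<^bsub>T\<^esub> y)"
      using add x'(1) y'(1) by (simp add: T.a_ac)
    then have "(x' \<oplus>\<^bsub>T\<^esub> y') \<oplus>\<^bsub>T\<^esub> (x \<oplus>\<^bsub>T\<^esub> y) = \<zero>\<^bsub>T\<^esub>" by (simp add: x'(2) y'(2))
    moreover have "x' \<oplus>\<^bsub>T\<^esub> y' \<in> carrier T" using x' y' by simp
    ultimately show ?case by blast
  qed (auto intro!: bexI[of _ "\<zero>\<^bsub>T\<^esub>"])
qed (auto simp: T.a_ac)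

lemma smult_T_add: "l \<in> carrier S \<Longrightarrow> x \<in> carrier T \<Longrightarrow> y \<in> carrier T \<Longrightarrow>
    l \<odot>\<^bsub>T\<^esub> (x \<oplus>\<^bsub>T\<^esub> y) = l \<odot>\<^bsub>T\<^esub> x \<oplus>\<^bsub>T\<^esub> l \<odot>\<^bsub>T\<^esub> y"
proof -
  assume l: "l \<in> carrier S" and "x \<in> carrier T" "y \<in> carrier T"
  then obtain p q where pq: "closed_list p" "x = tens R B N p" "closed_list q" "y = tens R B N q"
    by (auto simp: carrier_T)
  have "closed_list (map (\<lambda>(b, n). (l \<otimes>\<^bsub>S\<^esub> b, n)) r)" if "closed_list r" for r
    using that l by (auto simp: subset_iff)
  then show ?thesis using l pq by (simp add: tens_add tens_smult)
qed

lemma smult_T_closed: "l \<in> carrier S \<Longrightarrow> x \<in> carrier T \<Longrightarrow> l \<odot>\<^bsub>T\<^esub> x \<in> carrier T"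
proof -
  assume l: "l \<in> carrier S" and "x \<in> carrier T"
  then obtain p where pq: "closed_list p" "x = tens R B N p" by (auto simp: carrier_T)
  have "closed_list (map (\<lambda>(b, n). (l \<otimes>\<^bsub>S\<^esub> b, n)) p)"
    using pq(1) l by (auto simp: subset_iff)
  then show ?thesis unfolding pq(2) tens_smult[OF pq(1) l] carrier_T by blast
qed

lemma smult_T_zero: "l \<in> carrier S \<Longrightarrow> l \<odot>\<^bsub>T\<^esub> \<zero>\<^bsub>T\<^esub> = \<zero>\<^bsub>T\<^esub>"
  by (simp add: zero_T tens_smult)

lemma left_module_T: "left_module S T"
proof (rule left_moduleI[OF S.ring_axioms abelian_group_T smult_T_closed])
  fix r s x assume rs: "r \<in> carrier S" "s \<in> carrier S" and x: "x \<in> carrier T"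
  show "(r \<oplus>\<^bsub>S\<^esub> s) \<odot>\<^bsub>T\<^esub> x = r \<odot>\<^bsub>T\<^esub> x \<oplus>\<^bsub>T\<^esub> s \<odot>\<^bsub>T\<^esub> x"
    using x by (induction rule: T_induct)
      (use rs in \<open>auto simp: smult_T_zero smult_pure pure_add_left S.l_distr smult_T_add smult_T_closed T.a_ac\<close>)
  show "(r \<otimes>\<^bsub>S\<^esub> s) \<odot>\<^bsub>T\<^esub> x = r \<odot>\<^bsub>T\<^esub> (s \<odot>\<^bsub>T\<^esub> x)"
    using x by (induction rule: T_induct)
      (use rs in \<open>auto simp: smult_T_zero smult_pure S.m_assoc smult_T_add smult_T_closed\<close>)
next
  fix x assume x: "x \<in> carrier T"
  then show "\<one>\<^bsub>S\<^esub> \<odot>\<^bsub>T\<^esub> x = x"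
    by (induction rule: T_induct) (auto simp: smult_T_zero smult_pure smult_T_add)
qed (auto simp: smult_T_add)

lemma tensor_lift:
  assumes A: "abelian_group A"
    and closed: "\<And>u n. u \<in> carrier S \<Longrightarrow> n \<in> carrier N \<Longrightarrow> \<beta> u n \<in> carrier A"
    and add1: "\<And>u v n. u \<in> carrier S \<Longrightarrow> v \<in> carrier S \<Longrightarrow> n \<in> carrier N \<Longrightarrow>
      \<beta> (u \<oplus>\<^bsub>S\<^esub> v) n = \<beta> u n \<oplus>\<^bsub>A\<^esub> \<beta> v n"
    and add2: "\<And>u n n'. u \<in> carrier S \<Longrightarrow> n \<in> carrier N \<Longrightarrow> n' \<in> carrier N \<Longrightarrow>
      \<beta> u (n \<oplus>\<^bsub>N\<^esub> n') = \<beta> u n \<oplus>\<^bsub>A\<^esub> \<beta> u n'"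
    and bal: "\<And>u r n. u \<in> carrier S \<Longrightarrow> r \<in> carrier R \<Longrightarrow> n \<in> carrier N \<Longrightarrow>
      \<beta> (u \<otimes>\<^bsub>S\<^esub> \<rho> r) n = \<beta> u (r \<odot>\<^bsub>N\<^esub> n)"
  obtains \<psi> where "\<And>x. x \<in> carrier T \<Longrightarrow> \<psi> x \<in> carrier A"
    "\<And>x y. x \<in> carrier T \<Longrightarrow> y \<in> carrier T \<Longrightarrow> \<psi> (x \<oplus>\<^bsub>T\<^esub> y) = \<psi> x \<oplus>\<^bsub>A\<^esub> \<psi> y"
    "\<And>u n. u \<in> carrier S \<Longrightarrow> n \<in> carrier N \<Longrightarrow> \<psi> (pure u n) = \<beta> u n"
proof -
  interpret A: abelian_group A by fact
  \<comment> \<open>The map is defined on lists, where it is a plain sum; invariance under each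
    generating relation of \<open>tens_eq\<close> makes the value independent of the stored
    representative.\<close>
  define val where "val p = foldr (\<lambda>(u, n) x. \<beta> u n \<oplus>\<^bsub>A\<^esub> x) p \<zero>\<^bsub>A\<^esub>" for p
  have val_closed: "val p \<in> carrier A" if "closed_list p" for p
    using that by (induction p) (auto simp: val_def closed)
  have val_append: "val (p @ q) = val p \<oplus>\<^bsub>A\<^esub> val q" if "closed_list p" "closed_list q" for p q
    using that
  proof (induction p)
    case Nil
    then show ?case using val_closed[of q] by (simp add: val_def)
  next
    case (Cons a p)
    then show ?case using val_closed[of q] val_closed[of p] closed
      by (cases a) (auto simp: val_def A.a_assoc)
  qed
  have val_zero: "\<beta> \<zero>\<^bsub>S\<^esub> n = \<zero>\<^bsub>A\<^esub>" if "n \<in> carrier N" for n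
    using add1[of "\<zero>\<^bsub>S\<^esub>" "\<zero>\<^bsub>S\<^esub>" n] closed[of "\<zero>\<^bsub>S\<^esub>" n] that
    by (metis A.add.l_cancel_one' S.zero_closed S.r_zero)
  have val: "val p = val q" if "tens_eq R B N p q" for p q
    using that
  proof (induction rule: tens_eq.induct)
    case (append p q p' q')
    then show ?case using tens_eq_list[OF append.hyps(1)] tens_eq_list[OF append.hyps(2)]
      by (simp add: val_append)
  next
    case (commute p q)
    then show ?case using val_closed by (simp add: val_append A.a_comm)
  next
    case (zero n)
    then show ?case using val_zero by (simp add: val_def)
  next
    case (add_left b b' n)
    then show ?case by (simp add: val_def add1 closed A.a_assoc)
  next
    case (add_right b n n')
    then show ?case by (simp add: val_def add2 closed A.a_assoc)
  next
    case (balanced b r n)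
    then show ?case by (simp add: val_def bal)
  qed auto
  have vt: "val (summands (tens R B N p)) = val p" if "closed_list p" for p
    using val[OF tens_eq_summands[of p B N R]] that by simp
  show ?thesis
  proof (rule that[of "\<lambda>x. val (summands x)"])
    show "val (summands x) \<in> carrier A" if "x \<in> carrier T" for x
      using that by (auto simp: carrier_T vt val_closed)
    show "val (summands (x \<oplus>\<^bsub>T\<^esub> y)) = val (summands x) \<oplus>\<^bsub>A\<^esub> val (summands y)"
      if "x \<in> carrier T" "y \<in> carrier T" for x y
      using that by (auto simp: carrier_T vt val_append tens_add)
    show "val (summands (pure u n)) = \<beta> u n" if "u \<in> carrier S" "n \<in> carrier N" for u n
      using that vt[of "[(u, n)]"] by (simp add: pure_def) (simp add: val_def closed)
  qed
qed

section \<open>Parities in tensor products\<close>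

lemma mpart_T: "mpart T i = {tens R B N p |p. set p \<subseteq> (\<Union>j. P j \<times> mpart N (i + j))}"
  by (simp add: tensor_def)

lemma mpart_induct [consumes 3, case_names zero pure add]:
  assumes "x \<in> mpart T i" and sub: "\<And>j. P j \<subseteq> carrier S" "\<And>j. mpart N j \<subseteq> carrier N"
    and "Q \<zero>\<^bsub>T\<^esub>"
    and "\<And>j u n. u \<in> P j \<Longrightarrow> n \<in> mpart N (i + j) \<Longrightarrow> Q (pure u n)"
    and "\<And>x y. x \<in> carrier T \<Longrightarrow> y \<in> carrier T \<Longrightarrow> Q x \<Longrightarrow> Q y \<Longrightarrow> Q (x \<oplus>\<^bsub>T\<^esub> y)"
  shows "Q x"
proof -
  obtain p where p: "set p \<subseteq> (\<Union>j. P j \<times> mpart N (i + j))" "x = tens R B N p"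
    using assms(1) unfolding mpart_T by blast
  have "(\<Union>j. P j \<times> mpart N (i + j)) \<subseteq> carrier S \<times> carrier N" using sub by blast
  from tens_induct[OF p(1) this, of Q] show ?thesis using assms(4-6) p(2) by blast
qed

lemma mpart_closed:
  assumes sub: "\<And>j. P j \<subseteq> carrier S" "\<And>j. mpart N j \<subseteq> carrier N"
  shows "mpart T i \<subseteq> carrier T"
proof -
  have "(\<Union>j. P j \<times> mpart N (i + j)) \<subseteq> carrier S \<times> carrier N" using sub by blast
  then show ?thesis unfolding mpart_T carrier_T by blast
qed

lemma mpart_pure: "u \<in> P j \<Longrightarrow> n \<in> mpart N (i + j) \<Longrightarrow> pure u n \<in> mpart T i"
  unfolding mpart_T pure_def by (intro CollectI exI[of _ "[(u, n)]"]) auto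

lemma mpart_zero: "\<zero>\<^bsub>T\<^esub> \<in> mpart T i"
  unfolding mpart_T zero_T by (intro CollectI exI[of _ "[]"]) auto

lemma mpart_add:
  assumes sub: "\<And>j. P j \<subseteq> carrier S" "\<And>j. mpart N j \<subseteq> carrier N"
    and "x \<in> mpart T i" "y \<in> mpart T i"
  shows "x \<oplus>\<^bsub>T\<^esub> y \<in> mpart T i"
proof -
  obtain p q where p: "set p \<subseteq> (\<Union>j. P j \<times> mpart N (i + j))" "x = tens R B N p"
    and q: "set q \<subseteq> (\<Union>j. P j \<times> mpart N (i + j))" "y = tens R B N q"
    using assms(3,4) unfolding mpart_T by blast
  have "(\<Union>j. P j \<times> mpart N (i + j)) \<subseteq> carrier S \<times> carrier N" using sub by blast
  then have "closed_list p" "closed_list q" using p(1) q(1) by (meson order_trans)+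
  then have "x \<oplus>\<^bsub>T\<^esub> y = tens R B N (p @ q)" unfolding p(2) q(2) by (rule tens_add)
  then show ?thesis using p(1) q(1) unfolding mpart_T by (intro CollectI exI[of _ "p @ q"]) auto
qed

end

lemma tensor_map_pure:
  fixes P :: "bit \<Rightarrow> 'b set"
  assumes "ring_extension_tensor S R M \<rho>" "ring_extension_tensor S R N \<rho>"
    and \<phi>: "\<And>v. v \<in> carrier M \<Longrightarrow> \<phi> v \<in> carrier N"
      "\<And>v w. v \<in> carrier M \<Longrightarrow> w \<in> carrier M \<Longrightarrow> \<phi> (v \<oplus>\<^bsub>M\<^esub> w) = \<phi> v \<oplus>\<^bsub>N\<^esub> \<phi> w"
      "\<And>r v. r \<in> carrier R \<Longrightarrow> v \<in> carrier M \<Longrightarrow> \<phi> (r \<odot>\<^bsub>M\<^esub> v) = r \<odot>\<^bsub>N\<^esub> \<phi> v"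
  defines "B \<equiv> extension_bimod S \<rho> P"
  defines "t \<equiv> tensor_map R B M N \<phi>"
  shows "\<And>x. x \<in> carrier (tensor R B M) \<Longrightarrow> t x \<in> carrier (tensor R B N)"
    and "\<And>x y. x \<in> carrier (tensor R B M) \<Longrightarrow> y \<in> carrier (tensor R B M) \<Longrightarrow>
      t (x \<oplus>\<^bsub>tensor R B M\<^esub> y) = t x \<oplus>\<^bsub>tensor R B N\<^esub> t y"
    and "\<And>u n. u \<in> carrier S \<Longrightarrow> n \<in> carrier M \<Longrightarrow>
      t (ring_extension_tensor.pure S R M \<rho> P u n) = ring_extension_tensor.pure S R N \<rho> P u (\<phi> n)"
    and "\<And>l x. l \<in> carrier S \<Longrightarrow> x \<in> carrier (tensor R B M) \<Longrightarrow>
      t (l \<odot>\<^bsub>tensor R B M\<^esub> x) = l \<odot>\<^bsub>tensor R B N\<^esub> t x"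
proof -
  interpret M: ring_extension_tensor S R M \<rho> P by fact
  interpret N: ring_extension_tensor S R N \<rho> P by fact
  let ?m = "map (\<lambda>(b, n). (b, \<phi> n))"
  note cT = M.carrier_T[folded B_def] and cT' = N.carrier_T[folded B_def]
  have eq: "tens_eq R B N (?m p) (?m q)" if "tens_eq R B M p q" for p q
    using that
  proof (induction rule: tens_eq.induct)
    case (refl p)
    then show ?case using \<phi>(1) by (intro tens_eq.refl) auto
  next
    case (sym p q)
    show ?case by (rule tens_eq.sym[OF sym.IH])
  next
    case (trans p q r)
    show ?case by (rule tens_eq.trans[OF trans.IH])
  next
    case (append p q p' q')
    show ?case unfolding map_append by (rule tens_eq.append[OF append.IH])
  next
    case (commute p q)
    then show ?case using \<phi>(1) unfolding map_append by (intro tens_eq.commute) auto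
  next
    case (zero n)
    then show ?case using \<phi>(1) tens_eq.zero[of "\<phi> n" N R B] by simp
  next
    case (add_left b b' n)
    then show ?case using \<phi>(1) tens_eq.add_left[of b B b' "\<phi> n" N R] by simp
  next
    case (add_right b n n')
    then show ?case using \<phi>(1,2) tens_eq.add_right[of b B "\<phi> n" N "\<phi> n'" R] by simp
  next
    case (balanced b r n)
    then show ?case using \<phi>(1,3) tens_eq.balanced[of b B r R "\<phi> n" N] by simp
  qed
  have BS: "carrier B = carrier S" unfolding B_def by simp
  have t: "t (tens R B M p) = tens R B N (?m p)" if p: "M.closed_list p" for p
  proof -
    have "tens R B M p \<in> carrier (tensor R B M)" unfolding cT using p by blast
    moreover have "tens R B N (?m (summands (tens R B M p))) = tens R B N (?m p)"
      by (rule tens_eqI[OF eq[OF tens_eq.sym[OF tens_eq_summands]]]) (use p BS in simp)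
    ultimately show ?thesis by (simp add: t_def tensor_map_def)
  qed
  have cl: "N.closed_list (?m p)" if "M.closed_list p" for p using that \<phi>(1) by auto
  show "t x \<in> carrier (tensor R B N)" if x: "x \<in> carrier (tensor R B M)" for x
  proof -
    obtain p where p: "M.closed_list p" "x = tens R B M p"
      using x unfolding cT by blast
    show ?thesis unfolding p(2) t[OF p(1)] unfolding cT' using cl[OF p(1)] by blast
  qed
  show "t (x \<oplus>\<^bsub>tensor R B M\<^esub> y) = t x \<oplus>\<^bsub>tensor R B N\<^esub> t y"
    if xy: "x \<in> carrier (tensor R B M)" "y \<in> carrier (tensor R B M)" for x y
  proof -
    obtain p where p: "M.closed_list p" "x = tens R B M p" using xy(1) unfolding cT by blast
    obtain q where q: "M.closed_list q" "y = tens R B M q" using xy(2) unfolding cT by blast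
    have "M.closed_list (p @ q)" using p q by simp
    have "x \<oplus>\<^bsub>tensor R B M\<^esub> y = tens R B M (p @ q)"
      using M.tens_add[OF p(1) q(1)] unfolding p(2) q(2) B_def .
    moreover have "t x \<oplus>\<^bsub>tensor R B N\<^esub> t y = tens R B N (?m p @ ?m q)"
      using N.tens_add[OF cl[OF p(1)] cl[OF q(1)]] unfolding p(2) q(2) t[OF p(1)] t[OF q(1)] unfolding B_def .
    ultimately show ?thesis using t[OF \<open>M.closed_list (p @ q)\<close>] by simp
  qed
  show "t (M.pure u n) = N.pure u (\<phi> n)" if "u \<in> carrier S" "n \<in> carrier M" for u n
    using t[of "[(u, n)]"] that unfolding M.pure_def N.pure_def B_def by simp
  show "t (l \<odot>\<^bsub>tensor R B M\<^esub> x) = l \<odot>\<^bsub>tensor R B N\<^esub> t x"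
    if l: "l \<in> carrier S" and x: "x \<in> carrier (tensor R B M)" for l x
  proof -
    let ?l = "map (\<lambda>(b, n). (l \<otimes>\<^bsub>S\<^esub> b, n))"
    obtain p where p: "M.closed_list p" "x = tens R B M p"
      using x unfolding cT by blast
    have lp: "M.closed_list (?l p)" using p l by (auto simp: subset_iff)
    have "l \<odot>\<^bsub>tensor R B M\<^esub> x = tens R B M (?l p)"
      using M.tens_smult[OF p(1) l] p(2) unfolding B_def by simp
    moreover have "l \<odot>\<^bsub>tensor R B N\<^esub> t x = tens R B N (?l (?m p))"
      using N.tens_smult[OF cl[OF p(1)] l] unfolding p(2) t[OF p(1)] unfolding B_def .
    moreover have "?l (?m p) = ?m (?l p)" by auto
    ultimately show ?thesis using t[OF lp] by metis
  qed
qed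

section \<open>The twisted localization of a module\<close>

definition module_comp :: "bool \<Rightarrow> ('r, 'v) smod \<Rightarrow> bit \<Rightarrow> 'v set" where
  "module_comp s M i = (if s then mpart M i else carrier M)"

lemma module_comp_simps [simp]: "module_comp True M i = mpart M i" "module_comp False M i = carrier M"
  by (simp_all add: module_comp_def)

lemma bit_cancel: "(a + b) + ((i + a) + b) = (i :: bit)"
  by (cases a rule: bit.exhaust; cases b rule: bit.exhaust; cases i rule: bit.exhaust; simp)

context ring_extension_tensor
begin

lemma comp_induct [consumes 3, case_names zero pure add]:
  assumes "x \<in> module_comp s T i"
    and sub: "\<And>j. P j \<subseteq> carrier S" "\<And>j. module_comp s N j \<subseteq> carrier N"
    and "Q \<zero>\<^bsub>T\<^esub>"
    and pure: "\<And>j u n. u \<in> (if s then P j else carrier S) \<Longrightarrow> n \<in> module_comp s N (i + j) \<Longrightarrow> Q (pure u n)"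
    and "\<And>x y. x \<in> carrier T \<Longrightarrow> y \<in> carrier T \<Longrightarrow> Q x \<Longrightarrow> Q y \<Longrightarrow> Q (x \<oplus>\<^bsub>T\<^esub> y)"
  shows "Q x"
proof (cases s)
  case True
  show ?thesis
    by (rule mpart_induct[of x i Q]) (use assms True in auto)
next
  case False
  show ?thesis
    by (rule T_induct[of x Q]) (use assms False in auto)
qed

end

context lie_superalgebra
begin

text \<open>The grading axiom speaks about scalars and elements of the Lie superalgebra. Induction
  over the generation of the enveloping algebra extends it to homogeneous \<open>u\<close>; the flag
  \<open>s\<close> keeps the ungraded case in the same statement.\<close>

lemma module_comp_facts:
  assumes "lie_module s L M"
  shows "left_module (env L) M"
    and "module_comp s M i \<subseteq> carrier M"
    and "\<zero>\<^bsub>M\<^esub> \<in> module_comp s M i"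
    and "v \<in> module_comp s M i \<Longrightarrow> w \<in> module_comp s M i \<Longrightarrow> v \<oplus>\<^bsub>M\<^esub> w \<in> module_comp s M i"
    and "u \<in> env_comp s i \<Longrightarrow> v \<in> module_comp s M j \<Longrightarrow> u \<odot>\<^bsub>M\<^esub> v \<in> module_comp s M (i + j)"
proof -
  show lm: "left_module (env L) M" using assms by (simp add: lie_module_def)
  interpret M: left_module "env L" M by (rule lm)
  have sg: "additive_subgroup (mpart M i) M" "\<And>c v. v \<in> mpart M i \<Longrightarrow> csc L M c v \<in> mpart M i"
    "\<And>i j x v. x \<in> prt L i \<Longrightarrow> v \<in> mpart M j \<Longrightarrow> act L M x v \<in> mpart M (i + j)" if s for i
    using assms that by (auto simp: lie_module_def super_graded_def)
  show sub: "module_comp s M i \<subseteq> carrier M" for i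
    using additive_subgroup.a_subset[OF sg(1)] by (auto simp: module_comp_def)
  show "\<zero>\<^bsub>M\<^esub> \<in> module_comp s M i"
    using additive_subgroup.zero_closed[OF sg(1)] by (auto simp: module_comp_def)
  have sum_closed: "v \<oplus>\<^bsub>M\<^esub> w \<in> module_comp s M i" if "v \<in> module_comp s M i" "w \<in> module_comp s M i" for v w i
    using additive_subgroup.a_closed[OF sg(1)] that by (auto simp: module_comp_def)
  then show "v \<in> module_comp s M i \<Longrightarrow> w \<in> module_comp s M i \<Longrightarrow> v \<oplus>\<^bsub>M\<^esub> w \<in> module_comp s M i" .
  have "\<forall>v j. v \<in> module_comp s M j \<longrightarrow> u \<odot>\<^bsub>M\<^esub> v \<in> module_comp s M (i + j)" if "u \<in> env_comp s i" for u i
    using that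
  proof (induction rule: env_comp_induct)
    case (sc i c)
    then show ?case using sg(2) M.smult_closed by (auto simp: module_comp_def csc_def)
  next
    case (in_env i x)
    then show ?case using sg(3) M.smult_closed by (auto simp: module_comp_def act_def)
  next
    case (mult i k u v)
    show ?case
    proof (intro allI impI)
      fix w j assume w: "w \<in> module_comp s M j"
      then have "u \<odot>\<^bsub>M\<^esub> (v \<odot>\<^bsub>M\<^esub> w) \<in> module_comp s M (i + (k + j))" using mult by blast
      moreover have "(u \<otimes>\<^bsub>env L\<^esub> v) \<odot>\<^bsub>M\<^esub> w = u \<odot>\<^bsub>M\<^esub> (v \<odot>\<^bsub>M\<^esub> w)"
        using mult(1,2) w sub[of j] by (intro M.smult_assoc) blast+
      ultimately show "(u \<otimes>\<^bsub>env L\<^esub> v) \<odot>\<^bsub>M\<^esub> w \<in> module_comp s M (i + k + j)"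
        by (simp only: add.assoc)
    qed
  next
    case (add i u v)
    show ?case
    proof (intro allI impI)
      fix w j assume w: "w \<in> module_comp s M j"
      have "(u \<oplus>\<^bsub>env L\<^esub> v) \<odot>\<^bsub>M\<^esub> w = u \<odot>\<^bsub>M\<^esub> w \<oplus>\<^bsub>M\<^esub> v \<odot>\<^bsub>M\<^esub> w"
        using add(1,2) w sub[of j] by (intro M.smult_l_distr) blast+
      then show "(u \<oplus>\<^bsub>env L\<^esub> v) \<odot>\<^bsub>M\<^esub> w \<in> module_comp s M (i + j)"
        using sum_closed[of "u \<odot>\<^bsub>M\<^esub> w" "i + j" "v \<odot>\<^bsub>M\<^esub> w"] add(3,4) w by (simp only:)
    qed
  qed
  then show "u \<in> env_comp s i \<Longrightarrow> v \<in> module_comp s M j \<Longrightarrow> u \<odot>\<^bsub>M\<^esub> v \<in> module_comp s M (i + j)" by blast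
qed

end

context sl2_superalgebra
begin

text \<open>The twisted localization before restriction to the Lie superalgebra; on it the inverse
  of f remains available as a scalar.\<close>

definition D_ext :: "complex \<Rightarrow> ('g, 'm) gmod \<Rightarrow> ('g lel, ('g, 'm) gvec) smod" where
  "D_ext a N = tensor V (twist_bimod L f a) (loc_mod L f N)"

text \<open>The canonical map n -> f^a (x) 1 (x) n. Since f^a u = phi_a(u) f^a, it is linear only up
  to the twist, as in \<open>D_emb_smult\<close>.\<close>

definition D_emb :: "complex \<Rightarrow> ('g, 'm) gmod \<Rightarrow> ('g, 'm) gvec \<Rightarrow> ('g, 'm) gvec" where
  "D_emb a N n = tens V (twist_bimod L f a) (loc_mod L f N)
     [(\<one>\<^bsub>V\<^esub>, tens U (lenv_bimod L f) N [(\<one>\<^bsub>V\<^esub>, n)])]"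

lemma D_mod_eq: "D_mod L f a N = restrict_scalars L f (D_ext a N)"
  by (simp add: D_mod_def D_ext_def)

lemma bimod_eq: "lenv_bimod L f = extension_bimod V \<iota> (lenv_part L f)"
  "twist_bimod L f a = extension_bimod V (tw.twst a) (lenv_part L f)"
  by (simp_all add: lenv_bimod_def twist_bimod_def extension_bimod_def twist_eq)

lemma loc_tensor: "left_module U N \<Longrightarrow> ring_extension_tensor V U N \<iota>"
  by (intro ring_extension_tensor.intro ring_extension_tensor_axioms.intro lenv.ring_axioms) simp_all

lemma lenv_part_sub: "lenv_part L f i \<subseteq> carrier V"
  using lenv_comp_closed[of _ True i] by auto

section \<open>The canonical map and its kernel\<close>

context
  fixes N :: "('g, 'm) gmod"
  assumes lm: "left_module U N"
begin

interpretation N: left_module U N by (rule lm)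
interpretation A: ring_extension_tensor V U N \<iota> "lenv_part L f" by (rule loc_tensor[OF lm])

lemma loc_mod_eq: "loc_mod L f N = A.T" by (simp add: loc_mod_def bimod_eq)

lemma twist_tensor: "ring_extension_tensor V V A.T (tw.twst a)"
  by (intro ring_extension_tensor.intro ring_extension_tensor_axioms.intro lenv.ring_axioms A.left_module_T)
    simp_all

interpretation AT: left_module V A.T by (rule A.left_module_T)

context
  fixes a :: complex
begin

interpretation B: ring_extension_tensor V V A.T "tw.twst a" "lenv_part L f" by (rule twist_tensor)

lemma D_ext_eq: "D_ext a N = B.T" by (simp add: D_ext_def bimod_eq loc_mod_eq)

lemma D_emb_eq: "D_emb a N n = B.pure \<one>\<^bsub>V\<^esub> (A.pure \<one>\<^bsub>V\<^esub> n)"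
  by (simp add: D_emb_def B.pure_def A.pure_def bimod_eq loc_mod_eq)

lemma left_module_D: "left_module V (D_ext a N)"
  unfolding D_ext_eq by (rule B.left_module_T)

interpretation D: left_module V "D_ext a N" by (rule left_module_D)

lemma D_emb_closed: "n \<in> carrier N \<Longrightarrow> D_emb a N n \<in> carrier (D_ext a N)"
  unfolding D_emb_eq D_ext_eq by (intro B.pure_closed A.pure_closed) auto

lemma D_emb_add: "n \<in> carrier N \<Longrightarrow> n' \<in> carrier N \<Longrightarrow>
    D_emb a N (n \<oplus>\<^bsub>N\<^esub> n') = D_emb a N n \<oplus>\<^bsub>D_ext a N\<^esub> D_emb a N n'"
  unfolding D_emb_eq D_ext_eq by (simp add: A.pure_add_right B.pure_add_right)

text \<open>The right action moves v across f^a as phi_a(v), so the image of \<open>D_emb\<close>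
  generates the whole module over the localization.\<close>

lemma pure_pure:
  assumes "u \<in> carrier V" "v \<in> carrier V" "n \<in> carrier N"
  shows "B.pure u (A.pure v n) = (u \<otimes>\<^bsub>V\<^esub> tw.twst a v) \<odot>\<^bsub>B.T\<^esub> D_emb a N n"
proof -
  have "A.pure v n = v \<odot>\<^bsub>A.T\<^esub> A.pure \<one>\<^bsub>V\<^esub> n" using assms by (simp add: A.smult_pure)
  then have "B.pure u (A.pure v n) = B.pure (u \<otimes>\<^bsub>V\<^esub> tw.twst a v) (A.pure \<one>\<^bsub>V\<^esub> n)"
    using assms by (simp add: B.pure_balanced)
  then show ?thesis using assms by (simp add: D_emb_eq B.smult_pure)
qed

lemma D_emb_smult:
  assumes "u \<in> carrier U" "n \<in> carrier N"
  shows "D_emb a N (u \<odot>\<^bsub>N\<^esub> n) = tw.twst a (\<iota> u) \<odot>\<^bsub>D_ext a N\<^esub> D_emb a N n"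
proof -
  have "D_emb a N (u \<odot>\<^bsub>N\<^esub> n) = B.pure \<one>\<^bsub>V\<^esub> (A.pure (\<iota> u) n)"
    using assms A.pure_balanced[of "\<one>\<^bsub>V\<^esub>" u n] by (simp add: D_emb_eq)
  then show ?thesis using assms by (simp add: pure_pure D_ext_eq)
qed

lemma D_emb_zero: "D_emb a N \<zero>\<^bsub>N\<^esub> = \<zero>\<^bsub>D_ext a N\<^esub>"
  using D_emb_add[of "\<zero>\<^bsub>N\<^esub>" "\<zero>\<^bsub>N\<^esub>"] D_emb_closed[of "\<zero>\<^bsub>N\<^esub>"]
  by (metis D.M.add.l_cancel_one' N.M.zero_closed N.M.r_zero)

lemma D_emb_F: "n \<in> carrier N \<Longrightarrow> D_emb a N (in_env L f \<odot>\<^bsub>N\<^esub> n) = F \<odot>\<^bsub>D_ext a N\<^esub> D_emb a N n"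
  by (simp add: D_emb_smult tw.twst_F)

lemma D_emb_F_pow: "n \<in> carrier N \<Longrightarrow>
    D_emb a N (in_env L f [^]\<^bsub>U\<^esub> (k::nat) \<odot>\<^bsub>N\<^esub> n) = F [^]\<^bsub>V\<^esub> k \<odot>\<^bsub>D_ext a N\<^esub> D_emb a N n"
proof (induction k arbitrary: n)
  case 0
  then show ?case by (simp add: N.smult_one D.smult_one D_emb_closed)
next
  case (Suc k)
  then show ?case
    by (simp add: N.smult_assoc D.smult_assoc N.smult_closed D_emb_F D_emb_closed)
qed

lemma D_emb_K: "n \<in> carrier N \<Longrightarrow> D_emb a N (sc_env L c \<odot>\<^bsub>N\<^esub> n) = K c \<odot>\<^bsub>D_ext a N\<^esub> D_emb a N n"
  by (simp add: D_emb_smult tw.twst_K)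

lemma D_emb_kernel:
  assumes n: "n \<in> carrier N" "D_emb a N n = \<zero>\<^bsub>D_ext a N\<^esub>"
  shows "\<exists>k::nat. in_env L f [^]\<^bsub>U\<^esub> k \<odot>\<^bsub>N\<^esub> n = \<zero>\<^bsub>N\<^esub>"
proof -
  obtain G :: "('g lel, nat \<Rightarrow> ('g, 'm) gvec) module" and g where "left_module V G"
    and ker: "\<forall>n\<in>carrier N. g n \<in> carrier G \<and>
      (g n = \<zero>\<^bsub>G\<^esub> \<longrightarrow> (\<exists>k::nat. in_env L f [^]\<^bsub>U\<^esub> k \<odot>\<^bsub>N\<^esub> n = \<zero>\<^bsub>N\<^esub>))"
    and g_add: "\<forall>n\<in>carrier N. \<forall>n'\<in>carrier N. g (n \<oplus>\<^bsub>N\<^esub> n') = g n \<oplus>\<^bsub>G\<^esub> g n'"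
    and g_lin: "\<forall>u\<in>carrier U. \<forall>n\<in>carrier N. g (u \<odot>\<^bsub>N\<^esub> n) = \<iota> u \<odot>\<^bsub>G\<^esub> g n"
    using localized_module[OF lm] by (elim exE conjE) (rule that)
  interpret G: left_module V G by fact
  have g: "g n \<in> carrier G" if "n \<in> carrier N" for n using ker that by blast
  obtain \<psi> where \<psi>: "\<And>x. x \<in> carrier A.T \<Longrightarrow> \<psi> x \<in> carrier G"
    "\<And>x y. x \<in> carrier A.T \<Longrightarrow> y \<in> carrier A.T \<Longrightarrow> \<psi> (x \<oplus>\<^bsub>A.T\<^esub> y) = \<psi> x \<oplus>\<^bsub>G\<^esub> \<psi> y"
    "\<And>u n. u \<in> carrier V \<Longrightarrow> n \<in> carrier N \<Longrightarrow> \<psi> (A.pure u n) = u \<odot>\<^bsub>G\<^esub> g n"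
    by (rule A.tensor_lift[of G "\<lambda>u n. u \<odot>\<^bsub>G\<^esub> g n", OF G.M.abelian_group_axioms])
      (use g g_add g_lin in \<open>auto simp: G.smult_closed G.smult_l_distr G.smult_r_distr G.smult_assoc\<close>)
  have \<psi>0: "\<psi> \<zero>\<^bsub>A.T\<^esub> = \<zero>\<^bsub>G\<^esub>"
    using \<psi>(2)[of "\<zero>\<^bsub>A.T\<^esub>" "\<zero>\<^bsub>A.T\<^esub>"] \<psi>(1)[of "\<zero>\<^bsub>A.T\<^esub>"]
    by (metis G.M.add.l_cancel_one' AT.M.zero_closed AT.M.r_zero)
  have \<psi>_lin: "\<psi> (u \<odot>\<^bsub>A.T\<^esub> x) = u \<odot>\<^bsub>G\<^esub> \<psi> x" if u: "u \<in> carrier V" and x: "x \<in> carrier A.T" for u x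
    using x
    by (induction rule: A.T_induct)
      (use u in \<open>auto simp: A.smult_T_zero \<psi>0 A.smult_pure \<psi> g G.smult_assoc A.smult_T_add A.smult_T_closed
        G.smult_r_distr\<close>)
  \<comment> \<open>The twist is undone by u f^a (x) x -> phi_(-a)(u) \<psi>(x). This is balanced
    because phi_(-a)(u phi_a(r)) = phi_(-a)(u) r. The result is only additive, which suffices to
    compare kernels.\<close>
  obtain \<chi> where \<chi>: "\<And>x. x \<in> carrier B.T \<Longrightarrow> \<chi> x \<in> carrier G"
    "\<And>x y. x \<in> carrier B.T \<Longrightarrow> y \<in> carrier B.T \<Longrightarrow> \<chi> (x \<oplus>\<^bsub>B.T\<^esub> y) = \<chi> x \<oplus>\<^bsub>G\<^esub> \<chi> y"
    "\<And>u x. u \<in> carrier V \<Longrightarrow> x \<in> carrier A.T \<Longrightarrow> \<chi> (B.pure u x) = tw.twst (- a) u \<odot>\<^bsub>G\<^esub> \<psi> x"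
  proof (rule B.tensor_lift[of G "\<lambda>u x. tw.twst (- a) u \<odot>\<^bsub>G\<^esub> \<psi> x", OF G.M.abelian_group_axioms])
    fix u r x assume *: "u \<in> carrier V" "r \<in> carrier V" "x \<in> carrier A.T"
    then have "tw.twst (- a) (u \<otimes>\<^bsub>V\<^esub> tw.twst a r) = tw.twst (- a) u \<otimes>\<^bsub>V\<^esub> r"
      by (simp add: tw.twst_mult tw.twst_inverse)
    then show "tw.twst (- a) (u \<otimes>\<^bsub>V\<^esub> tw.twst a r) \<odot>\<^bsub>G\<^esub> \<psi> x = tw.twst (- a) u \<odot>\<^bsub>G\<^esub> \<psi> (r \<odot>\<^bsub>A.T\<^esub> x)"
      using * by (simp add: \<psi>_lin \<psi> G.smult_assoc)
  qed (auto simp: \<psi> tw.twst_add G.smult_closed G.smult_l_distr G.smult_r_distr)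
  have "\<chi> \<zero>\<^bsub>B.T\<^esub> = \<zero>\<^bsub>G\<^esub>"
    using \<chi>(2)[of "\<zero>\<^bsub>B.T\<^esub>" "\<zero>\<^bsub>B.T\<^esub>"] \<chi>(1)[of "\<zero>\<^bsub>B.T\<^esub>"] D.M.zero_closed D.M.r_zero
    unfolding D_ext_eq by (metis G.M.add.l_cancel_one')
  moreover have "\<chi> (D_emb a N n) = g n"
    using n(1) g[OF n(1)] unfolding D_emb_eq by (simp add: \<chi> \<psi> tw.twst_one G.smult_one)
  ultimately have "g n = \<zero>\<^bsub>G\<^esub>" using n(2) unfolding D_ext_eq by simp
  then show ?thesis using ker n(1) by blast
qed

lemma D_smult_pow: "d \<in> carrier (D_ext a N) \<Longrightarrow> F [^]\<^bsub>V\<^esub> (k + l::nat) \<odot>\<^bsub>D_ext a N\<^esub> d =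
    F [^]\<^bsub>V\<^esub> k \<odot>\<^bsub>D_ext a N\<^esub> (F [^]\<^bsub>V\<^esub> l \<odot>\<^bsub>D_ext a N\<^esub> d)"
  by (simp add: lenv.nat_pow_mult[symmetric] D.smult_assoc)

section \<open>Parity and denominators in the twisted localization\<close>

context
  fixes s :: bool
  assumes lie: "lie_module s L N"
begin

lemma loc_comp_sub: "module_comp s A.T j \<subseteq> carrier A.T"
  using A.mpart_closed[OF lenv_part_sub] module_comp_facts(2)[OF lie] by (cases s) auto

text \<open>Two nested inductions over tensor products collapse to the generators w j(n), because
  the inner factor is moved across f^a by \<open>pure_pure\<close>, and phi_a preserves
  parity.\<close>

lemma D_comp_induct [consumes 1, case_names zero gen add]:
  assumes "d \<in> module_comp s (D_ext a N) i"
    and zero: "Q \<zero>\<^bsub>D_ext a N\<^esub>"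
    and gen: "\<And>j w n. w \<in> lenv_comp s j \<Longrightarrow> n \<in> module_comp s N (i + j) \<Longrightarrow>
      Q (w \<odot>\<^bsub>D_ext a N\<^esub> D_emb a N n)"
    and add: "\<And>x y. x \<in> carrier (D_ext a N) \<Longrightarrow> y \<in> carrier (D_ext a N) \<Longrightarrow> Q x \<Longrightarrow> Q y \<Longrightarrow> Q (x \<oplus>\<^bsub>D_ext a N\<^esub> y)"
  shows "Q d"
  using assms(1) lenv_part_sub loc_comp_sub unfolding D_ext_eq
proof (induction rule: B.comp_induct)
  case zero
  show ?case using assms(2) by (simp add: D_ext_eq)
next
  case (pure j u x)
  from pure have u: "u \<in> lenv_comp s j" by (simp add: lenv_comp_def split: if_splits)
  note uc = lenv_comp_closed[OF u]
  have "Q (B.pure u x)"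
    using pure(2) lenv_part_sub module_comp_facts(2)[OF lie]
  proof (induction rule: A.comp_induct)
    case zero
    have "B.pure u \<zero>\<^bsub>A.T\<^esub> = \<zero>\<^bsub>B.T\<^esub>"
      using B.pure_add_right[OF uc, of "\<zero>\<^bsub>A.T\<^esub>" "\<zero>\<^bsub>A.T\<^esub>"] B.pure_closed[OF uc, of "\<zero>\<^bsub>A.T\<^esub>"]
        D.M.add.l_cancel_one' unfolding D_ext_eq by (metis AT.M.zero_closed AT.M.r_zero)
    then show ?case using assms(2) by (simp add: D_ext_eq)
  next
    case (pure k v n)
    from pure have v: "v \<in> lenv_comp s k" by (simp add: lenv_comp_def split: if_splits)
    have n: "n \<in> carrier N" using pure module_comp_facts(2)[OF lie] by blast
    have "u \<otimes>\<^bsub>V\<^esub> tw.twst a v \<in> lenv_comp s (j + k)" by (intro lenv_comp_mult u twist_comp v)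
    moreover have "n \<in> module_comp s N (i + (j + k))" using pure by (simp only: add.assoc)
    ultimately have "Q ((u \<otimes>\<^bsub>V\<^esub> tw.twst a v) \<odot>\<^bsub>D_ext a N\<^esub> D_emb a N n)" by (rule gen)
    then show ?case by (simp only: pure_pure[OF uc lenv_comp_closed[OF v] n] D_ext_eq)
  next
    case (add x y)
    then show ?case using assms(4)[unfolded D_ext_eq, OF B.pure_closed[OF uc] B.pure_closed[OF uc]]
      by (simp only: B.pure_add_right[OF uc])
  qed
  then show ?case .
next
  case (add x y)
  then show ?case using assms(4) unfolding D_ext_eq by blast
qed

lemma D_fraction:
  assumes "d \<in> module_comp s (D_ext a N) i"
  shows "\<exists>k::nat. \<exists>n\<in>module_comp s N i. F [^]\<^bsub>V\<^esub> k \<odot>\<^bsub>D_ext a N\<^esub> d = D_emb a N n"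
  using assms
proof (induction rule: D_comp_induct)
  case zero
  show ?case
    by (intro exI[of _ 0] bexI[OF _ module_comp_facts(3)[OF lie]]) (simp add: D_emb_zero)
next
  case (gen j w n)
  have n: "n \<in> carrier N" using gen module_comp_facts(2)[OF lie] by blast
  note wc = lenv_comp_closed[OF gen(1)]
  \<comment> \<open>The denominator is taken for phi_(-a)(w), because \<open>D_emb\<close> turns the
    numerator \<open>r\<close> into phi_a(r), and phi_a fixes powers of f.\<close>
  obtain k :: nat and r where r: "r \<in> env_comp s j" "F [^]\<^bsub>V\<^esub> k \<otimes>\<^bsub>V\<^esub> tw.twst (- a) w = \<iota> r"
    using lenv_fraction[OF twist_comp[OF gen(1)]] by blast
  have Fk: "tw.twst b (F [^]\<^bsub>V\<^esub> k) = F [^]\<^bsub>V\<^esub> k" for b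
    by (rule tw.twst_fixed) (auto simp: lenv.nat_pow_Suc2[symmetric] simp del: lenv.nat_pow_Suc)
  have "tw.twst a (\<iota> r) = F [^]\<^bsub>V\<^esub> k \<otimes>\<^bsub>V\<^esub> w"
    using wc by (simp add: r(2)[symmetric] tw.twst_mult Fk tw.twst_inverse)
  then have "F [^]\<^bsub>V\<^esub> k \<odot>\<^bsub>D_ext a N\<^esub> (w \<odot>\<^bsub>D_ext a N\<^esub> D_emb a N n) = D_emb a N (r \<odot>\<^bsub>N\<^esub> n)"
    using wc n env_comp_closed[OF r(1)]
    by (simp add: D_emb_smult D.smult_assoc D_emb_closed)
  moreover have "r \<odot>\<^bsub>N\<^esub> n \<in> module_comp s N i"
  proof -
    have "r \<odot>\<^bsub>N\<^esub> n \<in> module_comp s N (j + (i + j))"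
      by (rule module_comp_facts(5)[OF lie r(1) gen(2)])
    moreover have "j + (i + j) = i" using bit_cancel[of j 0 i] by (simp only: add_0_right)
    ultimately show ?thesis by (simp only:)
  qed
  ultimately show ?case by (intro exI bexI)
next
  case (add x y)
  then obtain k l :: nat and n n' where n: "n \<in> module_comp s N i" "F [^]\<^bsub>V\<^esub> k \<odot>\<^bsub>D_ext a N\<^esub> x = D_emb a N n"
    and n': "n' \<in> module_comp s N i" "F [^]\<^bsub>V\<^esub> l \<odot>\<^bsub>D_ext a N\<^esub> y = D_emb a N n'" by blast
  have nc: "n \<in> carrier N" "n' \<in> carrier N" using n n' module_comp_facts(2)[OF lie] by blast+
  have f: "in_env L f [^]\<^bsub>U\<^esub> m \<odot>\<^bsub>N\<^esub> v \<in> module_comp s N i" if "v \<in> module_comp s N i" for m :: nat and v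
  proof (induction m)
    case 0
    have "v \<in> carrier N" using that module_comp_facts(2)[OF lie] by blast
    then show ?case using that by (simp add: N.smult_one)
  next
    case (Suc m)
    have "v \<in> carrier N" using that module_comp_facts(2)[OF lie] by blast
    then have "in_env L f [^]\<^bsub>U\<^esub> Suc m \<odot>\<^bsub>N\<^esub> v = in_env L f \<odot>\<^bsub>N\<^esub> (in_env L f [^]\<^bsub>U\<^esub> m \<odot>\<^bsub>N\<^esub> v)"
      by (simp only: env.nat_pow_Suc2 N.smult_assoc in_env_closed env.nat_pow_closed)
    then show ?case
      using module_comp_facts(5)[OF lie env_comp_intros(2)[OF even(3)] Suc] by (simp only: add_0_left)
  qed
  have "F [^]\<^bsub>V\<^esub> (k + l) \<odot>\<^bsub>D_ext a N\<^esub> (x \<oplus>\<^bsub>D_ext a N\<^esub> y) =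
      F [^]\<^bsub>V\<^esub> (l + k) \<odot>\<^bsub>D_ext a N\<^esub> x \<oplus>\<^bsub>D_ext a N\<^esub> F [^]\<^bsub>V\<^esub> (k + l) \<odot>\<^bsub>D_ext a N\<^esub> y"
    using add by (simp add: D.smult_r_distr add.commute)
  also have "\<dots> = D_emb a N (in_env L f [^]\<^bsub>U\<^esub> l \<odot>\<^bsub>N\<^esub> n \<oplus>\<^bsub>N\<^esub> in_env L f [^]\<^bsub>U\<^esub> k \<odot>\<^bsub>N\<^esub> n')"
    using add nc by (simp only: D_smult_pow n(2) n'(2) D_emb_add D_emb_F_pow N.smult_closed
        env.nat_pow_closed in_env_closed)
  finally show ?case
    by (intro exI bexI[OF _ module_comp_facts(4)[OF lie f[OF n(1)] f[OF n'(1)]]])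
qed

lemma D_comp_emb: "n \<in> module_comp s N i \<Longrightarrow> D_emb a N n \<in> module_comp s (D_ext a N) i"
proof (cases s)
  case True
  assume n: "n \<in> module_comp s N i"
  have one: "\<one>\<^bsub>V\<^esub> \<in> lenv_part L f 0"
    using lenv_comp_iota[OF env_comp_intros(1)[of 1 True]] by (simp add: iota_one)
  have "A.pure \<one>\<^bsub>V\<^esub> n \<in> mpart A.T (i + 0)"
    by (rule A.mpart_pure[OF one]) (use n True in \<open>simp only: add_0_right module_comp_simps\<close>)
  then have "B.pure \<one>\<^bsub>V\<^esub> (A.pure \<one>\<^bsub>V\<^esub> n) \<in> mpart B.T i" by (rule B.mpart_pure[OF one])
  then show ?thesis using True by (simp add: D_emb_eq D_ext_eq)
qed (simp add: D_emb_closed)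

lemma D_comp_sub: "module_comp s (D_ext a N) i \<subseteq> carrier (D_ext a N)"
  using B.mpart_closed[OF lenv_part_sub] loc_comp_sub by (cases s) (auto simp: D_ext_eq)

lemma D_comp_add: "x \<in> module_comp s (D_ext a N) i \<Longrightarrow> y \<in> module_comp s (D_ext a N) i \<Longrightarrow>
    x \<oplus>\<^bsub>D_ext a N\<^esub> y \<in> module_comp s (D_ext a N) i"
  using B.mpart_add[OF lenv_part_sub, of x i y] loc_comp_sub D.M.a_closed by (cases s) (auto simp: D_ext_eq)

lemma D_comp_zero: "\<zero>\<^bsub>D_ext a N\<^esub> \<in> module_comp s (D_ext a N) i"
  using B.mpart_zero D.M.zero_closed by (cases s) (auto simp: D_ext_eq)

lemma D_comp_smult:
  assumes w: "w \<in> lenv_comp s j" and x: "x \<in> module_comp s (D_ext a N) i"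
  shows "w \<odot>\<^bsub>D_ext a N\<^esub> x \<in> module_comp s (D_ext a N) (j + i)"
  using x
proof (induction rule: D_comp_induct)
  case zero
  then show ?case using lenv_comp_closed[OF w] by (simp add: D_comp_zero)
next
  case (gen k v n)
  have n: "n \<in> carrier N" using gen module_comp_facts(2)[OF lie] by blast
  show ?case
  proof (cases s)
    case True
    let ?u = "w \<otimes>\<^bsub>V\<^esub> v"
    have uc: "?u \<in> lenv_part L f (j + k)" using lenv_comp_mult[OF w gen(1)] True by simp
    have one: "\<one>\<^bsub>V\<^esub> \<in> lenv_part L f 0"
      using lenv_comp_iota[OF env_comp_intros(1)[of 1 True]] by (simp add: iota_one)
    have "n \<in> mpart N (((j + i) + (j + k)) + 0)"
    proof -
      have "((j + i) + (j + k)) + 0 = i + k"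
        by (cases i rule: bit.exhaust; cases j rule: bit.exhaust; cases k rule: bit.exhaust; simp)
      then show ?thesis using gen(2) True by (simp only: module_comp_simps)
    qed
    then have "A.pure \<one>\<^bsub>V\<^esub> n \<in> mpart A.T ((j + i) + (j + k))" by (rule A.mpart_pure[OF one])
    then have "B.pure ?u (A.pure \<one>\<^bsub>V\<^esub> n) \<in> mpart B.T (j + i)" by (rule B.mpart_pure[OF uc])
    moreover have "B.pure ?u (A.pure \<one>\<^bsub>V\<^esub> n) = w \<odot>\<^bsub>B.T\<^esub> (v \<odot>\<^bsub>B.T\<^esub> D_emb a N n)"
      using lenv_comp_closed[OF w] lenv_comp_closed[OF gen(1)] n
      by (simp add: D_emb_eq B.smult_pure)
    ultimately show ?thesis using True by (simp add: D_ext_eq)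
  next
    case False
    then show ?thesis using lenv_comp_closed[OF w] lenv_comp_closed[OF gen(1)] n
      by (simp add: D.smult_closed D_emb_closed)
  qed
next
  case (add x y)
  then show ?case using lenv_comp_closed[OF w] by (simp add: D.smult_r_distr D_comp_add)
qed

end

end

end

end

section \<open>Complex vector spaces given by carriers\<close>

locale complex_space = abelian_group V for V :: "(complex, 'v, 'm) module_scheme" (structure) +
  assumes sc_closed [simp]: "v \<in> carrier V \<Longrightarrow> c \<odot> v \<in> carrier V"
    and sc_add_left: "v \<in> carrier V \<Longrightarrow> (c + d) \<odot> v = c \<odot> v \<oplus> d \<odot> v"
    and sc_add_right: "v \<in> carrier V \<Longrightarrow> w \<in> carrier V \<Longrightarrow> c \<odot> (v \<oplus> w) = c \<odot> v \<oplus> c \<odot> w"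
    and sc_mult: "v \<in> carrier V \<Longrightarrow> (c * d) \<odot> v = c \<odot> (d \<odot> v)"
    and sc_one [simp]: "v \<in> carrier V \<Longrightarrow> 1 \<odot> v = v"
begin

lemma sc_zero_left [simp]: "v \<in> carrier V \<Longrightarrow> 0 \<odot> v = \<zero>"
  using sc_add_left[of v 0 0] sc_closed[of v 0] by (metis add.l_cancel_one' add_0_left)

lemma sc_zero_right [simp]: "c \<odot> \<zero> = \<zero>"
  using sc_add_right[of \<zero> \<zero> c] sc_closed[of \<zero> c] by (metis add.l_cancel_one' zero_closed r_zero)

lemma sc_minus: "v \<in> carrier V \<Longrightarrow> (- 1) \<odot> v = \<ominus> v"
  using sc_add_left[of v "- 1" 1] by (simp add: minus_equality)

lemma sc_finsum: "finite A \<Longrightarrow> g \<in> A \<rightarrow> carrier V \<Longrightarrow> c \<odot> finsum V g A = finsum V (\<lambda>i. c \<odot> g i) A"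
  by (induction rule: finite_induct) (auto simp: sc_add_right Pi_iff)

lemma sc_cancel:
  assumes "c \<noteq> 0" "v \<in> carrier V" "c \<odot> v \<in> X" "\<And>d w. w \<in> X \<Longrightarrow> d \<odot> w \<in> X"
  shows "v \<in> X"
  using assms(4)[OF assms(3), of "inverse c"] assms(1,2) by (simp add: sc_mult[symmetric])

lemma finsum_superset:
  assumes "finite A" "B \<subseteq> A" "\<And>i. i \<in> B \<Longrightarrow> g i \<in> carrier V"
  shows "finsum V g B = finsum V (\<lambda>i. if i \<in> B then g i else \<zero>) A"
  by (rule add.finprod_mono_neutral_cong_left) (use assms in auto)

lemma lspan_zero: "\<zero> \<in> lspan V S"
  unfolding lspan_def by (intro CollectI exI[of _ "{}"] exI[of _ "\<lambda>_. 0"]) simp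

lemma lspan_add:
  assumes S: "S \<subseteq> carrier V" and "v \<in> lspan V S" "w \<in> lspan V S"
  shows "v \<oplus> w \<in> lspan V S"
proof -
  obtain c B d B' where B: "finite B" "B \<subseteq> S" "v = finsum V (\<lambda>b. c b \<odot> b) B"
    and B': "finite B'" "B' \<subseteq> S" "w = finsum V (\<lambda>b. d b \<odot> b) B'"
    using assms(2,3) unfolding lspan_def by blast
  let ?c = "\<lambda>b. (if b \<in> B then c b else 0) + (if b \<in> B' then d b else 0)"
  have "v \<oplus> w = finsum V (\<lambda>b. (if b \<in> B then c b \<odot> b else \<zero>) \<oplus> (if b \<in> B' then d b \<odot> b else \<zero>)) (B \<union> B')"
    unfolding B(3) B'(3) using B B' S
    by (subst (1 2) finsum_superset[of "B \<union> B'"]) (auto simp: finsum_addf Pi_iff subset_iff)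
  also have "\<dots> = finsum V (\<lambda>b. ?c b \<odot> b) (B \<union> B')"
    by (rule finsum_cong') (use B B' S in \<open>auto simp: sc_add_left subset_iff\<close>)
  finally show ?thesis using B B' unfolding lspan_def by (intro CollectI exI[of _ ?c] exI[of _ "B \<union> B'"]) auto
qed

lemma lspan_smult:
  assumes S: "S \<subseteq> carrier V" and v: "v \<in> lspan V S" shows "c \<odot> v \<in> lspan V S"
proof -
  obtain d B where B: "finite B" "B \<subseteq> S" "v = finsum V (\<lambda>b. d b \<odot> b) B"
    using v unfolding lspan_def by blast
  have "c \<odot> v = finsum V (\<lambda>b. (c * d b) \<odot> b) B"
    unfolding B(3) using B S by (subst sc_finsum) (auto intro!: finsum_cong' simp: sc_mult subset_iff)
  then show ?thesis
    using B unfolding lspan_def by (intro CollectI exI[of _ "\<lambda>b. c * d b"] exI[of _ B]) auto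
qed

lemma lspan_base: assumes "S \<subseteq> carrier V" "v \<in> S" shows "v \<in> lspan V S"
  unfolding lspan_def using assms
  by (intro CollectI exI[of _ "{v}"] exI[of _ "\<lambda>_. 1"]) (auto simp: subset_iff)

lemma lspan_least:
  assumes "S \<subseteq> X" "X \<subseteq> carrier V" "\<zero> \<in> X" "\<And>v w. v \<in> X \<Longrightarrow> w \<in> X \<Longrightarrow> v \<oplus> w \<in> X"
    "\<And>c v. v \<in> X \<Longrightarrow> c \<odot> v \<in> X"
  shows "lspan V S \<subseteq> X"
proof
  fix v assume "v \<in> lspan V S"
  then obtain d B where B: "finite B" "B \<subseteq> S" "v = finsum V (\<lambda>b. d b \<odot> b) B"
    unfolding lspan_def by blast
  have "finsum V (\<lambda>b. d b \<odot> b) B \<in> X"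
    using B(1,2)
  proof (induction rule: finite_induct)
    case (insert b B)
    then have "insert b B \<subseteq> X" "insert b B \<subseteq> carrier V" using assms(1,2) by blast+
    then show ?case using insert assms by (subst finsum_insert) auto
  qed (simp add: assms)
  then show "v \<in> X" using B by simp
qed

lemma lspan_closed: "S \<subseteq> carrier V \<Longrightarrow> lspan V S \<subseteq> carrier V"
  by (rule lspan_least) auto

end

section \<open>Weight vectors\<close>

locale sl2_module = sl2_superalgebra L e h f
  for L :: "'g::ab_group_add superalg" and e h f +
  fixes M :: "('g uel, 'v) smod"
  assumes lm: "left_module (env L) M"
begin

sublocale M: left_module U M by (rule lm)

abbreviation sc (infixr "\<cdot>" 75) where "sc \<equiv> csc L M"
abbreviation X where "X \<equiv> act L M"
abbreviation plus (infixl "+\<^sub>M" 65) where "v +\<^sub>M w \<equiv> v \<oplus>\<^bsub>M\<^esub> w"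
abbreviation Mc where "Mc \<equiv> carrier M"
abbreviation Z where "Z \<equiv> \<zero>\<^bsub>M\<^esub>"

lemma act_closed [simp]: "v \<in> Mc \<Longrightarrow> X x v \<in> Mc" by (simp add: act_def M.smult_closed)
lemma act_pow_closed [simp]: "v \<in> Mc \<Longrightarrow> (X x ^^ n) v \<in> Mc" by (induction n) auto
lemma act_add: "v \<in> Mc \<Longrightarrow> w \<in> Mc \<Longrightarrow> X x (v +\<^sub>M w) = X x v +\<^sub>M X x w"
  by (simp add: act_def M.smult_r_distr)
lemma act_zero [simp]: "X x Z = Z" by (simp add: act_def)

lemma underlying_simps [simp]: "carrier (underlying L M) = Mc" "\<zero>\<^bsub>underlying L M\<^esub> = Z"
  "add (underlying L M) = add M" "c \<odot>\<^bsub>underlying L M\<^esub> v = c \<cdot> v"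
  by (simp_all add: underlying_def)

sublocale space: complex_space "underlying L M"
proof (intro complex_space.intro complex_space_axioms.intro)
  show "abelian_group (underlying L M)"
    by (rule abelian_group_cong[OF M.M.abelian_group_axioms]) simp_all
qed (simp_all add: csc_def M.smult_closed sc_env_add sc_env_mult M.smult_l_distr M.smult_r_distr
    M.smult_assoc M.smult_one)

lemmas sc_closed [simp] = space.sc_closed[simplified]
lemmas sc_add_left = space.sc_add_left[simplified]
lemmas sc_add_right = space.sc_add_right[simplified]
lemmas sc_mult = space.sc_mult[simplified]
lemmas sc_one [simp] = space.sc_one[simplified]
lemmas sc_zero_left [simp] = space.sc_zero_left[simplified]
lemmas sc_zero_right [simp] = space.sc_zero_right[simplified]

lemma sc_minus: "v \<in> Mc \<Longrightarrow> (- 1) \<cdot> v = \<ominus>\<^bsub>M\<^esub> v"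
  using sc_add_left[of v "- 1" 1] by (simp add: M.M.minus_equality)

lemma sc_neg_cancel: "v \<in> Mc \<Longrightarrow> (- c) \<cdot> v +\<^sub>M c \<cdot> v = Z"
  by (simp add: sc_add_left[symmetric])

lemma act_sc: "v \<in> Mc \<Longrightarrow> X x (c \<cdot> v) = c \<cdot> X x v"
  by (simp add: act_def csc_def M.smult_assoc[symmetric] sc_env_central)

lemma act_pow_add: "v \<in> Mc \<Longrightarrow> w \<in> Mc \<Longrightarrow> (X x ^^ n) (v +\<^sub>M w) = (X x ^^ n) v +\<^sub>M (X x ^^ n) w"
  by (induction n) (auto simp: act_add)
lemma act_pow_sc: "v \<in> Mc \<Longrightarrow> (X x ^^ n) (c \<cdot> v) = c \<cdot> (X x ^^ n) v"
  by (induction n) (auto simp: act_sc)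
lemma act_pow_zero [simp]: "(X x ^^ n) Z = Z" by (induction n) auto

lemma act_finsum: "finite A \<Longrightarrow> g \<in> A \<rightarrow> Mc \<Longrightarrow> X x (finsum M g A) = finsum M (\<lambda>i. X x (g i)) A"
  by (simp add: act_def M.smult_finsum)

lemma sc_finsum: "finite A \<Longrightarrow> g \<in> A \<rightarrow> Mc \<Longrightarrow> c \<cdot> finsum M g A = finsum M (\<lambda>i. c \<cdot> g i) A"
  by (simp add: csc_def M.smult_finsum)

lemma act_brk:
  assumes x: "x \<in> prt L 0" and v: "v \<in> Mc"
  shows "X x (X y v) = X y (X x v) +\<^sub>M X (brk L x y) v"
proof -
  let ?x = "in_env L x" and ?y = "in_env L y"
  have "?x \<otimes>\<^bsub>U\<^esub> ?y = ?y \<otimes>\<^bsub>U\<^esub> ?x \<oplus>\<^bsub>U\<^esub> env.comm ?x ?y"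
    by (simp add: env.comm_def env.minus_eq env.a_lcomm env.r_neg)
  then have "?x \<otimes>\<^bsub>U\<^esub> ?y = ?y \<otimes>\<^bsub>U\<^esub> ?x \<oplus>\<^bsub>U\<^esub> in_env L (brk L x y)" by (simp only: even_comm[OF x])
  then show ?thesis
    using v by (simp add: act_def M.smult_assoc[symmetric] M.smult_l_distr[symmetric])
qed

lemma act_scl: "v \<in> Mc \<Longrightarrow> X (scl L c x) v = c \<cdot> X x v"
  by (simp add: act_def csc_def in_env_scl M.smult_assoc)

lemma e_f: "v \<in> Mc \<Longrightarrow> X e (X f v) = X f (X e v) +\<^sub>M X h v"
  using act_brk[OF even(1), of v f] by (simp add: brk)
lemma h_e: "v \<in> Mc \<Longrightarrow> X h (X e v) = X e (X h v) +\<^sub>M 2 \<cdot> X e v"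
  using act_brk[OF even(2), of v e] by (simp add: brk act_scl)
lemma h_f: "v \<in> Mc \<Longrightarrow> X h (X f v) = X f (X h v) +\<^sub>M (- 2) \<cdot> X f v"
  using act_brk[OF even(2), of v f] by (simp add: brk act_scl)

section \<open>Weight vectors and the operator fe\<close>

definition wt :: "complex \<Rightarrow> 'v \<Rightarrow> bool" where "wt c v \<longleftrightarrow> v \<in> Mc \<and> X h v = c \<cdot> v"

lemma wt_closed: "wt c v \<Longrightarrow> v \<in> Mc" by (simp add: wt_def)
lemma wt_eq: "wt c v \<Longrightarrow> X h v = c \<cdot> v" by (simp add: wt_def)
lemma wt_zero [simp]: "wt c Z" by (simp add: wt_def)
lemma wt_add: "wt c v \<Longrightarrow> wt c w \<Longrightarrow> wt c (v +\<^sub>M w)"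
  by (simp add: wt_def act_add sc_add_right)
lemma wt_sc: "wt c v \<Longrightarrow> wt c (d \<cdot> v)"
  by (simp add: wt_def act_sc sc_mult[symmetric] mult.commute)
lemma wt_e: "wt c v \<Longrightarrow> wt (c + 2) (X e v)"
  by (simp add: wt_def h_e act_sc sc_add_left)
lemma wt_f: "wt c v \<Longrightarrow> wt (c - 2) (X f v)"
  using sc_add_left[of "X f v" c "- 2"] by (simp add: wt_def h_f act_sc)
lemma wt_e_pow: "wt c v \<Longrightarrow> wt (c + 2 * of_nat k) ((X e ^^ k) v)"
  by (induction k) (auto dest: wt_e simp: algebra_simps)

lemma weight_space_eq: "weight_space L h M c = {v. wt c v}"
  by (auto simp: weight_space_def wt_def)

text \<open>The identity [e^(k+1), f] = (k+1) e^k (h + k), evaluated on a vector of weight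
  l.\<close>

lemma e_pow_f:
  assumes v: "wt l v"
  shows "(X e ^^ Suc k) (X f v) = X f ((X e ^^ Suc k) v) +\<^sub>M (of_nat (Suc k) * (l + of_nat k)) \<cdot> (X e ^^ k) v"
proof (induction k)
  case 0
  then show ?case using wt_closed[OF v] wt_eq[OF v] by (simp add: e_f)
next
  case (Suc k)
  note vc = wt_closed[OF v]
  have "X h ((X e ^^ Suc k) v) = (l + 2 * of_nat (Suc k)) \<cdot> (X e ^^ Suc k) v"
    using wt_eq[OF wt_e_pow[OF v]] .
  moreover have "(X e ^^ Suc (Suc k)) (X f v) = X e ((X e ^^ Suc k) (X f v))" by simp
  ultimately have "(X e ^^ Suc (Suc k)) (X f v) = X f ((X e ^^ Suc (Suc k)) v) +\<^sub>M
      ((l + 2 * of_nat (Suc k)) \<cdot> (X e ^^ Suc k) v +\<^sub>M (of_nat (Suc k) * (l + of_nat k)) \<cdot> (X e ^^ Suc k) v)"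
    unfolding Suc using vc by (simp add: act_add act_sc e_f M.M.a_assoc del: of_nat_Suc)
  also have "(l + 2 * of_nat (Suc k)) \<cdot> (X e ^^ Suc k) v +\<^sub>M (of_nat (Suc k) * (l + of_nat k)) \<cdot> (X e ^^ Suc k) v
      = (of_nat (Suc (Suc k)) * (l + of_nat (Suc k))) \<cdot> (X e ^^ Suc k) v"
    using vc by (simp only: sc_add_left[symmetric] act_pow_closed) (simp add: algebra_simps)
  finally show ?case .
qed

text \<open>On a weight space, \<open>f\<^sup>k e\<^sup>k\<close> is a polynomial in \<open>fe\<close>; \<open>fe_prod cs\<close> is the product of the
  operators \<open>fe - c\<close>.\<close>

definition fe_step :: "complex \<Rightarrow> 'v \<Rightarrow> 'v" where
  "fe_step c v = X f (X e v) +\<^sub>M (- c) \<cdot> v"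

fun fe_prod :: "complex list \<Rightarrow> 'v \<Rightarrow> 'v" where
  "fe_prod [] v = v"
| "fe_prod (c # cs) v = fe_prod cs (fe_step c v)"

lemma fe_step_closed [simp]: "v \<in> Mc \<Longrightarrow> fe_step c v \<in> Mc" by (simp add: fe_step_def)
lemma fe_step_zero [simp]: "fe_step c Z = Z" by (simp add: fe_step_def)
lemma fe_prod_zero [simp]: "fe_prod cs Z = Z" by (induction cs) auto

lemma fe_step_commute: "v \<in> Mc \<Longrightarrow> fe_step c (fe_step d v) = fe_step d (fe_step c v)"
  by (simp add: fe_step_def act_add act_sc sc_add_right sc_mult[symmetric] M.M.a_ac mult.commute)

lemma fe_prod_step: "v \<in> Mc \<Longrightarrow> fe_prod cs (fe_step c v) = fe_step c (fe_prod cs v)"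
proof (induction cs arbitrary: v)
  case (Cons a cs)
  then show ?case by (simp add: fe_step_commute[of v a c])
qed simp

lemma fe_prod_append: "fe_prod (xs @ ys) v = fe_prod ys (fe_prod xs v)"
  by (induction xs arbitrary: v) auto

lemma fe_prod_commute: "v \<in> Mc \<Longrightarrow> fe_prod xs (fe_prod ys v) = fe_prod ys (fe_prod xs v)"
  by (induction xs arbitrary: v) (auto simp: fe_prod_step[symmetric])

lemma fe_prod_rev: "v \<in> Mc \<Longrightarrow> fe_prod (rev xs) v = fe_prod xs v"
  by (induction xs arbitrary: v) (auto simp: fe_prod_append fe_prod_step[symmetric])

lemma wt_fe_step: "wt l v \<Longrightarrow> wt l (fe_step c v)"
  unfolding fe_step_def using wt_f[OF wt_e, of l v] by (intro wt_add wt_sc) auto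

lemma fe_step_add: "v \<in> Mc \<Longrightarrow> fe_step (c + d) v = fe_step c v +\<^sub>M (- d) \<cdot> v"
  using sc_add_left[of v "- c" "- d"] by (simp add: fe_step_def M.M.a_assoc)

text \<open>On vectors of weight l the operator fe is the Casimir operator minus l(l+2)/4. As the
  Casimir operator commutes with e, moving e^k across fe only changes the constant, by the
  difference of (l+2k)(l+2k+2)/4 and l(l+2)/4, which is k(l+k+1).\<close>

lemma fe_e_pow:
  assumes v: "wt l v"
  shows "X f (X e ((X e ^^ k) v)) = (X e ^^ k) (fe_step (of_nat k * (l + of_nat k + 1)) v)"
proof (induction k)
  case 0
  then show ?case using wt_closed[OF v] by (simp add: fe_step_def)
next
  case (Suc k)
  note vc = wt_closed[OF v]
  let ?w = "(X e ^^ k) v" and ?c = "of_nat k * (l + of_nat k + 1)"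
  let ?d = "l + 2 * of_nat k + 2"
  have "wt ?d (X e ?w)" by (rule wt_e[OF wt_e_pow[OF v]])
  then have "X f (X e (X e ?w)) +\<^sub>M ?d \<cdot> X e ?w = X e (X f (X e ?w))"
    using vc by (simp add: e_f wt_eq)
  then have "X f (X e (X e ?w)) = X e (X f (X e ?w)) +\<^sub>M (- ?d) \<cdot> X e ?w"
    using vc sc_neg_cancel[of "X e ?w" "- ?d"] by (simp only: M.M.a_assoc[symmetric] act_closed act_pow_closed sc_closed)
      (metis M.M.a_assoc M.M.r_zero act_closed act_pow_closed sc_closed minus_minus)
  also have "\<dots> = X e ((X e ^^ k) (fe_step ?c v)) +\<^sub>M (- ?d) \<cdot> X e ?w" by (simp only: Suc)
  also have "\<dots> = (X e ^^ Suc k) (fe_step ?c v +\<^sub>M (- ?d) \<cdot> v)"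
    using vc by (simp add: act_pow_add act_pow_sc act_add act_sc)
  also have "fe_step ?c v +\<^sub>M (- ?d) \<cdot> v = fe_step (?c + ?d) v" using vc by (simp only: fe_step_add)
  also have "?c + ?d = of_nat (Suc k) * (l + of_nat (Suc k) + 1)" by (simp add: algebra_simps)
  finally show ?case by simp
qed

lemma f_pow_e_pow:
  "wt l v \<Longrightarrow> (X f ^^ k) ((X e ^^ k) v) = fe_prod (map (\<lambda>q. of_nat q * (l + of_nat q + 1)) [0..<k]) v"
proof (induction k arbitrary: v)
  case (Suc k)
  let ?c = "of_nat k * (l + of_nat k + 1)"
  have "(X f ^^ Suc k) ((X e ^^ Suc k) v) = (X f ^^ k) (X f (X e ((X e ^^ k) v)))"
    by (simp add: funpow_swap1)
  also have "\<dots> = (X f ^^ k) ((X e ^^ k) (fe_step ?c v))" by (simp only: fe_e_pow[OF Suc.prems])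
  also have "\<dots> = fe_prod (map (\<lambda>q. of_nat q * (l + of_nat q + 1)) [0..<k]) (fe_step ?c v)"
    by (rule Suc.IH[OF wt_fe_step[OF Suc.prems]])
  finally show ?case using wt_closed[OF Suc.prems] by (simp add: fe_prod_append fe_prod_step)
qed simp

section \<open>Submodules and weight decompositions\<close>

text \<open>Stability under h puts the weight components of an element of \<open>S\<close> into
  \<open>S\<close> again. With S = 0 this gives uniqueness of weight decompositions; with a
  submodule it replaces the passage to a quotient module.\<close>

definition h_subspace :: "'v set \<Rightarrow> bool" where
  "h_subspace S \<longleftrightarrow> S \<subseteq> Mc \<and> Z \<in> S \<and> (\<forall>v\<in>S. \<forall>w\<in>S. v +\<^sub>M w \<in> S) \<and> (\<forall>c. \<forall>v\<in>S. c \<cdot> v \<in> S) \<and>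
     (\<forall>v\<in>S. X h v \<in> S)"

lemma h_subspaceD: assumes "h_subspace S"
  shows "S \<subseteq> Mc" "Z \<in> S" "v \<in> S \<Longrightarrow> w \<in> S \<Longrightarrow> v +\<^sub>M w \<in> S" "v \<in> S \<Longrightarrow> c \<cdot> v \<in> S" "v \<in> S \<Longrightarrow> X h v \<in> S"
  using assms by (auto simp: h_subspace_def)

lemma h_subspace_cancel:
  assumes "h_subspace S" "c \<noteq> 0" "v \<in> Mc" "c \<cdot> v \<in> S" shows "v \<in> S"
  using space.sc_cancel[of c v S] assms h_subspaceD(4)[OF assms(1)] by simp

lemma h_subspace_diff:
  assumes "h_subspace S" "v \<in> Mc" "w \<in> S" "v +\<^sub>M w \<in> S" shows "v \<in> S"
proof -
  have w: "w \<in> Mc" using assms h_subspaceD(1) by blast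
  have "(v +\<^sub>M w) +\<^sub>M (- 1) \<cdot> w = v"
    using assms(2) w by (simp add: sc_minus M.M.a_assoc M.M.r_neg)
  moreover have "(v +\<^sub>M w) +\<^sub>M (- 1) \<cdot> w \<in> S"
    using h_subspaceD(3,4)[OF assms(1)] assms by blast
  ultimately show ?thesis by simp
qed

lemma h_subspace_zero: "h_subspace {Z}" by (simp add: h_subspace_def)

text \<open>Elimination: h - \<gamma> j kills the component \<open>w j\<close> and multiplies every
  other one by the nonzero number \<gamma> k - \<gamma> j. Weights are given by an injective
  \<gamma> on an index set, so that the images f(w c), of weight c - 2, can be indexed by the old
  weights.\<close>

lemma weight_components:
  assumes S: "h_subspace S"
  shows "finite I \<Longrightarrow> inj_on \<gamma> I \<Longrightarrow> (\<And>i. i \<in> I \<Longrightarrow> wt (\<gamma> i) (w i)) \<Longrightarrow> finsum M w I \<in> S \<Longrightarrow>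
    i \<in> I \<Longrightarrow> w i \<in> S"
proof (induction arbitrary: w i rule: finite_induct)
  case (insert j I)
  have wc: "w k \<in> Mc" if "k \<in> insert j I" for k using insert.prems(2) that wt_closed by blast
  have wI: "w \<in> I \<rightarrow> Mc" using wc by auto
  let ?v = "finsum M w (insert j I)"
  have v: "?v = w j +\<^sub>M finsum M w I" using insert.hyps wI wc by simp
  let ?w = "\<lambda>k. (\<gamma> k - \<gamma> j) \<cdot> w k"
  have fc: "finsum M w I \<in> Mc" using wI by simp
  have "X h ?v +\<^sub>M (- \<gamma> j) \<cdot> ?v = finsum M ?w I"
  proof -
    have "X h ?v +\<^sub>M (- \<gamma> j) \<cdot> ?v =
        (\<gamma> j \<cdot> w j +\<^sub>M (- \<gamma> j) \<cdot> w j) +\<^sub>M (X h (finsum M w I) +\<^sub>M (- \<gamma> j) \<cdot> finsum M w I)"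
      unfolding v using wc fc wt_eq[OF insert.prems(2)[of j]] by (simp add: act_add sc_add_right M.M.a_ac)
    also have "\<gamma> j \<cdot> w j +\<^sub>M (- \<gamma> j) \<cdot> w j = Z" using wc by (simp add: sc_add_left[symmetric])
    also have "X h (finsum M w I) +\<^sub>M (- \<gamma> j) \<cdot> finsum M w I = finsum M (\<lambda>k. X h (w k) +\<^sub>M (- \<gamma> j) \<cdot> w k) I"
      using insert.hyps wI wc by (simp add: act_finsum sc_finsum M.M.finsum_addf Pi_iff)
    also have "\<dots> = finsum M ?w I"
    proof (rule M.M.finsum_cong')
      fix k assume "k \<in> I"
      then show "X h (w k) +\<^sub>M (- \<gamma> j) \<cdot> w k = ?w k"
        using wc wt_eq[OF insert.prems(2)[of k]] sc_add_left[of "w k" "\<gamma> k" "- \<gamma> j"] by simp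
    qed (use wc in auto)
    finally show ?thesis using wc by (simp add: Pi_iff)
  qed
  moreover have "X h ?v +\<^sub>M (- \<gamma> j) \<cdot> ?v \<in> S"
    by (intro h_subspaceD(3)[OF S] h_subspaceD(4)[OF S] h_subspaceD(5)[OF S] insert.prems(3))
  ultimately have "finsum M ?w I \<in> S" by (simp only:)
  moreover have "wt (\<gamma> k) (?w k)" if "k \<in> I" for k using insert.prems(2) that by (intro wt_sc) auto
  moreover have "inj_on \<gamma> I" using insert.prems(1) by auto
  ultimately have "?w k \<in> S" if "k \<in> I" for k using insert.IH[of ?w k] that by blast
  moreover have "\<gamma> k - \<gamma> j \<noteq> 0" if "k \<in> I" for k
    using insert.prems(1) insert.hyps(2) that by (auto simp: inj_on_def)
  ultimately have k: "w k \<in> S" if "k \<in> I" for k using h_subspace_cancel[OF S] wc that by blast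
  have "finsum M w A \<in> S" if "finite A" "A \<subseteq> I" for A
    using that
  proof (induction rule: finite_induct)
    case (insert a A)
    have aw: "w \<in> A \<rightarrow> Mc" "w a \<in> Mc" using insert wc by auto
    show ?case using insert h_subspaceD(3)[OF S k] by (simp add: M.M.finsum_insert[OF insert.hyps aw])
  qed (simp add: h_subspaceD(2)[OF S])
  then have "finsum M w I \<in> S" using insert.hyps by blast
  then have "w j \<in> S" using h_subspace_diff[OF S _ _ insert.prems(3)[unfolded v]] wc by blast
  then show ?case using k insert.prems(4) by blast
qed simp

text \<open>\<open>C\<close> is an upper bound for the weights that occur, as components may vanish.
  Thus several vectors can be given the same \<open>C\<close>.\<close>

definition wsum :: "complex set \<Rightarrow> 'v \<Rightarrow> bool" where
  "wsum C v \<longleftrightarrow> finite C \<and> (\<exists>w. (\<forall>c\<in>C. wt c (w c)) \<and> v = finsum M w C)"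

lemma wsum_zero: "finite C \<Longrightarrow> wsum C Z"
  unfolding wsum_def by (intro conjI exI[of _ "\<lambda>_. Z"]) auto

lemma wsum_mono: assumes "wsum C v" "C \<subseteq> D" "finite D" shows "wsum D v"
proof -
  obtain w where w: "\<forall>c\<in>C. wt c (w c)" "v = finsum M w C" using assms(1) by (auto simp: wsum_def)
  then have "\<And>c. c \<in> C \<Longrightarrow> w c \<in> Mc" using wt_closed by blast
  then have "v = finsum M (\<lambda>c. if c \<in> C then w c else Z) D"
    unfolding w(2) by (intro M.M.add.finprod_mono_neutral_cong_left) (use assms in auto)
  then show ?thesis using assms w(1) unfolding wsum_def by (intro conjI exI) auto
qed

lemma wsum_add: assumes "wsum C v" "wsum C w" shows "wsum C (v +\<^sub>M w)"
proof -
  obtain x y where x: "\<forall>c\<in>C. wt c (x c)" "v = finsum M x C" and y: "\<forall>c\<in>C. wt c (y c)" "w = finsum M y C"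
    using assms by (auto simp: wsum_def)
  then have "x \<in> C \<rightarrow> Mc" "y \<in> C \<rightarrow> Mc" using wt_closed by blast+
  then have "v +\<^sub>M w = finsum M (\<lambda>c. x c +\<^sub>M y c) C"
    by (simp add: x(2) y(2) M.M.finsum_addf)
  then show ?thesis using assms x y unfolding wsum_def by (intro conjI exI[of _ "\<lambda>c. x c +\<^sub>M y c"]) (auto intro: wt_add)
qed

lemma wsum_sc: assumes "wsum C v" shows "wsum C (d \<cdot> v)"
proof -
  obtain x where x: "\<forall>c\<in>C. wt c (x c)" "v = finsum M x C" using assms by (auto simp: wsum_def)
  then have "x \<in> C \<rightarrow> Mc" using wt_closed by blast
  then have "d \<cdot> v = finsum M (\<lambda>c. d \<cdot> x c) C"
    using assms by (simp add: x(2) sc_finsum wsum_def)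
  then show ?thesis using assms x unfolding wsum_def by (intro conjI exI[of _ "\<lambda>c. d \<cdot> x c"]) (auto intro: wt_sc)
qed

lemma wsum_wt: "wt c v \<Longrightarrow> wsum {c} v"
  unfolding wsum_def using wt_closed by (intro conjI exI[of _ "\<lambda>_. v"]) auto

text \<open>Subtracting the two expressions gives a weight decomposition of 0 over the union of
  \<open>C\<close> and \<open>D\<close>, whose components must vanish.\<close>

lemma wsum_disjoint:
  assumes "wsum C v" "wsum D v" "C \<inter> D = {}" shows "v = Z"
proof -
  obtain x y where fin: "finite C" "finite D" and x: "\<forall>c\<in>C. wt c (x c)" "v = finsum M x C"
    and y: "\<forall>c\<in>D. wt c (y c)" "v = finsum M y D"
    using assms(1,2) by (auto simp: wsum_def)
  let ?y = "\<lambda>c. (- 1) \<cdot> y c" and ?w = "\<lambda>c. if c \<in> C then x c else (- 1) \<cdot> y c"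
  have xy: "x \<in> C \<rightarrow> Mc" "y \<in> D \<rightarrow> Mc" using x(1) y(1) wt_closed by blast+
  then have vc: "v \<in> Mc" unfolding x(2) by simp
  have "finsum M ?w (C \<union> D) = finsum M ?w C +\<^sub>M finsum M ?w D"
    using fin assms(3) xy by (intro M.M.finsum_Un_disjoint) (auto simp: Pi_iff)
  also have "finsum M ?w C = v" unfolding x(2) by (rule M.M.finsum_cong') (use xy in auto)
  also have "finsum M ?w D = finsum M ?y D"
    by (rule M.M.finsum_cong') (use xy assms(3) in \<open>auto simp: Pi_iff\<close>)
  also have "finsum M ?y D = (- 1) \<cdot> v"
    unfolding y(2) using fin xy by (simp add: sc_finsum)
  finally have fs: "finsum M ?w (C \<union> D) \<in> {Z}" using vc by (simp add: sc_minus M.M.r_neg)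
  have ww: "wt c (?w c)" if "c \<in> C \<union> D" for c
    using x(1) y(1) that by (cases "c \<in> C") (auto intro: wt_sc)
  have "?w c \<in> {Z}" if "c \<in> C \<union> D" for c
    by (rule weight_components[OF h_subspace_zero _ _ ww fs that]) (use fin in auto)
  then have "x c = Z" if "c \<in> C" for c using that by force
  then have "v = finsum M (\<lambda>_. Z) C" unfolding x(2) by (intro M.M.finsum_cong') auto
  then show ?thesis by simp
qed

lemma diagonal_wsum:
  assumes "diagonal_in L h b M" "v \<in> Mc"
  obtains C where "wsum C v" "C \<subseteq> (\<lambda>k. b + of_int k) ` UNIV"
proof -
  let ?R = "range (\<lambda>k. b + of_int k)"
  let ?X = "{v \<in> Mc. \<exists>C. wsum C v \<and> C \<subseteq> ?R}"
  have "lspan (underlying L M) (\<Union>k::int. weight_space L h M (b + of_int k)) \<subseteq> ?X"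
  proof (rule space.lspan_least)
    show "(\<Union>k::int. weight_space L h M (b + of_int k)) \<subseteq> ?X"
      using wsum_wt wt_closed by (fastforce simp: weight_space_eq)
    show "\<zero>\<^bsub>underlying L M\<^esub> \<in> ?X" using wsum_zero[of "{}"] by auto
    show "v \<oplus>\<^bsub>underlying L M\<^esub> w \<in> ?X" if v: "v \<in> ?X" and w: "w \<in> ?X" for v w
    proof -
      obtain C D where "wsum C v" "C \<subseteq> ?R" "wsum D w" "D \<subseteq> ?R" using v w by blast
      then have "wsum (C \<union> D) v" "wsum (C \<union> D) w" "C \<union> D \<subseteq> ?R"
        using wsum_mono[of C v "C \<union> D"] wsum_mono[of D w "C \<union> D"] by (auto simp: wsum_def)
      then have "wsum (C \<union> D) (v +\<^sub>M w)" by (intro wsum_add)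
      then show ?thesis using v w \<open>C \<union> D \<subseteq> ?R\<close> by auto
    qed
    show "c \<odot>\<^bsub>underlying L M\<^esub> v \<in> ?X" if "v \<in> ?X" for c v using that wsum_sc by auto
  qed auto
  then show ?thesis using that assms unfolding diagonal_in_def by blast
qed

lemma diagonal_inI:
  assumes "\<And>v. v \<in> Mc \<Longrightarrow> \<exists>C. wsum C v \<and> C \<subseteq> (\<lambda>k. b + of_int k) ` UNIV"
  shows "diagonal_in L h b M"
proof -
  let ?W = "\<Union>k::int. weight_space L h M (b + of_int k)"
  have W: "?W \<subseteq> carrier (underlying L M)" using wt_closed by (auto simp: weight_space_eq)
  have "v \<in> lspan (underlying L M) ?W" if v: "v \<in> Mc" for v
  proof -
    obtain C w where C: "finite C" "C \<subseteq> (\<lambda>k. b + of_int k) ` UNIV" "\<forall>c\<in>C. wt c (w c)" "v = finsum M w C"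
      using assms[OF v] by (auto simp: wsum_def)
    have "finsum M w C \<in> lspan (underlying L M) ?W"
      using C(1-3)
    proof (induction rule: finite_induct)
      case empty
      then show ?case using space.lspan_zero by simp
    next
      case (insert c C)
      then have cw: "w \<in> C \<rightarrow> Mc" "w c \<in> Mc" using wt_closed by auto
      obtain k :: int where "c = b + of_int k" using insert.prems by auto
      then have "w c \<in> ?W" using insert.prems by (auto simp: weight_space_eq)
      then have "w c \<in> lspan (underlying L M) ?W" by (rule space.lspan_base[OF W])
      then show ?case using space.lspan_add[OF W] insert by (simp add: M.M.finsum_insert[OF insert.hyps cw])
    qed
    then show ?thesis using C by simp
  qed
  then show ?thesis using space.lspan_closed[OF W] unfolding diagonal_in_def by auto
qed

text \<open>Modulo \<open>S\<close>, suppose that f and e^(k+1) kill v. Then \<open>e_pow_f\<close>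
  leaves (k+1)(l+k) e^k v = 0, and l + k is nonzero as l is not an integer; so e^k already kills v,
  and k descends to 0.\<close>

lemma wt_f_injective:
  assumes S: "h_subspace S" "\<And>v. v \<in> S \<Longrightarrow> X e v \<in> S" "\<And>v. v \<in> S \<Longrightarrow> X f v \<in> S"
    and v: "wt l v" and l: "l \<notin> \<int>" and fv: "X f v \<in> S"
  shows "(X e ^^ k) v \<in> S \<Longrightarrow> v \<in> S"
proof (induction k)
  case (Suc k)
  note vc = wt_closed[OF v]
  have ek: "(X e ^^ m) w \<in> S" if "w \<in> S" for w m by (induction m) (use that S in auto)
  let ?c = "of_nat (Suc k) * (l + of_nat k)"
  have "l + of_nat k \<noteq> 0"
  proof
    assume "l + of_nat k = 0"
    then have "l = - of_nat k" by (simp add: eq_neg_iff_add_eq_0)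
    then show False using l by simp
  qed
  then have c0: "?c \<noteq> 0" by (simp del: of_nat_Suc)
  have "?c \<cdot> (X e ^^ k) v \<in> S"
  proof (rule h_subspace_diff[OF S(1)])
    show "X f ((X e ^^ Suc k) v) \<in> S" using S(3) Suc.prems by blast
    have "X f ((X e ^^ Suc k) v) +\<^sub>M ?c \<cdot> (X e ^^ k) v \<in> S"
      using ek[OF fv, of "Suc k"] unfolding e_pow_f[OF v] .
    then show "?c \<cdot> (X e ^^ k) v +\<^sub>M X f ((X e ^^ Suc k) v) \<in> S"
      using vc by (simp only: M.M.a_comm act_closed act_pow_closed sc_closed)
  qed (use vc in simp)
  then have "(X e ^^ k) v \<in> S" by (rule h_subspace_cancel[OF S(1) c0 act_pow_closed[OF vc]])
  then show ?case by (rule Suc.IH)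
qed simp

text \<open>For non-integral weights \<open>f\<close> is injective modulo submodules of a module on which \<open>e\<close> is
  locally nilpotent.\<close>

lemma f_injective:
  assumes S: "h_subspace S" "\<And>v. v \<in> S \<Longrightarrow> X e v \<in> S" "\<And>v. v \<in> S \<Longrightarrow> X f v \<in> S"
    and diag: "diagonal_in L h b M" and b: "b \<notin> \<int>" and nil: "locally_nilpotent L e M"
    and v: "v \<in> Mc" and fv: "X f v \<in> S"
  shows "v \<in> S"
proof -
  obtain C where "wsum C v" and R: "C \<subseteq> range (\<lambda>k. b + of_int k)" using diagonal_wsum[OF diag v] .
  then obtain w where C: "finite C" "\<forall>c\<in>C. wt c (w c)" "v = finsum M w C" by (auto simp: wsum_def)
  have wc: "w \<in> C \<rightarrow> Mc" using C wt_closed by auto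
  have "finsum M (\<lambda>c. X f (w c)) C \<in> S" using fv C wc by (simp add: act_finsum)
  then have fw: "X f (w c) \<in> S" if "c \<in> C" for c
    using weight_components[OF S(1) C(1), of "\<lambda>c. c - 2" "\<lambda>c. X f (w c)" c] C(2) that wt_f
    by (auto simp: inj_on_def)
  have "w c \<in> S" if c: "c \<in> C" for c
  proof -
    obtain k where "(X e ^^ k) (w c) = Z"
      using nil wc c unfolding locally_nilpotent_def torsion_def by blast
    then have "(X e ^^ k) (w c) \<in> S" using h_subspaceD(2)[OF S(1)] by simp
    moreover have "c \<notin> \<int>"
    proof -
      obtain m :: int where "c = b + of_int m" using R c by auto
      then show ?thesis using b Ints_diff[of c "of_int m"] by auto
    qed
    ultimately show ?thesis using wt_f_injective[OF S, of c "w c" k] C(2) c fw by blast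
  qed
  note wS = this
  have "finsum M w A \<in> S" if "finite A" "A \<subseteq> C" for A
    using that
  proof (induction rule: finite_induct)
    case (insert a A)
    then have aw: "w \<in> A \<rightarrow> Mc" "w a \<in> Mc" using wc by auto
    show ?case using insert wS h_subspaceD(3)[OF S(1)] by (simp add: M.M.finsum_insert[OF insert.hyps aw])
  qed (simp add: h_subspaceD(2)[OF S(1)])
  then show ?thesis using C by blast
qed

section \<open>The part on which \<open>e\<close> acts locally nilpotently\<close>

lemma torsion_closed: "v \<in> torsion L x M \<Longrightarrow> v \<in> Mc" by (simp add: torsion_def)

lemma act_pow_mono: "(X x ^^ n) v = Z \<Longrightarrow> n \<le> m \<Longrightarrow> (X x ^^ m) v = Z"
  by (metis act_pow_zero comp_apply funpow_add le_add_diff_inverse2)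

lemma torsion_add:
  assumes "v \<in> torsion L x M" "w \<in> torsion L x M" shows "v +\<^sub>M w \<in> torsion L x M"
proof -
  obtain n m where "v \<in> Mc" "w \<in> Mc" "(X x ^^ n) v = Z" "(X x ^^ m) w = Z" using assms by (auto simp: torsion_def)
  then have "(X x ^^ (n + m)) (v +\<^sub>M w) = Z"
    using act_pow_mono[of n x v "n + m"] act_pow_mono[of m x w "n + m"] by (simp add: act_pow_add)
  then show ?thesis using \<open>v \<in> Mc\<close> \<open>w \<in> Mc\<close> by (auto simp: torsion_def)
qed

text \<open>Each of n + m factors e acts either on v or, through ad e, on x. Local nilpotency of ad
  e on the whole Lie superalgebra is what makes the e-torsion a submodule.\<close>

lemma torsion_act:
  assumes v: "v \<in> torsion L e M" shows "X x v \<in> torsion L e M"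
proof -
  obtain n where "v \<in> Mc" "(X e ^^ n) v = Z" using v by (auto simp: torsion_def)
  moreover obtain m where "(brk L e ^^ m) x = 0" using brk_nilpotent(2) by blast
  ultimately have "(X e ^^ (n + m)) (X x v) = Z"
  proof (induction "n + m" arbitrary: n m v x)
    case 0
    then show ?case by simp
  next
    case (Suc k)
    have "(X e ^^ k) (X x (X e v)) = Z"
    proof (cases n)
      case 0
      then show ?thesis using Suc.prems by simp
    next
      case (Suc n')
      then show ?thesis using Suc.hyps(1)[of n' m "X e v" x] Suc.hyps(2) Suc.prems by (simp add: funpow_swap1)
    qed
    moreover have "(X e ^^ k) (X (brk L e x) v) = Z"
    proof (cases m)
      case 0
      then have "x = 0" using Suc.prems by simp
      moreover have "brk L e 0 = 0" using brk_add_right[of e 0 0] by simp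
      moreover have "X 0 v = Z" using Suc.prems(1) by (simp add: act_def in_env_zero)
      ultimately show ?thesis by simp
    next
      case (Suc m')
      then show ?thesis using Suc.hyps(1)[of n m' v "brk L e x"] Suc.hyps(2) Suc.prems by (simp add: funpow_swap1)
    qed
    ultimately have "(X e ^^ Suc k) (X x v) = Z"
      using Suc.prems(1) by (simp add: funpow_swap1 act_brk[OF even(1)] act_pow_add)
    then show ?case using Suc.hyps(2) by simp
  qed
  then show ?thesis using \<open>v \<in> Mc\<close> by (auto simp: torsion_def)
qed

lemma torsion_sc: "v \<in> torsion L x M \<Longrightarrow> c \<cdot> v \<in> torsion L x M"
  unfolding torsion_def by (auto simp: act_pow_sc) (metis sc_zero_right)

lemma torsion_zero: "Z \<in> torsion L x M" by (simp add: torsion_def)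

lemma torsion_smult:
  assumes u: "u \<in> carrier U" and "v \<in> torsion L e M" shows "u \<odot>\<^bsub>M\<^esub> v \<in> torsion L e M"
proof -
  from u have "\<forall>v\<in>torsion L e M. u \<odot>\<^bsub>M\<^esub> v \<in> torsion L e M"
  proof (induction rule: env_induct)
    case (sc c)
    then show ?case using torsion_sc[of _ e c] by (simp add: csc_def)
  next
    case (in_env x)
    then show ?case using torsion_act[of _ x] by (simp add: act_def)
  next
    case (mult u v)
    then show ?case using torsion_closed by (simp add: M.smult_assoc)
  next
    case (add u v)
    then show ?case using torsion_closed by (simp add: M.smult_l_distr torsion_add)
  qed
  then show ?thesis using assms by blast
qed

text \<open>From e^n h = (h - 2n) e^n. The exponent is fixed so that, by
  \<open>weight_components\<close>, all weight components of a torsion vector are killed by the same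
  power of e.\<close>

lemma torsion_h_subspace: "h_subspace {v \<in> Mc. (X e ^^ n) v = Z}"
proof -
  have "(X e ^^ n) (X h v) = Z" if "v \<in> Mc" "(X e ^^ n) v = Z" for v
  proof -
    have "(X e ^^ n) (X h v) +\<^sub>M (2 * of_nat n) \<cdot> (X e ^^ n) v = X h ((X e ^^ n) v)" for n
    proof (induction n)
      case (Suc n)
      have "X h ((X e ^^ Suc n) v) = X e (X h ((X e ^^ n) v)) +\<^sub>M 2 \<cdot> (X e ^^ Suc n) v"
        using that(1) by (simp add: h_e)
      also have "\<dots> = (X e ^^ Suc n) (X h v) +\<^sub>M ((2 * of_nat n) \<cdot> (X e ^^ Suc n) v +\<^sub>M 2 \<cdot> (X e ^^ Suc n) v)"
        using that(1) by (simp add: Suc[symmetric] act_add act_sc M.M.a_assoc)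
      also have "(2 * of_nat n) \<cdot> (X e ^^ Suc n) v +\<^sub>M 2 \<cdot> (X e ^^ Suc n) v = (2 * of_nat (Suc n)) \<cdot> (X e ^^ Suc n) v"
        using that(1) by (simp only: sc_add_left[symmetric] act_pow_closed) (simp add: algebra_simps)
      finally show ?case by simp
    qed (use that in simp)
    from this[of n] show ?thesis using that by simp
  qed
  then show ?thesis by (auto simp: h_subspace_def act_pow_add act_pow_sc)
qed

lemma torsion_components:
  assumes "wsum C v" "v \<in> torsion L e M"
  obtains w where "finite C" "\<And>c. c \<in> C \<Longrightarrow> wt c (w c)" "\<And>c. c \<in> C \<Longrightarrow> w c \<in> torsion L e M" "v = finsum M w C"
proof -
  obtain w where w: "finite C" "\<forall>c\<in>C. wt c (w c)" "v = finsum M w C" using assms(1) by (auto simp: wsum_def)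
  obtain n where "(X e ^^ n) v = Z" "v \<in> Mc" using assms(2) by (auto simp: torsion_def)
  then have "w c \<in> {v \<in> Mc. (X e ^^ n) v = Z}" if "c \<in> C" for c
    using weight_components[OF torsion_h_subspace, of C "\<lambda>c. c" w n c] w that by (simp add: inj_on_def)
  then show ?thesis using that[of w] w by (auto simp: torsion_def)
qed

text \<open>If C[e]v is finite dimensional, all e^k v have weights in a common finite set, whereas
  e^k moves the weights of v by 2k, out of that set for some k; hence that e^k v is zero. The
  Enright functor may therefore be computed as an e-torsion part.\<close>

lemma finite_vectors_torsion:
  assumes diag: "diagonal_in L h b M"
  shows "finite_vectors L e M = torsion L e M"
proof (intro equalityI subsetI)
  fix v assume "v \<in> torsion L e M"
  then obtain n where v: "v \<in> Mc" "(X e ^^ n) v = Z" by (auto simp: torsion_def)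
  let ?B = "(\<lambda>k. (X e ^^ k) v) ` {..<n}"
  have B: "?B \<subseteq> carrier (underlying L M)" "range (\<lambda>k. (X e ^^ k) v) \<subseteq> carrier (underlying L M)" using v by auto
  have "range (\<lambda>k. (X e ^^ k) v) \<subseteq> lspan (underlying L M) ?B"
  proof clarify
    fix k
    show "(X e ^^ k) v \<in> lspan (underlying L M) ?B"
    proof (cases "k < n")
      case True
      then show ?thesis by (intro space.lspan_base[OF B(1)]) auto
    next
      case False
      then have "(X e ^^ k) v = Z" using act_pow_mono[OF v(2)] by simp
      then show ?thesis using space.lspan_zero by simp
    qed
  qed
  then have "cyclic L e M v \<subseteq> lspan (underlying L M) ?B"
    unfolding cyclic_def
    by (rule space.lspan_least)
      (use space.lspan_closed[OF B(1)] space.lspan_add[OF B(1)] space.lspan_smult[OF B(1)] space.lspan_zero in auto)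
  moreover have "lspan (underlying L M) ?B \<subseteq> cyclic L e M v"
    unfolding cyclic_def
    by (rule space.lspan_least)
      (use space.lspan_base[OF B(2)] space.lspan_closed[OF B(2)] space.lspan_add[OF B(2)]
        space.lspan_smult[OF B(2)] space.lspan_zero in auto)
  ultimately show "v \<in> finite_vectors L e M"
    unfolding finite_vectors_def using v(1) B(1) by (intro CollectI conjI exI[of _ ?B]) auto
next
  fix v assume "v \<in> finite_vectors L e M"
  then obtain B where v: "v \<in> Mc" and B: "finite B" "B \<subseteq> Mc" "cyclic L e M v = lspan (underlying L M) B"
    by (auto simp: finite_vectors_def)
  have "\<exists>D. finite D \<and> (\<forall>b\<in>B. wsum D b)"
    using B(1,2)
  proof (induction rule: finite_induct)
    case (insert b B)
    then obtain D where D: "finite D" "\<forall>b\<in>B. wsum D b" by auto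
    have "b \<in> Mc" using insert.prems by simp
    then obtain C where C: "wsum C b" by (rule diagonal_wsum[OF diag])
    then have "finite C" by (simp add: wsum_def)
    then show ?case using D C by (intro exI[of _ "C \<union> D"]) (auto intro: wsum_mono)
  qed auto
  then obtain D where D: "finite D" "\<And>b. b \<in> B \<Longrightarrow> wsum D b" by blast
  have "lspan (underlying L M) B \<subseteq> {w \<in> Mc. wsum D w}"
    by (rule space.lspan_least) (use B D in \<open>auto intro: wsum_add wsum_sc wsum_zero\<close>)
  moreover have "(X e ^^ k) v \<in> cyclic L e M v" for k
    unfolding cyclic_def by (rule space.lspan_base) (use v in auto)
  ultimately have ekD: "wsum D ((X e ^^ k) v)" for k using B(3) by blast
  obtain C where C: "wsum C v" by (rule diagonal_wsum[OF diag v])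
  then have "finite C" by (simp add: wsum_def)
  have ekC: "wsum ((\<lambda>c. c + 2 * of_nat k) ` C) ((X e ^^ k) v)" for k
  proof -
    obtain w where w: "\<forall>c\<in>C. wt c (w c)" "v = finsum M w C" using C by (auto simp: wsum_def)
    have wM: "w \<in> C \<rightarrow> Mc" using w(1) wt_closed by blast
    then have fs: "(X e ^^ k) (finsum M w C) = finsum M (\<lambda>c. (X e ^^ k) (w c)) C"
      by (induction k) (use \<open>finite C\<close> in \<open>auto simp: act_finsum Pi_iff\<close>)
    have "wsum ((\<lambda>c. c + 2 * of_nat k) ` C) (finsum M (\<lambda>c. (X e ^^ k) (w c)) A)" if "finite A" "A \<subseteq> C" for A
      using that
    proof (induction rule: finite_induct)
      case empty
      then show ?case using \<open>finite C\<close> by (simp add: wsum_zero)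
    next
      case (insert c A)
      then have aw: "(\<lambda>c. (X e ^^ k) (w c)) \<in> A \<rightarrow> Mc" "(X e ^^ k) (w c) \<in> Mc" using wM by (auto simp: Pi_iff subset_iff)
      have "wsum {c + 2 * of_nat k} ((X e ^^ k) (w c))"
        by (rule wsum_wt[OF wt_e_pow]) (use w insert in auto)
      then have "wsum ((\<lambda>c. c + 2 * of_nat k) ` C) ((X e ^^ k) (w c))"
        by (rule wsum_mono) (use insert \<open>finite C\<close> in auto)
      then show ?case using insert by (simp add: M.M.finsum_insert[OF insert.hyps aw] wsum_add)
    qed
    then show ?thesis using \<open>finite C\<close> unfolding w(2) fs by blast
  qed
  have "finite (of_nat -` ((\<lambda>(d, c). (d - c) / 2) ` (D \<times> C)) :: nat set)"
    using D(1) \<open>finite C\<close> by (intro finite_vimageI finite_imageI finite_cartesian_product inj_of_nat)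
  from ex_new_if_finite[OF infinite_UNIV_nat this]
  obtain k :: nat where k: "of_nat k \<notin> (\<lambda>(d, c). (d - c) / 2) ` (D \<times> C)" by auto
  have "(\<lambda>c. c + 2 * of_nat k) ` C \<inter> D = {}"
  proof (rule ccontr)
    assume "(\<lambda>c. c + 2 * of_nat k) ` C \<inter> D \<noteq> {}"
    then obtain c where "c \<in> C" "c + 2 * of_nat k \<in> D" by blast
    then have "of_nat k \<in> (\<lambda>(d, c). (d - c) / 2) ` (D \<times> C)"
      by (intro image_eqI[of _ _ "(c + 2 * of_nat k, c)"]) auto
    then show False using k by blast
  qed
  from wsum_disjoint[OF ekC ekD this] show "v \<in> torsion L e M" using v by (auto simp: torsion_def)
qed

end

section \<open>Weights and torsion in the twisted localization\<close>

lemma gchoose_two: "(a :: complex) gchoose Suc (Suc 0) = a * (a - 1) / 2"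
  by (simp add: gbinomial_prod_rev numeral_2_eq_2)

context sl2_superalgebra
begin

lemma brk_f: "brk L f h = scl L 2 f" "brk L f e = scl L (- 1) h"
proof -
  interpret vector_space "scl L" by (rule vector_space)
  show "brk L f h = scl L 2 f" "brk L f e = scl L (- 1) h"
    using brk_swap[OF even(3,2)] brk_swap[OF even(3,1)] by (simp_all add: brk)
qed

lemma ad_iota: "tw.ad (\<iota> (in_env L x)) = \<iota> (in_env L (brk L f x))"
proof -
  have "tw.ad (\<iota> (in_env L x)) = \<iota> (env.comm (in_env L f) (in_env L x))"
    by (simp add: tw.ad_def env.comm_def lenv.minus_eq env.minus_eq)
  then show ?thesis by (simp add: even_comm[OF even(3)])
qed

lemma ad_F: "tw.ad F = \<zero>\<^bsub>V\<^esub>"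
  by (simp add: tw.ad_def lenv.minus_eq lenv.r_neg)

lemma ad_h: "tw.ad (\<iota> (in_env L h)) = K 2 \<otimes>\<^bsub>V\<^esub> F"
  by (simp add: ad_iota brk_f in_env_scl)

lemma ad_e: "tw.ad (\<iota> (in_env L e)) = K (- 1) \<otimes>\<^bsub>V\<^esub> \<iota> (in_env L h)"
  by (simp add: ad_iota brk_f in_env_scl)

lemma ad_h2: "tw.ad (K 2 \<otimes>\<^bsub>V\<^esub> F) = \<zero>\<^bsub>V\<^esub>"
  by (simp only: tw.ad_K ad_F iota_closed lenv.r_null)

lemma nl_h: "tw.nl (\<iota> (in_env L h)) = K 2"
  by (simp add: tw.nl_def ad_h lenv.m_assoc F_Fi)

lemma twist_h: "tw.twst a (\<iota> (in_env L h)) = \<iota> (in_env L h) \<oplus>\<^bsub>V\<^esub> K (2 * a)"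
proof -
  have n: "(tw.ad ^^ Suc (Suc 0)) (\<iota> (in_env L h)) = \<zero>\<^bsub>V\<^esub>" by (simp only: funpow.simps comp_apply id_apply ad_h ad_h2)
  have "tw.twst a (\<iota> (in_env L h)) = K a \<otimes>\<^bsub>V\<^esub> K 2 \<oplus>\<^bsub>V\<^esub> \<iota> (in_env L h)"
    by (simp add: tw.twst_eq[OF iota_closed n] lessThan_Suc nl_h K_one del: iota.hom_mult)
  then show ?thesis by (simp only: K_mult[symmetric] mult.commute lenv.a_comm iota_closed)
qed

text \<open>The series stops at (ad f)^3 e = 0 and yields phi_a(e) = e - a h f^(-1) - a(a-1) f^(-1).
  Multiplying by f on the left clears the denominator; f h f^(-1) = h + 2 turns the constant a(a-1)
  into a(a-1) + 2a = a(a+1).\<close>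

lemma twist_e: "F \<otimes>\<^bsub>V\<^esub> tw.twst a (\<iota> (in_env L e)) =
    F \<otimes>\<^bsub>V\<^esub> \<iota> (in_env L e) \<oplus>\<^bsub>V\<^esub> (K (- a) \<otimes>\<^bsub>V\<^esub> \<iota> (in_env L h) \<oplus>\<^bsub>V\<^esub> K (- (a * (a + 1))))"
proof -
  let ?e = "\<iota> (in_env L e)" and ?h = "\<iota> (in_env L h)"
  have ad2: "tw.ad (K (- 1) \<otimes>\<^bsub>V\<^esub> ?h) = K (- 2) \<otimes>\<^bsub>V\<^esub> F"
    by (simp only: tw.ad_K ad_h iota_closed lenv.m_assoc[symmetric] K_mult[symmetric]) simp
  have n: "(tw.ad ^^ Suc (Suc (Suc 0))) ?e = \<zero>\<^bsub>V\<^esub>"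
    by (simp only: funpow.simps comp_apply id_apply ad_e ad2 tw.ad_K ad_F iota_closed lenv.r_null)
  have nl1: "tw.nl ?e = K (- 1) \<otimes>\<^bsub>V\<^esub> (?h \<otimes>\<^bsub>V\<^esub> Fi)"
    by (simp only: tw.nl_def ad_e lenv.m_assoc iota_closed Fi_closed)
  have nl2: "tw.nl (K (- 1) \<otimes>\<^bsub>V\<^esub> (?h \<otimes>\<^bsub>V\<^esub> Fi)) = K (- 2) \<otimes>\<^bsub>V\<^esub> Fi"
  proof -
    have "(tw.ad ^^ Suc (Suc 0)) ?e = K (- 2) \<otimes>\<^bsub>V\<^esub> F"
      by (simp only: funpow.simps comp_apply id_apply ad_e ad2)
    then have "(tw.nl ^^ Suc (Suc 0)) ?e = K (- 2) \<otimes>\<^bsub>V\<^esub> F \<otimes>\<^bsub>V\<^esub> Fi [^]\<^bsub>V\<^esub> Suc (Suc 0)"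
      by (simp only: tw.nl_pow[OF iota_closed])
    then have "(tw.nl ^^ Suc (Suc 0)) ?e = K (- 2) \<otimes>\<^bsub>V\<^esub> Fi"
      by (simp add: lenv.m_assoc del: iota.hom_mult funpow.simps)
    then show ?thesis by (simp only: funpow.simps comp_apply id_apply nl1)
  qed
  have "tw.twst a ?e = K (a * (a - 1) / 2) \<otimes>\<^bsub>V\<^esub> (K (- 2) \<otimes>\<^bsub>V\<^esub> Fi) \<oplus>\<^bsub>V\<^esub>
      (K a \<otimes>\<^bsub>V\<^esub> (K (- 1) \<otimes>\<^bsub>V\<^esub> (?h \<otimes>\<^bsub>V\<^esub> Fi)) \<oplus>\<^bsub>V\<^esub> ?e)"
    unfolding tw.twst_eq[OF iota_closed n]
    by (simp add: lessThan_Suc nl1 nl2 gchoose_two K_one del: iota.hom_mult)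
  also have "K (a * (a - 1) / 2) \<otimes>\<^bsub>V\<^esub> (K (- 2) \<otimes>\<^bsub>V\<^esub> Fi) = K (- (a * (a - 1))) \<otimes>\<^bsub>V\<^esub> Fi"
    by (simp only: lenv.m_assoc[symmetric] iota_closed Fi_closed K_mult[symmetric]) simp
  also have "K a \<otimes>\<^bsub>V\<^esub> (K (- 1) \<otimes>\<^bsub>V\<^esub> (?h \<otimes>\<^bsub>V\<^esub> Fi)) = K (- a) \<otimes>\<^bsub>V\<^esub> (?h \<otimes>\<^bsub>V\<^esub> Fi)"
    by (simp only: lenv.m_assoc[symmetric] iota_closed Fi_closed lenv.m_closed K_mult[symmetric]) simp
  finally have "F \<otimes>\<^bsub>V\<^esub> tw.twst a ?e = F \<otimes>\<^bsub>V\<^esub> (K (- (a * (a - 1))) \<otimes>\<^bsub>V\<^esub> Fi) \<oplus>\<^bsub>V\<^esub>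
      (F \<otimes>\<^bsub>V\<^esub> (K (- a) \<otimes>\<^bsub>V\<^esub> (?h \<otimes>\<^bsub>V\<^esub> Fi)) \<oplus>\<^bsub>V\<^esub> F \<otimes>\<^bsub>V\<^esub> ?e)"
    by (simp only: lenv.r_distr iota_closed Fi_closed lenv.m_closed lenv.a_closed)
  also have "F \<otimes>\<^bsub>V\<^esub> (K (- (a * (a - 1))) \<otimes>\<^bsub>V\<^esub> Fi) = K (- (a * (a - 1)))"
    by (simp only: lenv.m_assoc[symmetric] iota_closed Fi_closed K_central[of F, symmetric])
      (simp only: lenv.m_assoc iota_closed Fi_closed F_Fi lenv.r_one)
  also have "F \<otimes>\<^bsub>V\<^esub> (K (- a) \<otimes>\<^bsub>V\<^esub> (?h \<otimes>\<^bsub>V\<^esub> Fi)) = K (- a) \<otimes>\<^bsub>V\<^esub> tw.Ad ?h"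
    by (simp only: tw.Ad_def lenv.m_assoc[symmetric] iota_closed Fi_closed lenv.m_closed K_central[of F, symmetric])
  also have "tw.Ad ?h = ?h \<oplus>\<^bsub>V\<^esub> K 2" by (simp only: tw.Ad_eq iota_closed nl_h)
  also have "K (- a) \<otimes>\<^bsub>V\<^esub> (?h \<oplus>\<^bsub>V\<^esub> K 2) = K (- a) \<otimes>\<^bsub>V\<^esub> ?h \<oplus>\<^bsub>V\<^esub> K (- a * 2)"
    by (simp only: lenv.r_distr iota_closed K_mult)
  also have "K (- (a * (a - 1))) \<oplus>\<^bsub>V\<^esub> (K (- a) \<otimes>\<^bsub>V\<^esub> ?h \<oplus>\<^bsub>V\<^esub> K (- a * 2) \<oplus>\<^bsub>V\<^esub> F \<otimes>\<^bsub>V\<^esub> ?e) =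
      F \<otimes>\<^bsub>V\<^esub> ?e \<oplus>\<^bsub>V\<^esub> (K (- a) \<otimes>\<^bsub>V\<^esub> ?h \<oplus>\<^bsub>V\<^esub> (K (- (a * (a - 1))) \<oplus>\<^bsub>V\<^esub> K (- a * 2)))"
    by (simp only: lenv.a_ac iota_closed lenv.m_closed lenv.a_closed)
  also have "K (- (a * (a - 1))) \<oplus>\<^bsub>V\<^esub> K (- a * 2) = K (- (a * (a + 1)))"
    by (simp only: K_add[symmetric]) (simp add: algebra_simps)
  finally show ?thesis .
qed

lemma wsum_image:
  assumes "sl2_module L e h f M" "sl2_module L e h f M'"
    and closed: "\<And>v. v \<in> carrier M \<Longrightarrow> \<phi> v \<in> carrier M'"
    and add: "\<And>v w. v \<in> carrier M \<Longrightarrow> w \<in> carrier M \<Longrightarrow> \<phi> (v \<oplus>\<^bsub>M\<^esub> w) = \<phi> v \<oplus>\<^bsub>M'\<^esub> \<phi> w"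
    and wt: "\<And>c v. sl2_module.wt L h M c v \<Longrightarrow> sl2_module.wt L h M' (g c) (\<phi> v)"
    and v: "sl2_module.wsum L h M C v"
  shows "sl2_module.wsum L h M' (g ` C) (\<phi> v)"
proof -
  interpret M: sl2_module L e h f M by fact
  interpret M': sl2_module L e h f M' by fact
  obtain w where w: "finite C" "\<forall>c\<in>C. M.wt c (w c)" "v = finsum M w C" using v by (auto simp: M.wsum_def)
  have wM: "w \<in> C \<rightarrow> carrier M" using w(2) M.wt_closed by blast
  have "\<phi> \<zero>\<^bsub>M\<^esub> \<oplus>\<^bsub>M'\<^esub> \<phi> \<zero>\<^bsub>M\<^esub> = \<phi> \<zero>\<^bsub>M\<^esub>" using add[of "\<zero>\<^bsub>M\<^esub>" "\<zero>\<^bsub>M\<^esub>"] by simp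
  then have z: "\<phi> \<zero>\<^bsub>M\<^esub> = \<zero>\<^bsub>M'\<^esub>"
    using closed[of "\<zero>\<^bsub>M\<^esub>"] by (metis M'.M.M.add.l_cancel_one' M.M.M.zero_closed)
  have "M'.wsum (g ` C) (\<phi> (finsum M w A))" if "finite A" "A \<subseteq> C" for A
    using that
  proof (induction rule: finite_induct)
    case empty
    then show ?case using w(1) by (simp add: z M'.wsum_zero)
  next
    case (insert c A)
    then have aw: "w \<in> A \<rightarrow> carrier M" "w c \<in> carrier M" using wM by (auto simp: Pi_iff)
    have "M'.wsum {g c} (\<phi> (w c))" by (rule M'.wsum_wt[OF wt]) (use w insert in auto)
    then have "M'.wsum (g ` C) (\<phi> (w c))" by (rule M'.wsum_mono) (use insert w in auto)
    moreover have "\<phi> (finsum M w (insert c A)) = \<phi> (w c) \<oplus>\<^bsub>M'\<^esub> \<phi> (finsum M w A)"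
      using aw by (simp add: M.M.M.finsum_insert[OF insert.hyps aw] add)
    ultimately show ?case using insert.IH insert.prems M'.wsum_add by auto
  qed
  then show ?thesis using w by blast
qed

lemma left_module_restrict: "left_module V M \<Longrightarrow> left_module U (restrict_scalars L f M)"
proof -
  assume "left_module V M"
  then interpret M: left_module V M .
  have "abelian_group (restrict_scalars L f M)"
    by (rule abelian_group_cong[OF M.M.abelian_group_axioms]) (simp_all add: restrict_scalars_def)
  then show ?thesis
    by (intro left_moduleI env.ring_axioms)
      (simp_all add: restrict_scalars_def M.smult_closed M.smult_l_distr M.smult_r_distr M.smult_assoc
        M.smult_one iota_one)
qed

end

locale twisted_module = sl2_superalgebra L e h f
  for L :: "'g::ab_group_add superalg" and e h f +
  fixes N :: "('g, 'm) gmod" and a :: complex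
  assumes N_module: "left_module (env L) N"
begin

abbreviation "D \<equiv> D_mod L f a N"
abbreviation "DV \<equiv> D_ext a N"
abbreviation "j \<equiv> D_emb a N"

sublocale N: sl2_module L e h f N
  by (intro sl2_module.intro sl2_superalgebra_axioms sl2_module_axioms.intro N_module)
sublocale DV: left_module V DV by (rule left_module_D[OF N_module])
sublocale D: sl2_module L e h f D
  by (intro sl2_module.intro sl2_superalgebra_axioms sl2_module_axioms.intro)
    (simp add: D_mod_eq left_module_restrict DV.left_module_axioms)

lemma D_simps: "carrier D = carrier DV" "add D = add DV" "\<zero>\<^bsub>D\<^esub> = \<zero>\<^bsub>DV\<^esub>" "u \<odot>\<^bsub>D\<^esub> v = \<iota> u \<odot>\<^bsub>DV\<^esub> v"
  "mpart D = mpart DV"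
  by (simp_all add: D_mod_eq restrict_scalars_def)

lemma act_D: "act L D x v = \<iota> (in_env L x) \<odot>\<^bsub>DV\<^esub> v"
  by (simp add: act_def D_simps)
lemma csc_D: "csc L D c v = K c \<odot>\<^bsub>DV\<^esub> v"
  by (simp add: csc_def D_simps)

lemma act_f_pow: "v \<in> carrier DV \<Longrightarrow> (act L D f ^^ k) v = F [^]\<^bsub>V\<^esub> k \<odot>\<^bsub>DV\<^esub> v"
proof (induction k)
  case (Suc k)
  have "F [^]\<^bsub>V\<^esub> Suc k \<odot>\<^bsub>DV\<^esub> v = F \<odot>\<^bsub>DV\<^esub> (F [^]\<^bsub>V\<^esub> k \<odot>\<^bsub>DV\<^esub> v)"
    by (simp only: lenv.nat_pow_Suc2 DV.smult_assoc iota_closed lenv.nat_pow_closed Suc.prems)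
  then show ?case using Suc by (simp add: act_D)
qed (simp add: DV.smult_one)

lemma N_f_pow: "n \<in> carrier N \<Longrightarrow> (act L N f ^^ k) n = in_env L f [^]\<^bsub>U\<^esub> k \<odot>\<^bsub>N\<^esub> n"
proof (induction k)
  case (Suc k)
  have "in_env L f [^]\<^bsub>U\<^esub> Suc k \<odot>\<^bsub>N\<^esub> n = in_env L f \<odot>\<^bsub>N\<^esub> (in_env L f [^]\<^bsub>U\<^esub> k \<odot>\<^bsub>N\<^esub> n)"
    by (simp only: env.nat_pow_Suc2 N.M.smult_assoc in_env_closed env.nat_pow_closed Suc.prems)
  then show ?case using Suc by (simp add: act_def)
qed (simp add: N.M.smult_one)

definition f_root :: "('g, 'm) gvec \<Rightarrow> ('g, 'm) gvec" where "f_root v = Fi \<odot>\<^bsub>DV\<^esub> v"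

lemma f_root_closed [simp]: "v \<in> carrier D \<Longrightarrow> f_root v \<in> carrier D"
  by (simp add: f_root_def D_simps DV.smult_closed)

lemma act_f_root [simp]: "v \<in> carrier D \<Longrightarrow> act L D f (f_root v) = v"
  by (simp add: f_root_def act_D D_simps DV.smult_assoc[symmetric] F_Fi DV.smult_one)

lemma f_root_act [simp]: "v \<in> carrier D \<Longrightarrow> f_root (act L D f v) = v"
  by (simp add: f_root_def act_D D_simps DV.smult_assoc[symmetric] Fi_F DV.smult_one)

lemma f_root_add: "v \<in> carrier D \<Longrightarrow> w \<in> carrier D \<Longrightarrow> f_root (v \<oplus>\<^bsub>D\<^esub> w) = f_root v \<oplus>\<^bsub>D\<^esub> f_root w"
  by (simp add: f_root_def D_simps DV.smult_r_distr)

lemma f_root_pow_closed [simp]: "v \<in> carrier D \<Longrightarrow> (f_root ^^ k) v \<in> carrier D"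
  by (induction k) auto

lemma f_pow_root_pow: "v \<in> carrier D \<Longrightarrow> (act L D f ^^ k) ((f_root ^^ k) v) = v"
  by (induction k arbitrary: v) (simp_all add: funpow_swap1[of "act L D f"])

lemma root_pow_f_pow: "v \<in> carrier D \<Longrightarrow> (f_root ^^ k) ((act L D f ^^ k) v) = v"
  by (induction k arbitrary: v) (simp_all add: funpow_swap1[of "f_root"])

lemma f_pow_inject: "v \<in> carrier D \<Longrightarrow> w \<in> carrier D \<Longrightarrow> (act L D f ^^ k) v = (act L D f ^^ k) w \<Longrightarrow> v = w"
  by (metis root_pow_f_pow)

lemma emb_closed [simp]: "n \<in> carrier N \<Longrightarrow> j n \<in> carrier D"
  by (simp add: D_simps D_emb_closed[OF N_module])

lemma emb_add: "n \<in> carrier N \<Longrightarrow> n' \<in> carrier N \<Longrightarrow> j (n \<oplus>\<^bsub>N\<^esub> n') = j n \<oplus>\<^bsub>D\<^esub> j n'"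
  by (simp add: D_simps D_emb_add[OF N_module])

lemma emb_zero [simp]: "j \<zero>\<^bsub>N\<^esub> = \<zero>\<^bsub>D\<^esub>" by (simp add: D_simps D_emb_zero[OF N_module])

lemma emb_sc: "n \<in> carrier N \<Longrightarrow> j (csc L N c n) = csc L D c (j n)"
  unfolding csc_D by (simp add: csc_def D_emb_K[OF N_module])

lemma emb_f: "n \<in> carrier N \<Longrightarrow> j (act L N f n) = act L D f (j n)"
  unfolding act_D by (simp add: act_def D_emb_F[OF N_module])

lemma emb_f_pow: "n \<in> carrier N \<Longrightarrow> j ((act L N f ^^ k) n) = (act L D f ^^ k) (j n)"
  by (induction k) (simp_all add: emb_f)

lemma emb_h: "n \<in> carrier N \<Longrightarrow> j (act L N h n) = act L D h (j n) \<oplus>\<^bsub>D\<^esub> csc L D (2 * a) (j n)"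
  unfolding act_D csc_D
  by (simp only: act_def D_emb_smult[OF N_module] in_env_closed twist_h D_simps)
    (rule DV.smult_l_distr[OF iota_closed iota_closed D_emb_closed[OF N_module]])

text \<open>By \<open>twist_e\<close>, f phi_a(e) = fe - ah - a(a+1), and h acts on j(n) as \<mu> -
  2a; collecting the constants gives a(\<mu> - a + 1).\<close>

lemma emb_e:
  assumes n: "N.wt \<mu> n"
  shows "act L D f (act L D e (j n)) = j (act L N f (act L N e n)) \<oplus>\<^bsub>D\<^esub> csc L D (a * (\<mu> - a + 1)) (j n)"
    and "D.wt (\<mu> - 2 * a) (j n)"
proof -
  note nc = N.wt_closed[OF n]
  have "act L D h (j n) \<oplus>\<^bsub>D\<^esub> csc L D (2 * a) (j n) = csc L D \<mu> (j n)"
    using emb_h[OF nc] N.wt_eq[OF n] nc by (simp add: emb_sc)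
  then have "act L D h (j n) \<oplus>\<^bsub>D\<^esub> csc L D (2 * a) (j n) = csc L D (\<mu> - 2 * a) (j n) \<oplus>\<^bsub>D\<^esub> csc L D (2 * a) (j n)"
    using nc by (simp add: D.sc_add_left[symmetric])
  then have h: "act L D h (j n) = csc L D (\<mu> - 2 * a) (j n)"
    using nc by (simp add: D.M.M.add.right_cancel)
  then show "D.wt (\<mu> - 2 * a) (j n)" using nc by (simp add: D.wt_def)
  let ?d = "j n"
  have dV: "?d \<in> carrier DV" using emb_closed[OF nc] by (simp add: D_simps)
  have "j (act L N f (act L N e n)) = (F \<otimes>\<^bsub>V\<^esub> tw.twst a (\<iota> (in_env L e))) \<odot>\<^bsub>DV\<^esub> ?d"
    using nc dV by (simp add: emb_f act_D)
      (simp add: act_def D_emb_smult[OF N_module] DV.smult_assoc)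
  also have "\<dots> = act L D f (act L D e ?d) \<oplus>\<^bsub>D\<^esub> (csc L D (- a) (act L D h ?d) \<oplus>\<^bsub>D\<^esub> csc L D (- (a * (a + 1))) ?d)"
    unfolding twist_e act_D csc_D D_simps(2)
    by (simp only: DV.smult_l_distr DV.smult_assoc dV iota_closed lenv.m_closed lenv.a_closed)
  also have "csc L D (- a) (act L D h ?d) \<oplus>\<^bsub>D\<^esub> csc L D (- (a * (a + 1))) ?d = csc L D (- (a * (\<mu> - a + 1))) ?d"
  proof -
    have "csc L D (- a) (act L D h ?d) \<oplus>\<^bsub>D\<^esub> csc L D (- (a * (a + 1))) ?d =
        csc L D (- a * (\<mu> - 2 * a) + - (a * (a + 1))) ?d"
      using nc by (simp only: h D.sc_add_left D.sc_mult emb_closed)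
    also have "- a * (\<mu> - 2 * a) + - (a * (a + 1)) = - (a * (\<mu> - a + 1))" by (simp add: algebra_simps)
    finally show ?thesis .
  qed
  finally have "j (act L N f (act L N e n)) \<oplus>\<^bsub>D\<^esub> csc L D (a * (\<mu> - a + 1)) ?d =
      act L D f (act L D e ?d) \<oplus>\<^bsub>D\<^esub> (csc L D (- (a * (\<mu> - a + 1))) ?d \<oplus>\<^bsub>D\<^esub> csc L D (a * (\<mu> - a + 1)) ?d)"
    using nc by (simp only: D.M.M.a_assoc D.sc_closed D.act_closed emb_closed)
  then show "act L D f (act L D e (j n)) = j (act L N f (act L N e n)) \<oplus>\<^bsub>D\<^esub> csc L D (a * (\<mu> - a + 1)) (j n)"
    using nc by (simp add: D.sc_neg_cancel)
qed

lemma emb_kernel: "n \<in> carrier N \<Longrightarrow> j n = \<zero>\<^bsub>D\<^esub> \<Longrightarrow> \<exists>k. (act L N f ^^ k) n = \<zero>\<^bsub>N\<^esub>"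
  using D_emb_kernel[OF N_module, of n a] by (simp add: D_simps N_f_pow)

lemma fraction_comp:
  assumes "lie_module s L N" "d \<in> module_comp s D i"
  shows "\<exists>k. \<exists>n\<in>module_comp s N i. (act L D f ^^ k) d = j n"
proof -
  have d: "d \<in> module_comp s DV i" using assms(2) by (simp add: module_comp_def D_simps split: if_splits)
  then have "d \<in> carrier DV" using D_comp_sub[OF N_module assms(1)] by blast
  then show ?thesis using D_fraction[OF N_module assms(1) d] by (simp add: act_f_pow)
qed

lemma fraction: "d \<in> carrier D \<Longrightarrow> \<exists>k. \<exists>n\<in>carrier N. (act L D f ^^ k) d = j n"
  using fraction_comp[of False d 0] N_module by (simp add: lie_module_def)

lemma wt_f_root: assumes v: "D.wt c v" shows "D.wt (c + 2) (f_root v)"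
proof -
  note vc = D.wt_closed[OF v]
  let ?w = "f_root v"
  have "act L D f (act L D h ?w) \<oplus>\<^bsub>D\<^esub> csc L D (- 2) v = csc L D c v"
    using D.h_f[of ?w] vc D.wt_eq[OF v] by simp
  then have "act L D f (act L D h ?w) \<oplus>\<^bsub>D\<^esub> csc L D (- 2) v = csc L D (c + 2) v \<oplus>\<^bsub>D\<^esub> csc L D (- 2) v"
    using vc D.sc_add_left[of v "c + 2" "- 2"] by simp
  then have "act L D f (act L D h ?w) = csc L D (c + 2) v" using vc by (simp add: D.M.M.add.right_cancel)
  then have "act L D f (act L D h ?w) = act L D f (csc L D (c + 2) ?w)" using vc by (simp add: D.act_sc)
  then have "f_root (act L D f (act L D h ?w)) = f_root (act L D f (csc L D (c + 2) ?w))" by simp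
  then show ?thesis using vc by (simp add: D.wt_def)
qed

text \<open>The numerator j(n) has weights in b - 2a + Z, and each division by f raises a weight by
  2, which stays inside this coset.\<close>

lemma diagonal_D:
  assumes diag: "diagonal_in L h b N" shows "diagonal_in L h (b - 2 * a) D"
proof (rule D.diagonal_inI)
  fix d assume d: "d \<in> carrier D"
  let ?R = "range (\<lambda>k. (b - 2 * a) + of_int k)"
  obtain k n where n: "n \<in> carrier N" "(act L D f ^^ k) d = j n" using fraction[OF d] by blast
  obtain C where C: "N.wsum C n" "C \<subseteq> range (\<lambda>k. b + of_int k)" using N.diagonal_wsum[OF diag n(1)] .
  have "D.wsum ((\<lambda>c. c - 2 * a) ` C) (j n)"
    by (rule wsum_image[OF N.sl2_module_axioms D.sl2_module_axioms _ _ _ C(1)]) (auto simp: emb_add emb_e(2))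
  moreover have "(\<lambda>c. c - 2 * a) ` C \<subseteq> ?R" using C(2) by (auto simp: algebra_simps)
  ultimately have "\<exists>C. D.wsum C (j n) \<and> C \<subseteq> ?R" by blast
  then have "\<exists>C. D.wsum C ((f_root ^^ m) (j n)) \<and> C \<subseteq> ?R" for m
  proof (induction m)
    case (Suc m)
    then obtain C where C: "D.wsum C ((f_root ^^ m) (j n))" "C \<subseteq> ?R" by blast
    have "D.wsum ((\<lambda>c. c + 2) ` C) (f_root ((f_root ^^ m) (j n)))"
      by (rule wsum_image[OF D.sl2_module_axioms D.sl2_module_axioms _ _ _ C(1)])
        (auto simp: f_root_add wt_f_root)
    moreover have "(\<lambda>c. c + 2) ` C \<subseteq> ?R"
    proof
      fix x assume "x \<in> (\<lambda>c. c + 2) ` C"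
      then obtain i :: int where "x = (b - 2 * a) + of_int i + 2" using C(2) by auto
      then have "x = (b - 2 * a) + of_int (i + 2)" by simp
      then show "x \<in> ?R" by blast
    qed
    ultimately show ?case by auto
  qed simp
  moreover have "d = (f_root ^^ k) (j n)" using root_pow_f_pow[OF d, of k] n(2) by simp
  ultimately show "\<exists>C. D.wsum C d \<and> C \<subseteq> ?R" by simp
qed

section \<open>Eigenvalues of fe on f^s j(n)\<close>

lemma fe_step_emb:
  assumes n: "N.wt \<mu> n" shows "D.fe_step (c + a * (\<mu> - a + 1)) (j n) = j (N.fe_step c n)"
proof -
  note nc = N.wt_closed[OF n]
  let ?x = "a * (\<mu> - a + 1)"
  have "D.fe_step (c + ?x) (j n) = D.fe_step (?x + c) (j n)" by (simp add: add.commute)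
  also have "\<dots> = D.fe_step ?x (j n) \<oplus>\<^bsub>D\<^esub> csc L D (- c) (j n)" using nc by (simp add: D.fe_step_add)
  also have "D.fe_step ?x (j n) = j (act L N f (act L N e n))"
    unfolding D.fe_step_def emb_e(1)[OF n]
    using nc D.sc_neg_cancel[of "j n" "- ?x"] by (simp add: D.M.M.a_assoc)
  finally show ?thesis using nc by (simp add: N.fe_step_def emb_add emb_sc)
qed

lemma fe_prod_emb: "N.wt \<mu> n \<Longrightarrow>
    D.fe_prod (map (\<lambda>c. c + a * (\<mu> - a + 1)) cs) (j n) = j (N.fe_prod cs n)"
  by (induction cs arbitrary: n) (simp_all add: fe_step_emb N.wt_fe_step)

text \<open>From e f = f e + h one gets (fe) f = f (fe + h), so every root grows by the weight
  l.\<close>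

lemma fe_step_f:
  assumes d: "D.wt l d" shows "D.fe_step (c + l) (act L D f d) = act L D f (D.fe_step c d)"
proof -
  note dc = D.wt_closed[OF d]
  have "D.fe_step (c + l) (act L D f d) = D.fe_step (l + c) (act L D f d)" by (simp add: add.commute)
  also have "\<dots> = D.fe_step l (act L D f d) \<oplus>\<^bsub>D\<^esub> csc L D (- c) (act L D f d)"
    using dc by (simp add: D.fe_step_add)
  also have "D.fe_step l (act L D f d) = act L D f (act L D f (act L D e d))"
    unfolding D.fe_step_def
    using dc D.sc_neg_cancel[of "act L D f d" "- l"] by (simp add: D.e_f D.act_add D.wt_eq[OF d] D.act_sc D.M.M.a_assoc)
  finally show ?thesis using dc by (simp add: D.fe_step_def D.act_add D.act_sc)
qed

lemma fe_prod_f: "D.wt l d \<Longrightarrow>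
    D.fe_prod (map (\<lambda>c. c + l) cs) (act L D f d) = act L D f (D.fe_prod cs d)"
  by (induction cs arbitrary: d) (simp_all add: fe_step_f D.wt_fe_step)

text \<open>On the weight \<open>\<mu>\<close> space of \<open>N\<close> the eigenvalues of \<open>fe\<close> on vectors killed by \<open>e\<^sup>k\<close> are \<open>i(\<mu>+i+1)\<close>
  with \<open>i < k\<close>. On \<open>f\<^sup>s j(n)\<close>, of weight \<open>l = \<mu>-2a-2s\<close>, they become \<open>q(l+q+1)\<close> with
  \<open>q = s+a-\<mu>-1-i\<close>, and these \<open>q\<close> are natural numbers when \<open>s\<close> is large. As \<open>f\<close> is injective on
  \<open>D\<close>, some power of \<open>e\<close> then kills \<open>f\<^sup>s j(n)\<close>.\<close>

lemma wt_f_pow_torsion: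
  assumes n: "N.wt \<mu> n" "(act L N e ^^ k) n = \<zero>\<^bsub>N\<^esub>" and mu: "\<mu> - a = of_int m"
  shows "\<exists>s. (act L D f ^^ s) (j n) \<in> torsion L e D"
proof -
  note nc = N.wt_closed[OF n(1)]
  \<comment> \<open>f^s j(n) behaves like the image of n under the canonical map for the parameter x
    = a + s: its weight is \<mu> - 2x and the roots are shifted by x(\<mu> - x + 1).\<close>
  define x where "x s = a + of_nat s" for s :: nat
  have wt: "D.wt (\<mu> - 2 * x s) ((act L D f ^^ s) (j n))" for s
  proof (induction s)
    case 0
    then show ?case using emb_e(2)[OF n(1)] by (simp add: x_def)
  next
    case (Suc s)
    have "\<mu> - 2 * x (Suc s) = \<mu> - 2 * x s - 2" by (simp add: x_def algebra_simps)
    then show ?case using D.wt_f[OF Suc] by (simp only: funpow.simps comp_apply)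
  qed
  have prod: "D.fe_prod (map (\<lambda>i. of_nat i * (\<mu> + of_nat i + 1) + x s * (\<mu> - x s + 1)) [0..<k])
      ((act L D f ^^ s) (j n)) = \<zero>\<^bsub>D\<^esub>" for s
  proof (induction s)
    case 0
    have "N.fe_prod (map (\<lambda>i. of_nat i * (\<mu> + of_nat i + 1)) [0..<k]) n = \<zero>\<^bsub>N\<^esub>"
      using N.f_pow_e_pow[OF n(1), of k] n(2) by simp
    then show ?case
      using fe_prod_emb[OF n(1), of "map (\<lambda>i. of_nat i * (\<mu> + of_nat i + 1)) [0..<k]"]
      by (simp add: x_def o_def)
  next
    case (Suc s)
    have "of_nat i * (\<mu> + of_nat i + 1) + x (Suc s) * (\<mu> - x (Suc s) + 1) =
        (of_nat i * (\<mu> + of_nat i + 1) + x s * (\<mu> - x s + 1)) + (\<mu> - 2 * x s)" for i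
      by (simp add: x_def algebra_simps)
    then show ?case
      using fe_prod_f[OF wt[of s], of "map (\<lambda>i. of_nat i * (\<mu> + of_nat i + 1) + x s * (\<mu> - x s + 1)) [0..<k]"] Suc
      by (simp add: o_def add.assoc del: of_nat_Suc)
  qed
  \<comment> \<open>Large enough for Q - i to be positive for all i < k, where Q is the value of q =
    s + a - \<mu> - 1 - i at i = 0.\<close>
  define s where "s = nat (m + 1 + int k)"
  define Q where "Q = nat (int s - m - 1)"
  have sQ: "int Q = int s - m - 1" "k \<le> Q" unfolding Q_def s_def by linarith+
  have "of_int (int Q) = (of_int (int s - m - 1) :: complex)" using sQ(1) by simp
  then have Q: "of_nat Q = x s - \<mu> - 1" using mu by (simp add: x_def algebra_simps)
  let ?d = "(act L D f ^^ s) (j n)" and ?l = "\<mu> - 2 * x s"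
  let ?c = "\<lambda>q. of_nat q * (?l + of_nat q + 1)"
  have dc: "?d \<in> carrier D" using nc by simp
  have "of_nat i * (\<mu> + of_nat i + 1) + x s * (\<mu> - x s + 1) = ?c (Q - i)" if "i < k" for i
  proof -
    have "of_nat (Q - i) = of_nat Q - (of_nat i :: complex)" using that sQ(2) by (simp add: of_nat_diff)
    then have Qi: "of_nat (Q - i) = x s - \<mu> - 1 - (of_nat i :: complex)" by (simp only: Q)
    show ?thesis unfolding Qi by (simp add: algebra_simps)
  qed
  then have "map (\<lambda>i. of_nat i * (\<mu> + of_nat i + 1) + x s * (\<mu> - x s + 1)) [0..<k] = map (\<lambda>i. ?c (Q - i)) [0..<k]"
    by simp
  also have "\<dots> = map ?c (map (\<lambda>i. Q - i) [0..<k])" by simp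
  also have "map (\<lambda>i. Q - i) [0..<k] = rev [Suc Q - k..<Suc Q]"
    by (rule nth_equalityI) (use sQ(2) in \<open>auto simp: rev_nth simp del: upt_Suc\<close>)
  also have "map ?c (rev [Suc Q - k..<Suc Q]) = rev (map ?c [Suc Q - k..<Suc Q])" by (rule rev_map[symmetric])
  finally have "D.fe_prod (map ?c [Suc Q - k..<Suc Q]) ?d = \<zero>\<^bsub>D\<^esub>"
    using prod[of s] by (simp only: D.fe_prod_rev[OF dc])
  \<comment> \<open>The k roots obtained are the top part of the Q + 1 roots belonging to f^(Q+1)
    e^(Q+1). Adding the missing ones only applies further commuting factors to zero.\<close>
  moreover have "map ?c [0..<Suc Q] = map ?c [0..<Suc Q - k] @ map ?c [Suc Q - k..<Suc Q]"
    using upt_add_eq_append[of 0 "Suc Q - k" k] sQ(2) by (simp only: map_append[symmetric]) simp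
  ultimately have "D.fe_prod (map ?c [0..<Suc Q]) ?d = \<zero>\<^bsub>D\<^esub>"
    using D.fe_prod_commute[OF dc, of "map ?c [0..<Suc Q - k]" "map ?c [Suc Q - k..<Suc Q]"]
    by (simp only: D.fe_prod_append D.fe_prod_zero)
  then have "(act L D f ^^ Suc Q) ((act L D e ^^ Suc Q) ?d) = \<zero>\<^bsub>D\<^esub>"
    by (simp only: D.f_pow_e_pow[OF wt])
  then have "(act L D e ^^ Suc Q) ?d = \<zero>\<^bsub>D\<^esub>"
    using f_pow_inject[of "(act L D e ^^ Suc Q) ?d" "\<zero>\<^bsub>D\<^esub>" "Suc Q"] dc by (simp del: funpow.simps)
  then show ?thesis using dc unfolding torsion_def by blast
qed

lemma torsion_f_pow: "v \<in> torsion L e D \<Longrightarrow> (act L D f ^^ t) v \<in> torsion L e D"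
  by (induction t) (auto intro: D.torsion_act)

text \<open>Diagonality with respect to a + Z is the integrality asked for by
  \<open>wt_f_pow_torsion\<close>. The exponents found for the weight components are added up, as
  the e-torsion is stable under f.\<close>

lemma f_pow_torsion:
  assumes diag: "diagonal_in L h a N" and nil: "locally_nilpotent L e N" and n: "n \<in> carrier N"
  shows "\<exists>s. (act L D f ^^ s) (j n) \<in> torsion L e D"
proof -
  obtain C where "N.wsum C n" and R: "C \<subseteq> range (\<lambda>k. a + of_int k)" using N.diagonal_wsum[OF diag n] .
  then obtain w where w: "finite C" "\<forall>c\<in>C. N.wt c (w c)" "n = finsum N w C" by (auto simp: N.wsum_def)
  have wN: "w \<in> C \<rightarrow> carrier N" using w(2) N.wt_closed by blast
  have "\<exists>s. (act L D f ^^ s) (j (finsum N w A)) \<in> torsion L e D" if "finite A" "A \<subseteq> C" for A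
    using that
  proof (induction rule: finite_induct)
    case empty
    then show ?case by (intro exI[of _ 0]) (simp add: D.torsion_zero)
  next
    case (insert c A)
    then have aw: "w \<in> A \<rightarrow> carrier N" "w c \<in> carrier N" using wN by (auto simp: Pi_iff)
    obtain s where s: "(act L D f ^^ s) (j (finsum N w A)) \<in> torsion L e D" using insert by auto
    obtain k where "(act L N e ^^ k) (w c) = \<zero>\<^bsub>N\<^esub>"
      using nil aw(2) unfolding locally_nilpotent_def torsion_def by blast
    moreover obtain i :: int where "c - a = of_int i" using R insert.prems by auto
    moreover have "N.wt c (w c)" using w insert.prems by auto
    ultimately obtain t where t: "(act L D f ^^ t) (j (w c)) \<in> torsion L e D"
      using wt_f_pow_torsion by blast
    let ?x = "j (w c)" and ?y = "j (finsum N w A)"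
    have xy: "?x \<in> carrier D" "?y \<in> carrier D" using aw by simp_all
    have "j (finsum N w (insert c A)) = ?x \<oplus>\<^bsub>D\<^esub> ?y"
      using aw by (simp add: N.M.M.finsum_insert[OF insert.hyps aw] emb_add)
    moreover have "(act L D f ^^ (s + t)) ?x = (act L D f ^^ s) ((act L D f ^^ t) ?x)"
      by (simp add: funpow_add)
    moreover have "(act L D f ^^ (s + t)) ?y = (act L D f ^^ t) ((act L D f ^^ s) ?y)"
      unfolding add.commute[of s t] by (simp add: funpow_add)
    ultimately have "(act L D f ^^ (s + t)) (j (finsum N w (insert c A))) =
        (act L D f ^^ s) ((act L D f ^^ t) ?x) \<oplus>\<^bsub>D\<^esub> (act L D f ^^ t) ((act L D f ^^ s) ?y)"
      using xy by (simp only: D.act_pow_add)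
    then have "(act L D f ^^ (s + t)) (j (finsum N w (insert c A))) \<in> torsion L e D"
      using torsion_f_pow[OF t, of s] torsion_f_pow[OF s, of t] D.torsion_add by simp
    then show ?case by blast
  qed
  then show ?thesis using w by blast
qed

lemma lie_module_D: assumes "lie_module s L N" shows "lie_module s L D"
proof -
  have "super_graded L D" if s: "s"
  proof -
    have lie: "lie_module True L N" using assms s by simp
    have sub: "mpart D i \<subseteq> carrier D" for i
      using D_comp_sub[OF N_module lie, of a i] by (simp add: D_simps)
    have add: "v \<oplus>\<^bsub>D\<^esub> w \<in> mpart D i" if "v \<in> mpart D i" "w \<in> mpart D i" for v w i
      using D_comp_add[OF N_module lie, of v a i w] that by (simp add: D_simps)
    have zero: "\<zero>\<^bsub>D\<^esub> \<in> mpart D i" for i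
      using D_comp_zero[OF N_module lie, of a i] by (simp add: D_simps)
    have smult: "u \<odot>\<^bsub>DV\<^esub> v \<in> mpart D (k + i)" if "u \<in> lenv_comp True k" "v \<in> mpart D i" for u v k i
      using D_comp_smult[OF N_module lie that(1), of v a i] that by (simp add: D_simps)
    have csc: "csc L D c v \<in> mpart D i" if "v \<in> mpart D i" for c v i
      using smult[OF lenv_comp_iota[OF env_comp_intros(1)] that, of c] unfolding csc_D by (simp only: add_0_left)
    have grp: "additive_subgroup (mpart D i) D" for i
    proof (rule additive_subgroup.intro, rule group.subgroupI[OF D.M.M.a_group])
      show "mpart D i \<noteq> {}" using zero by blast
      show "inv\<^bsub>add_monoid D\<^esub> v \<in> mpart D i" if "v \<in> mpart D i" for v
      proof -
        have "v \<in> carrier D" using sub that by blast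
        then have "\<ominus>\<^bsub>D\<^esub> v = csc L D (- 1) v" by (simp add: D.sc_minus)
        then show ?thesis using csc[OF that] unfolding a_inv_def by simp
      qed
    qed (use sub add in auto)
    \<comment> \<open>Parities in D are defined by representatives, so the kernel of j enters.
      Powers of f carry v to j(n0) and to j(n1) with n0 even and n1 odd; after equalizing exponents
      the difference of the numerators is f-torsion, so a power of f carries n0 into both parts of
      N, that is, to zero.\<close>
    have int: "v = \<zero>\<^bsub>D\<^esub>" if v: "v \<in> mpart D 0" "v \<in> mpart D 1" for v
    proof -
      have vc: "v \<in> carrier D" using sub v by blast
      obtain k n0 where n0: "n0 \<in> mpart N 0" "(act L D f ^^ k) v = j n0"
        using fraction_comp[OF lie, of v 0] v by auto
      obtain l n1 where n1: "n1 \<in> mpart N 1" "(act L D f ^^ l) v = j n1"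
        using fraction_comp[OF lie, of v 1] v by auto
      have Nc: "n0 \<in> carrier N" "n1 \<in> carrier N"
        using n0 n1 module_comp_facts(2)[OF lie, of 0] module_comp_facts(2)[OF lie, of 1] by auto
      have fN: "(act L N f ^^ m) n \<in> mpart N i" if "n \<in> mpart N i" for m n i
      proof (induction m)
        case (Suc m)
        have "act L N f ((act L N f ^^ m) n) \<in> module_comp True N (0 + i)"
          unfolding act_def[of _ _ _ "(act L N f ^^ m) n"]
          by (rule module_comp_facts(5)[OF lie env_comp_intros(2)[OF even(3)]]) (use Suc in simp)
        then show ?case by (simp only: add_0_left module_comp_simps funpow.simps comp_apply)
      qed (use that in simp)
      let ?n = "(act L N f ^^ l) n0" and ?n' = "(act L N f ^^ k) n1"
      have "j ?n = j ?n'"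
      proof -
        have "j ?n = (act L D f ^^ (l + k)) v" using Nc by (simp add: emb_f_pow n0(2)[symmetric] funpow_add)
        moreover have "j ?n' = (act L D f ^^ (k + l)) v" using Nc by (simp add: emb_f_pow n1(2)[symmetric] funpow_add)
        ultimately show ?thesis by (simp add: add.commute)
      qed
      then have "j (?n \<oplus>\<^bsub>N\<^esub> csc L N (- 1) ?n') = \<zero>\<^bsub>D\<^esub>"
        using Nc by (simp add: emb_add emb_sc D.sc_minus D.M.M.r_neg)
      then obtain m where "(act L N f ^^ m) (?n \<oplus>\<^bsub>N\<^esub> csc L N (- 1) ?n') = \<zero>\<^bsub>N\<^esub>"
        using emb_kernel[of "?n \<oplus>\<^bsub>N\<^esub> csc L N (- 1) ?n'"] Nc by auto
      then have "(act L N f ^^ m) ?n \<oplus>\<^bsub>N\<^esub> csc L N (- 1) ((act L N f ^^ m) ?n') = \<zero>\<^bsub>N\<^esub>"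
        using Nc by (simp add: N.act_pow_add N.act_pow_sc)
      then have "(act L N f ^^ m) ?n \<oplus>\<^bsub>N\<^esub> (\<ominus>\<^bsub>N\<^esub> (act L N f ^^ m) ?n') = \<zero>\<^bsub>N\<^esub>"
        using Nc by (simp add: N.sc_minus)
      then have eq: "(act L N f ^^ m) ?n = (act L N f ^^ m) ?n'"
        using Nc N.M.M.minus_equality[of "(act L N f ^^ m) ?n" "\<ominus>\<^bsub>N\<^esub> (act L N f ^^ m) ?n'"] by simp
      have "(act L N f ^^ m) ?n \<in> mpart N 0 \<inter> mpart N 1"
        using fN[OF fN[OF n0(1)], of m l] fN[OF fN[OF n1(1)], of m k] by (simp add: eq)
      moreover have "mpart N 0 \<inter> mpart N 1 = {\<zero>\<^bsub>N\<^esub>}" using lie by (simp add: lie_module_def super_graded_def)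
      ultimately have "(act L N f ^^ m) ?n = \<zero>\<^bsub>N\<^esub>" by simp
      then have "(act L D f ^^ (m + l + k)) v = \<zero>\<^bsub>D\<^esub>"
        using emb_f_pow[of "?n" m] emb_f_pow[of n0 l] Nc by (simp add: funpow_add n0(2))
      then show ?thesis using f_pow_inject[OF vc, of "\<zero>\<^bsub>D\<^esub>" "m + l + k"] by simp
    qed
    \<comment> \<open>A vector is decomposed by decomposing a numerator, since f^(-1) acts
      additively and preserves parity.\<close>
    have dec: "\<exists>x\<in>mpart D 0. \<exists>y\<in>mpart D 1. v = x \<oplus>\<^bsub>D\<^esub> y" if v: "v \<in> carrier D" for v
    proof -
      obtain k n where n: "n \<in> carrier N" "(act L D f ^^ k) v = j n" using fraction[OF v] by blast
      obtain n0 n1 where n01: "n0 \<in> mpart N 0" "n1 \<in> mpart N 1" "n = n0 \<oplus>\<^bsub>N\<^esub> n1"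
        using lie n(1) unfolding lie_module_def super_graded_def by blast
      have Nc: "n0 \<in> carrier N" "n1 \<in> carrier N"
        using n01 module_comp_facts(2)[OF lie, of 0] module_comp_facts(2)[OF lie, of 1] by auto
      have root: "(f_root ^^ k) w \<in> mpart D i" if "w \<in> mpart D i" for w i k
      proof (induction k)
        case (Suc k)
        show ?case using smult[OF lenv_comp_Fi Suc] by (simp only: add_0_left funpow.simps comp_apply f_root_def)
      qed (use that in simp)
      have "v = (f_root ^^ k) (j n)" using root_pow_f_pow[OF v, of k] n(2) by simp
      also have "(f_root ^^ m) (j n) = (f_root ^^ m) (j n0) \<oplus>\<^bsub>D\<^esub> (f_root ^^ m) (j n1)" for m
        using Nc by (induction m) (auto simp: n01(3) emb_add f_root_add)
      finally have "v = (f_root ^^ k) (j n0) \<oplus>\<^bsub>D\<^esub> (f_root ^^ k) (j n1)" .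
      moreover have "j n0 \<in> mpart D 0" "j n1 \<in> mpart D 1"
        using D_comp_emb[OF N_module lie, of n0 0 a] D_comp_emb[OF N_module lie, of n1 1 a] n01
        by (simp_all add: D_simps)
      ultimately show ?thesis using root by blast
    qed
    have "act L D x v \<in> mpart D (i + k)" if "x \<in> prt L i" "v \<in> mpart D k" for x v i k
      unfolding act_D by (rule smult[OF lenv_comp_iota[OF env_comp_intros(2)[OF that(1)]] that(2)])
    then show ?thesis
      unfolding super_graded_def using grp csc int zero dec by blast
  qed
  then show ?thesis using D.lm by (simp add: lie_module_def)
qed

end

section \<open>The Enright functor\<close>

lemma lie_homD:
  assumes "\<phi> \<in> lie_hom s L M N"
  shows "\<phi> \<in> extensional (carrier M)"
    and "v \<in> carrier M \<Longrightarrow> \<phi> v \<in> carrier N"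
    and "v \<in> carrier M \<Longrightarrow> w \<in> carrier M \<Longrightarrow> \<phi> (v \<oplus>\<^bsub>M\<^esub> w) = \<phi> v \<oplus>\<^bsub>N\<^esub> \<phi> w"
    and "u \<in> carrier (env L) \<Longrightarrow> v \<in> carrier M \<Longrightarrow> \<phi> (u \<odot>\<^bsub>M\<^esub> v) = u \<odot>\<^bsub>N\<^esub> \<phi> v"
    and "v \<in> module_comp s M i \<Longrightarrow> \<phi> v \<in> module_comp s N i"
  using assms by (auto simp: lie_hom_def module_comp_def image_subset_iff)

lemma lie_homI:
  assumes "\<phi> \<in> extensional (carrier M)"
    and "\<And>v. v \<in> carrier M \<Longrightarrow> \<phi> v \<in> carrier N"
    and "\<And>v w. v \<in> carrier M \<Longrightarrow> w \<in> carrier M \<Longrightarrow> \<phi> (v \<oplus>\<^bsub>M\<^esub> w) = \<phi> v \<oplus>\<^bsub>N\<^esub> \<phi> w"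
    and "\<And>u v. u \<in> carrier (env L) \<Longrightarrow> v \<in> carrier M \<Longrightarrow> \<phi> (u \<odot>\<^bsub>M\<^esub> v) = u \<odot>\<^bsub>N\<^esub> \<phi> v"
    and "\<And>v i. v \<in> module_comp s M i \<Longrightarrow> \<phi> v \<in> module_comp s N i"
  shows "\<phi> \<in> lie_hom s L M N"
  using assms by (auto simp: lie_hom_def module_comp_def split: if_splits)

text \<open>\<open>lie_hom\<close> without extensionality and parity, and over an arbitrary ring.
  The map induced on N[f^(-1)] is linear over the localization, and it is the input of the second
  tensor product.\<close>

definition linear_map :: "('r, 'k) ring_scheme \<Rightarrow> ('r, 'v) smod \<Rightarrow> ('r, 'w) smod \<Rightarrow> ('v \<Rightarrow> 'w) \<Rightarrow> bool" where
  "linear_map R M N \<phi> \<longleftrightarrow> (\<forall>v\<in>carrier M. \<phi> v \<in> carrier N) \<and>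
     (\<forall>v\<in>carrier M. \<forall>w\<in>carrier M. \<phi> (v \<oplus>\<^bsub>M\<^esub> w) = \<phi> v \<oplus>\<^bsub>N\<^esub> \<phi> w) \<and>
     (\<forall>r\<in>carrier R. \<forall>v\<in>carrier M. \<phi> (r \<odot>\<^bsub>M\<^esub> v) = r \<odot>\<^bsub>N\<^esub> \<phi> v)"

lemma linear_mapD:
  assumes "linear_map R M N \<phi>"
  shows "v \<in> carrier M \<Longrightarrow> \<phi> v \<in> carrier N"
    and "v \<in> carrier M \<Longrightarrow> w \<in> carrier M \<Longrightarrow> \<phi> (v \<oplus>\<^bsub>M\<^esub> w) = \<phi> v \<oplus>\<^bsub>N\<^esub> \<phi> w"
    and "r \<in> carrier R \<Longrightarrow> v \<in> carrier M \<Longrightarrow> \<phi> (r \<odot>\<^bsub>M\<^esub> v) = r \<odot>\<^bsub>N\<^esub> \<phi> v"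
  using assms by (auto simp: linear_map_def)

lemma lie_hom_linear: "\<phi> \<in> lie_hom s L M N \<Longrightarrow> linear_map (env L) M N \<phi>"
  by (auto simp: linear_map_def lie_hom_def)

lemma tensor_map_linear:
  fixes P :: "bit \<Rightarrow> 'b set"
  assumes T: "ring_extension_tensor S R M \<rho>" "ring_extension_tensor S R N \<rho>" and \<phi>: "linear_map R M N \<phi>"
  shows "linear_map S (tensor R (extension_bimod S \<rho> P) M) (tensor R (extension_bimod S \<rho> P) N)
      (tensor_map R (extension_bimod S \<rho> P) M N \<phi>)"
    and "u \<in> carrier S \<Longrightarrow> n \<in> carrier M \<Longrightarrow> tensor_map R (extension_bimod S \<rho> P) M N \<phi>
      (ring_extension_tensor.pure S R M \<rho> P u n) = ring_extension_tensor.pure S R N \<rho> P u (\<phi> n)"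
proof -
  note p = linear_mapD[OF \<phi>]
  show "linear_map S (tensor R (extension_bimod S \<rho> P) M) (tensor R (extension_bimod S \<rho> P) N)
      (tensor_map R (extension_bimod S \<rho> P) M N \<phi>)"
    unfolding linear_map_def
    by (intro conjI ballI; rule tensor_map_pure[OF T]; (assumption | rule p))
  show "u \<in> carrier S \<Longrightarrow> n \<in> carrier M \<Longrightarrow> tensor_map R (extension_bimod S \<rho> P) M N \<phi>
      (ring_extension_tensor.pure S R M \<rho> P u n) = ring_extension_tensor.pure S R N \<rho> P u (\<phi> n)"
    by (rule tensor_map_pure(3)[OF T]; (assumption | rule p))
qed

lemma left_module_smult_closed: "left_module R M \<Longrightarrow> r \<in> carrier R \<Longrightarrow> v \<in> carrier M \<Longrightarrow> r \<odot>\<^bsub>M\<^esub> v \<in> carrier M"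
  by (rule left_module.smult_closed)

lemma left_module_add_closed: "left_module R M \<Longrightarrow> v \<in> carrier M \<Longrightarrow> w \<in> carrier M \<Longrightarrow> v \<oplus>\<^bsub>M\<^esub> w \<in> carrier M"
  by (simp add: left_module_def abelian_group_def abelian_monoid.a_closed)

lemma (in lie_superalgebra) lie_hom_compose:
  assumes "lie_module s L X" "lie_module s L Y" "\<phi> \<in> lie_hom s L X Y" "\<psi> \<in> lie_hom s L Y Z"
  shows "compose (carrier X) \<psi> \<phi> \<in> lie_hom s L X Z"
proof (rule lie_homI)
  have X: "left_module (env L) X" using assms(1) by (simp add: lie_module_def)
  note 1 = lie_homD[OF assms(3)] and 2 = lie_homD[OF assms(4)]
  show "compose (carrier X) \<psi> \<phi> v \<in> module_comp s Z i" if "v \<in> module_comp s X i" for v i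
    using 1(5) 2(5) that module_comp_facts(2)[OF assms(1), of i] by (auto simp: compose_def)
  show "compose (carrier X) \<psi> \<phi> (v \<oplus>\<^bsub>X\<^esub> w) = compose (carrier X) \<psi> \<phi> v \<oplus>\<^bsub>Z\<^esub> compose (carrier X) \<psi> \<phi> w"
    if "v \<in> carrier X" "w \<in> carrier X" for v w
    using that left_module_add_closed[OF X that] 1(2,3) 2(3) by (simp add: compose_def)
  show "compose (carrier X) \<psi> \<phi> (u \<odot>\<^bsub>X\<^esub> v) = u \<odot>\<^bsub>Z\<^esub> compose (carrier X) \<psi> \<phi> v"
    if "u \<in> carrier (env L)" "v \<in> carrier X" for u v
    using that left_module_smult_closed[OF X that] 1(2,4) 2(4) by (simp add: compose_def)
qed (use lie_homD[OF assms(3)] lie_homD[OF assms(4)] in \<open>auto simp: compose_def\<close>)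

lemma (in lie_superalgebra) lie_hom_id:
  assumes "lie_module s L X" shows "(\<lambda>v\<in>carrier X. v) \<in> lie_hom s L X X"
proof (rule lie_homI)
  have X: "left_module (env L) X" using assms by (simp add: lie_module_def)
  show "(\<lambda>v\<in>carrier X. v) (v \<oplus>\<^bsub>X\<^esub> w) = (\<lambda>v\<in>carrier X. v) v \<oplus>\<^bsub>X\<^esub> (\<lambda>v\<in>carrier X. v) w"
    if "v \<in> carrier X" "w \<in> carrier X" for v w using that left_module_add_closed[OF X that] by simp
  show "(\<lambda>v\<in>carrier X. v) (u \<odot>\<^bsub>X\<^esub> v) = u \<odot>\<^bsub>X\<^esub> (\<lambda>v\<in>carrier X. v) v"
    if "u \<in> carrier (env L)" "v \<in> carrier X" for u v using that left_module_smult_closed[OF X that] by simp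
  show "(\<lambda>v\<in>carrier X. v) v \<in> module_comp s X i" if "v \<in> module_comp s X i" for v i
    using that module_comp_facts(2)[OF assms, of i] by auto
qed auto

lemma (in lie_superalgebra) category_M_e: "category (M_e s L e h b)"
proof -
  have e1: "compose (carrier X) f (\<lambda>v\<in>carrier X. v) = f" "compose (carrier X) (\<lambda>v\<in>carrier Y. v) f = f"
    if "f \<in> lie_hom s L X Y" for f :: "'x \<Rightarrow> 'x" and X Y :: "('g uel, 'x) smod"
    using lie_homD(1,2)[OF that] by (auto simp: compose_def extensional_def fun_eq_iff)
  have e2: "compose (carrier W) (compose (carrier X) k g) f = compose (carrier W) k (compose (carrier W) g f)"
    if "f \<in> lie_hom s L W X" for f g k :: "'x \<Rightarrow> 'x" and W X :: "('g uel, 'x) smod"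
    using lie_homD(2)[OF that] by (auto simp: compose_def fun_eq_iff)
  show ?thesis
    unfolding category_def M_e_def using e1 e2 lie_hom_compose lie_hom_id by (auto simp: restrict_def) 
qed

lemma obj_M_e: "N \<in> obj (M_e s L e h b) \<longleftrightarrow> lie_module s L N \<and> diagonal_in L h b N \<and> locally_nilpotent L e N"
  by (simp add: M_e_def)

section \<open>The e-torsion submodule\<close>

context sl2_module
begin

definition tors :: "('g uel, 'v) smod" where
  "tors = M\<lparr>carrier := torsion L e M, mpart := \<lambda>i. mpart M i \<inter> torsion L e M\<rparr>"

lemma tors_simps [simp]: "carrier tors = torsion L e M" "add tors = add M" "\<zero>\<^bsub>tors\<^esub> = \<zero>\<^bsub>M\<^esub>"
  "u \<odot>\<^bsub>tors\<^esub> v = u \<odot>\<^bsub>M\<^esub> v" "mpart tors i = mpart M i \<inter> torsion L e M"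
  "act L tors = act L M" "csc L tors = csc L M"
  by (simp_all add: tors_def act_def[abs_def] csc_def[abs_def])

lemma left_module_tors: "left_module U tors"
proof (rule left_moduleI[OF env.ring_axioms])
  show "abelian_group tors"
  proof (rule abelian_groupI)
    fix x assume x: "x \<in> carrier tors"
    then have "(- 1) \<cdot> x \<oplus>\<^bsub>M\<^esub> x = \<zero>\<^bsub>M\<^esub>" using sc_neg_cancel[of x 1] torsion_closed by simp
    then show "\<exists>y\<in>carrier tors. y \<oplus>\<^bsub>tors\<^esub> x = \<zero>\<^bsub>tors\<^esub>" using torsion_sc x by auto
  qed (auto simp: torsion_add torsion_zero torsion_closed M.M.a_ac)
qed (auto simp: torsion_smult torsion_closed M.smult_l_distr M.smult_r_distr M.smult_assoc M.smult_one)

lemma lie_module_tors: assumes "lie_module s L M" shows "lie_module s L tors"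
proof -
  have "super_graded L tors" if s
  proof -
    have sg: "super_graded L M" and lie: "lie_module True L M" using assms that by (simp_all add: lie_module_def)
    have grp: "additive_subgroup (mpart M i) M" for i using sg by (simp add: super_graded_def)
    have sc: "c \<cdot> v \<in> mpart M i" if "v \<in> mpart M i" for c v i using sg that by (simp add: super_graded_def)
    have ac: "X x v \<in> mpart M (i + k)" if "x \<in> prt L i" "v \<in> mpart M k" for x v i k
      using sg that unfolding super_graded_def by blast
    have int: "mpart M 0 \<inter> mpart M 1 = {Z}" using sg by (simp add: super_graded_def)
    have sub: "mpart M i \<subseteq> Mc" for i using additive_subgroup.a_subset[OF grp] .
    interpret T: left_module U tors by (rule left_module_tors)
    have ek: "(X e ^^ k) v \<in> mpart M i" if "v \<in> mpart M i" for k v i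
    proof (induction k)
      case (Suc k)
      show ?case using ac[OF even(1) Suc] by (simp only: add_0_left funpow.simps comp_apply)
    qed (use that in simp)
    have grp': "additive_subgroup (mpart tors i) tors" for i
    proof (rule additive_subgroup.intro, rule group.subgroupI[OF T.M.a_group])
      show "mpart tors i \<noteq> {}" using additive_subgroup.zero_closed[OF grp] torsion_zero by auto
      show "inv\<^bsub>add_monoid tors\<^esub> v \<in> mpart tors i" if v: "v \<in> mpart tors i" for v
      proof -
        have vt: "v \<in> torsion L e M" "v \<in> mpart M i" using v by auto
        then have "(- 1) \<cdot> v \<oplus>\<^bsub>tors\<^esub> v = \<zero>\<^bsub>tors\<^esub>" using sc_neg_cancel[of v 1] torsion_closed by simp
        then have "\<ominus>\<^bsub>tors\<^esub> v = (- 1) \<cdot> v" using vt torsion_sc by (intro T.M.minus_equality) auto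
        then show ?thesis using vt sc torsion_sc unfolding a_inv_def by simp
      qed
    qed (use additive_subgroup.a_closed[OF grp] torsion_add in auto)
    \<comment> \<open>The homogeneous parts of a torsion vector are torsion: e is even, so e^k x = -
      e^k y lies in both parts and vanishes.\<close>
    have dec: "\<exists>x\<in>mpart tors 0. \<exists>y\<in>mpart tors 1. v = x +\<^sub>M y" if v: "v \<in> torsion L e M" for v
    proof -
      obtain x y where xy: "x \<in> mpart M 0" "y \<in> mpart M 1" "v = x +\<^sub>M y"
        using sg torsion_closed[OF v] unfolding super_graded_def by blast
      have c: "x \<in> Mc" "y \<in> Mc" using xy sub by blast+
      obtain k where "(X e ^^ k) v = Z" using v by (auto simp: torsion_def)
      then have sum0: "(X e ^^ k) x +\<^sub>M (X e ^^ k) y = Z" using c xy by (simp add: act_pow_add)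
      have "(X e ^^ k) x = \<ominus>\<^bsub>M\<^esub> ((X e ^^ k) y)" using sum0 c by (simp add: M.M.minus_equality)
      then have "(X e ^^ k) x = (- 1) \<cdot> (X e ^^ k) y" using c by (simp add: sc_minus)
      then have "(X e ^^ k) x \<in> mpart M 1" using sc[OF ek[OF xy(2)]] by simp
      then have "(X e ^^ k) x \<in> mpart M 0 \<inter> mpart M 1" using ek[OF xy(1)] by blast
      then have x0: "(X e ^^ k) x = Z" using int by blast
      then have "(X e ^^ k) y = Z" using sum0 c by simp
      then show ?thesis using x0 xy c by (auto simp: torsion_def)
    qed
    have int': "mpart tors 0 \<inter> mpart tors 1 = {Z}" using int torsion_zero by auto
    show ?thesis
      unfolding super_graded_def using grp' sc ac int' dec torsion_sc torsion_act by auto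
  qed
  then show ?thesis using left_module_tors by (simp add: lie_module_def)
qed

lemma locally_nilpotent_tors: "locally_nilpotent L e tors"
  by (auto simp: locally_nilpotent_def torsion_def)

lemma diagonal_tors: assumes diag: "diagonal_in L h b M" shows "diagonal_in L h b tors"
proof -
  interpret T: sl2_module L e h f tors
    by (intro sl2_module.intro sl2_superalgebra_axioms sl2_module_axioms.intro left_module_tors)
  show ?thesis
  proof (rule T.diagonal_inI)
    fix v assume "v \<in> carrier tors"
    then have v: "v \<in> torsion L e M" by simp
    obtain C where C: "wsum C v" "C \<subseteq> range (\<lambda>k. b + of_int k)"
      using diagonal_wsum[OF diag torsion_closed[OF v]] .
    obtain w where w: "finite C" "\<And>c. c \<in> C \<Longrightarrow> wt c (w c)" "\<And>c. c \<in> C \<Longrightarrow> w c \<in> torsion L e M"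
      "v = finsum M w C" by (rule torsion_components[OF C(1) v], rule that) auto
    have "finsum tors w A = finsum M w A" if "finite A" "A \<subseteq> C" for A
      using that
    proof (induction rule: finite_induct)
      case (insert c A)
      then have "w \<in> A \<rightarrow> torsion L e M" "w c \<in> torsion L e M" using w(3) by auto
      moreover from this have "w \<in> A \<rightarrow> Mc" "w c \<in> Mc" using torsion_closed by auto
      ultimately show ?case using insert T.M.M.finsum_insert[OF insert.hyps, of w] M.M.finsum_insert[OF insert.hyps, of w]
        by simp
    qed simp
    then have "finsum tors w C = v" using w by blast
    moreover have "T.wt c (w c)" if "c \<in> C" for c using w that by (simp add: T.wt_def wt_def)
    ultimately have "T.wsum C v" using w(1) unfolding T.wsum_def by blast
    then show "\<exists>C. T.wsum C v \<and> C \<subseteq> range (\<lambda>k. b + of_int k)" using C(2) by blast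
  qed
qed

end

section \<open>The Enright functor on objects and morphisms\<close>

context twisted_module
begin

lemma enright_eq: "diagonal_in L h b N \<Longrightarrow> enright_mod L e f a N = D.tors"
  unfolding enright_mod_def Let_def D.tors_def D.finite_vectors_torsion[OF diagonal_D] ..

lemma enright_obj:
  assumes "N \<in> obj (M_e s L e h a)" shows "enright_mod L e f a N \<in> obj (M_e s L e h (- a))"
proof -
  have lie: "lie_module s L N" and diag: "diagonal_in L h a N" using assms by (auto simp: obj_M_e)
  have "diagonal_in L h (- a) D" using diagonal_D[OF diag] by simp
  then show ?thesis
    unfolding enright_eq[OF diag] obj_M_e
    using D.lie_module_tors[OF lie_module_D[OF lie]] D.diagonal_tors D.locally_nilpotent_tors by blast
qed

lemma f_inject: "v \<in> carrier D \<Longrightarrow> w \<in> carrier D \<Longrightarrow> act L D f v = act L D f w \<Longrightarrow> v = w"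
  using f_pow_inject[of v w "Suc 0"] by simp

text \<open>Each \<open>d\<close> satisfies f^k d = j(n), so a map commuting with f is determined by
  its values on j(N) as soon as f is injective on the target; \<open>g\<close> stands for f there.
  Identities, composites and linear combinations of induced maps are compared in this way, without
  tensors.\<close>

lemma emb_determines:
  assumes \<phi>: "\<And>v. v \<in> carrier D \<Longrightarrow> \<phi> (act L D f v) = g (\<phi> v)"
    and \<psi>: "\<And>v. v \<in> carrier D \<Longrightarrow> \<psi> (act L D f v) = g (\<psi> v)"
    and inj: "\<And>v w. v \<in> Y \<Longrightarrow> w \<in> Y \<Longrightarrow> g v = g w \<Longrightarrow> v = w"
    and Y: "\<And>v. v \<in> carrier D \<Longrightarrow> \<phi> v \<in> Y" "\<And>v. v \<in> carrier D \<Longrightarrow> \<psi> v \<in> Y"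
    and eq: "\<And>n. n \<in> carrier N \<Longrightarrow> \<phi> (j n) = \<psi> (j n)" and d: "d \<in> carrier D"
  shows "\<phi> d = \<psi> d"
proof -
  obtain k n where "n \<in> carrier N" "(act L D f ^^ k) d = j n" using fraction[OF d] by blast
  then have "\<phi> ((act L D f ^^ k) d) = \<psi> ((act L D f ^^ k) d)" using eq by simp
  then show ?thesis
  proof (induction k)
    case (Suc k)
    have c: "(act L D f ^^ k) d \<in> carrier D" using d by simp
    have "g (\<phi> ((act L D f ^^ k) d)) = g (\<psi> ((act L D f ^^ k) d))"
      using Suc.prems \<phi>[OF c] \<psi>[OF c] by simp
    then show ?case using Suc.IH inj Y c by blast
  qed simp
qed

end

context sl2_superalgebra
begin

lemma twisted_moduleI: "left_module U N \<Longrightarrow> twisted_module L e h f N"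
  by (intro twisted_module.intro sl2_superalgebra_axioms twisted_module_axioms.intro)

lemma D_map_linear:
  fixes N N' :: "('g, 'm) gmod"
  assumes N: "left_module U N" "left_module U N'" and \<phi>: "linear_map U N N' \<phi>"
  shows "linear_map V (D_ext a N) (D_ext a N') (D_map L f a N N' \<phi>)"
    and "n \<in> carrier N \<Longrightarrow> D_map L f a N N' \<phi> (D_emb a N n) = D_emb a N' (\<phi> n)"
proof -
  note T = loc_tensor[OF N(1)] loc_tensor[OF N(2)]
  interpret A: ring_extension_tensor V U N \<iota> "lenv_part L f" by (rule T)
  interpret A': ring_extension_tensor V U N' \<iota> "lenv_part L f" by (rule T)
  note t = tensor_map_linear[where P = "lenv_part L f", OF T \<phi>]
  note TT = twist_tensor[OF N(1), of a] twist_tensor[OF N(2), of a]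
  interpret B: ring_extension_tensor V V A.T "tw.twst a" "lenv_part L f" by (rule TT)
  interpret B': ring_extension_tensor V V A'.T "tw.twst a" "lenv_part L f" by (rule TT)
  note tt = tensor_map_linear[where P = "lenv_part L f", OF TT t(1)]
  have D: "D_map L f a N N' \<phi> = tensor_map V B.B A.T A'.T (tensor_map U A.B N N' \<phi>)"
    by (simp add: D_map_def loc_map_def bimod_eq loc_mod_eq[OF N(1)] loc_mod_eq[OF N(2)])
  show "linear_map V (D_ext a N) (D_ext a N') (D_map L f a N N' \<phi>)"
    unfolding D D_ext_eq[OF N(1), of a] D_ext_eq[OF N(2), of a] by (rule tt(1))
  show "D_map L f a N N' \<phi> (D_emb a N n) = D_emb a N' (\<phi> n)" if n: "n \<in> carrier N"
    unfolding D D_emb_eq[OF N(1)] D_emb_eq[OF N(2)]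
      tt(2)[OF lenv.one_closed A.pure_closed[OF lenv.one_closed n]] t(2)[OF lenv.one_closed n] ..
qed

lemma D_map_hom:
  fixes N N' :: "('g, 'm) gmod" and a :: complex
  assumes lie: "lie_module s L N" "lie_module s L N'" and \<phi>: "\<phi> \<in> lie_hom s L N N'"
  defines "t \<equiv> D_map L f a N N' \<phi>"
  shows "d \<in> carrier (D_mod L f a N) \<Longrightarrow> t d \<in> carrier (D_mod L f a N')"
    and "d \<in> carrier (D_mod L f a N) \<Longrightarrow> d' \<in> carrier (D_mod L f a N) \<Longrightarrow>
      t (d \<oplus>\<^bsub>D_mod L f a N\<^esub> d') = t d \<oplus>\<^bsub>D_mod L f a N'\<^esub> t d'"
    and "u \<in> carrier U \<Longrightarrow> d \<in> carrier (D_mod L f a N) \<Longrightarrow>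
      t (u \<odot>\<^bsub>D_mod L f a N\<^esub> d) = u \<odot>\<^bsub>D_mod L f a N'\<^esub> t d"
    and "n \<in> carrier N \<Longrightarrow> t (D_emb a N n) = D_emb a N' (\<phi> n)"
    and "d \<in> module_comp s (D_mod L f a N) i \<Longrightarrow> t d \<in> module_comp s (D_mod L f a N') i"
    and "d \<in> torsion L e (D_mod L f a N) \<Longrightarrow> t d \<in> torsion L e (D_mod L f a N')"
    and "d \<in> carrier (D_mod L f a N) \<Longrightarrow> t (act L (D_mod L f a N) x d) = act L (D_mod L f a N') x (t d)"
proof -
  have N: "left_module U N" "left_module U N'" using lie by (simp_all add: lie_module_def)
  interpret A: twisted_module L e h f N a by (rule twisted_moduleI[OF N(1)])
  interpret A': twisted_module L e h f N' a by (rule twisted_moduleI[OF N(2)])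
  note t = linear_mapD[OF D_map_linear(1)[OF N lie_hom_linear[OF \<phi>], of a, folded t_def]]
    D_map_linear(2)[OF N lie_hom_linear[OF \<phi>], of _ a, folded t_def]
  show closed: "t d \<in> carrier A'.D" if "d \<in> carrier A.D" for d
    using t(1) that by (simp add: A.D_simps A'.D_simps)
  show add: "t (d \<oplus>\<^bsub>A.D\<^esub> d') = t d \<oplus>\<^bsub>A'.D\<^esub> t d'" if "d \<in> carrier A.D" "d' \<in> carrier A.D" for d d'
    using t(2) that by (simp add: A.D_simps A'.D_simps)
  show lin: "t (u \<odot>\<^bsub>A.D\<^esub> d) = u \<odot>\<^bsub>A'.D\<^esub> t d" if "u \<in> carrier U" "d \<in> carrier A.D" for u d
    using t(3) that by (simp add: A.D_simps A'.D_simps)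
  show "n \<in> carrier N \<Longrightarrow> t (A.j n) = A'.j (\<phi> n)" by (rule t(4))
  show ac: "t (act L A.D x d) = act L A'.D x (t d)" if "d \<in> carrier A.D" for x d
    using lin that by (simp add: act_def)
  have z: "t \<zero>\<^bsub>A.D\<^esub> = \<zero>\<^bsub>A'.D\<^esub>"
    using add[of "\<zero>\<^bsub>A.D\<^esub>" "\<zero>\<^bsub>A.D\<^esub>"] closed[of "\<zero>\<^bsub>A.D\<^esub>"]
    by (metis A.D.M.M.r_zero A.D.M.M.zero_closed A'.D.M.M.add.l_cancel_one')
  show "t d \<in> torsion L e A'.D" if d: "d \<in> torsion L e A.D"
  proof -
    obtain k where k: "(act L A.D e ^^ k) d = \<zero>\<^bsub>A.D\<^esub>" and dc: "d \<in> carrier A.D"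
      using d by (auto simp: torsion_def)
    have "(act L A'.D e ^^ m) (t d) = t ((act L A.D e ^^ m) d)" for m
      using dc by (induction m) (simp_all add: ac)
    then have "(act L A'.D e ^^ k) (t d) = \<zero>\<^bsub>A'.D\<^esub>" by (simp only: k z)
    then show ?thesis using closed[OF dc] by (auto simp: torsion_def)
  qed
  show "t d \<in> module_comp s A'.D i" if d: "d \<in> module_comp s A.D i"
  proof -
    have cD: "module_comp s A'.D k = module_comp s A'.DV k" "module_comp s A.D k = module_comp s A.DV k" for k
      by (simp_all add: module_comp_def A.D_simps A'.D_simps)
    have "d \<in> module_comp s A.DV i" using d by (simp only: cD)
    then have "t d \<in> module_comp s A'.DV i"
    proof (induction rule: D_comp_induct[OF N(1) lie(1), consumes 1, case_names zero gen add])
      case zero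
      then show ?case using z D_comp_zero[OF N(2) lie(2)] by (simp add: A.D_simps A'.D_simps)
    next
      case (gen k w n)
      have n: "n \<in> carrier N" using gen module_comp_facts(2)[OF lie(1)] by blast
      then have nD: "A.j n \<in> carrier A.DV" using A.emb_closed by (simp add: A.D_simps)
      have "t (w \<odot>\<^bsub>A.DV\<^esub> A.j n) = w \<odot>\<^bsub>A'.DV\<^esub> A'.j (\<phi> n)"
        using lenv_comp_closed[OF gen(1)] n nD by (simp add: t(3,4))
      moreover have "w \<odot>\<^bsub>A'.DV\<^esub> A'.j (\<phi> n) \<in> module_comp s A'.DV (k + (i + k))"
        by (intro D_comp_smult[OF N(2) lie(2) gen(1)] D_comp_emb[OF N(2) lie(2)] lie_homD(5)[OF \<phi>] gen(2))
      moreover have "k + (i + k) = i" using bit_cancel[of k 0 i] by (simp only: add_0_right)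
      ultimately show ?case by (simp only:)
    next
      case (add x y)
      then show ?case using t(2) D_comp_add[OF N(2) lie(2)] by simp
    qed
    then show ?thesis by (simp only: cD)
  qed
qed

text \<open>Induced maps preserve e-torsion and hence restrict to the Enright modules. The functor
  laws are visible on the image of j and spread to all of D by
  \<open>emb_determines\<close>.\<close>

lemma enright_functor: "is_functor (M_e s L e h a :: (('g, 'm) gmod, _) cat) (M_e s L e h (- a)) (enright L e f a)"
proof -
  have tw: "twisted_module L e h f N" and li: "lie_module s L N" and di: "diagonal_in L h a N"
    if "N \<in> obj (M_e s L e h a)" for N :: "('g, 'm) gmod"
    using that twisted_moduleI by (auto simp: obj_M_e lie_module_def)
  have carr: "carrier (enright_mod L e f a N) = torsion L e (D_mod L f a N)"
    "add (enright_mod L e f a N) = add (D_mod L f a N)"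
    "u \<odot>\<^bsub>enright_mod L e f a N\<^esub> v = u \<odot>\<^bsub>D_mod L f a N\<^esub> v"
    "module_comp s (enright_mod L e f a N) i = module_comp s (D_mod L f a N) i \<inter> torsion L e (D_mod L f a N)"
    if N: "N \<in> obj (M_e s L e h a)" for N :: "('g, 'm) gmod" and u v i
  proof -
    interpret A: twisted_module L e h f N a by (rule tw[OF N])
    show "carrier (enright_mod L e f a N) = torsion L e A.D" "add (enright_mod L e f a N) = add A.D"
      "u \<odot>\<^bsub>enright_mod L e f a N\<^esub> v = u \<odot>\<^bsub>A.D\<^esub> v"
      "module_comp s (enright_mod L e f a N) i = module_comp s A.D i \<inter> torsion L e A.D"
      unfolding A.enright_eq[OF di[OF N]] by (auto simp: module_comp_def A.D.torsion_closed)
  qed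
  have tc: "v \<in> carrier (D_mod L f a N)" if "v \<in> torsion L e (D_mod L f a N)" for v and N :: "('g, 'm) gmod"
    using that by (simp add: torsion_def)
  have hom: "enright_map L e f a N N' \<phi> \<in> lie_hom s L (enright_mod L e f a N) (enright_mod L e f a N')"
    if N: "N \<in> obj (M_e s L e h a)" "N' \<in> obj (M_e s L e h a)" and \<phi>: "\<phi> \<in> lie_hom s L N N'"
    for N N' :: "('g, 'm) gmod" and \<phi>
  proof -
    interpret A: twisted_module L e h f N a by (rule tw[OF N(1)])
    note t = D_map_hom[OF li[OF N(1)] li[OF N(2)] \<phi>, where a = a]
    show ?thesis
      unfolding enright_map_def
      by (rule lie_homI) (use carr[OF N(1)] carr[OF N(2)] tc t(1-3,5,6)
          A.D.torsion_add A.D.torsion_smult in auto)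
  qed
  have ident: "enright_map L e f a N N (\<lambda>v\<in>carrier N. v) = (\<lambda>v\<in>carrier (enright_mod L e f a N). v)"
    if N: "N \<in> obj (M_e s L e h a)" for N :: "('g, 'm) gmod"
  proof -
    interpret A: twisted_module L e h f N a by (rule tw[OF N])
    note t = D_map_hom[OF li[OF N] li[OF N] lie_hom_id[OF li[OF N]], where a = a]
    have "D_map L f a N N (\<lambda>v\<in>carrier N. v) d = d" if "d \<in> carrier A.D" for d
    proof (rule A.emb_determines[where g = "act L A.D f" and Y = "carrier A.D" and \<psi> = "\<lambda>d. d"])
      show "D_map L f a N N (\<lambda>v\<in>carrier N. v) (A.j n) = A.j n" if "n \<in> carrier N" for n
        using t(4)[OF that] that by simp
    qed (assumption | rule HOL.refl t(7) t(1) that A.f_inject)+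
    then show ?thesis unfolding enright_map_def using carr[OF N] tc by (auto simp: restrict_def fun_eq_iff)
  qed
  have comp: "enright_map L e f a N N'' (compose (carrier N) \<psi> \<phi>) =
      compose (carrier (enright_mod L e f a N)) (enright_map L e f a N' N'' \<psi>) (enright_map L e f a N N' \<phi>)"
    if N: "N \<in> obj (M_e s L e h a)" "N' \<in> obj (M_e s L e h a)" "N'' \<in> obj (M_e s L e h a)"
      and \<phi>: "\<phi> \<in> lie_hom s L N N'" and \<psi>: "\<psi> \<in> lie_hom s L N' N''"
    for N N' N'' :: "('g, 'm) gmod" and \<phi> \<psi>
  proof -
    interpret A: twisted_module L e h f N a by (rule tw[OF N(1)])
    interpret A'': twisted_module L e h f N'' a by (rule tw[OF N(3)])
    note t = D_map_hom[OF li[OF N(1)] li[OF N(2)] \<phi>, where a = a]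
    note t' = D_map_hom[OF li[OF N(2)] li[OF N(3)] \<psi>, where a = a]
    note t'' = D_map_hom[OF li[OF N(1)] li[OF N(3)] lie_hom_compose[OF li[OF N(1)] li[OF N(2)] \<phi> \<psi>], where a = a]
    have "D_map L f a N N'' (compose (carrier N) \<psi> \<phi>) d = D_map L f a N' N'' \<psi> (D_map L f a N N' \<phi> d)"
      if "d \<in> carrier A.D" for d
    proof (rule A.emb_determines[where g = "act L A''.D f" and Y = "carrier A''.D"
          and \<psi> = "\<lambda>d. D_map L f a N' N'' \<psi> (D_map L f a N N' \<phi> d)"])
      show "D_map L f a N N'' (compose (carrier N) \<psi> \<phi>) (A.j n) =
          D_map L f a N' N'' \<psi> (D_map L f a N N' \<phi> (A.j n))" if "n \<in> carrier N" for n
        using t(4)[OF that] t''(4)[OF that] t'(4)[OF lie_homD(2)[OF \<phi> that]] that by (simp add: compose_eq)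
      show "D_map L f a N' N'' \<psi> (D_map L f a N N' \<phi> (act L A.D f v)) =
          act L A''.D f (D_map L f a N' N'' \<psi> (D_map L f a N N' \<phi> v))" if "v \<in> carrier A.D" for v
        using t(7)[OF that] t'(7)[OF t(1)[OF that]] by simp
      show "D_map L f a N' N'' \<psi> (D_map L f a N N' \<phi> v) \<in> carrier A''.D" if "v \<in> carrier A.D" for v
        by (rule t'(1)[OF t(1)[OF that]])
    qed (assumption | rule t''(7) t''(1) that A''.f_inject)+
    then show ?thesis
      unfolding enright_map_def using carr[OF N(1)] carr[OF N(2)] tc t(6)
      by (auto simp: restrict_def compose_def fun_eq_iff)
  qed
  have obj: "enright_mod L e f a N \<in> obj (M_e s L e h (- a))" if N: "N \<in> obj (M_e s L e h a)" for N :: "('g, 'm) gmod"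
    by (rule twisted_module.enright_obj[OF tw[OF N] N])
  have cat: "category (M_e s L e h b :: (('g, 'm) gmod, _) cat)" for b by (rule category_M_e)
  show ?thesis
    unfolding is_functor_def enright_def
    using cat hom ident comp obj by (simp add: M_e_def)
qed

end

section \<open>The unit of the Enright functors\<close>

context sl2_superalgebra
begin

text \<open>Heuristically \<open>\<D>\<^sub>-\<^sub>a\<D>\<^sub>a(N) = N[f\<^sup>-\<^sup>1]\<close>, and \<open>eta a N n\<close> is \<open>n\<close>; since \<open>D_emb a N n\<close> may lie
  outside of the Enright module, the element is described after multiplication with a power of \<open>f\<close>.\<close>

definition eta_rel :: "complex \<Rightarrow> ('g, 'm) gmod \<Rightarrow> ('g, 'm) gvec \<Rightarrow> ('g, 'm) gvec \<Rightarrow> bool" where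
  "eta_rel a N n y \<longleftrightarrow> y \<in> carrier (D_mod L f (- a) (enright_mod L e f a N)) \<and>
     (\<exists>t. (act L (D_mod L f a N) f ^^ t) (D_emb a N n) \<in> carrier (enright_mod L e f a N) \<and>
       (act L (D_mod L f (- a) (enright_mod L e f a N)) f ^^ t) y =
         D_emb (- a) (enright_mod L e f a N) ((act L (D_mod L f a N) f ^^ t) (D_emb a N n)))"

definition eta :: "complex \<Rightarrow> ('g, 'm) gmod \<Rightarrow> ('g, 'm) gvec \<Rightarrow> ('g, 'm) gvec" where
  "eta a N = (\<lambda>n\<in>carrier N. THE y. eta_rel a N n y)"

end

locale enright_object = twisted_module L e h f N a
  for L :: "'g::ab_group_add superalg" and e h f and N :: "('g, 'm) gmod" and a +
  fixes s :: bool
  assumes obj: "N \<in> obj (M_e s L e h a)"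
begin

abbreviation "C \<equiv> enright_mod L e f a N"

lemma lieN: "lie_module s L N" and diagN: "diagonal_in L h a N" and nilN: "locally_nilpotent L e N"
  using obj by (auto simp: obj_M_e)

lemma C_obj: "C \<in> obj (M_e s L e h (- a))" by (rule enright_obj[OF obj])

lemma lieC: "lie_module s L C" and diagC: "diagonal_in L h (- a) C"
  using C_obj by (auto simp: obj_M_e)

lemma C_simps: "carrier C = torsion L e D" "add C = add D" "\<zero>\<^bsub>C\<^esub> = \<zero>\<^bsub>D\<^esub>" "u \<odot>\<^bsub>C\<^esub> v = u \<odot>\<^bsub>D\<^esub> v"
  "act L C = act L D" "csc L C = csc L D" "module_comp s C i = module_comp s D i \<inter> torsion L e D"
  unfolding enright_eq[OF diagN] by (auto simp: module_comp_def D.torsion_closed)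

sublocale C: twisted_module L e h f C "- a"
  by (rule twisted_moduleI) (use lieC in \<open>simp add: lie_module_def\<close>)

lemma C_in_D: "m \<in> carrier C \<Longrightarrow> m \<in> carrier D" by (simp add: C_simps D.torsion_closed)

lemma C_f_pow: "m \<in> carrier C \<Longrightarrow> (act L D f ^^ k) m \<in> carrier C"
  by (simp add: C_simps torsion_f_pow)

lemma C_emb_f_pow: "m \<in> carrier C \<Longrightarrow> C.j ((act L D f ^^ k) m) = (act L C.D f ^^ k) (C.j m)"
  using C.emb_f_pow[of m k] by (simp add: C_simps)

definition rel_at :: "nat \<Rightarrow> ('g, 'm) gvec \<Rightarrow> ('g, 'm) gvec \<Rightarrow> bool" where
  "rel_at t n y \<longleftrightarrow> (act L D f ^^ t) (j n) \<in> carrier C \<and>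
     (act L C.D f ^^ t) y = C.j ((act L D f ^^ t) (j n))"

text \<open>Exponents may be raised, so finitely many elements of N can share one.\<close>

lemma rel_at_add: "rel_at t n y \<Longrightarrow> rel_at (k + t) n y"
  by (simp add: rel_at_def funpow_add C_f_pow C_emb_f_pow)

lemma eta_rel_iff: "eta_rel a N n y \<longleftrightarrow> y \<in> carrier C.D \<and> (\<exists>t. rel_at t n y)"
  by (simp add: eta_rel_def rel_at_def)

lemma rel_unique: "eta_rel a N n y \<Longrightarrow> eta_rel a N n y' \<Longrightarrow> y = y'"
proof -
  assume "eta_rel a N n y" "eta_rel a N n y'"
  then obtain t t' where y: "y \<in> carrier C.D" "y' \<in> carrier C.D" "rel_at t n y" "rel_at t' n y'"
    by (auto simp: eta_rel_iff)
  have "rel_at (t + t') n y" "rel_at (t + t') n y'"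
    using rel_at_add[OF y(3), of t'] rel_at_add[OF y(4), of t] by (simp_all add: add.commute)
  then show ?thesis using C.f_pow_inject[OF y(1,2), of "t + t'"] by (simp add: rel_at_def)
qed

lemma rel_exists: assumes n: "n \<in> carrier N" shows "\<exists>y. eta_rel a N n y"
proof -
  obtain t where t: "(act L D f ^^ t) (j n) \<in> torsion L e D"
    using f_pow_torsion[OF diagN nilN n] by blast
  let ?m = "(act L D f ^^ t) (j n)"
  have m: "?m \<in> carrier C" using t by (simp add: C_simps)
  then have "(act L C.D f ^^ t) ((C.f_root ^^ t) (C.j ?m)) = C.j ?m" by (simp add: C.f_pow_root_pow)
  then have "rel_at t n ((C.f_root ^^ t) (C.j ?m))" using m by (simp add: rel_at_def)
  then show ?thesis using m unfolding eta_rel_iff by (intro exI conjI) auto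
qed

lemma eta_rel: "n \<in> carrier N \<Longrightarrow> eta_rel a N n (eta a N n)"
  using theI'[of "eta_rel a N n"] rel_exists rel_unique by (simp add: eta_def) blast

lemma eta_eqI: "n \<in> carrier N \<Longrightarrow> y \<in> carrier C.D \<Longrightarrow> rel_at t n y \<Longrightarrow> eta a N n = y"
  using eta_rel rel_unique eta_rel_iff by blast

lemma eta_closed: "n \<in> carrier N \<Longrightarrow> eta a N n \<in> carrier C.D"
  using eta_rel eta_rel_iff by blast

lemma etaE: assumes "n \<in> carrier N" obtains t where "rel_at t n (eta a N n)"
  using eta_rel[OF assms] eta_rel_iff by blast

lemma eta_add:
  assumes n: "n \<in> carrier N" "n' \<in> carrier N"
  shows "eta a N (n \<oplus>\<^bsub>N\<^esub> n') = eta a N n \<oplus>\<^bsub>C.D\<^esub> eta a N n'"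
proof -
  obtain t where t: "rel_at t n (eta a N n)" using etaE[OF n(1)] .
  obtain t' where t': "rel_at t' n' (eta a N n')" using etaE[OF n(2)] .
  have r: "rel_at (t + t') n (eta a N n)" "rel_at (t + t') n' (eta a N n')"
    using rel_at_add[OF t, of t'] rel_at_add[OF t', of t] by (simp_all add: add.commute)
  have "rel_at (t + t') (n \<oplus>\<^bsub>N\<^esub> n') (eta a N n \<oplus>\<^bsub>C.D\<^esub> eta a N n')"
  proof -
    let ?m = "(act L D f ^^ (t + t')) (j n)" and ?m' = "(act L D f ^^ (t + t')) (j n')"
    have m: "?m \<in> carrier C" "?m' \<in> carrier C" using r by (auto simp: rel_at_def)
    have "(act L D f ^^ (t + t')) (j (n \<oplus>\<^bsub>N\<^esub> n')) = ?m \<oplus>\<^bsub>C\<^esub> ?m'"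
      using n by (simp add: emb_add D.act_pow_add C_simps)
    moreover have "?m \<oplus>\<^bsub>C\<^esub> ?m' \<in> carrier C" using m by (rule C.N.M.M.a_closed)
    ultimately show ?thesis
      using r m eta_closed[OF n(1)] eta_closed[OF n(2)] by (simp add: rel_at_def C.D.act_pow_add C.emb_add)
  qed
  then show ?thesis using n eta_closed by (intro eta_eqI) auto
qed

text \<open>Put m = f^t j(n). In D_a(N) one has j(un) = phi_a(u) f^(-t) m, and the canonical map
  into D_(-a)(C) applies phi_(-a) to the coefficient, leaving u f^(-t): the twists cancel. The power
  f^k clears the denominator first, so that an element of \<open>U\<close> acts on the element m of
  \<open>C\<close>.\<close>

lemma eta_smult:
  assumes u: "u \<in> carrier U" and n: "n \<in> carrier N"
  shows "eta a N (u \<odot>\<^bsub>N\<^esub> n) = u \<odot>\<^bsub>C.D\<^esub> eta a N n"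
proof -
  let ?y = "eta a N n"
  obtain t where t: "rel_at t n ?y" using etaE[OF n] .
  let ?m = "(act L D f ^^ t) (j n)"
  have m: "?m \<in> carrier C" "(act L C.D f ^^ t) ?y = C.j ?m" using t by (auto simp: rel_at_def)
  have inv: "Fi [^]\<^bsub>V\<^esub> t \<otimes>\<^bsub>V\<^esub> F [^]\<^bsub>V\<^esub> t = \<one>\<^bsub>V\<^esub>"
  proof (induction t)
    case (Suc k)
    have "Fi [^]\<^bsub>V\<^esub> Suc k \<otimes>\<^bsub>V\<^esub> F [^]\<^bsub>V\<^esub> Suc k = Fi [^]\<^bsub>V\<^esub> k \<otimes>\<^bsub>V\<^esub> (Fi \<otimes>\<^bsub>V\<^esub> (F \<otimes>\<^bsub>V\<^esub> F [^]\<^bsub>V\<^esub> k))"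
      by (simp only: lenv.nat_pow_Suc2[of F] lenv.nat_pow_Suc[of Fi] lenv.m_assoc iota_closed Fi_closed
          lenv.nat_pow_closed lenv.m_closed)
    then show ?case using Suc by simp
  qed simp
  have Fp: "tw.twst b (F [^]\<^bsub>V\<^esub> (k::nat)) = F [^]\<^bsub>V\<^esub> k" "tw.twst b (Fi [^]\<^bsub>V\<^esub> k) = Fi [^]\<^bsub>V\<^esub> k" for b k
    by (induction k) (simp_all add: tw.twst_one tw.twst_mult tw.twst_F tw.twst_Fi)
  let ?w = "tw.twst a (\<iota> u) \<otimes>\<^bsub>V\<^esub> Fi [^]\<^bsub>V\<^esub> t"
  obtain k :: nat and r where r: "r \<in> carrier U" "F [^]\<^bsub>V\<^esub> k \<otimes>\<^bsub>V\<^esub> ?w = \<iota> r"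
    using lenv_fraction[of ?w False 0] by auto
  have jn: "j n \<in> carrier DV" "?m \<in> carrier DV" using n emb_closed[OF n] D.act_pow_closed[of "j n" t f] by (simp_all add: D_simps)
  have "(act L D f ^^ k) (j (u \<odot>\<^bsub>N\<^esub> n)) = F [^]\<^bsub>V\<^esub> k \<odot>\<^bsub>DV\<^esub> (tw.twst a (\<iota> u) \<odot>\<^bsub>DV\<^esub> j n)"
    using u n jn by (simp add: D_emb_smult[OF N_module] act_f_pow DV.smult_closed)
  also have "tw.twst a (\<iota> u) \<odot>\<^bsub>DV\<^esub> j n = ?w \<odot>\<^bsub>DV\<^esub> ?m"
    using jn u by (simp add: act_f_pow DV.smult_assoc[symmetric] lenv.m_assoc inv)
  also have "F [^]\<^bsub>V\<^esub> k \<odot>\<^bsub>DV\<^esub> (?w \<odot>\<^bsub>DV\<^esub> ?m) = r \<odot>\<^bsub>C\<^esub> ?m"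
    using jn(2) u by (simp only: DV.smult_assoc[symmetric] r(2) C_simps D_simps lenv.m_closed tw.twst_closed
        iota_closed Fi_closed lenv.nat_pow_closed)
  finally have fk: "(act L D f ^^ k) (j (u \<odot>\<^bsub>N\<^esub> n)) = r \<odot>\<^bsub>C\<^esub> ?m" .
  have rm: "r \<odot>\<^bsub>C\<^esub> ?m \<in> carrier C" using r(1) m(1) by (rule C.N.M.smult_closed)
  have y: "?y \<in> carrier C.DV" using eta_closed[OF n] by (simp add: C.D_simps)
  have "C.j (r \<odot>\<^bsub>C\<^esub> ?m) = tw.twst (- a) (\<iota> r) \<odot>\<^bsub>C.DV\<^esub> C.j ?m"
    by (rule D_emb_smult[OF C.N_module r(1) m(1)])
  also have "tw.twst (- a) (\<iota> r) = F [^]\<^bsub>V\<^esub> k \<otimes>\<^bsub>V\<^esub> (\<iota> u \<otimes>\<^bsub>V\<^esub> Fi [^]\<^bsub>V\<^esub> t)"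
    unfolding r(2)[symmetric] using u by (simp add: tw.twst_mult Fp tw.twst_inverse)
  also have "C.j ?m = F [^]\<^bsub>V\<^esub> t \<odot>\<^bsub>C.DV\<^esub> ?y" using m(2) y by (simp add: C.act_f_pow)
  also have "(F [^]\<^bsub>V\<^esub> k \<otimes>\<^bsub>V\<^esub> (\<iota> u \<otimes>\<^bsub>V\<^esub> Fi [^]\<^bsub>V\<^esub> t)) \<odot>\<^bsub>C.DV\<^esub> (F [^]\<^bsub>V\<^esub> t \<odot>\<^bsub>C.DV\<^esub> ?y) =
      F [^]\<^bsub>V\<^esub> k \<odot>\<^bsub>C.DV\<^esub> (\<iota> u \<odot>\<^bsub>C.DV\<^esub> ?y)"
    using y u by (simp add: C.DV.smult_assoc[symmetric] lenv.m_assoc inv)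
  also have "\<dots> = (act L C.D f ^^ k) (u \<odot>\<^bsub>C.D\<^esub> ?y)"
    using y u by (simp add: C.act_f_pow C.D_simps C.DV.smult_closed)
  finally have "rel_at k (u \<odot>\<^bsub>N\<^esub> n) (u \<odot>\<^bsub>C.D\<^esub> ?y)" using rm by (simp add: rel_at_def fk)
  moreover have "u \<odot>\<^bsub>C.D\<^esub> ?y \<in> carrier C.D" using u eta_closed[OF n] by (rule C.D.M.smult_closed)
  ultimately show ?thesis using u n by (intro eta_eqI) (auto intro: N.M.smult_closed)
qed

lemma eta_act: "n \<in> carrier N \<Longrightarrow> eta a N (act L N x n) = act L C.D x (eta a N n)"
  by (simp add: act_def eta_smult)

lemma eta_zero: "eta a N \<zero>\<^bsub>N\<^esub> = \<zero>\<^bsub>C.D\<^esub>"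
  using eta_add[of "\<zero>\<^bsub>N\<^esub>" "\<zero>\<^bsub>N\<^esub>"] eta_closed[of "\<zero>\<^bsub>N\<^esub>"]
  by (metis N.M.M.r_zero N.M.M.zero_closed C.D.M.M.add.l_cancel_one')

lemma eta_torsion: assumes n: "n \<in> carrier N" shows "eta a N n \<in> torsion L e C.D"
proof -
  obtain k where "(act L N e ^^ k) n = \<zero>\<^bsub>N\<^esub>" using nilN n unfolding locally_nilpotent_def torsion_def by blast
  moreover have "(act L C.D e ^^ k) (eta a N n) = eta a N ((act L N e ^^ k) n)"
    using n by (induction k) (simp_all add: eta_act)
  ultimately have "(act L C.D e ^^ k) (eta a N n) = \<zero>\<^bsub>C.D\<^esub>" by (simp add: eta_zero)
  then show ?thesis using eta_closed[OF n] unfolding torsion_def by blast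
qed

text \<open>The parity of n is carried along j, f^t, the second canonical map and f^(-t), all of
  which preserve it.\<close>

lemma eta_comp: assumes n: "n \<in> module_comp s N i" shows "eta a N n \<in> module_comp s C.D i"
proof -
  have nc: "n \<in> carrier N" using n module_comp_facts(2)[OF lieN] by blast
  obtain t where t: "rel_at t n (eta a N n)" using etaE[OF nc] .
  let ?m = "(act L D f ^^ t) (j n)"
  have lieD: "lie_module s L D" by (rule lie_module_D[OF lieN])
  have jD: "j n \<in> module_comp s D i"
    using D_comp_emb[OF N_module lieN n, of a] by (simp add: module_comp_def D_simps split: if_splits)
  have "?m \<in> module_comp s D i"
  proof (induction t)
    case (Suc t)
    show ?case
      using module_comp_facts(5)[OF lieD env_comp_intros(2)[OF even(3)] Suc]
      by (simp only: add_0_left funpow.simps comp_apply act_def)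
  qed (use jD in simp)
  then have "?m \<in> module_comp s C i" using t by (simp add: rel_at_def C_simps)
  then have Cm: "C.j ?m \<in> module_comp s C.DV i" by (rule D_comp_emb[OF C.N_module lieC])
  have "(C.f_root ^^ k) (C.j ?m) \<in> module_comp s C.DV i" for k
  proof (induction k)
    case (Suc k)
    show ?case using D_comp_smult[OF C.N_module lieC lenv_comp_Fi Suc]
      by (simp only: add_0_left funpow.simps comp_apply C.f_root_def)
  qed (use Cm in simp)
  moreover have "eta a N n = (C.f_root ^^ t) (C.j ?m)"
    using t C.root_pow_f_pow[OF eta_closed[OF nc], of t] by (simp add: rel_at_def)
  ultimately show ?thesis by (cases s) (simp_all add: module_comp_def C.D_simps)
qed

abbreviation "C2 \<equiv> enright_mod L e f (- a) C"

lemma C2_eq: "C2 = C.D.tors" by (rule C.enright_eq[OF diagC])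

lemma C2_obj: "C2 \<in> obj (M_e s L e h a)"
  using C.enright_obj[OF C_obj] by simp

lemma C2_simps: "carrier C2 = torsion L e C.D" "add C2 = add C.D" "\<zero>\<^bsub>C2\<^esub> = \<zero>\<^bsub>C.D\<^esub>" "u \<odot>\<^bsub>C2\<^esub> v = u \<odot>\<^bsub>C.D\<^esub> v"
  "act L C2 = act L C.D" "csc L C2 = csc L C.D" "module_comp s C2 i = module_comp s C.D i \<inter> torsion L e C.D"
  unfolding C2_eq by (auto simp: module_comp_def C.D.torsion_closed)

lemma eta_hom: "eta a N \<in> lie_hom s L N C2"
proof (rule lie_homI)
  show "eta a N \<in> extensional (carrier N)" by (simp add: eta_def)
  show "eta a N v \<in> module_comp s C2 i" if "v \<in> module_comp s N i" for v i
    using that eta_comp eta_torsion module_comp_facts(2)[OF lieN, of i] by (auto simp: C2_simps)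
qed (simp_all add: C2_simps eta_torsion eta_add eta_smult)

section \<open>Bijectivity of the unit for non-integral parameters\<close>

lemma N_f_injective:
  assumes a: "a \<notin> \<int>" and n: "n \<in> carrier N" shows "(act L N f ^^ k) n = \<zero>\<^bsub>N\<^esub> \<Longrightarrow> n = \<zero>\<^bsub>N\<^esub>"
proof (induction k)
  case (Suc k)
  have "(act L N f ^^ k) n \<in> {\<zero>\<^bsub>N\<^esub>}"
    by (rule N.f_injective[OF N.h_subspace_zero _ _ diagN a nilN]) (use Suc.prems n in auto)
  then show ?case using Suc.IH by simp
qed simp

lemma eta_bij:
  assumes a: "a \<notin> \<int>" shows "bij_betw (eta a N) (carrier N) (carrier C2)"
proof -
  \<comment> \<open>Both canonical maps lose only f-torsion; f is injective on D_a(N), and on N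
    because a is not an integer.\<close>
  have ker: "n = \<zero>\<^bsub>N\<^esub>" if n: "n \<in> carrier N" and z: "eta a N n = \<zero>\<^bsub>C.D\<^esub>" for n
  proof -
    obtain t where t: "rel_at t n (eta a N n)" using etaE[OF n] .
    let ?m = "(act L D f ^^ t) (j n)"
    have m: "?m \<in> carrier C" "C.j ?m = \<zero>\<^bsub>C.D\<^esub>" using t z by (simp_all add: rel_at_def)
    then obtain k where "(act L D f ^^ k) ?m = \<zero>\<^bsub>D\<^esub>" using C.emb_kernel[OF m] by (auto simp: C_simps)
    then have "(act L D f ^^ (k + t)) (j n) = \<zero>\<^bsub>D\<^esub>" by (simp add: funpow_add)
    then have "j n = \<zero>\<^bsub>D\<^esub>" using f_pow_inject[of "j n" "\<zero>\<^bsub>D\<^esub>" "k + t"] n by simp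
    then obtain l where "(act L N f ^^ l) n = \<zero>\<^bsub>N\<^esub>" using emb_kernel[OF n] by blast
    then show ?thesis by (rule N_f_injective[OF a n])
  qed
  have "inj_on (eta a N) (carrier N)"
  proof (rule inj_onI)
    fix n n' assume n: "n \<in> carrier N" "n' \<in> carrier N" and eq: "eta a N n = eta a N n'"
    have "eta a N (csc L N (- 1) n' \<oplus>\<^bsub>N\<^esub> n) = csc L C.D (- 1) (eta a N n') \<oplus>\<^bsub>C.D\<^esub> eta a N n'"
      using n eq by (simp add: eta_add) (simp add: csc_def eta_smult)
    also have "\<dots> = \<zero>\<^bsub>C.D\<^esub>" using eta_closed[OF n(2)] C.D.sc_neg_cancel[of "eta a N n'" 1] by simp
    finally have "csc L N (- 1) n' \<oplus>\<^bsub>N\<^esub> n = \<zero>\<^bsub>N\<^esub>" using n by (intro ker) simp_all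
    then have "\<ominus>\<^bsub>N\<^esub> n' \<oplus>\<^bsub>N\<^esub> n = \<zero>\<^bsub>N\<^esub>" using n by (simp add: N.sc_minus)
    then have "n \<oplus>\<^bsub>N\<^esub> \<ominus>\<^bsub>N\<^esub> n' = \<zero>\<^bsub>N\<^esub>" using n by (simp add: N.M.M.a_comm)
    then show "n = n'" using n N.M.M.minus_equality[of n "\<ominus>\<^bsub>N\<^esub> n'"] by simp
  qed
  moreover have "carrier C2 \<subseteq> eta a N ` carrier N"
  proof
    fix y assume y: "y \<in> carrier C2"
    then have yD: "y \<in> carrier C.D" by (simp add: C2_simps C.D.torsion_closed)
    interpret T: sl2_module L e h f C2
      by (intro sl2_module.intro sl2_superalgebra_axioms sl2_module_axioms.intro)
        (use C2_obj in \<open>simp add: obj_M_e lie_module_def\<close>)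
    let ?S = "eta a N ` carrier N"
    \<comment> \<open>With the image of the unit a submodule, f is injective modulo it, and
      surjectivity reduces to finding some power of f that carries y into the image.\<close>
    have S: "T.h_subspace ?S"
      unfolding T.h_subspace_def
    proof (intro conjI ballI allI)
      show "?S \<subseteq> carrier C2" using eta_torsion by (auto simp: C2_simps)
      show "\<zero>\<^bsub>C2\<^esub> \<in> ?S" by (rule image_eqI[of _ _ "\<zero>\<^bsub>N\<^esub>"]) (simp_all add: C2_simps eta_zero)
      show "v \<oplus>\<^bsub>C2\<^esub> w \<in> ?S" if "v \<in> ?S" "w \<in> ?S" for v w
        using that by (auto simp: C2_simps eta_add[symmetric])
      show "csc L C2 c v \<in> ?S" if "v \<in> ?S" for c v
        using that by (auto simp: csc_def C2_simps eta_smult[symmetric] N.M.smult_closed)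
      show "act L C2 h v \<in> ?S" if "v \<in> ?S" for v
        using that by (auto simp: C2_simps eta_act[symmetric])
    qed
    have S': "act L C2 x v \<in> ?S" if "v \<in> ?S" for x v
      using that by (auto simp: C2_simps eta_act[symmetric])
    obtain t m where m: "m \<in> carrier C" "(act L C.D f ^^ t) y = C.j m" using C.fraction[OF yD] by blast
    obtain r n where n: "n \<in> carrier N" "(act L D f ^^ r) m = j n" using fraction[OF C_in_D[OF m(1)]] by blast
    have jC: "j n \<in> carrier C" using C_f_pow[OF m(1), of r] by (simp add: n(2))
    have "(act L C.D f ^^ (r + t)) y = C.j (j n)"
      using C_emb_f_pow[OF m(1), of r] by (simp add: funpow_add m(2) n(2))
    \<comment> \<open>The exponent 0 is admissible here, as j(n) = f^r m already lies in
      \<open>C\<close>.\<close>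
    then have "eta a N n = (act L C.D f ^^ (r + t)) y"
      using jC n(1) yD by (intro eta_eqI[of _ _ 0]) (simp_all add: rel_at_def)
    moreover have "eta a N n \<in> ?S" by (rule imageI[OF n(1)])
    ultimately have "(act L C2 f ^^ (r + t)) y \<in> ?S" by (simp only: C2_simps)
    moreover have "(act L C2 f ^^ k) y \<in> ?S \<Longrightarrow> y \<in> ?S" for k
    proof (induction k)
      case (Suc k)
      have "(act L C2 f ^^ k) y \<in> ?S"
        by (rule T.f_injective[OF S S' S' _ a])
          (use C2_obj y Suc.prems in \<open>simp_all add: obj_M_e\<close>)
      then show ?case by (rule Suc.IH)
    qed simp
    ultimately show "y \<in> ?S" by blast
  qed
  moreover have "eta a N ` carrier N \<subseteq> carrier C2" using eta_torsion by (auto simp: C2_simps)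
  ultimately show ?thesis by (auto simp: bij_betw_def)
qed

end

lemma is_functor_fmap:
  "is_functor C D F \<Longrightarrow> X \<in> obj C \<Longrightarrow> Y \<in> obj C \<Longrightarrow> f \<in> homs C X Y
    \<Longrightarrow> fmap F X Y f \<in> homs D (fobj F X) (fobj F Y)"
  unfolding is_functor_def by blast

context sl2_superalgebra
begin

lemma enright_objectI: "N \<in> obj (M_e s L e h a) \<Longrightarrow> enright_object L e h f N a s"
  by (intro enright_object.intro twisted_moduleI enright_object_axioms.intro)
    (simp_all add: obj_M_e lie_module_def)

text \<open>The value of the unit is characterized by an equation, so the right-hand side only has
  to satisfy the equation for \<phi> n; this holds because both induced maps commute with f and with
  the canonical maps.\<close>

lemma eta_natural:
  assumes N: "N \<in> obj (M_e s L e h a)" "N' \<in> obj (M_e s L e h a)" and \<phi>: "\<phi> \<in> lie_hom s L N N'"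
    and n: "n \<in> carrier N"
  shows "eta a N' (\<phi> n) = enright_map L e f (- a) (enright_mod L e f a N) (enright_mod L e f a N')
    (enright_map L e f a N N' \<phi>) (eta a N n)"
proof -
  interpret A: enright_object L e h f N a s by (rule enright_objectI[OF N(1)])
  interpret A': enright_object L e h f N' a s by (rule enright_objectI[OF N(2)])
  let ?\<psi> = "enright_map L e f a N N' \<phi>"
  have \<psi>: "?\<psi> \<in> lie_hom s L A.C A'.C"
    using is_functor_fmap[OF enright_functor N, of \<phi>] \<phi> by (simp add: enright_def M_e_def)
  note t = D_map_hom[OF A.lieN A'.lieN \<phi>, where a = a]
  note t' = D_map_hom[OF A.lieC A'.lieC \<psi>, where a = "- a"]
  let ?t = "D_map L f a N N' \<phi>" and ?t' = "D_map L f (- a) A.C A'.C ?\<psi>"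
  obtain k where k: "A.rel_at k n (eta a N n)" using A.etaE[OF n] .
  let ?m = "(act L A.D f ^^ k) (A.j n)" and ?m' = "(act L A'.D f ^^ k) (A'.j (\<phi> n))"
  have jn: "A.j n \<in> carrier A.D" using n by simp
  have y: "eta a N n \<in> carrier A.C.D" by (rule A.eta_closed[OF n])
  have m: "?m \<in> carrier A.C" "(act L A.C.D f ^^ k) (eta a N n) = A.C.j ?m"
    using k by (auto simp: A.rel_at_def)
  have m': "?t ?m = ?m'"
    using jn n by (induction k) (simp_all add: t(4,7))
  have \<psi>m: "?\<psi> ?m = ?m'" using m(1) m' by (simp add: enright_map_def)
  have "?t' ((act L A.C.D f ^^ i) (eta a N n)) = (act L A'.C.D f ^^ i) (?t' (eta a N n))" for i
    using y by (induction i) (simp_all add: t'(7))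
  then have "(act L A'.C.D f ^^ k) (?t' (eta a N n)) = ?t' (A.C.j ?m)" using m(2) by metis
  also have "\<dots> = A'.C.j ?m'" using t'(4)[OF m(1)] \<psi>m by simp
  finally have "A'.rel_at k (\<phi> n) (?t' (eta a N n))"
    using lie_homD(2)[OF \<psi> m(1)] \<psi>m by (simp add: A'.rel_at_def)
  then have "eta a N' (\<phi> n) = ?t' (eta a N n)"
    using lie_homD(2)[OF \<phi> n] t'(1)[OF y] by (intro A'.eta_eqI)
  then show ?thesis using A.eta_torsion[OF n] by (simp add: enright_map_def A.C2_simps)
qed

end

section \<open>Natural isomorphisms\<close>

lemma is_functor_id: "category C \<Longrightarrow> is_functor C C id_functor"
  by (simp add: is_functor_def id_functor_def)

lemma is_functor_comp: "is_functor C D F \<Longrightarrow> is_functor D E G \<Longrightarrow> is_functor C E (comp_functor G F)"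
  unfolding is_functor_def comp_functor_def by simp

text \<open>\<open>equivalence\<close> asks for a counit, whose direction is opposite to that of the
  unit at the parameter -a. Pointwise inverses are natural because the components can be
  cancelled.\<close>

lemma nat_iso_inverse:
  assumes "nat_iso C D F G \<eta>" shows "\<exists>\<epsilon>. nat_iso C D G F \<epsilon>"
proof -
  have nt: "nat_trans C D F G \<eta>" using assms by (simp add: nat_iso_def)
  then have FG: "is_functor C D F" "is_functor C D G" by (simp_all add: nat_trans_def)
  then have cat: "category D" by (simp add: is_functor_def)
  have ob: "fobj F X \<in> obj D" "fobj G X \<in> obj D" if "X \<in> obj C" for X
    using FG that by (auto simp: is_functor_def)
  have hm: "fmap F X Y f \<in> homs D (fobj F X) (fobj F Y)" "fmap G X Y f \<in> homs D (fobj G X) (fobj G Y)"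
    if "X \<in> obj C" "Y \<in> obj C" "f \<in> homs C X Y" for X Y f
    using FG that by (auto simp: is_functor_def)
  have e: "\<eta> X \<in> homs D (fobj F X) (fobj G X)" if "X \<in> obj C" for X
    using nt that by (auto simp: nat_trans_def)
  have nat: "comp D (fobj F X) (fobj F Y) (fobj G Y) (\<eta> Y) (fmap F X Y f) =
      comp D (fobj F X) (fobj G X) (fobj G Y) (fmap G X Y f) (\<eta> X)"
    if "X \<in> obj C" "Y \<in> obj C" "f \<in> homs C X Y" for X Y f
    using nt that by (auto simp: nat_trans_def)
  have cc: "comp D X Y Z g f \<in> homs D X Z"
    if "X \<in> obj D" "Y \<in> obj D" "Z \<in> obj D" "f \<in> homs D X Y" "g \<in> homs D Y Z" for X Y Z f g
    using cat that unfolding category_def by blast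
  have ci: "comp D X X Y f (ident D X) = f" "comp D X Y Y (ident D Y) f = f"
    if "X \<in> obj D" "Y \<in> obj D" "f \<in> homs D X Y" for X Y f
    using cat that unfolding category_def by blast+
  have ca: "comp D W X Z (comp D X Y Z k g) f = comp D W Y Z k (comp D W X Y g f)"
    if "W \<in> obj D" "X \<in> obj D" "Y \<in> obj D" "Z \<in> obj D" "f \<in> homs D W X" "g \<in> homs D X Y" "k \<in> homs D Y Z"
    for W X Y Z f g k
    using cat that unfolding category_def by blast
  have "\<forall>X\<in>obj C. \<exists>\<theta>. \<theta> \<in> homs D (fobj G X) (fobj F X) \<and>
        comp D (fobj F X) (fobj G X) (fobj F X) \<theta> (\<eta> X) = ident D (fobj F X) \<and>
        comp D (fobj G X) (fobj F X) (fobj G X) (\<eta> X) \<theta> = ident D (fobj G X)"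
    using assms unfolding nat_iso_def by blast
  from bchoice[OF this] obtain \<theta> where "\<forall>X\<in>obj C. \<theta> X \<in> homs D (fobj G X) (fobj F X) \<and>
        comp D (fobj F X) (fobj G X) (fobj F X) (\<theta> X) (\<eta> X) = ident D (fobj F X) \<and>
        comp D (fobj G X) (fobj F X) (fobj G X) (\<eta> X) (\<theta> X) = ident D (fobj G X)" ..
  then have th: "\<theta> X \<in> homs D (fobj G X) (fobj F X)"
    and th1: "comp D (fobj F X) (fobj G X) (fobj F X) (\<theta> X) (\<eta> X) = ident D (fobj F X)"
    and th2: "comp D (fobj G X) (fobj F X) (fobj G X) (\<eta> X) (\<theta> X) = ident D (fobj G X)"
    if "X \<in> obj C" for X using that by blast+
  have "comp D (fobj G X) (fobj G Y) (fobj F Y) (\<theta> Y) (fmap G X Y f) =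
      comp D (fobj G X) (fobj F X) (fobj F Y) (fmap F X Y f) (\<theta> X)"
    if X: "X \<in> obj C" and Y: "Y \<in> obj C" and f: "f \<in> homs C X Y" for X Y f
  proof -
    note o = ob[OF X] ob[OF Y] and m = hm[OF X Y f] e[OF X] e[OF Y] th[OF X] th[OF Y]
    have "fmap G X Y f = comp D (fobj G X) (fobj G X) (fobj G Y) (fmap G X Y f)
        (comp D (fobj G X) (fobj F X) (fobj G X) (\<eta> X) (\<theta> X))"
      unfolding th2[OF X] by (rule ci(1)[symmetric, OF o(2,4) m(2)])
    also have "\<dots> = comp D (fobj G X) (fobj F X) (fobj G Y)
        (comp D (fobj F X) (fobj G X) (fobj G Y) (fmap G X Y f) (\<eta> X)) (\<theta> X)"
      by (rule ca[symmetric, OF o(2) o(1) o(2) o(4) m(5) m(3) m(2)])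
    also have "\<dots> = comp D (fobj G X) (fobj F X) (fobj G Y)
        (comp D (fobj F X) (fobj F Y) (fobj G Y) (\<eta> Y) (fmap F X Y f)) (\<theta> X)"
      by (simp only: nat[OF X Y f])
    also have "\<dots> = comp D (fobj G X) (fobj F Y) (fobj G Y) (\<eta> Y)
        (comp D (fobj G X) (fobj F X) (fobj F Y) (fmap F X Y f) (\<theta> X))" (is "_ = comp D _ _ _ _ ?g")
      by (rule ca[OF o(2) o(1) o(3) o(4) m(5) m(1) m(4)])
    finally have "comp D (fobj G X) (fobj G Y) (fobj F Y) (\<theta> Y) (fmap G X Y f) =
        comp D (fobj G X) (fobj G Y) (fobj F Y) (\<theta> Y) (comp D (fobj G X) (fobj F Y) (fobj G Y) (\<eta> Y) ?g)"
      by simp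
    also have "\<dots> = comp D (fobj G X) (fobj F Y) (fobj F Y)
        (comp D (fobj F Y) (fobj G Y) (fobj F Y) (\<theta> Y) (\<eta> Y)) ?g"
      by (rule ca[symmetric, OF o(2) o(3) o(4) o(3) cc[OF o(2) o(1) o(3) m(5) m(1)] m(4) m(6)])
    also have "\<dots> = ?g"
      unfolding th1[OF Y] by (rule ci(2)[OF o(2,3) cc[OF o(2) o(1) o(3) m(5) m(1)]])
    finally show ?thesis .
  qed
  then have "nat_trans C D G F \<theta>" using FG th unfolding nat_trans_def by blast
  then have "nat_iso C D G F \<theta>" using e th1 th2 unfolding nat_iso_def by blast
  then show ?thesis by blast
qed

text \<open>Only the parity of the inverse requires an argument: if x0 + x1 is the preimage of a
  homogeneous y, the component of the wrong parity is mapped into both parts of \<open>Y\<close>,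
  hence to zero, and injectivity removes it.\<close>

lemma (in lie_superalgebra) lie_hom_inverse:
  assumes lie: "lie_module s L X" "lie_module s L Y" and \<phi>: "\<phi> \<in> lie_hom s L X Y"
    and bij: "bij_betw \<phi> (carrier X) (carrier Y)"
  shows "(\<lambda>y\<in>carrier Y. inv_into (carrier X) \<phi> y) \<in> lie_hom s L Y X"
proof -
  let ?i = "inv_into (carrier X) \<phi>"
  interpret X: left_module "env L" X using lie by (simp add: lie_module_def)
  interpret Y: left_module "env L" Y using lie by (simp add: lie_module_def)
  note p = lie_homD[OF \<phi>]
  have ic: "?i y \<in> carrier X" "\<phi> (?i y) = y" if "y \<in> carrier Y" for y
    using bij that by (auto simp: bij_betw_def inv_into_into f_inv_into_f)
  have ii: "?i (\<phi> x) = x" if "x \<in> carrier X" for x using bij that by (auto simp: bij_betw_def)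
  have comp: "?i y \<in> module_comp s X i" if y: "y \<in> module_comp s Y i" for y i
  proof (cases s)
    case False
    then show ?thesis using ic that by simp
  next
    case True
    have yc: "y \<in> carrier Y" using y module_comp_facts(2)[OF lie(2)] by blast
    have gX: "super_graded L X" and gY: "super_graded L Y" using lie True by (simp_all add: lie_module_def)
    have sgY: "additive_subgroup (mpart Y k) Y" for k using gY by (simp add: super_graded_def)
    obtain x0 x1 where x: "x0 \<in> mpart X 0" "x1 \<in> mpart X 1" "?i y = x0 \<oplus>\<^bsub>X\<^esub> x1"
      using gX ic(1)[OF yc] unfolding super_graded_def by blast
    have xc: "x0 \<in> carrier X" "x1 \<in> carrier X"
      using x True module_comp_facts(2)[OF lie(1), of 0] module_comp_facts(2)[OF lie(1), of 1] by auto
    have px: "\<phi> x0 \<in> mpart Y 0" "\<phi> x1 \<in> mpart Y 1" using p(5)[of x0 0] p(5)[of x1 1] x True by auto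
    have pc: "\<phi> x0 \<in> carrier Y" "\<phi> x1 \<in> carrier Y" using p(2) xc by auto
    have ysum: "y = \<phi> x0 \<oplus>\<^bsub>Y\<^esub> \<phi> x1" using ic(2)[OF yc] p(3)[OF xc] x(3) by simp
    have int: "mpart Y 0 \<inter> mpart Y 1 = {\<zero>\<^bsub>Y\<^esub>}" using gY by (simp add: super_graded_def)
    have z: "\<phi> \<zero>\<^bsub>X\<^esub> = \<zero>\<^bsub>Y\<^esub>"
      using p(3)[of "\<zero>\<^bsub>X\<^esub>" "\<zero>\<^bsub>X\<^esub>"] p(2)[of "\<zero>\<^bsub>X\<^esub>"]
      by (metis X.M.r_zero X.M.zero_closed Y.M.add.l_cancel_one')
    have diff: "v \<in> mpart Y k" if "v \<in> carrier Y" "w \<in> mpart Y k" "v \<oplus>\<^bsub>Y\<^esub> w \<in> mpart Y k" for v w k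
    proof -
      have wc: "w \<in> carrier Y" using additive_subgroup.a_Hcarr[OF sgY that(2)] .
      have "(v \<oplus>\<^bsub>Y\<^esub> w) \<oplus>\<^bsub>Y\<^esub> (\<ominus>\<^bsub>Y\<^esub> w) \<in> mpart Y k"
        by (intro additive_subgroup.a_closed[OF sgY] that additive_subgroup.a_inv_closed[OF sgY])
      then show ?thesis using that(1) wc by (simp add: Y.M.a_assoc Y.M.r_neg)
    qed
    show ?thesis
    proof (cases i rule: bit.exhaust)
      case zero
      have "\<phi> x1 \<oplus>\<^bsub>Y\<^esub> \<phi> x0 \<in> mpart Y 0" using y True zero ysum pc by (simp add: Y.M.a_comm)
      then have "\<phi> x1 \<in> mpart Y 0 \<inter> mpart Y 1" using diff[OF pc(2) px(1)] px by blast
      then have "\<phi> x1 = \<phi> \<zero>\<^bsub>X\<^esub>" unfolding int z by simp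
      then have "x1 = \<zero>\<^bsub>X\<^esub>" using bij xc(2) by (auto simp: bij_betw_def inj_on_def)
      then show ?thesis using x xc True zero by simp
    next
      case one
      have "\<phi> x0 \<oplus>\<^bsub>Y\<^esub> \<phi> x1 \<in> mpart Y 1" using y True one ysum by simp
      then have "\<phi> x0 \<in> mpart Y 0 \<inter> mpart Y 1" using diff[OF pc(1) px(2)] px by blast
      then have "\<phi> x0 = \<phi> \<zero>\<^bsub>X\<^esub>" unfolding int z by simp
      then have "x0 = \<zero>\<^bsub>X\<^esub>" using bij xc(1) by (auto simp: bij_betw_def inj_on_def)
      then show ?thesis using x xc True one by simp
    qed
  qed
  show ?thesis
  proof (rule lie_homI)
    show "(\<lambda>y\<in>carrier Y. ?i y) (v \<oplus>\<^bsub>Y\<^esub> w) = (\<lambda>y\<in>carrier Y. ?i y) v \<oplus>\<^bsub>X\<^esub> (\<lambda>y\<in>carrier Y. ?i y) w"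
      if v: "v \<in> carrier Y" and w: "w \<in> carrier Y" for v w
      using ii[of "?i v \<oplus>\<^bsub>X\<^esub> ?i w"] ic[OF v] ic[OF w] v w by (simp add: p(3))
    show "(\<lambda>y\<in>carrier Y. ?i y) (u \<odot>\<^bsub>Y\<^esub> v) = u \<odot>\<^bsub>X\<^esub> (\<lambda>y\<in>carrier Y. ?i y) v"
      if u: "u \<in> carrier (env L)" and v: "v \<in> carrier Y" for u v
      using ii[of "u \<odot>\<^bsub>X\<^esub> ?i v"] ic[OF v] u v by (simp add: p(4) X.smult_closed Y.smult_closed)
    show "(\<lambda>y\<in>carrier Y. ?i y) v \<in> module_comp s X i" if "v \<in> module_comp s Y i" for v i
      using comp[OF that] module_comp_facts(2)[OF lie(2), of i] that by auto
  qed (use ic in auto)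
qed

context sl2_superalgebra
begin

lemma eta_nat_trans: "nat_trans (M_e s L e h a :: (('g, 'm) gmod, _) cat) (M_e s L e h a)
    id_functor (comp_functor (enright L e f (- a)) (enright L e f a)) (eta a)"
proof -
  have F: "is_functor (M_e s L e h a :: (('g, 'm) gmod, _) cat) (M_e s L e h (- a)) (enright L e f a)"
    "is_functor (M_e s L e h (- a) :: (('g, 'm) gmod, _) cat) (M_e s L e h a) (enright L e f (- a))"
    using enright_functor[of s a] enright_functor[of s "- a"] by simp_all
  have "eta a X \<in> lie_hom s L X (enright_mod L e f (- a) (enright_mod L e f a X))"
    if "X \<in> obj (M_e s L e h a)" for X :: "('g, 'm) gmod"
    by (rule enright_object.eta_hom[OF enright_objectI[OF that]])
  moreover have "compose (carrier X) (eta a Y) \<phi> = compose (carrier X) (enright_map L e f (- a)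
      (enright_mod L e f a X) (enright_mod L e f a Y) (enright_map L e f a X Y \<phi>)) (eta a X)"
    if "X \<in> obj (M_e s L e h a)" "Y \<in> obj (M_e s L e h a)" "\<phi> \<in> lie_hom s L X Y" for X Y :: "('g, 'm) gmod" and \<phi>
    using eta_natural[OF that] by (auto simp: compose_def)
  moreover have "category (M_e s L e h a :: (('g, 'm) gmod, _) cat)" by (rule category_M_e)
  ultimately show ?thesis
    unfolding nat_trans_def using is_functor_id is_functor_comp[OF F]
    by (simp add: id_functor_def comp_functor_def enright_def M_e_def)
qed

lemma eta_nat_iso:
  assumes "a \<notin> \<int>"
  shows "nat_iso (M_e s L e h a :: (('g, 'm) gmod, _) cat) (M_e s L e h a)
    id_functor (comp_functor (enright L e f (- a)) (enright L e f a)) (eta a)"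
proof -
  have "\<exists>\<theta>\<in>lie_hom s L (enright_mod L e f (- a) (enright_mod L e f a X)) X.
      compose (carrier X) \<theta> (eta a X) = (\<lambda>v\<in>carrier X. v) \<and>
      compose (carrier (enright_mod L e f (- a) (enright_mod L e f a X))) (eta a X) \<theta> =
        (\<lambda>v\<in>carrier (enright_mod L e f (- a) (enright_mod L e f a X)). v)"
    if X: "X \<in> obj (M_e s L e h a)" for X :: "('g, 'm) gmod"
  proof -
    interpret A: enright_object L e h f X a s by (rule enright_objectI[OF X])
    let ?i = "\<lambda>y\<in>carrier A.C2. inv_into (carrier X) (eta a X) y"
    have bij: "bij_betw (eta a X) (carrier X) (carrier A.C2)" by (rule A.eta_bij[OF assms])
    have "lie_module s L A.C2" using A.C2_obj by (simp add: obj_M_e)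
    then have "?i \<in> lie_hom s L A.C2 X" by (rule lie_hom_inverse[OF A.lieN _ A.eta_hom bij])
    moreover have "compose (carrier X) ?i (eta a X) = (\<lambda>v\<in>carrier X. v)"
      using bij lie_homD(2)[OF A.eta_hom] by (auto simp: compose_def bij_betw_def)
    moreover have "compose (carrier A.C2) (eta a X) ?i = (\<lambda>v\<in>carrier A.C2. v)"
      using bij by (auto simp: compose_def bij_betw_def f_inv_into_f)
    ultimately show ?thesis by blast
  qed
  then show ?thesis
    unfolding nat_iso_def using eta_nat_trans[of s a]
    by (simp add: id_functor_def comp_functor_def enright_def M_e_def)
qed

text \<open>The quasi-inverse is C_(-a), and the counit is the inverse of the unit belonging to the
  parameter -a, which is again not an integer.\<close>

theorem enright_equivalence:
  assumes a: "a \<notin> \<int>"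
  shows "equivalence (M_e s L e h a :: (('g, 'm) gmod, _) cat) (M_e s L e h (- a)) (enright L e f a)"
proof -
  have "- a \<notin> \<int>" using a by simp
  then have "nat_iso (M_e s L e h (- a) :: (('g, 'm) gmod, _) cat) (M_e s L e h (- a))
      id_functor (comp_functor (enright L e f a) (enright L e f (- a))) (eta (- a))"
    using eta_nat_iso[of "- a" s] by simp
  then obtain \<epsilon> where "nat_iso (M_e s L e h (- a) :: (('g, 'm) gmod, _) cat) (M_e s L e h (- a))
      (comp_functor (enright L e f a) (enright L e f (- a))) id_functor \<epsilon>"
    using nat_iso_inverse by blast
  moreover have "is_functor (M_e s L e h (- a) :: (('g, 'm) gmod, _) cat) (M_e s L e h a) (enright L e f (- a))"
    using enright_functor[of s "- a"] by simp
  ultimately show ?thesis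
    unfolding equivalence_def using enright_functor[of s a] eta_nat_iso[OF a, of s] by blast
qed

end

section \<open>Dimensions\<close>

context complex_space
begin

lemma not_lindepD:
  assumes "\<not> lindep V S" "finite B" "B \<subseteq> S" "finsum V (\<lambda>b. c b \<odot> b) B = \<zero>" "b \<in> B"
  shows "c b = 0"
  using assms unfolding lindep_def by blast

lemma lindep_insert:
  assumes S: "S \<subseteq> carrier V" "\<not> lindep V S" and v: "v \<in> carrier V" "v \<notin> lspan V S"
  shows "\<not> lindep V (insert v S)"
proof
  assume "lindep V (insert v S)"
  then obtain c B where B: "finite B" "B \<subseteq> insert v S" "finsum V (\<lambda>b. c b \<odot> b) B = \<zero>" "\<exists>b\<in>B. c b \<noteq> 0"
    by (auto simp: lindep_def)
  let ?B = "B - {v}"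
  have sub: "?B \<subseteq> S" "finite ?B" using B by auto
  then have Bc: "(\<lambda>b. c b \<odot> b) \<in> ?B \<rightarrow> carrier V" using S by auto
  let ?w = "finsum V (\<lambda>b. c b \<odot> b) ?B"
  have wl: "?w \<in> lspan V S" using sub unfolding lspan_def by blast
  have wc: "?w \<in> carrier V" using Bc by simp
  show False
  proof (cases "v \<in> B \<and> c v \<noteq> 0")
    case True
    then have "B = insert v ?B" by auto
    then have "finsum V (\<lambda>b. c b \<odot> b) B = c v \<odot> v \<oplus> ?w"
      using sub(2) Bc v(1) finsum_insert[of ?B v "\<lambda>b. c b \<odot> b"] by simp
    then have sum0: "c v \<odot> v \<oplus> ?w = \<zero>" using B(3) by simp
    have "c v \<odot> v = \<ominus> ?w" using sum0 wc v(1) by (simp add: minus_equality)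
    then have "c v \<odot> v = (- 1) \<odot> ?w" using wc by (simp add: sc_minus)
    then have "c v \<odot> v \<in> lspan V S" using lspan_smult[OF S(1) wl] by simp
    then have "v \<in> lspan V S"
      using sc_cancel[of "c v" v "lspan V S"] True v(1) lspan_smult[OF S(1)] by blast
    then show False using v(2) by blast
  next
    case False
    have "?w = \<zero>"
    proof (cases "v \<in> B")
      case True
      then have "B = insert v ?B" by auto
      then have "finsum V (\<lambda>b. c b \<odot> b) B = c v \<odot> v \<oplus> ?w"
        using sub(2) Bc v(1) finsum_insert[of ?B v "\<lambda>b. c b \<odot> b"] by simp
      then show ?thesis using B(3) False True v(1) wc by simp
    next
      case False
      then show ?thesis using B(3) by simp
    qed
    then have "\<forall>b\<in>?B. c b = 0" using not_lindepD[OF S(2) sub(2,1)] by blast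
    then show False using B(4) False by auto
  qed
qed

lemma basis_exists: "\<exists>B. is_basis V B"
proof -
  let ?A = "{B. B \<subseteq> carrier V \<and> \<not> lindep V B}"
  have "\<Union>\<C> \<in> ?A" if chain: "subset.chain ?A \<C>" for \<C>
  proof -
    have sub: "\<Union>\<C> \<subseteq> carrier V" using chain by (auto simp: subset.chain_def)
    have "\<not> lindep V (\<Union>\<C>)"
    proof
      assume "lindep V (\<Union>\<C>)"
      then obtain c B where B: "finite B" "B \<subseteq> \<Union>\<C>" "finsum V (\<lambda>b. c b \<odot> b) B = \<zero>" "\<exists>b\<in>B. c b \<noteq> 0"
        by (auto simp: lindep_def)
      then have ne: "\<C> \<noteq> {}" by auto
      obtain S where "S \<in> \<C>" "B \<subseteq> S" using finite_subset_Union_chain[OF B(1,2) ne chain] by blast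
      moreover from this have "\<not> lindep V S" using chain by (auto simp: subset.chain_def)
      ultimately show False using B unfolding lindep_def by blast
    qed
    then show ?thesis using sub by blast
  qed
  then obtain B where B: "B \<in> ?A" "\<forall>S\<in>?A. B \<subseteq> S \<longrightarrow> S = B" using subset_Zorn'[of ?A] by blast
  have "v \<in> lspan V B" if v: "v \<in> carrier V" for v
  proof (rule ccontr)
    assume n: "v \<notin> lspan V B"
    then have "insert v B \<in> ?A" using lindep_insert[of B v] B(1) v by simp
    then have "insert v B = B" using B(2) by blast
    then show False using n lspan_base[of B v] B(1) by auto
  qed
  then show ?thesis using B(1) lspan_closed[of B] unfolding is_basis_def by blast
qed

text \<open>Coordinates with respect to a basis embed the space into \<^typ>\<open>'v \<Rightarrow>\<^sub>0 complex\<close>.\<close>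

lemma independent_embeds:
  assumes B: "is_basis V B" and I: "I \<subseteq> carrier V" "\<not> lindep V I"
  shows "\<exists>k. inj_on k I \<and> k ` I \<subseteq> B"
proof -
  define scale :: "complex \<Rightarrow> ('v \<Rightarrow>\<^sub>0 complex) \<Rightarrow> ('v \<Rightarrow>\<^sub>0 complex)"
    where "scale c p = Poly_Mapping.map ((*) c) p" for c p
  have lookup_scale: "Poly_Mapping.lookup (scale c p) b = c * Poly_Mapping.lookup p b" for c p b
    by (simp add: scale_def Poly_Mapping.map.rep_eq when_def)
  interpret P: vector_space scale
    by unfold_locales (auto intro!: poly_mapping_eqI simp: lookup_scale lookup_add algebra_simps)
  have Bc: "B \<subseteq> carrier V" and Bi: "\<not> lindep V B" and Bs: "lspan V B = carrier V"
    using B by (auto simp: is_basis_def)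
  define ev where "ev p = finsum V (\<lambda>b. Poly_Mapping.lookup p b \<odot> b) (Poly_Mapping.keys p)"
    for p :: "'v \<Rightarrow>\<^sub>0 complex"
  define FB where "FB = {p :: 'v \<Rightarrow>\<^sub>0 complex. Poly_Mapping.keys p \<subseteq> B}"
  have ev_super: "ev p = finsum V (\<lambda>b. Poly_Mapping.lookup p b \<odot> b) A"
    if "finite A" "Poly_Mapping.keys p \<subseteq> A" "A \<subseteq> B" for p A
    unfolding ev_def by (rule add.finprod_mono_neutral_cong_left) (use that Bc in \<open>auto simp: in_keys_iff\<close>)
  have evc: "ev p \<in> carrier V" if "p \<in> FB" for p
    unfolding ev_def by (rule finsum_closed) (use that Bc in \<open>auto simp: FB_def\<close>)
  have FB_add: "p + q \<in> FB" if "p \<in> FB" "q \<in> FB" for p q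
    using that Poly_Mapping.keys_add[of p q] by (auto simp: FB_def)
  have ev_add: "ev (p + q) = ev p \<oplus> ev q" if "p \<in> FB" "q \<in> FB" for p q
  proof -
    let ?A = "Poly_Mapping.keys p \<union> Poly_Mapping.keys q"
    have A: "finite ?A" "?A \<subseteq> B" "Poly_Mapping.keys (p + q) \<subseteq> ?A"
      using that Poly_Mapping.keys_add[of p q] by (auto simp: FB_def)
    then have Ac: "b \<in> carrier V" if "b \<in> ?A" for b using that Bc by blast
    have "ev (p + q) = finsum V (\<lambda>b. Poly_Mapping.lookup p b \<odot> b \<oplus> Poly_Mapping.lookup q b \<odot> b) ?A"
      unfolding ev_super[OF A(1,3,2)]
      by (rule finsum_cong') (use Ac in \<open>auto simp: lookup_add sc_add_left\<close>)
    also have "\<dots> = ev p \<oplus> ev q"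
      unfolding ev_super[OF A(1) Un_upper1 A(2)] ev_super[OF A(1) Un_upper2 A(2)]
      by (rule finsum_addf) (use Ac in auto)
    finally show ?thesis .
  qed
  have keys_scale: "Poly_Mapping.keys (scale c p) \<subseteq> Poly_Mapping.keys p" for c p
    by (auto simp: in_keys_iff lookup_scale)
  have ev_scale: "ev (scale c p) = c \<odot> ev p" if "p \<in> FB" for c p
  proof -
    have A: "Poly_Mapping.keys p \<subseteq> B" using that by (simp add: FB_def)
    then have Ac: "b \<in> carrier V" if "b \<in> Poly_Mapping.keys p" for b using that Bc by blast
    have "ev (scale c p) = finsum V (\<lambda>b. (c * Poly_Mapping.lookup p b) \<odot> b) (Poly_Mapping.keys p)"
      using ev_super[OF _ keys_scale A] by (simp add: lookup_scale)
    also have "\<dots> = finsum V (\<lambda>b. c \<odot> (Poly_Mapping.lookup p b \<odot> b)) (Poly_Mapping.keys p)"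
      by (rule finsum_cong') (use Ac in \<open>auto simp: sc_mult\<close>)
    also have "\<dots> = c \<odot> ev p" unfolding ev_def using Ac by (subst sc_finsum) auto
    finally show ?thesis .
  qed
  have "\<exists>p\<in>FB. ev p = v" if v: "v \<in> carrier V" for v
  proof -
    have "ev (Poly_Mapping.single b 1) = b" if "b \<in> B" for b
      using ev_super[of "{b}" "Poly_Mapping.single b 1"] that Bc by auto
    moreover have "Poly_Mapping.single b 1 \<in> FB" if "b \<in> B" for b using that by (simp add: FB_def)
    ultimately have "B \<subseteq> ev ` FB" by (metis image_eqI subsetI)
    moreover have "\<zero> \<in> ev ` FB" by (rule image_eqI[of _ _ 0]) (simp_all add: ev_def FB_def)
    moreover have "x \<oplus> y \<in> ev ` FB" if "x \<in> ev ` FB" "y \<in> ev ` FB" for x y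
      using that ev_add FB_add by (auto simp: image_iff) metis
    moreover have "c \<odot> x \<in> ev ` FB" if x: "x \<in> ev ` FB" for c x
    proof -
      obtain p where "p \<in> FB" "x = ev p" using x by blast
      then have "scale c p \<in> FB" "c \<odot> x = ev (scale c p)"
        using keys_scale[of c p] by (auto simp: FB_def ev_scale)
      then show ?thesis by blast
    qed
    ultimately have "lspan V B \<subseteq> ev ` FB" using evc by (intro lspan_least) auto
    then show ?thesis using v Bs by auto
  qed
  \<comment> \<open>A mere section of \<open>ev\<close>, chosen pointwise; that the image of
    \<open>I\<close> stays independent follows from the linearity of \<open>ev\<close>.\<close>
  then obtain g where g: "\<And>v. v \<in> carrier V \<Longrightarrow> g v \<in> FB" "\<And>v. v \<in> carrier V \<Longrightarrow> ev (g v) = v"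
    using bchoice[of "carrier V" "\<lambda>v p. p \<in> FB \<and> ev p = v"] by blast
  have g_inj: "inj_on g I" using g(2) I(1) by (metis inj_onI subsetD)
  have ev_sum: "(\<Sum>v\<in>J. scale (u v) (g v)) \<in> FB \<and> ev (\<Sum>v\<in>J. scale (u v) (g v)) = finsum V (\<lambda>v. u v \<odot> v) J"
    if "finite J" "J \<subseteq> carrier V" for J u
    using that
  proof (induction J rule: finite_induct)
    case empty
    then show ?case by (simp add: FB_def ev_def)
  next
    case (insert v J)
    have s: "scale (u v) (g v) \<in> FB" using insert g keys_scale[of "u v" "g v"] by (auto simp: FB_def)
    have c: "(\<lambda>v. u v \<odot> v) \<in> J \<rightarrow> carrier V" "u v \<odot> v \<in> carrier V" using insert.prems by auto
    show ?case using insert s g FB_add ev_add ev_scale by (simp add: finsum_insert[OF insert.hyps c])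
  qed
  have indep: "P.independent (g ` I)"
  proof (rule ccontr)
    assume "\<not> P.independent (g ` I)"
    then obtain t u where t: "finite t" "t \<subseteq> g ` I" "(\<Sum>x\<in>t. scale (u x) x) = 0" "\<exists>x\<in>t. u x \<noteq> 0"
      unfolding P.dependent_explicit by blast
    obtain J where J: "J \<subseteq> I" "t = g ` J" using t(2) by (auto simp: subset_image_iff)
    have fin: "finite J" using t(1) J inj_on_subset[OF g_inj J(1)] by (simp add: finite_image_iff)
    have "(\<Sum>v\<in>J. scale (u (g v)) (g v)) = 0"
      using t(3) inj_on_subset[OF g_inj J(1)] by (simp add: J(2) sum.reindex)
    then have "finsum V (\<lambda>v. u (g v) \<odot> v) J = \<zero>"
      using ev_sum[OF fin, of "\<lambda>v. u (g v)"] J(1) I(1) by (auto simp: ev_def)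
    then have "u (g v) = 0" if "v \<in> J" for v
      using not_lindepD[OF I(2) fin J(1), of "\<lambda>v. u (g v)"] that by blast
    then show False using t(4) J(2) by auto
  qed
  let ?E = "(\<lambda>b. Poly_Mapping.single b (1 :: complex)) ` B"
  have E_indep: "P.independent ?E"
  proof (rule ccontr)
    assume "\<not> P.independent ?E"
    then obtain t u where t: "finite t" "t \<subseteq> ?E" "(\<Sum>x\<in>t. scale (u x) x) = 0" "\<exists>x\<in>t. u x \<noteq> 0"
      unfolding P.dependent_explicit by blast
    then obtain b where b: "b \<in> B" "Poly_Mapping.single b 1 \<in> t" "u (Poly_Mapping.single b 1) \<noteq> 0" by blast
    have "Poly_Mapping.lookup x b = (if x = Poly_Mapping.single b 1 then 1 else 0)" if x: "x \<in> t" for x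
    proof -
      obtain b' where "x = Poly_Mapping.single b' (1 :: complex)" using t(2) x by blast
      then show ?thesis by (cases "b' = b") (auto simp: lookup_single when_def dest: arg_cong[of _ _ "\<lambda>x. Poly_Mapping.lookup x b"])
    qed
    then have "Poly_Mapping.lookup (scale (u x) x) b = (if x = Poly_Mapping.single b 1 then u x else 0)"
      if "x \<in> t" for x using that by (simp add: lookup_scale)
    note lookup_t = this
    have "0 = (\<Sum>x\<in>t. Poly_Mapping.lookup (scale (u x) x) b)"
      using t(3) by (metis lookup_sum lookup_zero)
    also have "\<dots> = (\<Sum>x\<in>t. if x = Poly_Mapping.single b 1 then u x else 0)"
      by (rule sum.cong[OF HOL.refl lookup_t])
    also have "\<dots> = u (Poly_Mapping.single b 1)" using t(1) b(2) by simp
    finally show False using b(3) by simp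
  qed
  have span: "FB \<subseteq> P.span ?E"
  proof
    fix p assume p: "p \<in> FB"
    have "p = (\<Sum>b\<in>Poly_Mapping.keys p. scale (Poly_Mapping.lookup p b) (Poly_Mapping.single b 1))"
    proof (rule poly_mapping_eqI)
      fix x
      have "Poly_Mapping.lookup (\<Sum>b\<in>Poly_Mapping.keys p. scale (Poly_Mapping.lookup p b) (Poly_Mapping.single b 1)) x =
          (\<Sum>b\<in>Poly_Mapping.keys p. if x = b then Poly_Mapping.lookup p b else 0)"
        unfolding lookup_sum by (intro sum.cong) (auto simp: lookup_scale lookup_single when_def)
      then show "Poly_Mapping.lookup p x =
          Poly_Mapping.lookup (\<Sum>b\<in>Poly_Mapping.keys p. scale (Poly_Mapping.lookup p b) (Poly_Mapping.single b 1)) x"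
        by (simp add: in_keys_iff)
    qed
    moreover have "(\<Sum>b\<in>Poly_Mapping.keys p. scale (Poly_Mapping.lookup p b) (Poly_Mapping.single b 1)) \<in> P.span ?E"
      by (intro P.span_sum P.span_scale P.span_base) (use p in \<open>auto simp: FB_def\<close>)
    ultimately show "p \<in> P.span ?E" by simp
  qed
  have gI: "g ` I \<subseteq> P.span ?E" using span g(1) I(1) by blast
  \<comment> \<open>Extended to a basis of the span of the unit vectors, the image of
    \<open>I\<close> is compared with them through the equal cardinality of two bases of one space,
    which covers infinite bases as well.\<close>
  obtain X where X: "g ` I \<subseteq> X" "X \<subseteq> P.span ?E" "P.independent X" "P.span ?E \<subseteq> P.span X"
    using P.maximal_independent_subset_extend[OF gI indep] by blast
  have "P.span X = P.span ?E" using X(2,4) by (metis P.span_mono P.span_span subset_antisym)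
  then obtain k where k: "bij_betw k X ?E"
    using P.bij_if_span_eq_span_bases[OF X(3) E_indep] by blast
  have s_inj: "inj_on (\<lambda>b. Poly_Mapping.single b (1 :: complex)) B"
    by (auto simp: inj_on_def dest: arg_cong[of _ _ Poly_Mapping.keys])
  let ?h = "\<lambda>v. inv_into B (\<lambda>b. Poly_Mapping.single b (1 :: complex)) (k (g v))"
  have kE: "k (g v) \<in> ?E" if "v \<in> I" for v using k X(1) that by (auto simp: bij_betw_def)
  have "inj_on ?h I"
  proof (rule inj_onI)
    fix v w assume v: "v \<in> I" "w \<in> I" "?h v = ?h w"
    then have "k (g v) = k (g w)" using inv_into_injective[OF _ kE kE] by blast
    then have "g v = g w" using k X(1) v(1,2) unfolding bij_betw_def inj_on_def by blast
    then show "v = w" using g_inj v(1,2) by (auto simp: inj_on_def)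
  qed
  moreover have "?h ` I \<subseteq> B" using inv_into_into[OF kE] by blast
  ultimately show ?thesis by blast
qed

end

text \<open>\<open>cdim\<close> refers to one chosen basis of each space. The image of the basis of
  \<open>V\<close> is independent in \<open>W\<close> and therefore embeds into the basis of
  \<open>W\<close>, which is what the cardinal inequality between different types demands.\<close>

lemma cdim_le:
  fixes V :: "(complex, 'v, 'm) module_scheme" and W :: "(complex, 'w, 'n) module_scheme"
  assumes "complex_space V" "complex_space W"
    and T: "T \<in> carrier V \<rightarrow> carrier W" "inj_on T (carrier V)"
    and T_add: "\<And>v w. v \<in> carrier V \<Longrightarrow> w \<in> carrier V \<Longrightarrow> T (v \<oplus>\<^bsub>V\<^esub> w) = T v \<oplus>\<^bsub>W\<^esub> T w"
    and T_smult: "\<And>c v. v \<in> carrier V \<Longrightarrow> T (c \<odot>\<^bsub>V\<^esub> v) = c \<odot>\<^bsub>W\<^esub> T v"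
  shows "cdim V \<le>o cdim W"
proof -
  interpret V: complex_space V by fact
  interpret W: complex_space W by fact
  let ?A = "SOME B. is_basis V B" and ?B = "SOME B. is_basis W B"
  have A: "is_basis V ?A" using V.basis_exists by (rule someI_ex)
  have B: "is_basis W ?B" using W.basis_exists by (rule someI_ex)
  have Ac: "?A \<subseteq> carrier V" and Ai: "\<not> lindep V ?A" using A by (auto simp: is_basis_def)
  have T0: "T \<zero>\<^bsub>V\<^esub> = \<zero>\<^bsub>W\<^esub>"
    using T_smult[of "\<zero>\<^bsub>V\<^esub>" 0] T(1) by (simp add: Pi_iff)
  have sum: "T (finsum V (\<lambda>v. c v \<odot>\<^bsub>V\<^esub> v) J) = finsum W (\<lambda>v. c v \<odot>\<^bsub>W\<^esub> T v) J"
    if "finite J" "J \<subseteq> carrier V" for c J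
    using that
  proof (induction J rule: finite_induct)
    case (insert v J)
    then have "(\<lambda>v. c v \<odot>\<^bsub>V\<^esub> v) \<in> J \<rightarrow> carrier V" "(\<lambda>v. c v \<odot>\<^bsub>W\<^esub> T v) \<in> J \<rightarrow> carrier W"
      "c v \<odot>\<^bsub>V\<^esub> v \<in> carrier V" "c v \<odot>\<^bsub>W\<^esub> T v \<in> carrier W" using T(1) by (auto simp: Pi_iff)
    then show ?case using insert by (simp add: T_add T_smult)
  qed (simp add: T0)
  have "\<not> lindep W (T ` ?A)"
  proof
    assume "lindep W (T ` ?A)"
    then obtain c X where X: "finite X" "X \<subseteq> T ` ?A" "finsum W (\<lambda>b. c b \<odot>\<^bsub>W\<^esub> b) X = \<zero>\<^bsub>W\<^esub>" "\<exists>b\<in>X. c b \<noteq> 0"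
      by (auto simp: lindep_def)
    obtain J where J: "J \<subseteq> ?A" "X = T ` J" using X(2) by (auto simp: subset_image_iff)
    have inj: "inj_on T J" using T(2) J(1) Ac by (meson inj_on_subset order_trans)
    have fin: "finite J" using X(1) J(2) inj by (simp add: finite_image_iff)
    have Jc: "J \<subseteq> carrier V" using J(1) Ac by blast
    have "finsum W (\<lambda>b. c b \<odot>\<^bsub>W\<^esub> b) (T ` J) = finsum W (\<lambda>v. c (T v) \<odot>\<^bsub>W\<^esub> T v) J"
      by (rule W.finsum_reindex) (use inj T(1) Jc in \<open>auto simp: Pi_iff\<close>)
    then have "T (finsum V (\<lambda>v. c (T v) \<odot>\<^bsub>V\<^esub> v) J) = T \<zero>\<^bsub>V\<^esub>"
      using X(3) by (simp add: J(2) sum[OF fin Jc] T0)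
    moreover have "finsum V (\<lambda>v. c (T v) \<odot>\<^bsub>V\<^esub> v) J \<in> carrier V" using Jc by (intro V.finsum_closed) auto
    ultimately have "finsum V (\<lambda>v. c (T v) \<odot>\<^bsub>V\<^esub> v) J = \<zero>\<^bsub>V\<^esub>" using T(2) by (auto simp: inj_on_def)
    then have "c (T v) = 0" if "v \<in> J" for v
      using V.not_lindepD[OF Ai fin J(1), of "\<lambda>v. c (T v)"] that by blast
    then show False using X(4) J(2) by auto
  qed
  moreover have "T ` ?A \<subseteq> carrier W" using T(1) Ac by auto
  ultimately have "\<exists>k. inj_on k (T ` ?A) \<and> k ` T ` ?A \<subseteq> ?B" by (rule W.independent_embeds[OF B, rotated])
  then obtain k where k: "inj_on k (T ` ?A)" "k ` T ` ?A \<subseteq> ?B" by (elim exE conjE)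
  have "inj_on (k \<circ> T) ?A" by (rule comp_inj_on[OF inj_on_subset[OF T(2) Ac] k(1)])
  moreover have "(k \<circ> T) ` ?A \<subseteq> ?B" using k(2) by (simp only: image_comp)
  ultimately have "|?A| \<le>o |?B|"
    by (intro card_of_ordLeq[THEN iffD1] exI[of _ "k \<circ> T"] conjI)
  then show ?thesis unfolding cdim_def .
qed

section \<open>The Enright functor at parameter zero\<close>

context sl2_superalgebra
begin

lemma hom_space_simps: "carrier (hom_space s L M N) = lie_hom s L M N"
  "\<phi> \<oplus>\<^bsub>hom_space s L M N\<^esub> \<psi> = (\<lambda>v\<in>carrier M. \<phi> v \<oplus>\<^bsub>N\<^esub> \<psi> v)"
  "\<zero>\<^bsub>hom_space s L M N\<^esub> = (\<lambda>v\<in>carrier M. \<zero>\<^bsub>N\<^esub>)"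
  "c \<odot>\<^bsub>hom_space s L M N\<^esub> \<phi> = (\<lambda>v\<in>carrier M. csc L N c (\<phi> v))"
  by (simp_all add: hom_space_def)

lemma complex_space_hom:
  fixes M :: "('g uel, 'v) smod" and N :: "('g uel, 'w) smod"
  assumes lie: "lie_module s L M" "lie_module s L N"
  shows "complex_space (hom_space s L M N)"
proof -
  interpret M: sl2_module L e h f M
    by (intro sl2_module.intro sl2_superalgebra_axioms sl2_module_axioms.intro)
      (use lie in \<open>simp add: lie_module_def\<close>)
  interpret N: sl2_module L e h f N
    by (intro sl2_module.intro sl2_superalgebra_axioms sl2_module_axioms.intro)
      (use lie in \<open>simp add: lie_module_def\<close>)
  let ?H = "hom_space s L M N"
  have comp_closed: "\<And>v i. v \<in> module_comp s M i \<Longrightarrow> v \<in> carrier M" using module_comp_facts(2)[OF lie(1)] by blast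
  have add: "\<phi> \<oplus>\<^bsub>?H\<^esub> \<psi> \<in> lie_hom s L M N" if "\<phi> \<in> lie_hom s L M N" "\<psi> \<in> lie_hom s L M N" for \<phi> \<psi>
  proof -
    note p = lie_homD[OF that(1)] and q = lie_homD[OF that(2)]
    show ?thesis
      unfolding hom_space_simps
      by (rule lie_homI) (use p q in \<open>auto simp: M.M.smult_closed N.M.smult_r_distr N.M.M.a_ac comp_closed
          intro!: module_comp_facts(4)[OF lie(2)]\<close>)
  qed
  have smult: "c \<odot>\<^bsub>?H\<^esub> \<phi> \<in> lie_hom s L M N" if "\<phi> \<in> lie_hom s L M N" for c \<phi>
  proof -
    note p = lie_homD[OF that]
    have lin: "csc L N c (u \<odot>\<^bsub>N\<^esub> v) = u \<odot>\<^bsub>N\<^esub> csc L N c v" if "u \<in> carrier U" "v \<in> carrier N" for u v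
      using that by (simp add: csc_def N.M.smult_assoc[symmetric] sc_env_central)
    have "csc L N c v \<in> module_comp s N i" if "v \<in> module_comp s N i" for v i
      using module_comp_facts(5)[OF lie(2) env_comp_intros(1) that] unfolding csc_def by (simp only: add_0_left)
    then show ?thesis
      unfolding hom_space_simps
      by (intro lie_homI) (use p lin in \<open>auto simp: M.M.smult_closed N.sc_add_right comp_closed\<close>)
  qed
  have zero: "\<zero>\<^bsub>?H\<^esub> \<in> lie_hom s L M N"
    unfolding hom_space_simps
    by (rule lie_homI) (auto simp: M.M.smult_closed comp_closed module_comp_facts(3)[OF lie(2)])
  have ext: "(\<lambda>v\<in>carrier M. \<phi> v) = \<phi>" if "\<phi> \<in> lie_hom s L M N" for \<phi>
    using lie_homD(1)[OF that] by (auto simp: extensional_def fun_eq_iff)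
  have cl: "\<phi> v \<in> carrier N" if "\<phi> \<in> lie_hom s L M N" "v \<in> carrier M" for \<phi> v
    using lie_homD(2)[OF that] .
  note H = hom_space_simps[of s M N]
  have ab: "abelian_group ?H"
  proof (rule abelian_groupI; unfold H(1))
    show "\<phi> \<oplus>\<^bsub>?H\<^esub> \<psi> \<oplus>\<^bsub>?H\<^esub> \<chi> = \<phi> \<oplus>\<^bsub>?H\<^esub> (\<psi> \<oplus>\<^bsub>?H\<^esub> \<chi>)"
      if "\<phi> \<in> lie_hom s L M N" "\<psi> \<in> lie_hom s L M N" "\<chi> \<in> lie_hom s L M N" for \<phi> \<psi> \<chi>
      using that cl by (auto simp: H fun_eq_iff N.M.M.a_assoc)
    show "\<phi> \<oplus>\<^bsub>?H\<^esub> \<psi> = \<psi> \<oplus>\<^bsub>?H\<^esub> \<phi>" if "\<phi> \<in> lie_hom s L M N" "\<psi> \<in> lie_hom s L M N" for \<phi> \<psi>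
      using that cl by (auto simp: H fun_eq_iff N.M.M.a_comm)
    show "\<zero>\<^bsub>?H\<^esub> \<oplus>\<^bsub>?H\<^esub> \<phi> = \<phi>" if "\<phi> \<in> lie_hom s L M N" for \<phi>
      by (subst (2) ext[OF that, symmetric]) (use that cl in \<open>auto simp: H fun_eq_iff\<close>)
    show "\<exists>\<psi>\<in>lie_hom s L M N. \<psi> \<oplus>\<^bsub>?H\<^esub> \<phi> = \<zero>\<^bsub>?H\<^esub>" if "\<phi> \<in> lie_hom s L M N" for \<phi>
    proof (rule bexI[OF _ smult[OF that, of "- 1"]])
      show "(- 1) \<odot>\<^bsub>?H\<^esub> \<phi> \<oplus>\<^bsub>?H\<^esub> \<phi> = \<zero>\<^bsub>?H\<^esub>"
        using cl[OF that] N.sc_neg_cancel[of _ 1] by (auto simp: H fun_eq_iff)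
    qed
  qed (fact add zero)+
  show ?thesis
  proof (intro complex_space.intro[OF ab] complex_space_axioms.intro; unfold H(1))
    show "1 \<odot>\<^bsub>?H\<^esub> \<phi> = \<phi>" if "\<phi> \<in> lie_hom s L M N" for \<phi>
      by (subst (2) ext[OF that, symmetric]) (use that cl in \<open>auto simp: H fun_eq_iff\<close>)
  qed (auto simp: smult[unfolded H] H fun_eq_iff cl N.sc_add_left N.sc_add_right N.sc_mult)
qed

text \<open>The torsion of the target is what matters: two homomorphisms with equal images under C_0
  differ by one with values in the f-torsion of \<open>N2\<close>. A Verma module mapping onto a
  nonzero finite dimensional quotient shows how such a homomorphism can be lost.\<close>

lemma enright_zero:
  fixes N1 N2 :: "('g, 'm) gmod"
  assumes N1: "N1 \<in> obj (M_e s L e h 0)" and N2: "N2 \<in> obj (M_e s L e h 0)"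
    and tor: "torsion L f N2 = {\<zero>\<^bsub>N2\<^esub>}"
  defines "\<Phi> \<equiv> enright_map L e f 0 N1 N2"
  shows "\<Phi> \<in> lie_hom s L N1 N2 \<rightarrow> lie_hom s L (enright_mod L e f 0 N1) (enright_mod L e f 0 N2)"
    and "inj_on \<Phi> (lie_hom s L N1 N2)"
    and "cdim (hom_space s L N1 N2) \<le>o
      cdim (hom_space s L (enright_mod L e f 0 N1) (enright_mod L e f 0 N2))"
proof -
  interpret A: enright_object L e h f N1 0 s by (rule enright_objectI[OF N1])
  interpret B: enright_object L e h f N2 0 s by (rule enright_objectI[OF N2])
  show maps: "\<Phi> \<in> lie_hom s L N1 N2 \<rightarrow> lie_hom s L A.C B.C"
    using is_functor_fmap[OF enright_functor N1 N2] by (auto simp: enright_def M_e_def \<Phi>_def)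
  \<comment> \<open>At parameter 0 the twist is the identity, so j is linear and maps e-torsion to
    e-torsion: j(n) lies in the Enright module without any power of f.\<close>
  have jC: "A.j n \<in> carrier A.C" if n: "n \<in> carrier N1" for n
  proof -
    have "A.j (act L N1 x v) = act L A.D x (A.j v)" if "v \<in> carrier N1" for x v
      using that by (simp add: act_def D_emb_smult[OF A.N_module] tw.twst_zero_exp A.D_simps)
    then have "(act L A.D e ^^ k) (A.j n) = A.j ((act L N1 e ^^ k) n)" for k
      using n by (induction k) simp_all
    moreover obtain k where "(act L N1 e ^^ k) n = \<zero>\<^bsub>N1\<^esub>"
      using A.nilN n unfolding locally_nilpotent_def torsion_def by blast
    ultimately have "(act L A.D e ^^ k) (A.j n) = \<zero>\<^bsub>A.D\<^esub>" by simp
    then show ?thesis using n unfolding A.C_simps torsion_def by auto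
  qed
  have \<Phi>: "\<Phi> \<phi> d = D_map L f 0 N1 N2 \<phi> d" if "d \<in> carrier A.C" for \<phi> d
    using that by (simp add: \<Phi>_def enright_map_def)
  have \<Phi>_out: "\<Phi> \<phi> d = undefined" if "d \<notin> carrier A.C" for \<phi> d
    using that by (simp add: \<Phi>_def enright_map_def)
  have \<Phi>_j: "\<Phi> \<phi> (A.j n) = B.j (\<phi> n)" if "\<phi> \<in> lie_hom s L N1 N2" "n \<in> carrier N1" for \<phi> n
    using \<Phi>[OF jC[OF that(2)]] D_map_hom(4)[OF A.lieN B.lieN that] by simp
  show inj: "inj_on \<Phi> (lie_hom s L N1 N2)"
  proof (rule inj_onI)
    fix \<phi> \<psi> assume p: "\<phi> \<in> lie_hom s L N1 N2" and q: "\<psi> \<in> lie_hom s L N1 N2" and eq: "\<Phi> \<phi> = \<Phi> \<psi>"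
    have "\<phi> n = \<psi> n" if n: "n \<in> carrier N1" for n
    proof -
      have c: "\<phi> n \<in> carrier N2" "\<psi> n \<in> carrier N2" using lie_homD(2)[OF p n] lie_homD(2)[OF q n] by auto
      let ?d = "csc L N2 (- 1) (\<psi> n) \<oplus>\<^bsub>N2\<^esub> \<phi> n"
      have "B.j (\<phi> n) = B.j (\<psi> n)" using \<Phi>_j[OF p n] \<Phi>_j[OF q n] eq by simp
      then have "B.j ?d = \<zero>\<^bsub>B.D\<^esub>"
        using c B.D.sc_neg_cancel[of "B.j (\<psi> n)" 1] by (simp add: B.emb_add B.emb_sc)
      then obtain k where "(act L N2 f ^^ k) ?d = \<zero>\<^bsub>N2\<^esub>" using B.emb_kernel[of ?d] c by auto
      then have "?d \<in> torsion L f N2" using c unfolding torsion_def by auto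
      then have "\<ominus>\<^bsub>N2\<^esub> \<psi> n \<oplus>\<^bsub>N2\<^esub> \<phi> n = \<zero>\<^bsub>N2\<^esub>" using tor c by (simp add: B.N.sc_minus)
      then have "\<phi> n \<oplus>\<^bsub>N2\<^esub> \<ominus>\<^bsub>N2\<^esub> \<psi> n = \<zero>\<^bsub>N2\<^esub>" using c by (simp add: B.N.M.M.a_comm)
      then show ?thesis using c B.N.M.M.minus_equality[of "\<phi> n" "\<ominus>\<^bsub>N2\<^esub> \<psi> n"] by simp
    qed
    then show "\<phi> = \<psi>" using lie_homD(1)[OF p] lie_homD(1)[OF q] by (rule extensionalityI[rotated 2])
  qed
  have H: "complex_space (hom_space s L N1 N2)" by (rule complex_space_hom[OF A.lieN B.lieN])
  have H': "complex_space (hom_space s L A.C B.C)" by (rule complex_space_hom[OF A.lieC B.lieC])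
  interpret H: complex_space "hom_space s L N1 N2" by (rule H)
  show "cdim (hom_space s L N1 N2) \<le>o cdim (hom_space s L A.C B.C)"
  \<comment> \<open>Linearity of the passage from \<phi> to its induced map is again checked on the
    image of j, through \<open>emb_determines\<close>.\<close>
  proof (rule cdim_le[OF H H', of \<Phi>]; unfold hom_space_simps(1))
    show "\<Phi> (\<phi> \<oplus>\<^bsub>hom_space s L N1 N2\<^esub> \<psi>) = \<Phi> \<phi> \<oplus>\<^bsub>hom_space s L A.C B.C\<^esub> \<Phi> \<psi>"
      if p: "\<phi> \<in> lie_hom s L N1 N2" and q: "\<psi> \<in> lie_hom s L N1 N2" for \<phi> \<psi>
    proof -
      let ?s = "\<phi> \<oplus>\<^bsub>hom_space s L N1 N2\<^esub> \<psi>"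
      have r: "?s \<in> lie_hom s L N1 N2" using H.a_closed[of \<phi> \<psi>] p q by (simp add: hom_space_simps(1))
      note t = D_map_hom[OF A.lieN B.lieN p, where a = 0] and t' = D_map_hom[OF A.lieN B.lieN q, where a = 0]
        and t'' = D_map_hom[OF A.lieN B.lieN r, where a = 0]
      have "D_map L f 0 N1 N2 ?s d = D_map L f 0 N1 N2 \<phi> d \<oplus>\<^bsub>B.D\<^esub> D_map L f 0 N1 N2 \<psi> d" if "d \<in> carrier A.D" for d
      proof (rule A.emb_determines[where g = "act L B.D f" and Y = "carrier B.D"
            and \<psi> = "\<lambda>d. D_map L f 0 N1 N2 \<phi> d \<oplus>\<^bsub>B.D\<^esub> D_map L f 0 N1 N2 \<psi> d"])
        show "D_map L f 0 N1 N2 ?s (A.j n) = D_map L f 0 N1 N2 \<phi> (A.j n) \<oplus>\<^bsub>B.D\<^esub> D_map L f 0 N1 N2 \<psi> (A.j n)"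
          if "n \<in> carrier N1" for n
          using that t(4) t'(4) t''(4) lie_homD(2)[OF p that] lie_homD(2)[OF q that]
          by (simp add: B.emb_add hom_space_simps(2))
        show "D_map L f 0 N1 N2 \<phi> (act L A.D f v) \<oplus>\<^bsub>B.D\<^esub> D_map L f 0 N1 N2 \<psi> (act L A.D f v) =
            act L B.D f (D_map L f 0 N1 N2 \<phi> v \<oplus>\<^bsub>B.D\<^esub> D_map L f 0 N1 N2 \<psi> v)" if "v \<in> carrier A.D" for v
          using that by (simp add: t(1,7) t'(1,7) B.D.act_add)
        show "D_map L f 0 N1 N2 \<phi> v \<oplus>\<^bsub>B.D\<^esub> D_map L f 0 N1 N2 \<psi> v \<in> carrier B.D" if "v \<in> carrier A.D" for v
          using that by (simp add: t(1) t'(1))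
      qed (assumption | rule t''(7) t''(1) that B.f_inject)+
      then show ?thesis
        by (auto simp: hom_space_simps(2) fun_eq_iff \<Phi> \<Phi>_out B.C_simps A.C_in_D restrict_def)
    qed
    show "\<Phi> (c \<odot>\<^bsub>hom_space s L N1 N2\<^esub> \<phi>) = c \<odot>\<^bsub>hom_space s L A.C B.C\<^esub> \<Phi> \<phi>"
      if p: "\<phi> \<in> lie_hom s L N1 N2" for c \<phi>
    proof -
      let ?s = "c \<odot>\<^bsub>hom_space s L N1 N2\<^esub> \<phi>"
      have r: "?s \<in> lie_hom s L N1 N2" using H.sc_closed[of \<phi> c] p by (simp add: hom_space_simps(1))
      note t = D_map_hom[OF A.lieN B.lieN p, where a = 0] and t'' = D_map_hom[OF A.lieN B.lieN r, where a = 0]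
      have "D_map L f 0 N1 N2 ?s d = csc L B.D c (D_map L f 0 N1 N2 \<phi> d)" if "d \<in> carrier A.D" for d
      proof (rule A.emb_determines[where g = "act L B.D f" and Y = "carrier B.D"
            and \<psi> = "\<lambda>d. csc L B.D c (D_map L f 0 N1 N2 \<phi> d)"])
        show "D_map L f 0 N1 N2 ?s (A.j n) = csc L B.D c (D_map L f 0 N1 N2 \<phi> (A.j n))" if "n \<in> carrier N1" for n
          using that t(4) t''(4) lie_homD(2)[OF p that] by (simp add: B.emb_sc hom_space_simps(4))
        show "csc L B.D c (D_map L f 0 N1 N2 \<phi> (act L A.D f v)) =
            act L B.D f (csc L B.D c (D_map L f 0 N1 N2 \<phi> v))" if "v \<in> carrier A.D" for v
          using that by (simp add: t(1,7) B.D.act_sc)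
        show "csc L B.D c (D_map L f 0 N1 N2 \<phi> v) \<in> carrier B.D" if "v \<in> carrier A.D" for v
          using that by (simp add: t(1))
      qed (assumption | rule t''(7) t''(1) that B.f_inject)+
      then show ?thesis
        by (auto simp: hom_space_simps(4) fun_eq_iff \<Phi> \<Phi>_out B.C_simps A.C_in_D restrict_def)
    qed
  qed (fact maps inj)+
qed

end

theorem theorem2p2p5:
  fixes L :: "'g::ab_group_add superalg" and e h f :: 'g and a :: complex and super :: bool
  assumes "lie_superalgebra L"
    and "sl2_triple L e h f"
    and "acts_locally_finitely L {e, h, f}"
  shows
    "(is_functor (M_e super L e h a :: (('g, 'm) gmod, _) cat) (M_e super L e h (- a))
        (enright L e f a) \<and>
      is_functor (M_e super L e h (- a) :: (('g, 'm) gmod, _) cat) (M_e super L e h a)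
        (enright L e f (- a)) \<and>
      (\<exists>\<eta>. nat_trans (M_e super L e h a :: (('g, 'm) gmod, _) cat) (M_e super L e h a)
        id_functor (comp_functor (enright L e f (- a)) (enright L e f a)) \<eta>)) \<and>
     (a \<notin> \<int> \<longrightarrow>
      equivalence (M_e super L e h a :: (('g, 'm) gmod, _) cat) (M_e super L e h (- a))
        (enright L e f a)) \<and>
     (\<forall>N\<^sub>1 \<in> obj (M_e super L e h 0 :: (('g, 'm) gmod, _) cat).
      \<forall>N\<^sub>2 \<in> obj (M_e super L e h 0).
        torsion L f N\<^sub>2 = {\<zero>\<^bsub>N\<^sub>2\<^esub>} \<longrightarrow>
        enright_map L e f 0 N\<^sub>1 N\<^sub>2 \<in>
          lie_hom super L N\<^sub>1 N\<^sub>2 \<rightarrow>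
          lie_hom super L (enright_mod L e f 0 N\<^sub>1) (enright_mod L e f 0 N\<^sub>2) \<and>
        inj_on (enright_map L e f 0 N\<^sub>1 N\<^sub>2) (lie_hom super L N\<^sub>1 N\<^sub>2) \<and>
        cdim (hom_space super L N\<^sub>1 N\<^sub>2) \<le>o
          cdim (hom_space super L (enright_mod L e f 0 N\<^sub>1) (enright_mod L e f 0 N\<^sub>2)))"
proof -
  interpret sl2_superalgebra L e h f
    using assms by (intro sl2_superalgebra.intro sl2_superalgebra_axioms.intro)
  have "is_functor (M_e super L e h (- a) :: (('g, 'm) gmod, _) cat) (M_e super L e h (- (- a)))
      (enright L e f (- a))"
    by (rule enright_functor)
  then have "is_functor (M_e super L e h (- a) :: (('g, 'm) gmod, _) cat) (M_e super L e h a)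
      (enright L e f (- a))"
    by (simp only: minus_minus)
  then show ?thesis
    by (intro conjI impI ballI exI[of _ "eta a"] enright_functor eta_nat_trans enright_equivalence enright_zero)
qed

end
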